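(* In the combinatorial model of the context, the following hold for all $g\ge0$, $n\ge1$. (i) \[ W^{[r]}_{g,n}(z_1,\dots,z_n)=\frac{1}{V''(z_1)}\frac{\partial}{\partial z_1}\cdots\frac{1}{V''(z_n)}\frac{\partial}{\partial z_n}F^{[r]}_{g,n}(z_1,\dots,z_n)+\delta_{g,0}\delta_{n,2}\Big(\frac{1}{V''(z_1)V''(z_2)(z_1-z_2)^2}-\frac{1}{(V'(z_1)-V'(z_2))^2}\Big)+\delta_{g,0}\delta_{n,1}\sum_{j=1}^N\Big(\frac{1}{V''(z_1)(z_1-\lambda_j)}-\frac{1}{V'(z_1)-V'(\lambda_j)}\Big). \] (ii) For $(g,n)\ne(0,1)$ and $k_1,\dots,k_n\ge1$, with $S_m=[z_{m,1},\dots,z_{m,k_m}]$, \[ S^{[r]}_{g;\underline k}(S_1,\dots,S_n)=\sum_{j_1=1}^{k_1}\cdots\sum_{j_n=1}^{k_n}\frac{W^{[r]}_{g,n}(z_{1,j_1},\dots,z_{n,j_n})}{\prod_{m=1}^n\alpha^{(k_m-1)(r+1)}\prod_{i_m\ne j_m}\big(V'(z_{m,j_m})-V'(z_{m,i_m})\big)}. \] (iii) $-\operatorname*{Res}_{u=\infty}du\,V'(u)\,U^{[r]}_{g,n}(u;z_1,\dots,z_n)=\delta_{g,0}\delta_{n,1}\frac{V'(z_1)}{V''(z_1)}\alpha^{r+1}$. (iv) $-\operatorname*{Res}_{u=\infty}du\,V'(u)(u-z_1)U^{[r]}_{g,n}(u;z_1,\dots,z_n)=\frac{V'(z_1)}{V''(z_1)}W^{[r]}_{g,n}(z_1,\dots,z_n)+\delta_{g,0}\delta_{n,1}\frac{N}{V''(z_1)}$.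 (v) $\lim_{u\to\infty}\Big(u^2U^{[r]}_{g,n}(u;z_1,\dots,z_n)-\delta_{g,0}\delta_{n,1}\frac{\alpha^{r+1}}{V''(z_1)(u-z_1)}\Big)=\frac{W^{[r]}_{g,n}(z_1,\dots,z_n)}{V''(z_1)}$.
   Context: Fix $r\ge2$, $N\ge0$, $\lambda_1,\dots,\lambda_N\in\mathbb C$, $V(z)=\sum_{j=1}^{r+1}\frac{v_j}{j}z^j$ of degree $r+1$, $\alpha$ a formal parameter. A map is a finite graph without isolated vertices embedded in an oriented compact surface whose complement is a disjoint union of open discs (faces). Vertices are black (degree between 3 and $r+1$), white, or square (any positive degree); each face is adjacent to at most one white vertex. A white vertex satisfies the star constraint if the corners around it lie in pairwise distinct faces. Sets (all maps connected of genus $g$, unmarked faces decorated by elements of $\{\lambda_1,\dots,\lambda_N\}$): $\mathcal F^{[r]}_{g,n}(z_1,\dots,z_n)$: only black vertices, $n$ marked faces labeled $1..n$, the $i$-th decorated $z_i$. $\mathcal W^{[r]}_{g,n}(z_1,\dots,z_n)$: black and white vertices, exactly $n$ white vertices all of degree 1 labeled $1..n$, the face adjacent to the $i$-th white vertex (the $i$-th marked face) decorated $z_i$. $\mathcal U^{[r]}_{g,n}(u;z_1,\dots,z_n)$: as $\mathcal W^{[r]}_{g,n}$ but with in addition exactly one square vertex, decorated $u$, such that the edge at the first white vertex is incident to it. $\mathcal S^{[r]}_{g;\underline k}(S_1,\dots,S_n)$ for cyclically ordered sets $S_i=[z_{i,1},\dots,z_{i,k_i}]$: no square vertex, $n$ white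 vertices labeled $1..n$ satisfying the star constraint, the $i$-th of degree $k_i$ with adjacent faces decorated $z_{i,1},\dots,z_{i,k_i}$ in clockwise order. Weights: edge between faces decorated $a_1,a_2$: $\mathcal P(a_1,a_2)=\frac{a_1-a_2}{V'(a_1)-V'(a_2)}$ ($=1/V''(a)$ if equal); black vertex with corners in faces decorated $a_1,\dots,a_d$: $\mathcal V_d(a_1,\dots,a_d)=\sum_i\frac{-V'(a_i)}{\prod_{j\ne i}(a_i-a_j)}$ (by continuity at coinciding arguments); white vertex: $1$; square vertex decorated $u$ with corners in faces $a_1,\dots,a_d$: $\prod_i\frac1{u-a_i}$. $w(G)$ is the product of local weights; $\deg G=(r+1)(\#\text{edges}-\#\text{vertices})$. Generating functions (formal Laurent series in $\alpha^{-1}$ whose coefficients are rational in the variables): $F^{[r]}_{g,n}=\sum_{G\in\mathcal F^{[r]}_{g,n}}\frac{w(G)}{\#\mathrm{Aut}\,G}\alpha^{-\deg G}$, and $W^{[r]}_{g,n}$, $U^{[r]}_{g,n}$, $S^{[r]}_{g;\underline k}$ defined in the same way over the other sets (there automorphism groups are trivial). Residues at $u=\infty$ are taken coefficientwise in $\alpha$.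
   Formalization: In (v) the factor u² multiplies the whole bracket (the printed limit diverges for (g,n)=(0,1)); the weights between the λ_j are assumed defined (V''(λ_j)≠0, V'(λ_i)≠V'(λ_j) if λ_i≠λ_j), and coinciding λ_j count as separate decorations. *)

theory Defs
  imports "HOL-Complex_Analysis.Complex_Analysis" "HOL-Combinatorics.Combinatorics"
begin
text \<open>
  A map without isolated vertices is encoded by its finite set of darts (half-edges), the
  rotation sending a dart to the next one counterclockwise around its vertex, and the
  fixed-point-free involution exchanging the two halves of an edge. A dart also stands for the
  corner between it and its successor under the rotation, which is the corner on its left when
  it points away from its vertex. Walking along a dart with the face on the left, the next
  corner of that face is the one that precedes the opposite dart, hence the face permutation
  below: its orbits are the faces, and the orbit of a dart is the face on its left, which
  contains the corresponding corner.

  Unmarked faces carry an index of the list \<open>\<lambda>\<^sub>1, \<dots>, \<lambda>\<^sub>N\<close>, so that coinciding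
  \<open>\<lambda>\<close>'s are counted separately.
\<close>

datatype colour = Black | White nat | Square

datatype 'm decoration = Marked 'm | Unmarked nat

record 'm cmap =
  darts :: "nat set"
  rot :: "nat \<Rightarrow> nat"
  opp :: "nat \<Rightarrow> nat"
  colour :: "nat set \<Rightarrow> colour"
  decor :: "nat set \<Rightarrow> 'm decoration"

definition vertex_at :: "'m cmap \<Rightarrow> nat \<Rightarrow> nat set" where
  "vertex_at G h = orbit (rot G) h"

definition face_perm :: "'m cmap \<Rightarrow> nat \<Rightarrow> nat" where
  "face_perm G = inv (rot G) \<circ> opp G"

definition face_at :: "'m cmap \<Rightarrow> nat \<Rightarrow> nat set" where
  "face_at G h = orbit (face_perm G) h"

definition vertices :: "'m cmap \<Rightarrow> nat set set" where
  "vertices G = vertex_at G ` darts G"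

definition edges :: "'m cmap \<Rightarrow> nat set set" where
  "edges G = (\<lambda>h. {h, opp G h}) ` darts G"

definition faces :: "'m cmap \<Rightarrow> nat set set" where
  "faces G = face_at G ` darts G"

definition is_map :: "'m cmap \<Rightarrow> bool" where
  "is_map G \<longleftrightarrow> finite (darts G) \<and> rot G permutes darts G \<and> opp G permutes darts G \<and>
     (\<forall>h\<in>darts G. opp G h \<noteq> h \<and> opp G (opp G h) = h)"

definition connected_map :: "'m cmap \<Rightarrow> bool" where
  "connected_map G \<longleftrightarrow> darts G \<noteq> {} \<and>
     (\<forall>h\<in>darts G. \<forall>h'\<in>darts G. (h, h') \<in> ({(x, rot G x) |x. x \<in> darts G} \<union> {(x, opp G x) |x. x \<in> darts G})\<^sup>*)"

definition has_genus :: "nat \<Rightarrow> 'm cmap \<Rightarrow> bool" where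
  "has_genus g G \<longleftrightarrow>
     int (card (vertices G)) - int (card (edges G)) + int (card (faces G)) = 2 - 2 * int g"

definition coloured_map :: "nat \<Rightarrow> nat \<Rightarrow> 'm cmap \<Rightarrow> bool" where
  "coloured_map r g G \<longleftrightarrow> is_map G \<and> connected_map G \<and> has_genus g G \<and>
     (\<forall>x\<in>vertices G. colour G x = Black \<longrightarrow> 3 \<le> card x \<and> card x \<le> r + 1) \<and>
     (\<forall>h\<in>darts G. \<forall>h'\<in>darts G. \<forall>i j. face_at G h = face_at G h' \<and>
        colour G (vertex_at G h) = White i \<and> colour G (vertex_at G h') = White j \<longrightarrow>
        vertex_at G h = vertex_at G h')"

definition decorated :: "nat \<Rightarrow> 'm set \<Rightarrow> 'm cmap \<Rightarrow> bool" where
  "decorated N M G \<longleftrightarrow>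
     (\<forall>f\<in>faces G. decor G f \<in> Marked ` M \<union> Unmarked ` {1..N}) \<and>
     (\<forall>m\<in>M. \<exists>!f. f \<in> faces G \<and> decor G f = Marked m)"

definition white_labelled :: "nat \<Rightarrow> 'm cmap \<Rightarrow> bool" where
  "white_labelled n G \<longleftrightarrow>
     (\<forall>x\<in>vertices G. \<forall>i. colour G x = White i \<longrightarrow> i \<in> {1..n}) \<and>
     (\<forall>i\<in>{1..n}. \<exists>!x. x \<in> vertices G \<and> colour G x = White i)"

definition white_leaves :: "nat cmap \<Rightarrow> bool" where
  "white_leaves G \<longleftrightarrow>
     (\<forall>h\<in>darts G. \<forall>i. colour G (vertex_at G h) = White i \<longrightarrow>
        card (vertex_at G h) = 1 \<and> decor G (face_at G h) = Marked i)"

definition star_constraint :: "'m cmap \<Rightarrow> nat set \<Rightarrow> bool" where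
  "star_constraint G x \<longleftrightarrow> inj_on (face_at G) x"

definition maps_F :: "nat \<Rightarrow> nat \<Rightarrow> nat \<Rightarrow> nat \<Rightarrow> nat cmap set" where
  "maps_F r N g n = {G. coloured_map r g G \<and> decorated N {1..n} G \<and>
     (\<forall>x\<in>vertices G. colour G x = Black)}"

definition maps_W :: "nat \<Rightarrow> nat \<Rightarrow> nat \<Rightarrow> nat \<Rightarrow> nat cmap set" where
  "maps_W r N g n = {G. coloured_map r g G \<and> decorated N {1..n} G \<and>
     white_labelled n G \<and> white_leaves G \<and> (\<forall>x\<in>vertices G. colour G x \<noteq> Square)}"

definition maps_U :: "nat \<Rightarrow> nat \<Rightarrow> nat \<Rightarrow> nat \<Rightarrow> nat cmap set" where
  "maps_U r N g n = {G. coloured_map r g G \<and> decorated N {1..n} G \<and>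
     white_labelled n G \<and> white_leaves G \<and>
     (\<exists>!x. x \<in> vertices G \<and> colour G x = Square) \<and>
     (\<exists>h\<in>darts G. colour G (vertex_at G h) = White 1 \<and> colour G (vertex_at G (opp G h)) = Square)}"

text \<open>
  The label \<open>(m, i)\<close> stands for the decoration \<open>z\<^sub>m\<^sub>,\<^sub>i\<close>. Turning clockwise means iterating
  the inverse of the rotation; the corner at which the enumeration starts is not specified,
  since only the cyclic order of the decorations is prescribed.
\<close>

definition maps_S :: "nat \<Rightarrow> nat \<Rightarrow> nat \<Rightarrow> nat \<Rightarrow> (nat \<Rightarrow> nat) \<Rightarrow> (nat \<times> nat) cmap set" where
  "maps_S r N g n k = {G. coloured_map r g G \<and> decorated N (SIGMA m:{1..n}. {1..k m}) G \<and>
     white_labelled n G \<and> (\<forall>x\<in>vertices G. colour G x \<noteq> Square) \<and>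
     (\<forall>x\<in>vertices G. \<forall>m. colour G x = White m \<longrightarrow>
        star_constraint G x \<and> card x = k m \<and>
        (\<exists>h\<in>x. \<forall>i\<in>{1..k m}. decor G (face_at G ((inv (rot G) ^^ (i - 1)) h)) = Marked (m, i)))}"

definition is_iso :: "(nat \<Rightarrow> nat) \<Rightarrow> 'm cmap \<Rightarrow> 'm cmap \<Rightarrow> bool" where
  "is_iso f G H \<longleftrightarrow> bij_betw f (darts G) (darts H) \<and>
     (\<forall>h\<in>darts G. f (rot G h) = rot H (f h) \<and> f (opp G h) = opp H (f h)) \<and>
     (\<forall>x\<in>vertices G. colour H (f ` x) = colour G x) \<and>
     (\<forall>x\<in>faces G. decor H (f ` x) = decor G x)"

definition automorphisms :: "'m cmap \<Rightarrow> (nat \<Rightarrow> nat) set" where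
  "automorphisms G = {f. f permutes darts G \<and> is_iso f G G}"

definition iso_rel :: "'m cmap set \<Rightarrow> ('m cmap \<times> 'm cmap) set" where
  "iso_rel A = {(G, H). G \<in> A \<and> H \<in> A \<and> (\<exists>f. is_iso f G H)}"

definition representatives :: "'m cmap set \<Rightarrow> 'm cmap set" where
  "representatives A = (\<lambda>C. SOME G. G \<in> C) ` (A // iso_rel A)"

definition edge_weight :: "complex poly \<Rightarrow> complex \<Rightarrow> complex \<Rightarrow> complex" where
  "edge_weight V a b =
     (if a = b then 1 / poly (pderiv (pderiv V)) a
      else (a - b) / (poly (pderiv V) a - poly (pderiv V) b))"

definition black_formula :: "complex poly \<Rightarrow> nat set \<Rightarrow> (nat \<Rightarrow> complex) \<Rightarrow> complex" where
  "black_formula V C a = (\<Sum>i\<in>C. - poly (pderiv V) (a i) / (\<Prod>j\<in>C - {i}. a i - a j))"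

text \<open>
  The limit is taken in the product topology on \<open>nat \<Rightarrow> complex\<close>, along arguments whose values
  on the set \<open>C\<close> of corners are pairwise distinct.
\<close>

definition black_weight :: "complex poly \<Rightarrow> nat set \<Rightarrow> (nat \<Rightarrow> complex) \<Rightarrow> complex" where
  "black_weight V C a =
     (if inj_on a C then black_formula V C a
      else Lim (at a within {b. inj_on b C}) (black_formula V C))"

fun dec_value :: "('m \<Rightarrow> complex) \<Rightarrow> (nat \<Rightarrow> complex) \<Rightarrow> 'm decoration \<Rightarrow> complex" where
  "dec_value z lam (Marked m) = z m"
| "dec_value z lam (Unmarked j) = lam j"

definition corner_value :: "('m \<Rightarrow> complex) \<Rightarrow> (nat \<Rightarrow> complex) \<Rightarrow> 'm cmap \<Rightarrow> nat \<Rightarrow> complex" where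
  "corner_value z lam G h = dec_value z lam (decor G (face_at G h))"

definition vertex_weight ::
  "complex poly \<Rightarrow> (nat \<Rightarrow> complex) \<Rightarrow> ('m \<Rightarrow> complex) \<Rightarrow> complex \<Rightarrow> 'm cmap \<Rightarrow> nat set \<Rightarrow> complex" where
  "vertex_weight V lam z u G x =
     (case colour G x of
        Black \<Rightarrow> black_weight V x (corner_value z lam G)
      | White i \<Rightarrow> 1
      | Square \<Rightarrow> (\<Prod>h\<in>x. 1 / (u - corner_value z lam G h)))"

text \<open>
  The choice of a dart of each edge is immaterial because \<^const>\<open>edge_weight\<close> is symmetric.
  The argument \<open>u\<close> is irrelevant for maps without square vertex.
\<close>

definition weight ::
  "complex poly \<Rightarrow> (nat \<Rightarrow> complex) \<Rightarrow> ('m \<Rightarrow> complex) \<Rightarrow> complex \<Rightarrow> 'm cmap \<Rightarrow> complex" where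
  "weight V lam z u G =
     (\<Prod>e\<in>edges G. let h = (SOME h. h \<in> e) in
        edge_weight V (corner_value z lam G h) (corner_value z lam G (opp G h))) *
     (\<Prod>x\<in>vertices G. vertex_weight V lam z u G x)"

definition map_degree :: "nat \<Rightarrow> 'm cmap \<Rightarrow> int" where
  "map_degree r G = (int r + 1) * (int (card (edges G)) - int (card (vertices G)))"

text \<open>
  Laurent series in \<open>\<alpha>\<^sup>-\<^sup>1\<close>: \<^const>\<open>fls_X\<close> is \<open>\<alpha>\<^sup>-\<^sup>1\<close> and \<^const>\<open>fls_X_inv\<close> is \<open>\<alpha>\<close>.
  The sums below run over finite sets: black vertices have degree at least 3 and the number of
  other vertices is fixed, so that the Euler relation bounds the number of edges of the maps
  with a given degree.
\<close>

definition gen_coeff :: "nat \<Rightarrow> 'm cmap set \<Rightarrow> ('m cmap \<Rightarrow> complex) \<Rightarrow> int \<Rightarrow> complex" where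
  "gen_coeff r A w d =
     (\<Sum>G\<in>{G \<in> representatives A. map_degree r G = d}. w G / of_nat (card (automorphisms G)))"

definition gen_fun :: "nat \<Rightarrow> 'm cmap set \<Rightarrow> ('m cmap \<Rightarrow> complex) \<Rightarrow> complex fls" where
  "gen_fun r A w = Abs_fls (gen_coeff r A w)"

definition gen_F ::
  "nat \<Rightarrow> complex poly \<Rightarrow> nat \<Rightarrow> (nat \<Rightarrow> complex) \<Rightarrow> nat \<Rightarrow> nat \<Rightarrow> (nat \<Rightarrow> complex) \<Rightarrow> complex fls" where
  "gen_F r V N lam g n z = gen_fun r (maps_F r N g n) (weight V lam z 0)"

definition gen_W ::
  "nat \<Rightarrow> complex poly \<Rightarrow> nat \<Rightarrow> (nat \<Rightarrow> complex) \<Rightarrow> nat \<Rightarrow> nat \<Rightarrow> (nat \<Rightarrow> complex) \<Rightarrow> complex fls" where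
  "gen_W r V N lam g n z = gen_fun r (maps_W r N g n) (weight V lam z 0)"

definition gen_U ::
  "nat \<Rightarrow> complex poly \<Rightarrow> nat \<Rightarrow> (nat \<Rightarrow> complex) \<Rightarrow> nat \<Rightarrow> nat \<Rightarrow> complex \<Rightarrow> (nat \<Rightarrow> complex) \<Rightarrow> complex fls" where
  "gen_U r V N lam g n u z = gen_fun r (maps_U r N g n) (weight V lam z u)"

definition gen_S ::
  "nat \<Rightarrow> complex poly \<Rightarrow> nat \<Rightarrow> (nat \<Rightarrow> complex) \<Rightarrow> nat \<Rightarrow> nat \<Rightarrow> (nat \<Rightarrow> nat) \<Rightarrow> (nat \<Rightarrow> nat \<Rightarrow> complex) \<Rightarrow> complex fls" where
  "gen_S r V N lam g n k z = gen_fun r (maps_S r N g n k) (weight V lam (\<lambda>(m, i). z m i) 0)"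

lemma representatives_subset: "G \<in> representatives A \<Longrightarrow> G \<in> A"
proof -
  assume "G \<in> representatives A"
  then obtain H where H: "H \<in> A" "G = (SOME G. G \<in> iso_rel A `` {H})"
    by (auto simp: representatives_def quotient_def)
  have "is_iso id H H" by (auto simp: is_iso_def)
  then have "H \<in> iso_rel A `` {H}" using H(1) by (auto simp: iso_rel_def)
  then have "G \<in> iso_rel A `` {H}" using H(2) by (metis someI)
  then show "G \<in> A" by (auto simp: iso_rel_def)
qed

lemma map_degree_ge:
  assumes "coloured_map r g G"
  shows "map_degree r G \<ge> - (int r + 1)"
proof -
  have "finite (faces G)" "faces G \<noteq> {}"
    using assms by (auto simp: coloured_map_def is_map_def connected_map_def faces_def)
  then have "card (faces G) \<ge> 1" by (simp add: Suc_le_eq card_gt_0_iff)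
  then have "int (card (edges G)) - int (card (vertices G)) \<ge> -1"
    using assms by (auto simp: coloured_map_def has_genus_def)
  then have "(int r + 1) * (int (card (edges G)) - int (card (vertices G))) \<ge> (int r + 1) * (-1)"
    by (intro mult_left_mono) auto
  then show ?thesis by (simp add: map_degree_def)
qed

text \<open>
  The coefficients vanish in sufficiently negative degrees, so \<^const>\<open>Abs_fls\<close> is applied to
  a genuine coefficient sequence.
\<close>

lemma nth_gen_fun:
  assumes "\<And>G. G \<in> A \<Longrightarrow> coloured_map r g G"
  shows "fls_nth (gen_fun r A w) d = gen_coeff r A w d"
proof -
  have "gen_coeff r A w m = 0" if "m < - (int r + 1)" for m
  proof -
    have "{G \<in> representatives A. map_degree r G = m} = {}"
      using map_degree_ge[OF assms, OF representatives_subset] that by fastforce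
    then show ?thesis unfolding gen_coeff_def by (simp only: sum.empty)
  qed
  then show ?thesis
    unfolding gen_fun_def by (intro nth_Abs_fls_lower_bound[of "- (int r + 1)"]) auto
qed

lemma nth_gen:
  "fls_nth (gen_F r V N lam g n z) d = gen_coeff r (maps_F r N g n) (weight V lam z 0) d"
  "fls_nth (gen_W r V N lam g n z) d = gen_coeff r (maps_W r N g n) (weight V lam z 0) d"
  "fls_nth (gen_U r V N lam g n u z) d = gen_coeff r (maps_U r N g n) (weight V lam z u) d"
  "fls_nth (gen_S r V N lam g n k z') d =
     gen_coeff r (maps_S r N g n k) (weight V lam (\<lambda>(m, i). z' m i) 0) d"
  unfolding gen_F_def gen_W_def gen_U_def gen_S_def
  by (rule nth_gen_fun[where g = g]; auto simp: maps_F_def maps_W_def maps_U_def maps_S_def)+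

text \<open>
  Identities between rational functions of the decorations are stated at the points where no
  denominator vanishes. For the fixed parameters \<open>\<lambda>\<^sub>j\<close> this is the condition that the edge
  weights between unmarked faces are defined.
\<close>

definition nondegenerate :: "complex poly \<Rightarrow> nat \<Rightarrow> (nat \<Rightarrow> complex) \<Rightarrow> bool" where
  "nondegenerate V N lam \<longleftrightarrow>
     (\<forall>i\<in>{1..N}. poly (pderiv (pderiv V)) (lam i) \<noteq> 0) \<and>
     (\<forall>i\<in>{1..N}. \<forall>j\<in>{1..N}. lam i \<noteq> lam j \<longrightarrow> poly (pderiv V) (lam i) \<noteq> poly (pderiv V) (lam j))"

definition generic ::
  "complex poly \<Rightarrow> nat \<Rightarrow> (nat \<Rightarrow> complex) \<Rightarrow> 'i set \<Rightarrow> ('i \<Rightarrow> complex) \<Rightarrow> bool" where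
  "generic V N lam I z \<longleftrightarrow>
     (\<forall>i\<in>I. poly (pderiv (pderiv V)) (z i) \<noteq> 0) \<and>
     inj_on (\<lambda>i. poly (pderiv V) (z i)) I \<and>
     (\<forall>i\<in>I. \<forall>j\<in>{1..N}. poly (pderiv V) (z i) \<noteq> poly (pderiv V) (lam j))"

definition weighted_partial ::
  "complex poly \<Rightarrow> nat \<Rightarrow> ((nat \<Rightarrow> complex) \<Rightarrow> complex) \<Rightarrow> (nat \<Rightarrow> complex) \<Rightarrow> complex" where
  "weighted_partial V i f z =
     1 / poly (pderiv (pderiv V)) (z i) * deriv (\<lambda>x. f (z(i := x))) (z i)"

definition residue_at_infinity :: "(complex \<Rightarrow> complex) \<Rightarrow> complex" where
  "residue_at_infinity f = - residue (\<lambda>t. f (1 / t) / t\<^sup>2) 0"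

end

theory Submission
  imports Defs
begin

text \<open>
  Weights are written with divided differences: with \<open>g\<^sub>a = X / (1 - a X)\<close> and the functional
  \<open>ev\<close> sending \<open>X\<^sup>k\<^sup>+\<^sup>1\<close> to the \<open>k\<close>-th coefficient of \<open>V'\<close>, an edge between faces decorated \<open>a, b\<close>
  weighs \<open>1 / ev (g\<^sub>a g\<^sub>b)\<close> and a black vertex \<open>- ev (\<Prod>g\<^sub>a)\<close>, so the latter vanishes in degree
  above \<open>r + 1\<close> and the degree bound can be dropped. Since \<open>g\<^sub>x - g\<^sub>y = (x - y) g\<^sub>x g\<^sub>y\<close>, changing the
  decoration of one corner or edge side from \<open>x\<close> to \<open>y\<close> multiplies the weight by \<open>x - y\<close> and
  inserts the factors of a new edge attached there. Letting \<open>y\<close> tend to \<open>x\<close> for a whole face, a derivative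
  grows a univalent white vertex, which gives (i); the configurations that do not arise by
  deleting a leaf are a single edge and a loop with a leaf, and they produce the exceptional terms.
  For (iii)--(v) the residue in \<open>u\<close> turns the square vertex into a black one or into one of lower
  degree. For (ii), walking around the face \<open>(m, l)\<close> from its white corner and replacing
  \<open>z\<^sub>m\<^sub>,\<^sub>l\<close> by \<open>z\<^sub>m\<^sub>,\<^sub>l\<^sub>+\<^sub>1\<close> one corner or side at a time telescopes into the sum over all edges
  from the white vertex into that face; this is the recursion satisfied by the Lagrange sum.
\<close>

text \<open>Maps without white vertices may have symmetries, and every surgery needs arbitrary fresh
  darts. Surgeries are therefore relations, compared on pairs of a map and a distinguished dart. A
  labelled white vertex excludes nontrivial automorphisms, while automorphisms of the smaller map
  act freely on its darts, so counting pairs up to isomorphism produces exactly its factor 1/#Aut.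
  Corners and sides have separate values because a face may meet the same vertex or edge several
  times, whereas the identity for \<open>gg\<close> governs the change of a single factor. A leaf at
  a corner makes a vertex of degree at least four, a leaf on a side a trivalent one. The two kinds
  of terms thus enumerate disjoint classes, told apart by the degree of the neighbour. In (ii) the
  new edge is first grown with a univalent square vertex at its free end, which is then merged into
  the white vertex. The merge cuts the face in two and lowers the number of vertices by one, so the
  degree rises by r + 1: this is the origin of the powers of \<alpha>. All classes are taken at a
  fixed map degree, where they are finite up to isomorphism.\<close>

abbreviation (input) iff_ascii (infixr "<->" 25) where "P<->Q == P = Q"
abbreviation vx :: "'m cmap=>nat=>nat set" where "vx == vertex_at"
abbreviation fc :: "'m cmap=>nat=>nat set" where "fc == face_at"
abbreviation cv :: "('m => complex)=>(nat => complex)=>'m cmap=>nat => complex" where "cv == corner_value"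
abbreviation reps :: "'m cmap set=>'m cmap set" where "reps == representatives"

section \<open>Geometric series and divided differences\<close>

text \<open>With X = 1/u this is the expansion of 1/(u - s) at infinity. Products of
  \<open>gg\<close> thus encode the fractions carried by a square vertex, and \<open>ev\<close>
  becomes, up to sign, a residue at infinity.\<close>

definition gg :: "complex => complex fps" where
 "gg s = Abs_fps (%n. if n = 0 then 0 else s ^ (n - 1))"

lemma gg_nth_0 [simp]: "fps_nth (gg s) 0 = 0"
 and gg_nth_Suc [simp]: "fps_nth (gg s) (Suc n) = s ^ n" by (auto simp: gg_def)

lemma gg_eq: "gg s * (1 - fps_const s * fps_X) = fps_X"
proof (rule fps_ext)
 fix n
 have *: "gg s * (1 - fps_const s * fps_X) = gg s - fps_const s * (fps_X * gg s)" by (simp add: algebra_simps)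
 show "fps_nth (gg s * (1 - fps_const s * fps_X)) n = fps_nth fps_X n"
 proof (cases n)
  case (Suc m)
  then show ?thesis unfolding * by (cases m) auto
 qed (simp add: *)
qed

text \<open>The resolvent identity for 1/(u - s) and 1/(u - t). Both sides are compared after
  multiplication by the two denominators, which are nonzero because each of them divides X.\<close>

lemma gg_diff: "gg s - gg t = fps_const (s - t) * (gg s * gg t)"
proof -
 let ?s = "1 - fps_const s * fps_X" and ?t = "1 - fps_const t * fps_X"
 have nz: "1 - fps_const c * fps_X~=0" for c :: complex by (metis (no_types, lifting) fps_X_neq_zero gg_eq mult_zero_right)
 have "(gg s - gg t) * (?s * ?t) = (gg s * ?s) * ?t - (gg t * ?t) * ?s" by (simp only: left_diff_distrib mult_ac)
 also have "... = fps_const (s - t) * fps_X * fps_X" unfolding gg_eq by (simp add: algebra_simps flip: fps_const_sub)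
 also have "... = fps_const (s - t) * (gg s * ?s) * (gg t * ?t)" by (simp add: gg_eq)
 also have "... = (fps_const (s - t) * (gg s * gg t)) * (?s * ?t)" by (simp add: mult_ac)
 finally show ?thesis using nz[of s] nz[of t] by simp
qed

text \<open>
 \<open>ev p F\<close> is the coefficient of \<open>X\<close> in \<open>p(1/X) F(X)\<close>. On a product of the geometric series
 \<open>gg s = X/(1 - s X)\<close> it is the divided difference of \<open>p\<close> at the points \<open>s\<close>.
\<close>

definition ev :: "complex poly => complex fps => complex" where
 "ev p F = (\<Sum>k\<le>degree p. coeff p k * fps_nth F (Suc k))"

abbreviation eiv :: "complex poly => complex => complex => complex" where
 "eiv V x y == inverse (ev (pderiv V) (gg x * gg y))"

lemma ev_eq: "degree p <= n==>ev p F = (\<Sum>k\<le>n. coeff p k * fps_nth F (Suc k))" unfolding ev_def by (rule sum.mono_neutral_left) (auto simp: coeff_eq_0)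

lemma ev_diff: "ev p F - ev p G = ev p (F - G)" by (simp add: ev_def sum_subtractf algebra_simps)

lemma ev_scale: "ev p (fps_const c * F) = c * ev p F" by (simp add: ev_def sum_distrib_left algebra_simps)

lemma ev_uminus: "ev (- p) F = - ev p F" by (simp add: ev_def sum_negf)

lemma ev_add_poly: "ev (p + q) F = ev p F + ev q F"
proof -
 let ?n = "max (degree p) (degree q)"
 have "degree (p + q) <= ?n" by (rule degree_add_le_max)
 then show ?thesis by (simp add: ev_eq[of _ ?n] sum.distrib algebra_simps)
qed

text \<open>The factor u - s of the polynomial cancels the fraction 1/(u - s). Coefficientwise, (1 -
  s X) times \<open>gg s * F\<close> is X times F, and this is summed against the coefficients of q.
  In (iv) the cancellation makes corner and side terms compensate each other.\<close>

lemma ev_shift: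
 assumes "fps_nth F 0 = 0"
 shows "ev ([:- s, 1:] * q) (gg s * F) = ev q F"
proof -
 let ?n = "Suc (degree q)" and ?F = "gg s * F"
 have "?F * (1 - fps_const s * fps_X) = F * fps_X" using gg_eq[of s] by (simp add: mult_ac)
 moreover have "?F * (1 - fps_const s * fps_X) = ?F - fps_const s * (fps_X * ?F)" by (simp only: right_diff_distrib mult_1_right) (simp only: mult_ac)
 ultimately have "?F - fps_const s * (fps_X * ?F) = fps_X * F" by (simp only: mult_ac)
 then have *: "fps_nth ?F (Suc (Suc k)) - s * fps_nth ?F (Suc k) = fps_nth F (Suc k)" for k by (metis diff_Suc_1 fps_mult_left_const_nth fps_sub_nth fps_X_mult_nth nat.distinct(1))
 have F1: "fps_nth ?F (Suc 0) = 0" using assms by (simp add: fps_mult_nth)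
 have "degree ([:- s, 1:] * q) <= ?n" by (metis degree_mult_le degree_pCons_eq_if plus_1_eq_Suc one_neq_zero add.commute degree_0 pCons_eq_0_iff One_nat_def)
 then have "ev ([:- s, 1:] * q) ?F = (\<Sum>k\<le>?n. coeff ([:- s, 1:] * q) k * fps_nth ?F (Suc k))" by (rule ev_eq)
 also have "... = (\<Sum>k\<le>?n. coeff (pCons 0 q) k * fps_nth ?F (Suc k))
  - (\<Sum>k\<le>?n. s * coeff q k * fps_nth ?F (Suc k))" by (simp add: sum_subtractf[symmetric] algebra_simps del: sum.atMost_Suc)
 also have "(\<Sum>k\<le>?n. coeff (pCons 0 q) k * fps_nth ?F (Suc k)) =
  (\<Sum>k\<le>degree q. coeff q k * fps_nth ?F (Suc (Suc k)))" unfolding sum.atMost_Suc_shift using F1 by simp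
 also have "(\<Sum>k\<le>?n. s * coeff q k * fps_nth ?F (Suc k)) =
  (\<Sum>k\<le>degree q. s * coeff q k * fps_nth ?F (Suc k))" by (simp add: coeff_eq_0)
 finally show ?thesis by (simp add: ev_def *[symmetric] sum_subtractf[symmetric] algebra_simps)
qed

lemma ev_gg: "ev p (gg s) = poly p s" by (simp add: ev_def poly_altdef)

lemma ev_gg_diff: "(s - t) * ev p (gg s * gg t) = poly p s - poly p t" by (metis ev_diff ev_gg ev_scale gg_diff)

text \<open>The recursion of divided differences; the remaining points are collected in the
  spectator F.\<close>

lemma ev_gg_diff_mult: "(s - t) * ev p (gg s * gg t * F) = ev p (gg s * F) - ev p (gg t * F)"
proof -
 have "gg s * F - gg t * F = fps_const (s - t) * (gg s * gg t * F)" using gg_diff[of s t] by (metis left_diff_distrib mult.assoc)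
 then show ?thesis by (metis ev_diff ev_scale)
qed

text \<open>Confluent points give the derivative: with p - p(s) = (u - s) q both sides are q(s). The
  constant p(s) is invisible to the left side because \<open>gg s * gg s\<close> starts in order
  two.\<close>

lemma ev_gg_gg: "ev p (gg s * gg s) = poly (pderiv p) s"
proof -
 have "[:- s, 1:] dvd p - [:poly p s:]" by (simp add: poly_eq_0_iff_dvd[symmetric])
 then obtain q where "p - [:poly p s:] = [:- s, 1:] * q" by (elim dvdE)
 then have q: "p = [:- s, 1:] * q + [:poly p s:]" by (metis diff_add_cancel)
 have "ev p (gg s * gg s) = ev ([:- s, 1:] * q) (gg s * gg s) + ev [:poly p s:] (gg s * gg s)" by (metis q ev_add_poly)
 also have "ev ([:- s, 1:] * q) (gg s * gg s) = poly q s" by (subst ev_shift) (auto simp: ev_gg)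
 also have "ev [:poly p s:] (gg s * gg s) = 0" by (simp add: ev_def fps_mult_nth)
 finally have "ev p (gg s * gg s) = poly q s" by simp
 moreover have "pderiv p = [:- s, 1:] * pderiv q + q" by (subst q) (simp add: pderiv_add pderiv_mult pderiv_pCons pderiv_diff pderiv_smult)
 ultimately show ?thesis by simp
qed

text \<open>The divided difference of p at the values of a. The points are indexed by darts, so that
  equal decorations count with multiplicity.\<close>

definition dd :: "complex poly=>nat set=>(nat => complex) => complex" where
 "dd p C a = ev p (\<Prod>i\<in>C. gg (a i))"

lemma dd_cong: "(!!i. i:C==>a i = b i)==>dd p C a = dd p C b" by (simp add: dd_def)

lemma dd_reindex: "inj_on f C==>dd p (f ` C) a = dd p C (a \<circ> f)" by (simp add: dd_def prod.reindex)

lemma prod_gg_low: "finite C==>k < card C==>fps_nth (\<Prod>i\<in>C. gg (a i)) k = 0"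
proof (induction C arbitrary: k rule: finite_induct)
 case (insert c C)
 have "fps_nth (gg (a c)) i * fps_nth (\<Prod>i\<in>C. gg (a i)) (k - i) = 0" if "i <= k" for i using insert that by (cases i) auto
 then show ?case using insert.hyps unfolding prod.insert[OF insert.hyps] fps_mult_nth by (intro sum.neutral) auto
qed auto

text \<open>Every factor \<open>gg\<close> starts in order one, so the product starts beyond the
  last coefficient that \<open>ev p\<close> reads, which has index
  \<open>degree p + 1\<close>.\<close>

lemma dd_zero: "finite C==>degree p + 1 < card C==>dd p C a = 0" unfolding dd_def ev_def by (rule sum.neutral) (auto intro!: prod_gg_low)

text \<open>Both sides satisfy the two-point recursion that expresses (a x - a y) times the value on
  C by the values on C without y and on C without x: the left side by the identity for
  \<open>gg\<close>, the right side by partial fractions. Induction on the cardinality identifies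
  them.\<close>

lemma dd_distinct:
 assumes "finite C" "C~={}" "inj_on a C"
 shows "dd p C a = (\<Sum>i\<in>C. poly p (a i) / (\<Prod>j\<in>C - {i}. a i - a j))" using assms
proof (induction "card C" arbitrary: C)
 case (Suc n)
 show ?case
 proof (cases "n = 0")
  case True
  with Suc obtain x where "C = {x}" by (metis One_nat_def card_1_singletonE)
  then show ?thesis by (simp add: dd_def ev_gg)
 next
  case False
  then obtain x y where xy: "x:C" "y:C" "x~=y" by (metis Suc.hyps(2) Suc.prems(1) Suc_inject card_1_singleton_iff card_le_Suc0_iff_eq le_Suc_eq
  less_Suc_eq_le nat.simps(3) not_less_eq_eq le_0_eq)
  define L where "L C = (\<Sum>i\<in>C. poly p (a i) / (\<Prod>j\<in>C - {i}. a i - a j))" for C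
  define S where "S = C - {x, y}"
  have S: "finite S" "x~:S" "y~:S" and C: "C = insert x (insert y S)" using xy Suc.prems by (auto simp: S_def)
  have axy: "a x~=a y" using Suc.prems(3) xy by (auto dest: inj_onD)
  have inj: "i:S==>a i~=a x&a i~=a y" for i using Suc.prems(3) xy S by (metis C inj_onD insertCI)
  have "dd p (insert x S) a = L (insert x S)" "dd p (insert y S) a = L (insert y S)" unfolding L_def using Suc.hyps(2) Suc.prems(3) S xy(3) by (intro Suc.hyps(1); auto simp: C intro: inj_on_subset)+
  moreover have "(a x - a y) * dd p C a = dd p (insert x S) a - dd p (insert y S) a" using S xy by (simp add: C dd_def ev_gg_diff_mult[symmetric] mult_ac)
  moreover have "(a x - a y) * L C = L (insert x S) - L (insert y S)"
  proof -
  have 1: "insert x (insert y S) - {x} = insert y S" "insert x (insert y S) - {y} = insert x S"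
  "insert x S - {x} = S" "insert y S - {y} = S" using S xy by auto
  have 2: "i:S==>insert x (insert y S) - {i} = insert x (insert y (S - {i}))"
  "i:S==>insert x S - {i} = insert x (S - {i})"
  "i:S==>insert y S - {i} = insert y (S - {i})" for i using S by auto
  \<comment> \<open>Partial fractions for one summand. For P = 0 all three quotients are zero, so
    nothing has to be known about the other differences.\<close>
  have t: "(a x - a y) * (q / ((b - a x) * ((b - a y) * P))) = q / ((b - a x) * P) - q / ((b - a y) * P)"
  if "b~=a x" "b~=a y" for b q P :: complex using that by (cases "P = 0") (auto simp: divide_simps, auto simp: algebra_simps)
  have "L C = poly p (a x) / ((a x - a y) * (\<Prod>j\<in>S. a x - a j))
  + poly p (a y) / ((a y - a x) * (\<Prod>j\<in>S. a y - a j))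
  + (\<Sum>i\<in>S. poly p (a i) / ((a i - a x) * ((a i - a y) * (\<Prod>j\<in>S - {i}. a i - a j))))" unfolding L_def C using S xy by (simp add: 1 2)
  moreover have "(a x - a y) * (\<Sum>i\<in>S. poly p (a i) / ((a i - a x) * ((a i - a y) * (\<Prod>j\<in>S - {i}. a i - a j))))
  = (\<Sum>i\<in>S. poly p (a i) / ((a i - a x) * (\<Prod>j\<in>S - {i}. a i - a j)))
  - (\<Sum>i\<in>S. poly p (a i) / ((a i - a y) * (\<Prod>j\<in>S - {i}. a i - a j)))" unfolding sum_distrib_left sum_subtractf[symmetric] by (rule sum.cong[OF refl], rule t) (auto simp: inj)
  moreover have "(a x - a y) * (poly p (a x) / ((a x - a y) * (\<Prod>j\<in>S. a x - a j)))
  = poly p (a x) / (\<Prod>j\<in>S. a x - a j)" using axy by simp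
  moreover have "(a x - a y) * (poly p (a y) / ((a y - a x) * (\<Prod>j\<in>S. a y - a j)))
  = - (poly p (a y) / (\<Prod>j\<in>S. a y - a j))"
  proof -
  have "a y - a x = - (a x - a y)" by simp
  then show ?thesis using axy by (simp only: mult_minus_left divide_minus_right) simp
  qed
  ultimately show ?thesis unfolding L_def using S xy by (simp add: 1 2 ring_distribs)
  qed
  ultimately have "(a x - a y) * dd p C a = (a x - a y) * L C" by simp
  then show ?thesis using axy by (simp add: L_def)
 qed
qed auto

lemma tendsto_fps_prod:
 assumes "finite C" "!!i. i:C==>((%x. f x i) \<longlongrightarrow> a i) F"
 shows "((%x. fps_nth (\<Prod>i\<in>C. gg (f x i)) k) \<longlongrightarrow> fps_nth (\<Prod>i\<in>C. gg (a i)) k) F" using assms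
proof (induction C arbitrary: k rule: finite_induct)
 case (insert c C)
 have "((%x. fps_nth (gg (f x c)) i) \<longlongrightarrow> fps_nth (gg (a c)) i) F" for i using insert.prems by (cases i) (auto intro!: tendsto_intros)
 then show ?case using insert by (auto simp: fps_mult_nth intro!: tendsto_intros)
qed auto

lemma tendsto_dd:
 assumes "finite C" "!!i. i:C==>((%x. f x i) \<longlongrightarrow> a i) F"
 shows "((%x. dd p C (f x)) \<longlongrightarrow> dd p C a) F" unfolding dd_def ev_def using assms by (auto intro!: tendsto_intros tendsto_fps_prod)

text \<open>Divided differences are continuous, so the limit prescribed for coinciding decorations
  is their value there. What has to be shown is that the limit is not taken along the trivial
  filter: the point is approached along a line on which all but finitely many members are injective
  on C.\<close>

lemma black_weight_eq:
 assumes "finite C" "C~={}"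
 shows "black_weight V C a = - dd (pderiv V) C a"
proof -
 have formula: "black_formula V C b = - dd (pderiv V) C b" if "inj_on b C" for b using assms that by (simp add: dd_distinct black_formula_def sum_negf)
 show ?thesis
 proof (cases "inj_on a C")
  case False
  \<comment> \<open>Two different darts collide, so at least one of them is a nonzero number. Its
    value moves along the line below, which keeps \<open>b e\<close> different from a.\<close>
  then obtain i0 where i0: "i0:C" "i0~=0" by (auto simp: inj_on_def)
  \<comment> \<open>Darts are natural numbers, so they serve as pairwise distinct slopes; each pair
    of darts collides for at most one e.\<close>
  define b where "b = (%e::real. %i::nat. a i + of_real e * of_nat i)"
  have tb: "(b \<longlongrightarrow> a) (at 0)"
  proof -
  have "continuous_on UNIV b" unfolding b_def by (intro continuous_on_coordinatewise_then_product continuous_intros)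
  then have "(b \<longlongrightarrow> b 0) (at 0)" by (simp add: continuous_on_def)
  then show ?thesis by (simp add: b_def)
  qed
  have bad: "finite {e. ~ inj_on (b e) C}"
  proof (rule finite_subset)
  show "{e. ~ inj_on (b e) C} <= (%(i, j). Re ((a i - a j) / (of_nat j - of_nat i))) ` (C \<times> C)"
  proof
  fix e assume "e:{e. ~ inj_on (b e) C}"
  then obtain i j where ij: "i:C" "j:C" "i~=j" "b e i = b e j" by (auto simp: inj_on_def)
  then have "a i - a j = of_real e * (of_nat j - of_nat i)" by (simp add: b_def algebra_simps)
  moreover have "(of_nat j :: complex) - of_nat i~=0" using ij by simp
  ultimately have "complex_of_real e = (a i - a j) / (of_nat j - of_nat i)" by (simp add: field_simps)
  then have "e = Re ((a i - a j) / (of_nat j - of_nat i))" by (metis Re_complex_of_real)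
  then show "e:(%(i, j). Re ((a i - a j) / (of_nat j - of_nat i))) ` (C \<times> C)" using ij by force
  qed
  qed (use assms in auto)
  have "eventually (%e. e~:{e. ~ inj_on (b e) C} - {0}) (at 0)" using bad open_Compl[OF finite_imp_closed[of "{e. ~ inj_on (b e) C} - {0}"]] unfolding eventually_at_topological by (intro exI[of _ "- ({e. ~ inj_on (b e) C} - {0})"]) auto
  then have ev1: "eventually (%e. inj_on (b e) C) (at 0)" by (auto simp: eventually_at_filter elim: eventually_mono)
  have ev2: "eventually (%e. b e~=a) (at (0::real))"
  proof -
  have "b e~=a" if "e~=0" for e using i0 that by (auto simp: b_def fun_eq_iff intro!: exI[of _ i0])
  then show ?thesis by (simp add: eventually_at_filter)
  qed
  have "filterlim b (at a within {b. inj_on b C}) (at 0)" unfolding filterlim_at using ev1 ev2 tb by (auto intro: eventually_conj)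
  \<comment> \<open>A filter that receives a nontrivial one is nontrivial. Only then does
    \<open>Lim\<close> denote the limit rather than an arbitrary value.\<close>
  then have nb: "at a within {b. inj_on b C}~=bot" by (metis at_neq_bot bot.extremum_uniqueI filterlim_def filtermap_bot_iff)
  have "((%b. - dd (pderiv V) C b) \<longlongrightarrow> - dd (pderiv V) C a) (at a within {b. inj_on b C})"
  proof (intro tendsto_minus tendsto_dd assms)
  fix i
  have "continuous_on UNIV (%b::nat=>complex. b i)" by (rule continuous_on_product_coordinates)
  then show "((%b. b i) \<longlongrightarrow> a i) (at a within {b. inj_on b C})" by (meson UNIV_I continuous_on_def subset_UNIV tendsto_within_subset)
  qed
  then have "(black_formula V C \<longlongrightarrow> - dd (pderiv V) C a) (at a within {b. inj_on b C})" by (rule Lim_transform_eventually) (auto simp: eventually_at_filter formula)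
  then show ?thesis using False nb by (simp add: black_weight_def tendsto_Lim)
 qed (simp add: black_weight_def formula)
qed

lemma edge_weight_eq: "edge_weight V a b = eiv V a b"
proof (cases "a = b")
 case False
 then have "ev (pderiv V) (gg a * gg b) = (poly (pderiv V) a - poly (pderiv V) b) / (a - b)" using ev_gg_diff[of a b "pderiv V"] by (simp add: field_simps)
 then show ?thesis using False by (simp add: edge_weight_def)
qed (simp add: edge_weight_def ev_gg_gg inverse_eq_divide)

text \<open>After u = 1/t the integrand is a power series in t divided by the power of exponent m +
  2, where m is the degree of p. Its residue is the coefficient of order m + 1, and this is
  \<open>ev\<close> of the series. The sum over J is the sum over the maps that contribute at one
  order of \<alpha>.\<close>

lemma residue_sum_fractions:
 assumes "finite J" "!!j. j:J==>finite (C j)"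
 shows "- residue_at_infinity (%u. poly p u * (\<Sum>j\<in>J. c j * (\<Prod>i\<in>C j. 1 / (u - a j i))))
  = (\<Sum>j\<in>J. c j * dd p (C j) (a j))"
proof -
 let ?m = "degree p"
 define f where "f t = (\<Sum>k\<le>?m. coeff p k * t ^ (?m - k)) * (\<Sum>j\<in>J. c j * (\<Prod>i\<in>C j. t / (1 - a j i * t)))"
  for t
 define F where "F = (\<Sum>k\<le>?m. fps_const (coeff p k) * fps_X ^ (?m - k)) *
  (\<Sum>j\<in>J. fps_const (c j) * (\<Prod>i\<in>C j. fps_X / (1 - fps_const (a j i) * fps_X)))"
 have gg: "gg s = fps_X / (1 - fps_const s * fps_X)" for s using gg_eq[of s] by (metis fps_X_neq_zero mult_zero_right nonzero_mult_div_cancel_right)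
 have "f has_fps_expansion F" unfolding f_def F_def by (intro fps_expansion_intros has_fps_expansion_sum has_fps_expansion_prod) auto
 then have res: "residue (%t. f t / t ^ Suc (?m + 1)) 0 = fps_nth F (?m + 1)" by (rule residue_fps_expansion_over_power_at_0)
 have "- residue_at_infinity (%u. poly p u * (\<Sum>j\<in>J. c j * (\<Prod>i\<in>C j. 1 / (u - a j i))))
  = residue (%t. f t / t ^ Suc (?m + 1)) 0" unfolding residue_at_infinity_def minus_minus
 proof (rule residue_cong)
  have "poly p (1 / t) * (\<Sum>j\<in>J. c j * (\<Prod>i\<in>C j. 1 / (1 / t - a j i))) / t\<^sup>2 = f t / t ^ Suc (?m + 1)"
  if "t~=0" for t
  proof -
  \<comment> \<open>Valid also for 1 - b t = 0, where both sides are quotients by zero.\<close>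
  have 1: "1 / (1 / t - b) = t / (1 - b * t)" for b using that by (cases "1 - b * t = 0") (auto simp: field_simps)
  have 2: "poly p (1 / t) / t\<^sup>2 = (\<Sum>k\<le>?m. coeff p k * t ^ (?m - k)) / t ^ Suc (?m + 1)" unfolding poly_altdef sum_divide_distrib
  proof (rule sum.cong)
  fix k assume "k:{..?m}"
  then have "t ^ Suc (?m + 1) = t ^ (?m - k) * t ^ k * t\<^sup>2" by (simp flip: power_add)
  then show "coeff p k * (1 / t) ^ k / t\<^sup>2 = coeff p k * t ^ (?m - k) / t ^ Suc (?m + 1)" using that by (simp add: power_divide)
  qed simp
  have 3: "x * S / y = x / y * S" for x y S :: complex by simp
  show ?thesis unfolding f_def 1 3 2 ..
  qed
  then show "eventually (%t. poly p (1 / t) * (\<Sum>j\<in>J. c j * (\<Prod>i\<in>C j. 1 / (1 / t - a j i))) / t\<^sup>2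
  = f t / t ^ Suc (?m + 1)) (at 0)" by (auto simp: eventually_at_filter)
 qed simp
 also have "... = fps_nth F (?m + 1)" by (rule res)
 also have "... = (\<Sum>k\<le>?m. coeff p k * fps_nth (\<Sum>j\<in>J. fps_const (c j) * (\<Prod>i\<in>C j. gg (a j i))) (Suc k))" unfolding F_def gg[symmetric] sum_distrib_right fps_sum_nth by (rule sum.cong) (auto simp: mult.assoc fps_X_power_mult_nth Suc_diff_le fps_sum_nth)
 also have "... = (\<Sum>j\<in>J. c j * dd p (C j) (a j))" unfolding dd_def ev_def fps_sum_nth sum_distrib_left by (subst sum.swap) (simp add: sum_distrib_left mult_ac)
 finally show ?thesis .
qed

section \<open>Cycles of permutations: inserting a point, cutting and merging\<close>

abbreviation (input) swp :: "nat=>nat=>nat=>nat" where "swp == Transposition.transpose"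

lemma orbit_self: "finite D==>pe permutes D==>x : orbit pe x" by (meson permutation_permutes permutation_self_in_orbit)

lemma orbit_closed_subset: "x:S==>(!!y. y:S==>pe y:S) ==> orbit pe x <= S"
proof
 fix y assume S: "x:S" "!!y. y:S==>pe y:S" and "y : orbit pe x"
 from this(3) show "y:S" by induction (auto simp: S)
qed

lemma orbit_eq_of_mem:
 assumes "finite D" "pe permutes D" "y : orbit pe x"
 shows "orbit pe y = orbit pe x"
proof
 show "orbit pe y <= orbit pe x" using assms(3) by (meson orbit_trans subsetI)
 have "x : orbit pe y" using assms by (metis orbit_self orbit_swap)
 then show "orbit pe x <= orbit pe y" by (meson orbit_trans subsetI)
qed

lemma orbit_in: "pe permutes D==>x:D ==> orbit pe x <= D" by (rule permutes_orbit_subset)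

text \<open>The least positive return time n enumerates the orbit without repetition, hence n is the
  cardinality of the orbit.\<close>

lemma orbit_enum:
 assumes "finite D" "pe permutes D" "L = card (orbit pe b)"
 shows "orbit pe b = (%t. (pe ^^ t) b) ` {..<L}" "inj_on (%t. (pe ^^ t) b) {..<L}" "(pe ^^ L) b = b" "0 < L"
proof -
 have perm: "permutation pe" using assms permutation_permutes by blast
 define n where "n = (LEAST n. 0 < n&(pe ^^ n) b = b)"
 have "b : orbit pe b" using assms by (rule_tac orbit_self)
 then have "EX n. 0 < n&(pe ^^ n) b = b" unfolding orbit_altdef by (auto simp: eq_commute)
 then have n: "0 < n&(pe ^^ n) b = b" unfolding n_def by (rule LeastI_ex)
 have least: "~ (0 < m&(pe ^^ m) b = b)" if "m < n" for m using that unfolding n_def by (rule not_less_Least)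
 have orb: "orbit pe b = (%t. (pe ^^ t) b) ` {..<n}" using n orbit_altdef_bounded[of n pe b] by auto
 have bij: "bij (pe ^^ m)" for m using perm permutation_bijective bij_fn by blast
 have aux: False if "(pe ^^ s) b = (pe ^^ t) b" "s < t" "t < n" for s t
 proof -
  have "(pe ^^ t) b = (pe ^^ s) ((pe ^^ (t - s)) b)" using that(2) by (metis add_diff_inverse_nat funpow_add comp_apply less_imp_not_less)
  then have "(pe ^^ (t - s)) b = b" using that(1) bij[of s] by (metis bij_def injD)
  then show False by (metis that(2,3) least less_imp_diff_less zero_less_diff)
 qed
 have inj: "inj_on (%t. (pe ^^ t) b) {..<n}" by (rule inj_onI) (metis aux lessThan_iff linorder_neqE_nat)
 have "L = n" using assms(3) unfolding orb by (simp add: card_image[OF inj])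
 then show "orbit pe b = (%t. (pe ^^ t) b) ` {..<L}" "inj_on (%t. (pe ^^ t) b) {..<L}" "(pe ^^ L) b = b" "0 < L" using orb inj n by auto
qed

text \<open>If p is a fixed point of the permutation, this places p into the cycle of h immediately
  after h.\<close>

definition ins :: "(nat=>nat)=>nat=>nat=>nat=>nat" where
 "ins pe h p = pe \<circ> swp h p"

context
 fixes D :: "nat set" and pe :: "nat=>nat" and h p :: nat
 assumes fin: "finite D" and perm: "pe permutes D" and hD: "h:D" and pD: "p~:D"
begin

lemma ins_apply: "ins pe h p h = p" "ins pe h p p = pe h" "x~=h==>x~=p==>ins pe h p x = pe x" using perm pD by (auto simp: ins_def permutes_def Transposition.transpose_def)

lemma ins_permutes: "ins pe h p permutes insert p D" unfolding ins_def using perm hD by (intro permutes_compose[OF permutes_swap_id]) (auto intro: permutes_subset)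

lemma orbit_ins:
 assumes "y:D"
 shows "orbit (ins pe h p) y = (if h : orbit pe y then insert p (orbit pe y) else orbit pe y)"
proof -
 let ?pe = "ins pe h p"
 have fin': "finite (insert p D)" using fin by simp
 have sub: "orbit pe y <= D" using orbit_in[OF perm assms] .
 have step: "pe x : orbit ?pe x" if "x:D" for x using that pD ins_apply by (metis orbit.base orbit.step)
 have A: "orbit pe y <= orbit ?pe y"
 proof
  fix x assume "x : orbit pe y"
  then show "x : orbit ?pe y"
  proof induction
  case base show ?case by (rule step[OF assms])
  next
  case (step x)
  then show ?case using \<open>!!x. x : D ==> pe x : orbit ?pe x\<close> sub by (metis orbit_trans subsetD)
  qed
 qed
 have self: "y : orbit pe y" by (rule orbit_self[OF fin perm])
 show ?thesis
 proof (cases "h : orbit pe y")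
  case True
  have "orbit ?pe y <= insert p (orbit pe y)" by (rule orbit_closed_subset) (use self True ins_apply in \<open>auto intro: orbit.intros\<close>,
  metis ins_apply orbit.step)
  moreover have "p : orbit ?pe y" using A True ins_apply(1) by (metis orbit.step subsetD)
  ultimately show ?thesis using A True by auto
 next
  case False
  have "orbit ?pe y <= orbit pe y" by (rule orbit_closed_subset) (use self False sub pD ins_apply(3) in
  \<open>auto simp del: ins_def, metis orbit.step subsetD\<close>)
  then show ?thesis using A False by auto
 qed
qed

lemma orbit_ins_new: "orbit (ins pe h p) p = insert p (orbit pe h)"
proof -
 have "p : orbit (ins pe h p) h" using ins_apply(1) by (metis orbit.base)
 then have "orbit (ins pe h p) p = orbit (ins pe h p) h" using orbit_eq_of_mem[OF _ ins_permutes] fin by blast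
 then show ?thesis using orbit_ins[OF hD] orbit_self[OF fin perm] by simp
qed

lemma orbits_ins:
 "orbit (ins pe h p) ` insert p D = insert (insert p (orbit pe h)) (orbit pe ` D - {orbit pe h})"
proof -
 have 1: "orbit (ins pe h p) y = (if orbit pe y = orbit pe h then insert p (orbit pe h) else orbit pe y)"
  if "y:D" for y unfolding orbit_ins[OF that] using orbit_eq_of_mem[OF fin perm] orbit_self[OF fin perm] by metis
 have "orbit (ins pe h p) ` D = (%X. if X = orbit pe h then insert p (orbit pe h) else X) ` (orbit pe ` D)" unfolding image_image by (rule image_cong) (auto simp: 1)
 then show ?thesis using orbit_ins_new hD by (auto simp: image_iff)
qed

lemma orbit_ins_new_notin: "insert p (orbit pe h) ~: orbit pe ` D" using orbit_in[OF perm] pD by blast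

text \<open>Only the cycle through h changes. Its enlarged version contains p, so it is none of the
  old cycles.\<close>

lemma card_orbits_ins: "card (orbit (ins pe h p) ` insert p D) = card (orbit pe ` D)" unfolding orbits_ins using fin hD orbit_ins_new_notin by (metis (no_types, lifting) card.remove card_insert_disjoint finite_Diff finite_imageI image_eqI Diff_iff)

end

lemma ins_delete:
 assumes "finite D" "pe' permutes insert p D" "p~:D" "pe' h = p" "h~=p"
 obtains pe where "pe permutes D" "pe' = ins pe h p" "h:D"
proof
 let ?pe = "pe' \<circ> swp h p"
 show hD: "h:D" using assms by (metis insertE permutes_def permutes_not_in)
 show "pe' = ins ?pe h p" by (simp add: ins_def fun_eq_iff)
 have "?pe permutes insert p D" using assms hD by (intro permutes_compose[OF permutes_swap_id]) auto
 moreover have "?pe p = p" using assms by simp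
 ultimately show "?pe permutes D" by (metis (no_types, lifting) permutes_superset Diff_iff insertE)
qed

context
 fixes D :: "nat set" and pe :: "nat=>nat" and b :: nat and j :: nat
 assumes fin: "finite D" and perm: "pe permutes D" and bD: "b:D"
  and j: "0 < j" "j < card (orbit pe b)"
begin

text \<open>A transposition of two points of one cycle cuts this cycle into the arc from b up to the
  predecessor of q and the arc from q up to the predecessor of b. Applied to the face permutation it
  cuts a face in two.\<close>

lemma orbit_split:
 defines "q == (pe ^^ j) b"
 defines "pe' == swp b q \<circ> pe"
 shows "orbit pe' b = (%t. (pe ^^ t) b) ` {..<j}"
  and "orbit pe' q = (%t. (pe ^^ t) b) ` {j..<card (orbit pe b)}"
  and "y ~: orbit pe b ==> orbit pe' y = orbit pe y"
  and "pe' permutes D"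
  and "q ~: orbit pe' b"
  and "orbit pe' ` D = insert (orbit pe' b) (insert (orbit pe' q) (orbit pe ` D - {orbit pe b}))"
  and "card (orbit pe' ` D) = Suc (card (orbit pe ` D))"
proof -
 define L where "L = card (orbit pe b)"
 define f where "f t = (pe ^^ t) b" for t
 note en = orbit_enum[OF fin perm L_def, folded f_def]
 have bf: "b = f 0" and qf: "q = f j" by (auto simp: f_def q_def)
 have f_inj: "f s = f t<->s = t" if "s < L" "t < L" for s t using en(2) that by (auto simp: inj_on_def)
 have f_Suc: "f (Suc t) = pe (f t)" for t by (simp add: f_def)
 have jL: "0 < j" "j < L" using j by (auto simp: L_def)
 have qD: "q:D" using orbit_in[OF perm bD] en(1) jL by (auto simp: qf)
 have bq: "b~=q" using f_inj[of 0 j] jL by (simp add: bf qf)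
 show permutes: "pe' permutes D" unfolding pe'_def using perm bD qD by (intro permutes_compose permutes_swap_id)
 \<comment> \<open>Only two steps are redirected: the one that would reach q now closes the first
   arc at b, and the one that would return to b now closes the second arc at q.\<close>
 have step: "pe' (f t) = (if Suc t = j then b else if Suc t = L then q else f (Suc t))" if "t < L" for t
 proof -
  consider "Suc t = j" | "Suc t = L" | "Suc t~=j" "Suc t < L" using \<open>t < L\<close> by linarith
  then show ?thesis
  proof cases
  case 3
  then have "f (Suc t)~=b" "f (Suc t)~=q" using f_inj[of "Suc t" 0] f_inj[of "Suc t" j] jL by (auto simp: bf qf)
  then show ?thesis using 3 by (simp add: pe'_def f_Suc[symmetric])
  qed (use jL en(3) in \<open>auto simp: pe'_def f_Suc[symmetric] qf[symmetric]\<close>)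
 qed
 have reach: "f (s + t) : orbit pe' (f s)" if "(s + t < j) | (j <= s&s + t < L)" for s t using that
 proof (induction t)
  case 0 show ?case using orbit_self[OF fin permutes] by simp
 next
  case (Suc t)
  then have "f (s + t) : orbit pe' (f s)" by auto
  moreover have "pe' (f (s + t)) = f (s + Suc t)" using Suc.prems jL by (subst step) auto
  ultimately show ?case by (metis orbit.step)
 qed
 show ob: "orbit pe' b = (%t. (pe ^^ t) b) ` {..<j}" unfolding f_def[symmetric]
 proof
  show "orbit pe' b <= f ` {..<j}" by (rule orbit_closed_subset) (use jL step bf in \<open>auto intro!: imageI\<close>)
  show "f ` {..<j} <= orbit pe' b" using reach[of 0] by (auto simp: bf)
 qed
 show oq: "orbit pe' q = (%t. (pe ^^ t) b) ` {j..<card (orbit pe b)}" unfolding f_def[symmetric] L_def[symmetric]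
 proof
  show "orbit pe' q <= f ` {j..<L}" by (rule orbit_closed_subset) (use jL step qf in \<open>auto intro!: imageI\<close>)
  show "f ` {j..<L} <= orbit pe' q"
  proof
  fix x assume "x:f ` {j..<L}"
  then obtain t where "x = f t" "j <= t" "t < L" by auto
  then show "x : orbit pe' q" using reach[of j "t - j"] by (simp add: qf)
  qed
 qed
 show qnb: "q ~: orbit pe' b" unfolding ob using f_inj jL by (force simp: qf f_def)
 have other: "orbit pe' y = orbit pe y" if "y ~: orbit pe b" for y
 proof (rule orbit_cong[OF orbit_self[OF fin perm]])
  fix s assume "s : orbit pe y"
  then have "pe s : orbit pe y" by (rule orbit.step)
  moreover have "b : orbit pe b" "q : orbit pe b" using en(1) jL by (auto simp: bf qf)
  ultimately have "pe s~=b" "pe s~=q" using that by (metis orbit_eq_of_mem[OF fin perm] orbit_self[OF fin perm])+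
  then show "pe' s = pe s" by (simp add: pe'_def)
 qed
 show "y ~: orbit pe b ==> orbit pe' y = orbit pe y" by (rule other)
 have in_b: "orbit pe' y:{orbit pe' b, orbit pe' q}" if "y : orbit pe b" for y
 proof -
  have "y : orbit pe' b Un orbit pe' q" using that en(1) unfolding ob oq f_def[symmetric] L_def[symmetric] by fastforce
  then show ?thesis using orbit_eq_of_mem[OF fin permutes] by auto
 qed
 show im: "orbit pe' ` D = insert (orbit pe' b) (insert (orbit pe' q) (orbit pe ` D - {orbit pe b}))"
 proof
  show "orbit pe' ` D <= insert (orbit pe' b) (insert (orbit pe' q) (orbit pe ` D - {orbit pe b}))"
  proof
  fix x assume "x : orbit pe' ` D"
  then obtain y where y: "y:D" "x = orbit pe' y" by auto
  show "x:insert (orbit pe' b) (insert (orbit pe' q) (orbit pe ` D - {orbit pe b}))"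
  proof (cases "y : orbit pe b")
  case True then show ?thesis using in_b y by auto
  next
  case False
  then have "orbit pe y ~= orbit pe b" using orbit_self[OF fin perm] by metis
  then show ?thesis using y other[OF False] by auto
  qed
  qed
  show "insert (orbit pe' b) (insert (orbit pe' q) (orbit pe ` D - {orbit pe b})) <= orbit pe' ` D"
  proof -
  have "orbit pe y : orbit pe' ` D" if "y:D" "orbit pe y ~= orbit pe b" for y using other[of y] that orbit_eq_of_mem[OF fin perm] by (metis image_eqI)
  then show ?thesis using bD qD by auto
  qed
 qed
 have "b : orbit pe' b" "q : orbit pe' q" "q : orbit pe b" using orbit_self[OF fin permutes] en(1) jL by (auto simp: qf)
 note in_orbits = this
 have "x = b | x = q==>x : orbit pe y ==> orbit pe y = orbit pe b" for x y using in_orbits(3) orbit_eq_of_mem[OF fin perm] by metis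
 then have "orbit pe' b ~: orbit pe ` D - {orbit pe b}" "orbit pe' q ~: orbit pe ` D - {orbit pe b}" using in_orbits by blast+
 moreover have "orbit pe' b ~= orbit pe' q" using qnb in_orbits by auto
 ultimately have "card (orbit pe' ` D) = Suc (Suc (card (orbit pe ` D - {orbit pe b})))" unfolding im using fin by (subst card_insert_disjoint; simp)+
 also have "Suc (card (orbit pe ` D - {orbit pe b})) = card (orbit pe ` D)" using fin bD by (intro card_Suc_Diff1) auto
 finally show "card (orbit pe' ` D) = Suc (card (orbit pe ` D))" .
qed

end

text \<open>Following the old cycle of b, the step that would close it is redirected to q, so b and
  q come to lie on one cycle. The position j of q is what \<open>orbit_split\<close> needs in order
  to reverse the operation.\<close>

lemma orbit_merge:
 assumes fin: "finite D" and perm: "pe permutes D" and D: "b:D" "q:D" and "q ~: orbit pe b"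
 obtains j where "0 < j" "j < card (orbit (swp b q \<circ> pe) b)" "((swp b q \<circ> pe) ^^ j) b = q"
proof -
 let ?pe = "swp b q \<circ> pe"
 have perm': "?pe permutes D" using perm D by (intro permutes_compose permutes_swap_id)
 define L where "L = card (orbit pe b)"
 note en = orbit_enum[OF fin perm L_def]
 have step: "(?pe ^^ t) b = (pe ^^ t) b" if "t < L" for t using that
 proof (induction t)
  case (Suc t)
  have "(pe ^^ Suc t) b : orbit pe b" "(pe ^^ Suc t) b~=(pe ^^ 0) b" using en(1) inj_onD[OF en(2), of "Suc t" 0] Suc.prems by (blast, fastforce)
  then have "(pe ^^ Suc t) b~=q" "(pe ^^ Suc t) b~=b" using assms(5) by auto
  then show ?case using Suc by simp
 qed simp
 define K where "K = card (orbit ?pe b)"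
 obtain m where m: "L = Suc m" using en(4) by (metis Suc_pred)
 have "(?pe ^^ L) b = q" using step[of m] en(3) by (simp add: m)
 then have "q : orbit ?pe b" unfolding orbit_altdef using en(4) by (intro CollectI exI[of _ L]) simp
 then obtain j where j: "j < K" "q = (?pe ^^ j) b" using orbit_enum(1)[OF fin perm' K_def] by auto
 moreover have "b~=q" using assms(5) orbit_self[OF fin perm, of b] by auto
 ultimately have "0 < j" by (cases j) auto
 then show thesis using that[of j] j by (simp add: K_def)
qed

lemma orbit_image:
 fixes pe :: "'c=>'c" and pe' :: "'d=>'d"
 assumes "pe permutes D" "!!x. x:D==>f (pe x) = pe' (f x)" "x:D"
 shows "f ` orbit pe x = orbit pe' (f x)"
proof -
 have "f ((pe ^^ n) x) = (pe' ^^ n) (f x)&(pe ^^ n) x:D" for n by (induction n) (use assms in \<open>auto simp: permutes_in_image\<close>)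
 moreover have "orbit g y = (%n. (g ^^ n) y) ` {0<..}" for g :: "'c=>'c" and y by (auto simp: orbit_altdef)
 moreover have "orbit g y = (%n. (g ^^ n) y) ` {0<..}" for g :: "'d=>'d" and y by (auto simp: orbit_altdef)
 ultimately show ?thesis by (simp add: image_image)
qed

lemma orbit_invariant:
 assumes "pe permutes D" "!!x. x:D ==> c (pe x) = c x" "x:D" "y : orbit pe x"
 shows "c y = c x" using assms(4)
proof induction
 case (step y)
 then show ?case using orbit_in[OF assms(1,3)] assms(2) by (metis subsetD)
qed (use assms in auto)

lemma card_orbit_ge_3:
 assumes "finite D" "pe permutes D"
 shows "3 <= card (orbit pe h)<->pe h~=h&pe (pe h)~=h"
proof
 define L where "L = card (orbit pe h)"
 note en = orbit_enum[OF assms L_def]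
 show "pe h~=h&pe (pe h)~=h" if "3 <= card (orbit pe h)" using that inj_onD[OF en(2), of 1 0] inj_onD[OF en(2), of 2 0] by (auto simp: L_def numeral_2_eq_2)
 assume *: "pe h~=h&pe (pe h)~=h"
 have "L~=1" using en(3) * by auto
 moreover have "L~=2" using en(3) * by (auto simp: numeral_2_eq_2)
 ultimately show "3 <= card (orbit pe h)" using en(4) by (simp add: L_def)
qed

lemma involution_permutes:
 assumes "!!x. x:D==>sg x:D&sg (sg x) = x" "!!x. x~:D==>sg x = x"
 shows "sg permutes D"
proof -
 have "bij_betw sg D D" by (rule bij_betwI[of sg D D sg]) (use assms in auto)
 then show ?thesis using assms(2) by (rule bij_imp_permutes)
qed

section \<open>Cells of a map and their description by darts\<close>

lemma
 assumes "is_map G"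
 shows fin_darts: "finite (darts G)"
  and rot_permutes: "rot G permutes darts G"
  and opp_permutes: "opp G permutes darts G"
  and fp_permutes: "face_perm G permutes darts G" using assms by (auto simp: is_map_def face_perm_def intro: permutes_compose permutes_inv)

lemma
 assumes "is_map G"
 shows rot_in: "rot G h:darts G<->h:darts G"
  and opp_in: "opp G h:darts G<->h:darts G"
  and face_perm_in: "face_perm G h:darts G<->h:darts G"
  and rot_inj: "rot G h = rot G h'<->h = h'"
  and opp_inj: "opp G h = opp G h'<->h = h'"
  and opp_opp: "opp G (opp G h) = h"
  and opp_neq: "h:darts G ==> opp G h~=h"
proof -
 note P = rot_permutes[OF assms] opp_permutes[OF assms] fp_permutes[OF assms]
 show "rot G h:darts G<->h:darts G" "opp G h:darts G<->h:darts G"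
  "face_perm G h:darts G<->h:darts G" using P by (auto simp: permutes_in_image)
 show "rot G h = rot G h'<->h = h'" "opp G h = opp G h'<->h = h'" using P by (auto dest: permutes_inj injD)
 show "opp G (opp G h) = h" using assms P(2) by (cases "h:darts G") (auto simp: is_map_def permutes_not_in)
 show "h:darts G ==> opp G h~=h" using assms by (auto simp: is_map_def)
qed

text \<open>All computations with the face permutation go through this form, which avoids the
  inverse of the rotation.\<close>

lemma fp_iff: "is_map G==>face_perm G h = y <-> opp G h = rot G y" using rot_permutes[of G] by (auto simp: face_perm_def permutes_inverses dest: permutes_inv_eq[THEN iffD1])

lemma rot_face_perm: "is_map G==>rot G (face_perm G h) = opp G h" using fp_iff by metis

text \<open>Colours and decorations are read at darts. Values of \<open>colour\<close> and
  \<open>decor\<close> at sets that are not cells become invisible, and a surgery only has to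
  prescribe functions on darts.\<close>

definition cl :: "'m cmap=>nat => colour" where "cl G h = colour G (vx G h)"

definition dl :: "'m cmap=>nat=>'m decoration" where "dl G h = decor G (fc G h)"

lemma vx_rot: "is_map G==>vx G (rot G h) = vx G h" unfolding vertex_at_def by (rule orbit_eq_of_mem[OF fin_darts rot_permutes]) (auto intro: orbit.base)

lemma fc_face_perm: "is_map G==>fc G (face_perm G h) = fc G h" unfolding face_at_def by (rule orbit_eq_of_mem[OF fin_darts fp_permutes]) (auto intro: orbit.base)

lemma cl_rot: "is_map G ==> cl G (rot G h) = cl G h" by (simp add: cl_def vx_rot)

lemma dl_face_perm: "is_map G==>dl G (face_perm G h) = dl G h" by (simp add: dl_def fc_face_perm)

lemma vx_self: "is_map G==>h:vx G h" unfolding vertex_at_def by (rule orbit_self[OF fin_darts rot_permutes])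

lemma fc_self: "is_map G==>h:fc G h" unfolding face_at_def by (rule orbit_self[OF fin_darts fp_permutes])

lemma vx_eq: "is_map G==>h':vx G h<->vx G h' = vx G h" by (metis fin_darts orbit_eq_of_mem rot_permutes vertex_at_def vx_self)

lemma fc_eq: "is_map G==>h':fc G h<->fc G h' = fc G h" by (metis fin_darts orbit_eq_of_mem fp_permutes face_at_def fc_self)

lemma vx_subset: "is_map G==>h:darts G==>vx G h <= darts G" unfolding vertex_at_def by (rule orbit_in[OF rot_permutes])

lemma fc_subset: "is_map G==>h:darts G==>fc G h <= darts G" unfolding face_at_def by (rule orbit_in[OF fp_permutes])

lemma cl_vertex: "is_map G==>h':vx G h ==> cl G h' = cl G h" by (simp add: cl_def vx_eq)

lemma dl_face: "is_map G==>h':fc G h==>dl G h' = dl G h" by (simp add: dl_def fc_eq)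

lemma commute_face_perm:
 assumes "is_map G" "is_map H"
  and "!!h. h:darts G==>f (rot G h) = rot H (f h)&f (opp G h) = opp H (f h)" "h:darts G"
 shows "f (face_perm G h) = face_perm H (f h)" using assms fp_iff[OF assms(2)] face_perm_in[OF assms(1)] rot_face_perm[OF assms(1)] by metis

text \<open>A map of darts that commutes with \<open>rot\<close> and \<open>opp\<close> commutes
  with the face permutation, hence carries cells onto cells; the conditions on colours and
  decorations can then be tested at each dart.\<close>

lemma is_iso_iff:
 assumes "is_map G" "is_map H"
 shows "is_iso f G H<->bij_betw f (darts G) (darts H) &
  (ALL h:darts G. f (rot G h) = rot H (f h)&f (opp G h) = opp H (f h) &
  cl H (f h) = cl G h&dl H (f h) = dl G h)"
proof -
 {
  assume c: "!!h. h:darts G==>f (rot G h) = rot H (f h)&f (opp G h) = opp H (f h)"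
  have "f ` vx G h = vx H (f h)" "f ` fc G h = fc H (f h)" if "h:darts G" for h unfolding vertex_at_def face_at_def using c commute_face_perm[OF assms c]
  orbit_image[OF rot_permutes[OF assms(1)] _ that, of f "rot H"]
  orbit_image[OF fp_permutes[OF assms(1)] _ that, of f "face_perm H"] by simp_all
 }
 then show ?thesis unfolding is_iso_def vertices_def faces_def cl_def dl_def by auto
qed

lemma vx_iso:
 assumes "is_map G" "is_map H" "is_iso f G H" "h:darts G"
 shows "vx H (f h) = f ` vx G h" unfolding vertex_at_def using assms by (intro orbit_image[symmetric, OF rot_permutes[OF assms(1)]]) (auto simp: is_iso_def)

lemma is_mapI:
 assumes "finite (darts G)" "rot G permutes darts G" "opp G permutes darts G"
  "!!h. h:darts G ==> opp G h~=h & opp G (opp G h) = h"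
 shows "is_map G" using assms by (simp add: is_map_def)

text \<open>The colour of a set of darts is read at a chosen element of it, and likewise the
  decoration. This is consistent because c is constant along the rotation and d along the face
  permutation: \<open>sg h = rh y\<close> says that y follows h on the boundary of its face.\<close>

lemma ex_map:
 assumes "finite D" "rh permutes D" "sg permutes D" "!!h. h:D==>sg h~=h&sg (sg h) = h"
  and c: "!!h. h:D ==> c (rh h) = c h" and d: "!!h y. h:D==>sg h = rh y==>d y = d h"
 obtains G :: "'m cmap" where "is_map G" "darts G = D" "rot G = rh" "opp G = sg"
  "!!h. h:D ==> cl G h = c h" "!!h. h:D==>dl G h = d h"
proof -
 define G :: "'m cmap" where "G = \<lparr>darts = D, rot = rh, opp = sg, colour = (%X. c (SOME x. x:X)),
  decor = (%X. d (SOME x. x:X))\<rparr>"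
 have G: "darts G = D" "rot G = rh" "opp G = sg" by (auto simp: G_def)
 have dec: "decor G = (%X. d (SOME x. x:X))" by (simp add: G_def)
 have m: "is_map G" using assms by (auto simp: is_map_def G)
 have "cl G h = c h" if "h:D" for h
 proof -
  have "(SOME x. x:vx G h) : orbit rh h" using vx_self[OF m, of h] by (metis G(2) someI vertex_at_def)
  then show ?thesis using orbit_invariant[OF assms(2), of c, OF c that] by (simp add: cl_def G_def)
 qed
 moreover have "dl G h = d h" if "h:D" for h
 proof -
  have "(SOME x. x:fc G h) : orbit (face_perm G) h" using fc_self[OF m, of h] by (metis someI face_at_def)
  then have "d (SOME x. x:fc G h) = d h"
  proof (rule orbit_invariant[OF fp_permutes[OF m], rotated 2])
  show "d (face_perm G y) = d y" if "y:darts G" for y using that d[of y] rot_face_perm[OF m] G by metis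
  qed (simp add: that G)
  then show ?thesis by (simp add: dl_def dec)
 qed
 ultimately show thesis using that m G by blast
qed

text \<open>Connectedness as the absence of a proper nonempty set of darts closed under
  \<open>rot\<close> and \<open>opp\<close>. In this form it passes through a surgery by extending
  and restricting closed sets.\<close>

lemma connected_map_iff:
 assumes "is_map G"
 shows "connected_map G<->darts G~={} &
  (ALL S. S <= darts G&S~={}&(ALL x:S. rot G x:S & opp G x:S)-->S = darts G)"
proof -
 let ?R = "{(x, rot G x) |x. x:darts G} Un {(x, opp G x) |x. x:darts G}"
 have closed: "y:S" if "(x, y):?R\<^sup>*" "x:S" "ALL x:S. rot G x:S & opp G x:S" for x y S using that by (induction rule: rtrancl_induct) auto
 show ?thesis
 proof (intro iffI conjI allI impI; (elim conjE)?)
  assume c: "connected_map G"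
  then show "darts G~={}" by (simp add: connected_map_def)
  fix S assume S: "S <= darts G" "S~={}" "ALL x:S. rot G x:S & opp G x:S"
  then obtain x where x: "x:S" by auto
  have "y:S" if "y:darts G" for y using c x S that unfolding connected_map_def by (intro closed[of x y S]) auto
  then show "S = darts G" using S by auto
 next
  assume D: "darts G~={}"
  and c: "ALL S. S <= darts G&S~={}&(ALL x:S. rot G x:S & opp G x:S)-->S = darts G"
  have "(x, y):?R\<^sup>*" if "x:darts G" "y:darts G" for x y
  proof -
  have "y:darts G" if "(x, y):?R\<^sup>*" for y by (rule closed[OF that \<open>x : darts G\<close>]) (simp add: rot_in[OF assms] opp_in[OF assms])
  moreover have "(x, rot G y):?R\<^sup>* & (x, opp G y):?R\<^sup>*" if "(x, y):?R\<^sup>*" for y using that calculation[OF that] by (intro conjI; elim rtrancl_into_rtrancl) auto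
  ultimately have "{y. (x, y):?R\<^sup>*} = darts G" by (intro c[rule_format] conjI) blast+
  then show ?thesis using that by auto
  qed
  then show "connected_map G" using D by (simp add: connected_map_def)
 qed
qed

lemma finite_edges: "is_map G==>finite (edges G)" by (simp add: edges_def fin_darts)

lemma card_edges:
 assumes "is_map G"
 shows "2 * card (edges G) = card (darts G)"
proof -
 have U: "\<Union>(edges G) = darts G" by (auto simp: edges_def opp_in[OF assms])
 have "2 * card (edges G) = card (\<Union>(edges G))"
 proof (rule card_partition)
  show "finite (edges G)" "finite (\<Union>(edges G))" using assms by (auto simp: U finite_edges fin_darts)
  show "card e = 2" if e: "e:edges G" for e
  proof -
  obtain h where "h:darts G" "e = {h, opp G h}" using e by (auto simp: edges_def)
  then show ?thesis using opp_neq[OF assms, of h] by simp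
  qed
  show "e Int e' = {}" if "e:edges G" "e':edges G" "e~=e'" for e e' using that by (auto simp: edges_def opp_opp[OF assms] opp_inj[OF assms] insert_commute)
 qed
 then show ?thesis by (simp add: U)
qed

lemma finite_vertices: "is_map G==>finite (vertices G)" "is_map G==>finite (faces G)" by (simp_all add: vertices_def faces_def fin_darts)

lemma decorated_iff:
 "decorated N M G<->(ALL h:darts G. dl G h:Marked ` M Un Unmarked ` {1..N}) &
  (ALL m:M. EX h:darts G. dl G h = Marked m) &
  (ALL m:M. ALL h:darts G. ALL h':darts G. dl G h = Marked m&dl G h' = Marked m-->fc G h = fc G h')"
proof -
 have "(\<exists>!f. f:faces G&decor G f = Marked m) <->
  (EX h:darts G. dl G h = Marked m) &
  (ALL h:darts G. ALL h':darts G. dl G h = Marked m&dl G h' = Marked m-->fc G h = fc G h')" for m unfolding Ex1_def faces_def dl_def by blast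
 then show ?thesis unfolding decorated_def by (simp add: faces_def dl_def ball_conj_distrib)
qed

section \<open>Isomorphism classes and weighted sums over them\<close>

lemma is_iso_id: "is_iso id G G" by (auto simp: is_iso_def)

lemma is_iso_comp:
 assumes "is_map G" "is_map H" "is_map K" "is_iso f G H" "is_iso g H K"
 shows "is_iso (g \<circ> f) G K" using assms unfolding is_iso_iff[OF assms(1,2)] is_iso_iff[OF assms(2,3)] is_iso_iff[OF assms(1,3)] by (auto intro: bij_betw_trans dest: bij_betwE)

lemma is_iso_inv:
 assumes "is_map G" "is_map H" "is_iso f G H"
 shows "is_iso (inv_into (darts G) f) H G"
proof -
 let ?g = "inv_into (darts G) f"
 note i = assms(3)[unfolded is_iso_iff[OF assms(1,2)]]
 have bij: "bij_betw f (darts G) (darts H)" using i by blast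
 have g: "bij_betw ?g (darts H) (darts G)" using bij by (rule bij_betw_inv_into)
 have gf: "?g (f x) = x" if "x:darts G" for x using bij that by (rule bij_betw_inv_into_left)
 show ?thesis unfolding is_iso_iff[OF assms(2,1)]
 proof (intro conjI ballI)
  fix h assume "h:darts H"
  then obtain x where x: "x:darts G" "h = f x" using bij by (auto simp: bij_betw_def)
  have r: "rot G x:darts G" "opp G x:darts G" using x assms(1) by (auto simp: rot_in opp_in)
  show "?g (rot H h) = rot G (?g h)" using i x gf[OF x(1)] gf[OF r(1)] by metis
  show "?g (opp H h) = opp G (?g h)" using i x gf[OF x(1)] gf[OF r(2)] by metis
  show "cl G (?g h) = cl H h" using i x gf by metis
  show "dl G (?g h) = dl H h" using i x gf by metis
 qed (rule g)
qed

lemma equiv_iso_rel: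
 assumes "!!G. G:A==>is_map G"
 shows "equiv A (iso_rel A)"
proof (rule equivI)
 show "iso_rel A <= A \<times> A" by (auto simp: iso_rel_def)
 show "refl_on A (iso_rel A)" using is_iso_id by (auto simp: refl_on_def iso_rel_def)
 show "sym (iso_rel A)" unfolding sym_def iso_rel_def using is_iso_inv assms by blast
 show "trans (iso_rel A)" unfolding trans_def iso_rel_def using is_iso_comp assms by blast
qed

lemma reps_ex:
 assumes "!!G. G:A==>is_map G" "G:A"
 obtains R f where "R:reps A" "is_iso f R G"
proof -
 let ?C = "iso_rel A `` {G}"
 have C: "?C:A // iso_rel A" using assms(2) by (rule quotientI)
 have "G:?C" using assms(2) is_iso_id by (auto simp: iso_rel_def)
 then have "(SOME H. H:?C):?C" by (rule someI)
 then obtain f where "is_iso f G (SOME H. H:?C)" "(SOME H. H:?C):A" by (auto simp: iso_rel_def)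
 moreover have "(SOME H. H:?C):reps A" unfolding representatives_def using C by (rule imageI)
 ultimately show thesis using that is_iso_inv assms by blast
qed

lemma reps_eq:
 assumes "!!G. G:A==>is_map G" "R:reps A" "R':reps A" "is_iso f R R'"
 shows "R = R'"
proof -
 note e = equiv_iso_rel[of A, OF assms(1)]
 obtain C where C: "C:A // iso_rel A" "R = (SOME G. G:C)" using assms(2) by (auto simp: representatives_def)
 obtain C' where C': "C':A // iso_rel A" "R' = (SOME G. G:C')" using assms(3) by (auto simp: representatives_def)
 have "R:C" "R':C'" using C C' in_quotient_imp_non_empty[OF e] by (simp_all add: some_in_eq)
 moreover have "(R, R'):iso_rel A" using assms representatives_subset by (auto simp: iso_rel_def)
 ultimately have "C = C'" using quotient_eqI[OF e C(1) C'(1)] by blast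
 then show ?thesis using C C' by simp
qed

text \<open>An invariant property selects whole isomorphism classes, and these classes are literally
  the same sets in A and in the selected part. The choice of a representative therefore returns the
  same map.\<close>

lemma reps_Collect:
 assumes "!!G H f. G:A==>H:A==>is_iso f G H==>P G<->P H"
 shows "reps {G:A. P G} = {G:reps A. P G}"
proof -
 have img: "reps B = (%G. SOME H. H:iso_rel B `` {G}) ` B" for B :: "'m cmap set"
 proof -
  have "B // iso_rel B = (%G. iso_rel B `` {G}) ` B" by (auto simp: quotient_def)
  then show ?thesis unfolding representatives_def by (simp only: image_image)
 qed
 have eq: "iso_rel {G:A. P G} `` {G} = iso_rel A `` {G}" if "G:A" "P G" for G using that assms by (auto simp: iso_rel_def)
 have P: "P (SOME H. H:iso_rel A `` {G})<->P G" if "G:A" for G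
 proof -
  have "G:iso_rel A `` {G}" using that is_iso_id by (auto simp: iso_rel_def)
  then have "(SOME H. H:iso_rel A `` {G}):iso_rel A `` {G}" by (rule someI)
  then show ?thesis using assms by (auto simp: iso_rel_def)
 qed
 have "reps {G:A. P G} = (%G. SOME H. H:iso_rel A `` {G}) ` {G:A. P G}" unfolding img[of "{G:A. P G}"] by (rule image_cong) (auto simp: eq)
 also have "... = {G:reps A. P G}" unfolding img[of A] using P by auto
 finally show ?thesis .
qed

definition gsum :: "'m cmap set=>('m cmap => complex) => complex" where
 "gsum A w = (\<Sum>G\<in>reps A. w G / of_nat (card (automorphisms G)))"

lemma gsum_cong: "(!!G. G:A==>w G = w' G)==>gsum A w = gsum A w'" unfolding gsum_def by (auto intro!: sum.cong dest: representatives_subset)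

lemma gsum_split:
 assumes "finite (reps A)"
  "!!G H f. G:A==>H:A==>is_iso f G H==>P G<->P H"
 shows "gsum A w = gsum {G:A. P G} w + gsum {G:A. ~ P G} w"
proof -
 have 1: "reps {G:A. P G} = {G:reps A. P G}" by (rule reps_Collect) (rule assms(2))
 have 2: "reps {G:A. ~ P G} = {G:reps A. ~ P G}" by (rule reps_Collect) (simp add: assms(2))
 show ?thesis unfolding gsum_def 1 2 by (subst sum.union_disjoint[symmetric]) (auto intro: sum.cong simp: assms(1))
qed

lemma gsum_mono_class:
 assumes "finite (reps A)"
  "!!G H f. G:A==>H:A==>is_iso f G H==>P G<->P H"
  "!!G. G:A ==> ~ P G==>w G = 0"
 shows "gsum {G:A. P G} w = gsum A w"
proof -
 have "gsum {G:A. ~ P G} w = gsum {G:A. ~ P G} (%_. 0)" by (rule gsum_cong) (simp add: assms(3))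
 then show ?thesis using gsum_split[OF assms(1), of P w] assms(2) by (simp add: gsum_def[of _ "%_. 0"])
qed

text \<open>The darts on which two isomorphisms agree form a closed set; by connectedness, one
  common value forces agreement everywhere.\<close>

lemma iso_unique:
 assumes "is_map G" "is_map H" "connected_map G" "is_iso f G H" "is_iso f' G H" "h:darts G" "f h = f' h"
  and "x:darts G"
 shows "f x = f' x"
proof -
 let ?S = "{x:darts G. f x = f' x}"
 have "?S = darts G" using assms(3) unfolding connected_map_iff[OF assms(1)] by (elim conjE allE[of _ ?S]) (use assms in \<open>auto simp: is_iso_iff rot_in opp_in\<close>)
 then show ?thesis using assms(8) by blast
qed

lemma automorphisms_trivial:
 assumes "is_map G" "connected_map G" "q:darts G" "!!f. is_iso f G G==>f q = q"
 shows "card (automorphisms G) = 1"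
proof -
 have "f = id" if "f permutes darts G" "is_iso f G G" for f
 proof
  fix x
  show "f x = id x" using iso_unique[OF assms(1,1,2) that(2) is_iso_id assms(3)] assms(4)[OF that(2)] that(1) by (cases "x:darts G") (auto simp: permutes_not_in)
 qed
 then have "automorphisms G = {id}" using is_iso_id[of G] permutes_id by (auto simp: automorphisms_def)
 then show ?thesis by simp
qed

text \<open>Double counting. X is a finite set of recipes, and R relates a recipe to every map it
  can produce. The sets \<open>Q x\<close> are the blocks of recipes with isomorphic results, so
  division by the size of the block counts each class of B once; no automorphism factor remains
  because the maps in B are rigid.\<close>

lemma gsum_transfer:
 assumes B: "!!H. H:B==>is_map H" and rigid: "!!H. H:B ==> card (automorphisms H) = 1"
  and X: "finite X"
  and R: "!!x. x:X==>EX H:B. R x H"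
  and L: "!!H. H:B==>EX x:X. R x H"
  and iso: "!!x H x' H'. x:X==>x':X==>H:B==>H':B==>R x H==>R x' H' ==>
  (EX f. is_iso f H H')<->x':Q x"
  and QX: "!!x. x:X==>Q x <= X"
  and w: "!!x H. x:X==>H:B==>R x H==>w H = w' x"
  and winv: "!!H H' f. H:B==>H':B==>is_iso f H H'==>w H = w H'"
 shows "finite (reps B)" "gsum B w = (\<Sum>x\<in>X. w' x / of_nat (card (Q x)))"
proof -
 let ?B = "reps B"
 have "ALL H:?B. EX x:X. R x H" using L representatives_subset by blast
 then obtain ps where psi: "!!H. H:?B==>ps H:X" "!!H. H:?B==>R (ps H) H" by metis
 have BB: "H:?B==>H:B" for H by (rule representatives_subset)
 have self: "x:Q x" if x: "x:X" for x
 proof -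
  obtain H where "H:B" "R x H" using R[OF x] by blast
  then show ?thesis using iso[of x x H H] x is_iso_id by blast
 qed
 have sym: "x:Q y" if xy: "y:Q x" "x:X" for x y
 proof -
  have "y:X" using QX xy by blast
  obtain H H' where H: "H:B" "R x H" "H':B" "R y H'" using R xy(2) \<open>y : X\<close> by metis
  then have "EX f. is_iso f H H'" using iso[of x y H H'] xy \<open>y : X\<close> by blast
  then have "EX f. is_iso f H' H" using is_iso_inv[OF B B] H by blast
  then show ?thesis using iso[of y x H' H] H xy(2) \<open>y : X\<close> by blast
 qed
 have trans: "z:Q x" if xyz: "y:Q x" "z:Q y" "x:X" for x y z
 proof -
  have X: "y:X" "z:X" using QX xyz by blast+
  obtain H H' K where H: "H:B" "R x H" "H':B" "R y H'" "K:B" "R z K" using R xyz(3) X by metis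
  then have "EX f. is_iso f H H'" "EX g. is_iso g H' K" using iso[of x y H H'] iso[of y z H' K] xyz X by blast+
  then have "EX f. is_iso f H K" using is_iso_comp[OF B B B] H by blast
  then show ?thesis using iso[of x z H K] H xyz(3) X by blast
 qed
 have Q_eq: "Q y = Q x" if "y:Q x" "x:X" for x y
 proof -
  have "y:X" using QX that by blast
  then show ?thesis using sym trans that by blast
 qed
 have inj: "H = H'" if H: "H:?B" "H':?B" "ps H':Q (ps H)" for H H'
 proof -
  have "EX f. is_iso f H H'" using iso[OF psi(1) psi(1) BB BB psi(2) psi(2)] H by blast
  then show ?thesis using reps_eq[OF B] H by blast
 qed
 have "inj_on ps ?B" by (rule inj_onI) (metis inj psi(1) self)
 then show fin: "finite ?B" using X psi(1) by (meson finite_imageD finite_subset image_subsetI)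
 have cover: "X = (\<Union>H\<in>?B. Q (ps H))"
 proof
  show "X <= (\<Union>H\<in>?B. Q (ps H))"
  proof
  fix x assume x: "x:X"
  then obtain H where H: "H:B" "R x H" using R by blast
  obtain K f where K: "K:?B" "is_iso f K H" using reps_ex[OF B H(1)] by blast
  then have "x:Q (ps K)" using iso[OF psi(1) x BB H(1) psi(2) H(2)] by blast
  then show "x:(\<Union>H\<in>?B. Q (ps H))" using K by blast
  qed
  show "(\<Union>H\<in>?B. Q (ps H)) <= X" using QX psi(1) by blast
 qed
 have "(\<Sum>x\<in>X. w' x / of_nat (card (Q x))) = (\<Sum>H\<in>?B. \<Sum>x\<in>Q (ps H). w' x / of_nat (card (Q x)))" unfolding cover
 proof (rule sum.UNION_disjoint)
  show "finite ?B" by (rule fin)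
  show "ALL H:?B. finite (Q (ps H))" using QX psi(1) X finite_subset by blast
  show "ALL H:?B. ALL H':?B. H~=H'-->Q (ps H) Int Q (ps H') = {}" using inj Q_eq psi(1) self by (metis disjoint_iff)
 qed
 also have "... = (\<Sum>H\<in>?B. w H)"
 proof (rule sum.cong[OF refl])
  fix H assume H: "H:?B"
  have "w' x / of_nat (card (Q x)) = w H / of_nat (card (Q (ps H)))" if x: "x:Q (ps H)" for x
  proof -
  have xX: "x:X" using x QX psi(1) H by blast
  then obtain K where K: "K:B" "R x K" using R by blast
  then obtain f where "is_iso f H K" using iso[OF psi(1) xX BB K(1) psi(2) K(2)] H x by blast
  then have "w H = w' x" using winv[OF BB[OF H] K(1)] w[OF xX K] by simp
  then show ?thesis using Q_eq[OF x psi(1)[OF H]] by simp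
  qed
  moreover have "card (Q (ps H))~=0" using self[OF psi(1)[OF H]] QX[OF psi(1)[OF H]] X by (metis card_0_eq empty_iff finite_subset)
  ultimately show "(\<Sum>x\<in>Q (ps H). w' x / of_nat (card (Q x))) = w H" by simp
 qed
 also have "... = gsum B w" unfolding gsum_def by (rule sum.cong) (simp_all add: rigid BB)
 finally show "gsum B w = (\<Sum>x\<in>X. w' x / of_nat (card (Q x)))" by simp
qed

text \<open>An automorphism has to fix every number that is not a dart, while an isomorphism is
  arbitrary there; it is corrected outside the darts.\<close>

lemma ex_automorphism_iff:
 assumes "is_map G" and that: "h:darts G"
 shows "(EX f. is_iso f G G&f h = h')<->(EX f:automorphisms G. f h = h')"
proof
 assume "EX f. is_iso f G G&f h = h'"
 then obtain f where f: "is_iso f G G" "f h = h'" by blast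
 let ?g = "%x. if x:darts G then f x else x"
 have bij: "bij_betw f (darts G) (darts G)" using f(1) by (simp add: is_iso_def)
 have "is_iso ?g G G" using f(1) unfolding is_iso_iff[OF assms(1,1)] by (auto simp: rot_in[OF assms(1)] opp_in[OF assms(1)] cong: bij_betw_cong)
 moreover have "?g permutes darts G" using bij by (intro bij_imp_permutes) (simp_all cong: bij_betw_cong)
 ultimately show "EX f:automorphisms G. f h = h'" using f(2) that by (auto simp: automorphisms_def intro!: exI[of _ ?g])
qed (auto simp: automorphisms_def)

text \<open>The recipes are now a representative G together with a dart h of \<open>P G\<close>. Two
  such pairs yield isomorphic maps exactly if an automorphism of G carries one dart to the other.
  Automorphisms of a connected map act freely on darts by \<open>iso_unique\<close>, so each block
  has #Aut(G) elements, which is the origin of the denominator.\<close>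

lemma gsum_transfer_pointed:
 fixes A :: "'a cmap set" and B :: "'b cmap set"
 assumes A: "!!G. G:A==>is_map G" "!!G. G:A ==> connected_map G" and fin: "finite (reps A)"
  and B: "!!H. H:B==>is_map H" and rigid: "!!H. H:B ==> card (automorphisms H) = 1"
  and P: "!!G. G:A==>P G <= darts G"
  and Pinv: "!!G G' f h. G:A==>G':A==>is_iso f G G'==>h:P G==>f h:P G'"
  and R: "!!G h. G:A==>h:P G==>EX H:B. R G h H"
  and L: "!!H. H:B==>EX G:A. EX h:P G. R G h H"
  and iso: "!!G h H G' h' H'. G:A==>G':A==>h:P G==>h':P G'==>H:B==>H':B ==>
  R G h H==>R G' h' H'==>(EX f. is_iso f H H')<->(EX f. is_iso f G G'&f h = h')"
  and w: "!!G h H. G:A==>h:P G==>H:B==>R G h H==>w H = w' G h"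
  and winv: "!!H H' f. H:B==>H':B==>is_iso f H H'==>w H = w H'"
 shows "finite (reps B)"
  "gsum B w = (\<Sum>G\<in>reps A. (\<Sum>h\<in>P G. w' G h) / of_nat (card (automorphisms G)))"
proof -
 let ?A = "reps A"
 have AA: "G:?A==>G:A" for G by (rule representatives_subset)
 have finP: "finite (P G)" if "G:A" for G using P[OF that] fin_darts[OF A(1)[OF that]] finite_subset by blast
 define X where "X = Sigma ?A P"
 \<comment> \<open>The orbit of the pair under the automorphism group of G.\<close>
 define Q where "Q = (%(G :: 'a cmap, h). (%f. (G, f h)) ` automorphisms G)"
 \<comment> \<open>The map H may have been built from any map isomorphic to the representative; R is
   transported along the isomorphism.\<close>
 define R' where "R' = (%(G, h) H. EX G':A. EX h':P G'. R G' h' H&(EX f. is_iso f G G'&f h = h'))"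
 have finX: "finite X" unfolding X_def using fin finP AA by (auto intro: finite_SigmaI)
 have cardQ: "card (Q (G, h)) = card (automorphisms G)" if "(G, h):X" for G h
 proof -
  have GA: "G:A" and hD: "h:darts G" using that P AA by (auto simp: X_def)
  have "inj_on (%f. (G, f h)) (automorphisms G)"
  proof (rule inj_onI)
  fix f f' assume f: "f:automorphisms G" "f':automorphisms G" "(G, f h) = (G, f' h)"
  show "f = f'"
  proof
  fix x
  show "f x = f' x" using iso_unique[OF A(1)[OF GA] A(1)[OF GA] A(2)[OF GA] _ _ hD, of f f' x] f by (cases "x:darts G") (auto simp: automorphisms_def permutes_not_in)
  qed
  qed
  then show ?thesis by (simp add: Q_def card_image)
 qed
 have Q_iff: "x':Q x<->fst x' = fst x&(EX f. is_iso f (fst x) (fst x)&f (snd x) = snd x')"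
  if "x:X" for x x'
 proof -
  obtain G h where x: "x = (G, h)" by (metis surj_pair)
  have G: "G:A" "h:darts G" using that P AA by (auto simp: X_def x)
  show ?thesis using ex_automorphism_iff[OF A(1)[OF G(1)] G(2)] by (cases x') (auto simp: Q_def x)
 qed
  have R1: "EX H:B. R' x H" if "x:X" for x using that R[OF AA, of "fst x" "snd x"] is_iso_id AA unfolding X_def R'_def by (cases x) (force intro!: exI[of _ id])
  have L1: "EX x:X. R' x H" if HB: "H:B" for H
  proof -
  obtain G h where G: "G:A" "h:P G" "R G h H" using L[OF HB] by blast
  obtain K f where K: "K:?A" "is_iso f K G" using reps_ex[OF A(1) G(1)] by blast
  let ?g = "inv_into (darts K) f"
  have g: "is_iso ?g G K" using is_iso_inv[OF A(1)[OF AA[OF K(1)]] A(1)[OF G(1)] K(2)] .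
  have "h:darts G" using P G by blast
  then have "f (?g h) = h" using K(2) by (meson bij_betw_inv_into_right is_iso_def)
  moreover have "?g h:P K" using Pinv[OF G(1) AA[OF K(1)] g G(2)] .
  ultimately have "(K, ?g h):X" "R' (K, ?g h) H" using K G by (auto simp: X_def R'_def)
  then show ?thesis by blast
  qed
  have iso1: "(EX f. is_iso f H H')<->x':Q x"
  if x: "x:X" "x':X" and H: "H:B" "H':B" and RR: "R' x H" "R' x' H'" for x H x' H'
  proof -
  obtain G h where xe: "x = (G, h)" by (metis surj_pair)
  obtain G' h' where xe': "x' = (G', h')" by (metis surj_pair)
  obtain K k f where K: "K:A" "k:P K" "R K k H" "is_iso f G K" "f h = k" using RR(1) by (auto simp: R'_def xe)
  obtain K' k' f' where K': "K':A" "k':P K'" "R K' k' H'" "is_iso f' G' K'" "f' h' = k'" using RR(2) by (auto simp: R'_def xe')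
  have GA: "G:?A" "G':?A" "h:P G" "h':P G'" using x by (auto simp: X_def xe xe')
  note m = A(1)[OF AA[OF GA(1)]] A(1)[OF AA[OF GA(2)]] A(1)[OF K(1)] A(1)[OF K'(1)]
  have hD: "h:darts G" "h':darts G'" using P AA GA by blast+
  have "(EX f. is_iso f H H')<->(EX g. is_iso g K K'&g k = k')" by (rule iso[OF K(1) K'(1) K(2) K'(2) H K(3) K'(3)])
  also have "... <-> (EX g. is_iso g G G'&g h = h')"
  proof
  assume "EX g. is_iso g K K'&g k = k'"
  then obtain g where g: "is_iso g K K'" "g k = k'" by blast
  have "is_iso (inv_into (darts G') f' \<circ> (g \<circ> f)) G G'" using is_iso_comp[OF m(1,4,2) is_iso_comp[OF m(1,3,4) K(4) g(1)] is_iso_inv[OF m(2,4) K'(4)]] .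
  moreover have "inv_into (darts G') f' k' = h'" using K'(4,5) hD(2) by (auto simp: is_iso_def bij_betw_def)
  ultimately show "EX g. is_iso g G G'&g h = h'" using g K(5) by (intro exI[of _ "inv_into (darts G') f' \<circ> (g \<circ> f)"]) simp
  next
  assume "EX g. is_iso g G G'&g h = h'"
  then obtain g where g: "is_iso g G G'" "g h = h'" by blast
  have "is_iso (f' \<circ> (g \<circ> inv_into (darts G) f)) K K'" using is_iso_comp[OF m(3,2,4) is_iso_comp[OF m(3,1,2) is_iso_inv[OF m(1,3) K(4)] g(1)] K'(4)] .
  moreover have "inv_into (darts G) f k = h" using K(4,5) hD(1) by (auto simp: is_iso_def bij_betw_def)
  ultimately show "EX g. is_iso g K K'&g k = k'" using g K'(5) by (intro exI[of _ "f' \<circ> (g \<circ> inv_into (darts G) f)"]) simp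
  qed
  also have "... <-> x':Q x" using reps_eq[OF A(1) GA(1,2)] unfolding Q_iff[OF x(1)] by (auto simp: xe xe')
  finally show ?thesis .
  qed
  have Q1: "Q x <= X" if "x:X" for x using that AA Pinv by (cases x) (auto simp: Q_def X_def automorphisms_def intro: Pinv[OF AA AA])
  have w1: "w H = (case x of (G, h)=>w' G h)" if x: "x:X" and H: "H:B" and RR: "R' x H" for x H
  proof -
  obtain G h where xe: "x = (G, h)" by (metis surj_pair)
  obtain K k f where K: "K:A" "k:P K" "R K k H" "is_iso f G K" "f h = k" using RR by (auto simp: R'_def xe)
  have GA: "G:A" "h:P G" using x AA by (auto simp: X_def xe)
  obtain H' where H': "H':B" "R G h H'" using R[OF GA] by blast
  have "EX f. is_iso f H' H" using iso[OF GA(1) K(1) GA(2) K(2) H'(1) H H'(2) K(3)] K(4,5) by blast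
  then have "w H' = w H" using winv[OF H'(1) H] by blast
  then show ?thesis using w[OF GA H'] by (simp add: xe)
  qed
 note T = gsum_transfer[OF B rigid finX R1 L1 iso1 Q1 w1 winv]
 have 1: "finite (reps B)" by (rule T(1))
 have 2: "gsum B w = (\<Sum>x\<in>X. (case x of (G, h)=>w' G h) / of_nat (card (Q x)))" by (rule T(2))
 show "finite (reps B)" by (rule 1)
 have "(\<Sum>x\<in>X. (case x of (G, h)=>w' G h) / of_nat (card (Q x)))
  = (\<Sum>(G, h)\<in>X. w' G h / of_nat (card (automorphisms G)))" by (rule sum.cong) (auto simp: cardQ)
 also have "... = (\<Sum>G\<in>?A. \<Sum>h\<in>P G. w' G h / of_nat (card (automorphisms G)))" unfolding X_def using fin finP AA by (subst sum.Sigma) auto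
 finally show "gsum B w = (\<Sum>G\<in>?A. (\<Sum>h\<in>P G. w' G h) / of_nat (card (automorphisms G)))" by (simp add: 2 sum_divide_distrib)
qed

text \<open>After its darts are numbered, a map becomes a word of bounded length over a finite
  alphabet that records rotation, opposite dart, colour and decoration. Maps with equal words are
  isomorphic, so representatives with equal words coincide.\<close>

lemma finite_reps:
 assumes A: "!!G. G:A==>is_map G" and K: "!!G. G:A ==> card (darts G) <= K"
  and cs: "finite C" "!!G h. G:A==>h:darts G ==> cl G h:C"
  and ds: "finite E" "!!G h. G:A==>h:darts G==>dl G h:E"
 shows "finite (reps A)"
proof -
 have "EX e. bij_betw e {..<card (darts G)} (darts G)" if "G:A" for G using ex_bij_betw_nat_finite[OF fin_darts[OF A[OF that]]] by (simp add: lessThan_atLeast0)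
 then obtain e where e: "!!G. G:A==>bij_betw (e G) {..<card (darts G)} (darts G)" by metis
 define g where "g G = inv_into {..<card (darts G)} (e G)" for G
 have g: "bij_betw (g G) (darts G) {..<card (darts G)}" if "G:A" for G unfolding g_def using e[OF that] by (rule bij_betw_inv_into)
 have ge: "g G (e G i) = i" if "G:A" "i < card (darts G)" for G i unfolding g_def using that by (intro bij_betw_inv_into_left[OF e]) auto
 have eg: "e G (g G h) = h" if "G:A" "h:darts G" for G h unfolding g_def using that by (intro bij_betw_inv_into_right[OF e]) auto
 define code where "code G = map (%i. (g G (rot G (e G i)), g G (opp G (e G i)), cl G (e G i), dl G (e G i)))
  [0..<card (darts G)]" for G
 define Y where "Y = {xs. set xs <= {..<K} \<times> {..<K} \<times> C \<times> E&length xs <= K}"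
 have "finite Y" unfolding Y_def using cs ds by (intro finite_lists_length_le) auto
 moreover have "code ` reps A <= Y"
 proof
  fix y assume "y : code ` reps A"
  then obtain G where G: "G:A" "y = code G" using representatives_subset by blast
  have "e G i:darts G" if "i < card (darts G)" for i using e[OF G(1)] that by (auto simp: bij_betw_def)
  moreover have "g G h < K" if "h:darts G" for h using bij_betwE[OF g[OF G(1)]] that K[OF G(1)] by (meson lessThan_iff less_le_trans)
  ultimately show "y:Y" using G K cs ds A[OF G(1)] by (auto simp: Y_def code_def rot_in opp_in)
 qed
 moreover have "inj_on code (reps A)"
 proof (rule inj_onI)
  fix G H assume GH: "G:reps A" "H:reps A" "code G = code H"
  then have A': "G:A" "H:A" by (auto dest: representatives_subset)
  have m: "card (darts G) = card (darts H)" using arg_cong[OF GH(3), of length] by (simp add: code_def)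
  have c: "g G (rot G (e G i)) = g H (rot H (e H i))&g G (opp G (e G i)) = g H (opp H (e H i)) &
  cl G (e G i) = cl H (e H i)&dl G (e G i) = dl H (e H i)" if "i < card (darts G)" for i using arg_cong[OF GH(3), of "%xs. xs ! i"] that m by (simp add: code_def)
  have gi: "g G h < card (darts G)" if "h:darts G" for h using g[OF A'(1)] that by (auto simp: bij_betw_def)
  have ei: "e H i:darts H" if "i < card (darts H)" for i using e[OF A'(2)] that by (auto simp: bij_betw_def)
  have "is_iso (e H \<circ> g G) G H" unfolding is_iso_iff[OF A[OF A'(1)] A[OF A'(2)]]
  proof (intro conjI ballI)
  show "bij_betw (e H \<circ> g G) (darts G) (darts H)" using bij_betw_trans[OF g[OF A'(1)], of "e H"] e[OF A'(2)] m by simp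
  fix h assume h: "h:darts G"
  have hh: "e G (g G h) = h" using eg[OF A'(1) h] .
  note ch = c[OF gi[OF h], unfolded hh]
  have hH: "rot H (e H (g G h)):darts H" "opp H (e H (g G h)):darts H" using ei[of "g G h"] gi[OF h] m A[OF A'(2)] by (auto simp: rot_in opp_in)
  show "(e H \<circ> g G) (rot G h) = rot H ((e H \<circ> g G) h)" "(e H \<circ> g G) (opp G h) = opp H ((e H \<circ> g G) h)" using ch eg[OF A'(2) hH(1)] eg[OF A'(2) hH(2)] by simp_all
  show "cl H ((e H \<circ> g G) h) = cl G h" "dl H ((e H \<circ> g G) h) = dl G h" using ch by simp_all
  qed
  then show "G = H" using reps_eq[OF A GH(1,2)] by blast
 qed
 ultimately show ?thesis by (metis finite_imageD finite_subset)
qed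

section \<open>Weights and their dependence on one corner or one side\<close>

lemma cv_dl: "cv z lam G h = dec_value z lam (dl G h)" by (simp add: corner_value_def dl_def)

definition EW :: "complex poly=>(nat => complex)=>'m cmap => complex" where
 "EW V b G = (\<Prod>e\<in>edges G. inverse (dd (pderiv V) e b))"

text \<open>Only black vertices have a factor here. A white vertex weighs 1, and the factor of the
  square vertex is treated separately because it carries the variable u.\<close>

definition vw :: "complex poly=>'m cmap=>(nat => complex)=>nat set => complex" where
 "vw V G a x = (if colour G x = Black then - dd (pderiv V) x a else 1)"

text \<open>
 Corners and sides of edges carry separate decorations \<open>a\<close> and \<open>b\<close>, so that the decoration of a
 face can be changed one corner or side at a time.
\<close>

definition wt :: "complex poly=>(nat => complex)=>(nat => complex)=>'m cmap => complex" where
 "wt V a b G = EW V b G * (\<Prod>x\<in>vertices G. vw V G a x)"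

abbreviation wtc :: "complex poly=>('m => complex)=>(nat => complex)=>'m cmap => complex" where
 "wtc V z lam G == wt V (cv z lam G) (cv z lam G) G"

text \<open>The vertex X receives the divided difference of p in place of its own factor. For black
  X the polynomial p = - V' gives back the weight; for square X a residue in u leads to other
  polynomials.\<close>

definition wsp :: "complex poly => complex poly=>(nat => complex)=>(nat => complex)=>'m cmap=>nat set => complex"
 where "wsp p V a b G X = EW V b G * (\<Prod>x\<in>vertices G - {X}. vw V G a x) * dd p X a"

text \<open>The corner h is doubled into two corners with values x and y. For p = - V' and a black
  vertex this is the divided difference of the weight as a function of the value at that
  corner.\<close>

definition Tc :: "complex poly => complex poly=>'m cmap=>(nat => complex)=>(nat => complex) =>
  nat => complex => complex => complex" where
 "Tc p V G a b h x y = EW V b G * (\<Prod>X\<in>vertices G - {vx G h}. vw V G a X) *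
  ev p (gg x * gg y * (\<Prod>i\<in>vx G h - {h}. gg (a i)))"

text \<open>The edge of h is broken by a trivalent vertex with corners x and y on the side of h and
  one corner on the other side; its two halves weigh \<open>eiv\<close> with x and with y. For p = -
  V' this is the divided difference of the weight as a function of the value at the side h.\<close>

definition Ts :: "complex poly => complex poly=>'m cmap=>(nat => complex)=>(nat => complex) =>
  nat => complex => complex => complex" where
 "Ts p V G a b h x y = (\<Prod>e\<in>edges G - {{h, opp G h}}. inverse (dd (pderiv V) e b)) *
  (\<Prod>X\<in>vertices G. vw V G a X) * ev p (gg x * gg y * gg (b (opp G h))) *
  eiv V x (b (opp G h)) * eiv V y (b (opp G h))"

lemma in_verticesD:
 assumes "is_map G" "x:vertices G"
 shows "finite x" "x~={}" "x <= darts G" "h:x==>x = vx G h"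
proof -
 obtain k where k: "k:darts G" "x = vx G k" using assms(2) by (auto simp: vertices_def)
 show "x <= darts G" "x~={}" using k assms(1) vx_subset vx_self by blast+
 then show "finite x" using fin_darts[OF assms(1)] finite_subset by blast
 show "h:x==>x = vx G h" using k assms(1) vx_eq by blast
qed

lemma in_edgesD:
 assumes "is_map G" "e:edges G"
 shows "finite e" "e <= darts G" "h:e==>e = {h, opp G h}"
proof -
 obtain k where k: "k:darts G" "e = {k, opp G k}" using assms(2) by (auto simp: edges_def)
 show "e <= darts G" "finite e" using k assms(1) by (auto simp: opp_in)
 show "h:e==>e = {h, opp G h}" using k opp_opp[OF assms(1)] by (auto simp: insert_commute)
qed

lemma dd_edge:
 assumes "is_map G" "h:darts G"
 shows "dd p {h, opp G h} b = ev p (gg (b h) * gg (b (opp G h)))"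
proof -
 show ?thesis using opp_neq[OF assms] dd_def by auto
qed

lemma edge_weights_eq:
 assumes "is_map G"
 shows "(\<Prod>e\<in>edges G. let h = (SOME h. h:e) in edge_weight V (c h) (c (opp G h))) = EW V c G" unfolding EW_def
proof (rule prod.cong[OF refl])
 fix e assume e: "e:edges G"
 then have "e~={}" by (auto simp: edges_def)
 then have h: "(SOME h. h:e):e" by (simp add: some_in_eq)
 have "dd (pderiv V) e c = ev (pderiv V) (gg (c (SOME h. h:e)) * gg (c (opp G (SOME h. h:e))))" using in_edgesD(2)[OF assms e] dd_edge[OF assms] in_edgesD(3)[OF assms e h] by force
 then show "(let h = (SOME h. h:e) in edge_weight V (c h) (c (opp G h))) = inverse (dd (pderiv V) e c)" by (simp add: Let_def edge_weight_eq)
qed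

lemma weight_eq_wt:
 assumes "is_map G" "!!h. h:darts G ==> cl G h~=Square"
 shows "weight V lam z u G = wtc V z lam G"
proof -
 have "vertex_weight V lam z u G x = vw V G (cv z lam G) x" if "x:vertices G" for x
 proof -
  have "colour G x~=Square" using assms(2) that by (auto simp: vertices_def cl_def)
  then show ?thesis using in_verticesD[OF assms(1) that] by (auto simp: vertex_weight_def vw_def black_weight_eq split: colour.splits)
 qed
 then show ?thesis unfolding weight_def wt_def edge_weights_eq[OF assms(1)] by simp
qed

lemma weight_square:
 assumes "is_map G" "X:vertices G" "colour G X = Square"
  "!!x. x:vertices G ==> colour G x = Square==>x = X"
 shows "weight V lam z u G = EW V (cv z lam G) G *
  (\<Prod>x\<in>vertices G - {X}. vw V G (cv z lam G) x) * (\<Prod>h\<in>X. 1 / (u - cv z lam G h))"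
proof -
 have "vertex_weight V lam z u G x = vw V G (cv z lam G) x" if "x:vertices G - {X}" for x
 proof -
  have "colour G x~=Square" using assms(4) that by auto
  then show ?thesis using in_verticesD[OF assms(1), of x] that by (auto simp: vertex_weight_def vw_def black_weight_eq split: colour.splits)
 qed
 then have "(\<Prod>x\<in>vertices G. vertex_weight V lam z u G x) =
  (\<Prod>h\<in>X. 1 / (u - cv z lam G h)) * (\<Prod>x\<in>vertices G - {X}. vw V G (cv z lam G) x)" using assms(3) by (subst prod.remove[OF finite_vertices(1)[OF assms(1)] assms(2)])
  (simp add: vertex_weight_def)
 then show ?thesis unfolding weight_def edge_weights_eq[OF assms(1)] by simp
qed

lemma EW_cong:
 assumes "is_map G" "!!h. h:darts G==>b h = b' h"
 shows "EW V b G = EW V b' G" unfolding EW_def using assms in_edgesD[OF assms(1)] by (intro prod.cong refl arg_cong[of _ _ inverse] dd_cong) blast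

lemma vw_cong:
 assumes "!!h. h:x==>a h = a' h"
 shows "vw V G a x = vw V G a' x" unfolding vw_def using dd_cong[of x a a'] assms by metis

lemma
 assumes "is_map G" "is_map H" "is_iso f G H"
 shows edges_iso: "edges H = (`) f ` edges G" and vertices_iso: "vertices H = (`) f ` vertices G"
  and inj_image_iso: "inj_on ((`) f) (Pow (darts G))"
proof -
 have bij: "bij_betw f (darts G) (darts H)" using assms(3) by (simp add: is_iso_def)
 then have H: "darts H = f ` darts G" by (simp add: bij_betw_def)
 show "inj_on ((`) f) (Pow (darts G))" using bij by (intro inj_on_image_Pow) (simp add: bij_betw_def)
 show "edges H = (`) f ` edges G" unfolding edges_def H image_image using assms(3) by (intro image_cong) (auto simp: is_iso_def)
 show "vertices H = (`) f ` vertices G" unfolding vertices_def H image_image using vx_iso[OF assms] by (intro image_cong) auto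
qed

lemma EW_iso:
 assumes "is_map G" "is_map H" "is_iso f G H"
 shows "EW V b H = EW V (b \<circ> f) G"
proof -
 have inj: "inj_on f (darts G)" using assms(3) by (simp add: is_iso_def bij_betw_def)
 have i: "inj_on ((`) f) (edges G)" by (rule inj_on_subset[OF inj_image_iso[OF assms]]) (use in_edgesD(2)[OF assms(1)] in blast)
 show ?thesis unfolding EW_def edges_iso[OF assms] prod.reindex[OF i] comp_def[of _ "(`) f"] by (intro prod.cong refl arg_cong[of _ _ inverse] dd_reindex inj_on_subset[OF inj])
  (use in_edgesD(2)[OF assms(1)] in blast)
qed

lemma vw_iso:
 assumes "is_map G" "is_map H" "is_iso f G H" "x:vertices G"
 shows "vw V H a (f ` x) = vw V G (a \<circ> f) x"
proof -
 show ?thesis by (metis in_verticesD(3)[OF assms(1,4)] is_iso_def bij_betw_def inj_on_subset assms(3,4) vw_def dd_reindex)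
qed

lemma cv_iso:
 assumes "is_map G" "is_map H" "is_iso f G H" "h:darts G"
 shows "cv z lam H (f h) = cv z lam G h" using assms by (simp add: cv_dl is_iso_iff[OF assms(1,2)])

lemma wsp_iso:
 assumes "is_map G" "is_map H" "is_iso f G H" "X:vertices G"
 shows "wsp p V (cv z lam H) (cv z lam H) H (f ` X)
  = wsp p V (cv z lam G) (cv z lam G) G X"
proof -
 let ?c = "cv z lam H" and ?d = "cv z lam G"
 note cv = cv_iso[OF assms(1-3), of _ z lam]
 note vs = in_verticesD[OF assms(1)]
 have E: "EW V ?c H = EW V ?d G" unfolding EW_iso[OF assms(1-3)] using cv by (intro EW_cong assms) simp
 have i: "inj_on ((`) f) (vertices G)" by (rule inj_on_subset[OF inj_image_iso[OF assms(1-3)]]) (use vs(3) in blast)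
 have "vertices H - {f ` X} = (`) f ` (vertices G - {X})" unfolding vertices_iso[OF assms(1-3)] using inj_on_image_set_diff[OF i, of "vertices G" "{X}"] assms(4) by auto
 moreover have "inj_on ((`) f) (vertices G - {X})" using i by (rule inj_on_subset) auto
 ultimately have "(\<Prod>x\<in>vertices H - {f ` X}. vw V H ?c x) = (\<Prod>x\<in>vertices G - {X}. vw V H ?c (f ` x))" by (simp add: prod.reindex)
 also have "... = (\<Prod>x\<in>vertices G - {X}. vw V G ?d x)"
 proof (rule prod.cong[OF refl])
  fix x assume x: "x:vertices G - {X}"
  then have "vw V H ?c (f ` x) = vw V G (?c \<circ> f) x" using vw_iso[OF assms(1-3)] by blast
  also have "... = vw V G ?d x" using x vs(3) cv by (intro vw_cong) auto
  finally show "vw V H ?c (f ` x) = vw V G ?d x" .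
 qed
 finally have P: "(\<Prod>x\<in>vertices H - {f ` X}. vw V H ?c x) = (\<Prod>x\<in>vertices G - {X}. vw V G ?d x)" .
 have "dd p (f ` X) ?c = dd p X (?c \<circ> f)" by (metis assms(3) vs(3)[OF assms(4)] is_iso_def bij_betw_def inj_on_subset dd_reindex)
 also have "... = dd p X ?d" using vs(3)[OF assms(4)] cv by (intro dd_cong) auto
 finally show ?thesis by (simp add: wsp_def E P)
qed

lemma wt_iso:
 assumes "is_map G" "is_map H" "is_iso f G H"
 shows "wtc V z lam H
  = wtc V z lam G"
proof -
 let ?c = "cv z lam H" and ?d = "cv z lam G"
 note cv = cv_iso[OF assms(1-3), of _ z lam]
 note vs = in_verticesD[OF assms(1)]
 have E: "EW V ?c H = EW V ?d G" unfolding EW_iso[OF assms(1-3)] using cv by (intro EW_cong assms) simp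
 have i: "inj_on ((`) f) (vertices G)" by (rule inj_on_subset[OF inj_image_iso[OF assms(1-3)]]) (use vs(3) in blast)
 have "vw V H ?c (f ` x) = vw V G ?d x" if "x:vertices G" for x unfolding vw_iso[OF assms(1-3) that] using that vs(3) cv by (intro vw_cong) auto
 then show ?thesis unfolding wt_def E vertices_iso[OF assms(1-3)] by (simp add: prod.reindex[OF i])
qed

lemma wsp_black:
 assumes "is_map G" "X:vertices G" "colour G X = Black"
 shows "wsp (pderiv V) V a b G X = - wt V a b G" unfolding wsp_def wt_def prod.remove[OF finite_vertices(1)[OF assms(1)] assms(2)] using assms(3) by (simp add: vw_def)

lemma wsp_uminus: "wsp (- p) V a b G X = - wsp p V a b G X" by (simp add: wsp_def dd_def ev_uminus)

text \<open>The corner enters only through the divided difference at its own vertex, where the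
  two-point recursion applies. If the vertex is not black, the weight does not see the
  corner.\<close>

lemma wt_change_corner:
 assumes "is_map G" "h:darts G"
 shows "wt V (a(h := x)) b G - wt V (a(h := y)) b G =
  (x - y) * (if cl G h = Black then Tc (- pderiv V) V G a b h x y else 0)"
proof -
 let ?v = "vx G h"
 have v: "?v:vertices G" "h:?v" "finite ?v" using assms vx_self in_verticesD(1)[OF assms(1)] by (auto simp: vertices_def)
 have *: "wt V (a(h := c)) b G = EW V b G * (\<Prod>X\<in>vertices G - {?v}. vw V G a X) * vw V G (a(h := c)) ?v" for c
 proof -
  have "vw V G (a(h := c)) X = vw V G a X" if "X:vertices G - {?v}" for X using in_verticesD(4)[OF assms(1), of X h] that by (intro vw_cong) auto
  then show ?thesis unfolding wt_def prod.remove[OF finite_vertices(1)[OF assms(1)] v(1)] by (simp add: mult_ac)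
 qed
 have **: "dd p ?v (a(h := c)) = ev p (gg c * (\<Prod>i\<in>?v - {h}. gg (a i)))" for p c
 proof -
  have "(\<Prod>i\<in>?v - {h}. gg ((a(h := c)) i)) = (\<Prod>i\<in>?v - {h}. gg (a i))" by (rule prod.cong) auto
  then show ?thesis unfolding dd_def prod.remove[OF v(3,2)] by simp
 qed
 have vwc: "vw V G (a(h := c)) ?v = (if cl G h = Black then - ev (pderiv V) (gg c * (\<Prod>i\<in>?v - {h}. gg (a i))) else 1)"
  for c by (simp add: vw_def ** cl_def)
 have alg: "K * (- e) - K * (- e') = - K * (e - e')" for K e e' :: complex by (simp add: algebra_simps)
 show ?thesis
 proof (cases "cl G h = Black")
  case True
  show ?thesis unfolding * vwc if_P[OF True] alg ev_gg_diff_mult[symmetric] by (simp add: Tc_def ev_uminus)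
 qed (simp add: * vwc)
qed

text \<open>The side enters only through the inverse of a divided difference at two points.
  Subtracting two such inverses leaves both of them as factors, the weights of the two halves of the
  edge, and a divided difference at three points between them.\<close>

lemma wt_change_side:
 assumes "is_map G" "h:darts G"
  and "ev (pderiv V) (gg x * gg (b (opp G h)))~=0" "ev (pderiv V) (gg y * gg (b (opp G h)))~=0"
 shows "wt V a (b(h := x)) G - wt V a (b(h := y)) G = (x - y) * Ts (- pderiv V) V G a b h x y"
proof -
 let ?k = "opp G h" and ?e = "{h, opp G h}"
 let ?D = "%c. ev (pderiv V) (gg c * gg (b ?k))"
 have hk: "h~=?k" using opp_neq[OF assms(1,2)] by metis
 have e: "?e:edges G" using assms(2) by (auto simp: edges_def)
 have *: "EW V (b(h := c)) G = inverse (?D c) * (\<Prod>e\<in>edges G - {?e}. inverse (dd (pderiv V) e b))" for c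
 proof -
  have "dd (pderiv V) e (b(h := c)) = dd (pderiv V) e b" if "e:edges G - {?e}" for e using in_edgesD(3)[OF assms(1), of e h] that by (intro dd_cong) auto
  then show ?thesis unfolding EW_def prod.remove[OF finite_edges[OF assms(1)] e] using dd_edge[OF assms(1,2), of _ "b(h := c)"] hk by simp
 qed
 \<comment> \<open>The minus sign is the one in the weight of a black vertex: the vertex that breaks
   the edge is black.\<close>
 have "inverse (?D x) - inverse (?D y) = - (?D x - ?D y) * inverse (?D x) * inverse (?D y)" using assms(3,4) by (simp add: field_simps)
 also have "?D x - ?D y = (x - y) * ev (pderiv V) (gg x * gg y * gg (b ?k))" by (rule ev_gg_diff_mult[symmetric])
 finally have "inverse (?D x) - inverse (?D y) =
  (x - y) * (ev (- pderiv V) (gg x * gg y * gg (b ?k)) * inverse (?D x) * inverse (?D y))" by (simp add: ev_uminus)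
 moreover have "wt V a (b(h := x)) G - wt V a (b(h := y)) G = (inverse (?D x) - inverse (?D y)) *
  ((\<Prod>e\<in>edges G - {?e}. inverse (dd (pderiv V) e b)) * (\<Prod>X\<in>vertices G. vw V G a X))" unfolding wt_def * by (simp add: algebra_simps)
 ultimately show ?thesis by (simp add: Ts_def mult_ac)
qed

section \<open>Replacing the decoration of a whole face\<close>

text \<open>A face F on its way from x to y: the darts in A have already been switched, the other
  darts of F not yet, and the rest of the map is left at v.\<close>

definition asg :: "nat set => complex => complex=>(nat => complex)=>nat set=>nat => complex" where
 "asg F x y v A h = (if h:F then if h:A then y else x else v h)"

text \<open>The darts that precede \<open>h\<close> on the boundary of its face, starting from \<open>b\<close>.\<close>

definition pre :: "'m cmap=>nat=>nat=>nat set" where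
 "pre G b h = (%s. (face_perm G ^^ s) b) ` {..<(LEAST t. (face_perm G ^^ t) b = h)}"

lemma face_enum:
 assumes "is_map G" "L = card (fc G b)"
 shows "fc G b = (%t. (face_perm G ^^ t) b) ` {..<L}" "inj_on (%t. (face_perm G ^^ t) b) {..<L}" "0 < L" using orbit_enum[OF fin_darts[OF assms(1)] fp_permutes[OF assms(1)]] assms(2) by (auto simp: face_at_def)

lemma pre_funpow:
 assumes "is_map G" "t < card (fc G b)"
 shows "pre G b ((face_perm G ^^ t) b) = (%s. (face_perm G ^^ s) b) ` {..<t}"
proof -
 have "(LEAST s. (face_perm G ^^ s) b = (face_perm G ^^ t) b) = t"
 proof (rule Least_equality)
  fix s assume s: "(face_perm G ^^ s) b = (face_perm G ^^ t) b"
  show "t <= s"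
  proof (rule ccontr)
  assume "~ t <= s"
  then show False using inj_onD[OF face_enum(2)[OF assms(1) refl] s] assms(2) by auto
  qed
 qed simp
 then show ?thesis by (simp add: pre_def)
qed

definition nonzero_on :: "complex poly => complex set=>bool" where
 "nonzero_on V S<->(ALL a:S. ALL b:S. ev (pderiv V) (gg a * gg b)~=0)"

text \<open>The boundary of F is walked through from b. At each dart the corner is switched before
  the side, so the side term finds the corner already at its new value; this explains
  \<open>insert h (pre G b h)\<close> in one argument and \<open>pre G b h\<close> in the
  other.\<close>

lemma wt_telescope:
 assumes G: "is_map G" "b:darts G" and F: "F = fc G b" and nz: "nonzero_on V S"
  and S: "x:S" "y:S" "!!h. h:darts G - F==>v h:S"
 shows "wt V (asg F x y v {}) (asg F x y v {}) G - wt V (asg F x y v F) (asg F x y v F) G =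
  (x - y) * (\<Sum>h\<in>F. (if cl G h = Black then
  Tc (- pderiv V) V G (asg F x y v (pre G b h)) (asg F x y v (pre G b h)) h x y else 0) +
  Ts (- pderiv V) V G (asg F x y v (insert h (pre G b h))) (asg F x y v (pre G b h)) h x y)"
proof -
 define L where "L = card F"
 define f where "f t = (face_perm G ^^ t) b" for t
 note en = face_enum[OF G(1), of L b, folded F, OF L_def, folded f_def]
 define A where "A t = f ` {..<t}" for t
 let ?a = "asg F x y v"
 let ?T = "%h. (if cl G h = Black then Tc (- pderiv V) V G (?a (pre G b h)) (?a (pre G b h)) h x y else 0) +
  Ts (- pderiv V) V G (?a (insert h (pre G b h))) (?a (pre G b h)) h x y"
 have pre: "pre G b (f t) = A t" if "t < L" for t using pre_funpow[OF G(1), of t b] that by (simp add: A_def f_def L_def F)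
 have step: "wt V (?a (A t)) (?a (A t)) G - wt V (?a (A (Suc t))) (?a (A (Suc t))) G = (x - y) * ?T (f t)"
  if t: "t < L" for t
 proof -
  have "f t~=f s" if "s < t" for s using inj_onD[OF en(2), of t s] t that by auto
  then have h: "f t:F" "f t~:A t" using t unfolding en(1) by (auto simp: A_def)
  have hD: "f t:darts G" using h(1) F fc_subset[OF G] by auto
  have Suc: "A (Suc t) = insert (f t) (A t)" by (simp add: A_def lessThan_Suc)
  have a1: "(?a (A t))(f t := x) = ?a (A t)" and a2: "(?a (A t))(f t := y) = ?a (A (Suc t))" using h by (auto simp: asg_def Suc fun_eq_iff)
  have inS: "?a B k:S" if "k:darts G" for B k using that S by (auto simp: asg_def)
  have nzk: "ev (pderiv V) (gg c * gg (?a (A t) (opp G (f t))))~=0" if "c:S" for c using nz inS[of "opp G (f t)" "A t"] that hD by (auto simp: nonzero_on_def opp_in[OF G(1)])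
  have "wt V (?a (A t)) (?a (A t)) G - wt V (?a (A (Suc t))) (?a (A t)) G =
  (x - y) * (if cl G (f t) = Black then Tc (- pderiv V) V G (?a (A t)) (?a (A t)) (f t) x y else 0)" using wt_change_corner[OF G(1) hD, of V "?a (A t)" x "?a (A t)" y] unfolding a1 a2 .
  moreover have "wt V (?a (A (Suc t))) (?a (A t)) G - wt V (?a (A (Suc t))) (?a (A (Suc t))) G =
  (x - y) * Ts (- pderiv V) V G (?a (A (Suc t))) (?a (A t)) (f t) x y" using wt_change_side[where b = "?a (A t)" and x = x and y = y and a = "?a (A (Suc t))", OF G(1) hD nzk[OF S(1)] nzk[OF S(2)]] unfolding a1 a2 .
  ultimately show ?thesis unfolding pre[OF t] Suc[symmetric] by (simp add: algebra_simps)
 qed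
 have "wt V (?a (A 0)) (?a (A 0)) G - wt V (?a (A L)) (?a (A L)) G =
  (\<Sum>t<L. wt V (?a (A t)) (?a (A t)) G - wt V (?a (A (Suc t))) (?a (A (Suc t))) G)" by (rule sum_lessThan_telescope'[symmetric, where f = "%t. wt V (?a (A t)) (?a (A t)) G"])
 also have "... = (\<Sum>t<L. (x - y) * ?T (f t))" by (rule sum.cong[OF refl]) (simp only: lessThan_iff step)
 also have "... = (x - y) * (\<Sum>h\<in>F. ?T h)" unfolding sum_distrib_left[symmetric] en(1) sum.reindex[OF en(2)] by (simp add: comp_def)
 finally show ?thesis using en(1) by (simp add: A_def)
qed

lemma tendsto_ev:
 assumes "!!k. ((%x. fps_nth (F x) k) \<longlongrightarrow> fps_nth F0 k) net"
 shows "((%x. ev p (F x)) \<longlongrightarrow> ev p F0) net" unfolding ev_def by (intro tendsto_intros assms)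

lemma tendsto_fps_mult:
 fixes F H :: "'a => complex fps"
 assumes "!!k. ((%x. fps_nth (F x) k) \<longlongrightarrow> fps_nth F0 k) net" "!!k. ((%x. fps_nth (H x) k) \<longlongrightarrow> fps_nth H0 k) net"
 shows "((%x. fps_nth (F x * H x) k) \<longlongrightarrow> fps_nth (F0 * H0) k) net" unfolding fps_mult_nth by (intro tendsto_sum tendsto_mult assms)

lemma tendsto_gg: "(f \<longlongrightarrow> s) net==>((%x. fps_nth (gg (f x)) k) \<longlongrightarrow> fps_nth (gg s) k) net" by (cases k) (auto intro!: tendsto_intros)

lemma
 assumes G: "is_map G" "h:darts G"
  and a: "!!k. k:darts G==>((%x. a x k) \<longlongrightarrow> aL k) net" and b: "!!k. k:darts G==>((%x. b x k) \<longlongrightarrow> bL k) net"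
  and xy: "(\<xi> \<longlongrightarrow> x0) net" "(\<eta> \<longlongrightarrow> y0) net"
  and nz: "nonzero_on V S" and S: "!!k. k:darts G==>bL k:S" "x0:S" "y0:S"
 shows tendsto_Tc: "((%x. Tc p V G (a x) (b x) h (\<xi> x) (\<eta> x)) \<longlongrightarrow> Tc p V G aL bL h x0 y0) net"
  and tendsto_Ts: "((%x. Ts p V G (a x) (b x) h (\<xi> x) (\<eta> x)) \<longlongrightarrow> Ts p V G aL bL h x0 y0) net"
proof -
 have hk: "opp G h:darts G" using G by (simp add: opp_in)
 have E: "((%x. inverse (dd (pderiv V) e (b x))) \<longlongrightarrow> inverse (dd (pderiv V) e bL)) net" if e: "e:edges G" for e
 proof (rule tendsto_inverse[OF tendsto_dd])
  note ed = in_edgesD[OF G(1) e]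
  show "finite e" by (rule ed(1))
  show "((%x. b x i) \<longlongrightarrow> bL i) net" if "i:e" for i using b ed(2) that by blast
  from e obtain k where k: "k:darts G" "e = {k, opp G k}" by (auto simp: edges_def)
  then show "dd (pderiv V) e bL~=0" using nz S(1)[of k] S(1)[of "opp G k"] G(1) by (simp add: dd_edge nonzero_on_def opp_in)
 qed
 have W: "((%x. vw V G (a x) X) \<longlongrightarrow> vw V G aL X) net" if X: "X:vertices G" for X
 proof -
  note vd = in_verticesD[OF G(1) X]
  have "((%x. - dd (pderiv V) X (a x)) \<longlongrightarrow> - dd (pderiv V) X aL) net" using a vd(3) by (intro tendsto_minus tendsto_dd vd(1)) auto
  then show ?thesis by (auto simp: vw_def)
 qed
 have v: "finite (vx G h)" "vx G h <= darts G" using in_verticesD(1,3)[OF G(1)] G(2) by (auto simp: vertices_def)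
 show "((%x. Tc p V G (a x) (b x) h (\<xi> x) (\<eta> x)) \<longlongrightarrow> Tc p V G aL bL h x0 y0) net" unfolding Tc_def EW_def using v a by (intro tendsto_mult tendsto_prod E W tendsto_ev tendsto_fps_mult tendsto_gg xy tendsto_fps_prod) auto
 have nz': "ev (pderiv V) (gg x0 * gg (bL (opp G h)))~=0" "ev (pderiv V) (gg y0 * gg (bL (opp G h)))~=0" using nz S hk by (auto simp: nonzero_on_def)
 show "((%x. Ts p V G (a x) (b x) h (\<xi> x) (\<eta> x)) \<longlongrightarrow> Ts p V G aL bL h x0 y0) net" unfolding Ts_def using nz' hk b by (intro tendsto_mult tendsto_prod E W tendsto_inverse tendsto_ev tendsto_fps_mult tendsto_gg xy) auto
qed

text \<open>The difference quotient at x0 is exactly the telescoped sum with endpoints x and x0, and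
  all its terms are continuous. The partially switched decorations converge to the constant one, so
  the order of the walk disappears in the limit.\<close>

lemma wt_has_derivative:
 assumes G: "is_map G" "b:darts G" and F: "F = fc G b" and nz: "nonzero_on V S"
  and S: "x0:S" "!!h. h:darts G - F==>v h:S"
 defines "a == %x h. if h:F then x else v h"
 shows "((%x. wt V (a x) (a x) G) has_field_derivative
  (\<Sum>h\<in>F. (if cl G h = Black then Tc (- pderiv V) V G (a x0) (a x0) h x0 x0 else 0) +
  Ts (- pderiv V) V G (a x0) (a x0) h x0 x0)) (at x0)"
proof -
 \<comment> \<open>Only finitely many values occur in G, so all edge denominators stay nonzero
   simultaneously in one neighbourhood of x0.\<close>
 define S' where "S' = insert x0 (v ` (darts G - F))"
 have finS': "finite S'" and S'S: "S' <= S" using fin_darts[OF G(1)] S by (auto simp: S'_def)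
 have nz': "nonzero_on V S'" using nz S'S by (auto simp: nonzero_on_def)
 let ?T = "%x h. (if cl G h = Black then Tc (- pderiv V) V G (asg F x x0 v (pre G b h)) (asg F x x0 v (pre G b h)) h x x0 else 0) +
  Ts (- pderiv V) V G (asg F x x0 v (insert h (pre G b h))) (asg F x x0 v (pre G b h)) h x x0"
 have ev1: "\<forall>\<^sub>F x in at x0. ALL c:S'. ev (pderiv V) (gg x * gg c)~=0"
 proof (intro eventually_ball_finite finS' ballI)
  fix c assume "c:S'"
  then have "ev (pderiv V) (gg x0 * gg c)~=0" using nz' by (auto simp: nonzero_on_def S'_def)
  moreover have "((%x. ev (pderiv V) (gg x * gg c)) \<longlongrightarrow> ev (pderiv V) (gg x0 * gg c)) (at x0)" by (intro tendsto_ev tendsto_fps_mult tendsto_gg tendsto_ident_at tendsto_const)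
  ultimately show "\<forall>\<^sub>F x in at x0. ev (pderiv V) (gg x * gg c)~=0" by (rule tendsto_imp_eventually_ne[rotated])
 qed
 have ev2: "\<forall>\<^sub>F x in at x0. ev (pderiv V) (gg x * gg x)~=0"
 proof -
  have "ev (pderiv V) (gg x0 * gg x0)~=0" using nz' by (auto simp: nonzero_on_def S'_def)
  moreover have "((%x. ev (pderiv V) (gg x * gg x)) \<longlongrightarrow> ev (pderiv V) (gg x0 * gg x0)) (at x0)" by (intro tendsto_ev tendsto_fps_mult tendsto_gg tendsto_ident_at)
  ultimately show ?thesis by (rule tendsto_imp_eventually_ne[rotated])
 qed
 have ev3: "\<forall>\<^sub>F x in at x0. x~=x0" by (simp add: eventually_at_filter)
 have "\<forall>\<^sub>F x in at x0. (\<Sum>h\<in>F. ?T x h) = (wt V (a x) (a x) G - wt V (a x0) (a x0) G) / (x - x0)" using ev1 ev2 ev3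
 proof eventually_elim
  case (elim x)
  have comm: "ev (pderiv V) (gg c * gg x) = ev (pderiv V) (gg x * gg c)" for c by (simp add: mult.commute)
  have "nonzero_on V (insert x S')" using elim(1,2) nz' comm unfolding nonzero_on_def by (metis insertE)
  then have "wt V (asg F x x0 v {}) (asg F x x0 v {}) G - wt V (asg F x x0 v F) (asg F x x0 v F) G =
  (x - x0) * (\<Sum>h\<in>F. ?T x h)" using G F by (intro wt_telescope[where S = "insert x S'"]) (auto simp: S'_def)
  moreover have "asg F x x0 v {} = a x" "asg F x x0 v F = a x0" by (auto simp: asg_def a_def)
  ultimately show ?case using elim by simp
 qed
 moreover have "((%x. \<Sum>h\<in>F. ?T x h) \<longlongrightarrow> (\<Sum>h\<in>F. (if cl G h = Black then Tc (- pderiv V) V G (a x0) (a x0) h x0 x0 else 0) +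
  Ts (- pderiv V) V G (a x0) (a x0) h x0 x0)) (at x0)"
 proof (rule tendsto_sum)
  fix h assume h: "h:F"
  then have hD: "h:darts G" using F fc_subset[OF G] by auto
  have lim: "((%x. asg F x x0 v A k) \<longlongrightarrow> a x0 k) (at x0)" for A k by (cases "k:F"; cases "k:A") (simp_all add: asg_def a_def)
  have inS: "a x0 k:S'" if "k:darts G" for k using that by (auto simp: a_def S'_def)
  have x0: "x0:S'" by (simp add: S'_def)
  note tc = tendsto_Tc[where p = "- pderiv V" and a = "%x. asg F x x0 v (pre G b h)" and b = "%x. asg F x x0 v (pre G b h)"
  and aL = "a x0" and bL = "a x0", OF G(1) hD lim lim tendsto_ident_at tendsto_const nz' inS x0 x0]
  note ts = tendsto_Ts[where p = "- pderiv V" and a = "%x. asg F x x0 v (insert h (pre G b h))" and b = "%x. asg F x x0 v (pre G b h)"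
  and aL = "a x0" and bL = "a x0", OF G(1) hD lim lim tendsto_ident_at tendsto_const nz' inS x0 x0]
  show "((%x. ?T x h) \<longlongrightarrow> (if cl G h = Black then Tc (- pderiv V) V G (a x0) (a x0) h x0 x0 else 0) +
  Ts (- pderiv V) V G (a x0) (a x0) h x0 x0) (at x0)" using tc ts by (intro tendsto_add) auto
 qed
 ultimately show ?thesis unfolding has_field_derivative_iff by (rule Lim_transform_eventually[rotated])
qed

section \<open>Surgery: attaching a leaf and subdividing an edge\<close>

text \<open>A new edge {p, q} is drawn into the corner h: p joins the vertex of h right after h, and
  q is a univalent vertex of colour k. It is a relation because p and q may be any fresh
  darts.\<close>

definition leafins :: "colour=>'m cmap=>nat=>nat=>nat=>'m cmap=>bool" where
 "leafins k G h p q H<->h:darts G&p~:darts G&q~:darts G&p~=q &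
  darts H = insert q (insert p (darts G))&rot H = ins (rot G) h p &
  opp H p = q & opp H q = p&(ALL x. x~=p-->x~=q --> opp H x = opp G x) &
  (ALL x:darts G. cl H x = cl G x&dl H x = dl G x) &
  cl H p = cl G h & cl H q = k&dl H p = dl G h&dl H q = dl G h"

text \<open>The edge of h receives a bivalent vertex {s, t} of colour k. Then h is paired with s,
  and t with the former opposite of h; t lies in the face of h, and s in the face on the other
  side.\<close>

definition subdiv :: "colour=>'m cmap=>nat=>nat=>nat=>'m cmap=>bool" where
 "subdiv k G h s t H<->h:darts G&s~:darts G&t~:darts G&s~=t &
  darts H = insert t (insert s (darts G))&rot H = ins (rot G) s t &
  opp H h = s & opp H s = h & opp H (opp G h) = t & opp H t = opp G h &
  (ALL x. x~:{h, opp G h, s, t} --> opp H x = opp G x) &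
  (ALL x:darts G. cl H x = cl G x&dl H x = dl G x) &
  cl H s = k & cl H t = k&dl H t = dl G h&dl H s = dl G (opp G h)"

text \<open>Every face of H contains an old dart, and two old darts share a face of H exactly if
  they did so in G. The faces are therefore in a bijection that respects decorations.\<close>

lemma decorated_transfer:
 assumes "is_map G" "is_map H" "darts G <= darts H" "!!x. x:darts G==>dl H x = dl G x"
  and r: "!!x. x:darts H==>EX y:darts G. fc H x = fc H y"
  and f: "!!x y. x:darts G==>y:darts G==>fc H x = fc H y<->fc G x = fc G y"
 shows "decorated N M H<->decorated N M G"
proof -
 obtain r where r: "!!x. x:darts H==>r x:darts G&fc H x = fc H (r x)" using r by metis
 have d: "dl H x = dl G (r x)" if "x:darts H" for x using r[OF that] assms(4) by (metis dl_def)
 have "(ALL h:darts H. dl H h:X)<->(ALL h:darts G. dl G h:X)" for X using r d assms(3,4) by (metis subsetD)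
 moreover have "(EX h:darts H. dl H h = X)<->(EX h:darts G. dl G h = X)" for X using r d assms(3,4) by (metis subsetD)
 moreover have "(ALL h:darts H. ALL h':darts H. dl H h = X&dl H h' = X-->fc H h = fc H h') <->
  (ALL h:darts G. ALL h':darts G. dl G h = X&dl G h' = X-->fc G h = fc G h')" (is "?A<->?B") for X
 proof
  assume ?A then show ?B using assms(3,4) f by (metis subsetD)
 next
  assume ?B then show ?A using r d f by metis
 qed
 ultimately show ?thesis unfolding decorated_iff by (simp only:)
qed

text \<open>One edge and one vertex are added at a constant number of faces, so neither the Euler
  characteristic nor the difference in the degree moves.\<close>

lemma euler_transfer:
 assumes "is_map G" "is_map H" "card (darts H) = card (darts G) + 2" "card (vertices H) = Suc (card (vertices G))"
  "card (faces H) = card (faces G)"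
 shows "has_genus g H<->has_genus g G" "map_degree r H = map_degree r G"
proof -
 have "card (edges H) = Suc (card (edges G))" using card_edges[OF assms(1)] card_edges[OF assms(2)] assms(3) by simp
 then show "has_genus g H<->has_genus g G" "map_degree r H = map_degree r G" using assms(4,5) by (simp_all add: has_genus_def map_degree_def)
qed

lemma ex_fresh2:
 assumes "finite (D :: nat set)"
 obtains p q where "p~:D" "q~:D" "p~=q"
proof -
 obtain p where p: "p~:D" using ex_new_if_finite[OF infinite_UNIV_nat assms] by blast
 obtain q where q: "q~:insert p D" using ex_new_if_finite[OF infinite_UNIV_nat, of "insert p D"] assms by blast
 show thesis using that[of p q] p q by auto
qed

lemma bij_betw_insert2:
 assumes "bij_betw f D D'" "p~:D" "q~:D" "p~=q" "p'~:D'" "q'~:D'" "p'~=q'"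
 shows "bij_betw (f(p := p', q := q')) (insert q (insert p D)) (insert q' (insert p' D'))"
proof -
 have "bij_betw (f(p := p', q := q')) D D'"
 proof -
  have "bij_betw (f(p := p', q := q')) D D'<->bij_betw f D D'" by (rule bij_betw_cong) (use assms(2,3) in auto)
  then show ?thesis using assms(1) by simp
 qed
 then show ?thesis using notIn_Un_bij_betw[of p D "f(p := p', q := q')" D'] notIn_Un_bij_betw[of q "insert p D" "f(p := p', q := q')" "insert p' D'"]
  assms by simp
qed

lemma bij_betw_remove2:
 assumes "bij_betw F (insert q (insert p D)) (insert q' (insert p' D'))" "F p = p'" "F q = q'"
  "p~:D" "q~:D" "p'~:D'" "q'~:D'" "p~=q"
 shows "bij_betw F D D'"
proof -
 have inj: "inj_on F (insert q (insert p D))" and im: "F ` insert q (insert p D) = insert q' (insert p' D')" using assms(1) by (auto simp: bij_betw_def)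
 have "F x~=p'&F x~=q'" if "x:D" for x using inj_onD[OF inj, of x p] inj_onD[OF inj, of x q] that assms by auto
 then have "F ` D = D'" using im assms(2-7) by auto
 then show ?thesis using inj by (auto simp: bij_betw_def intro: inj_on_subset)
qed

context
 fixes k :: colour and G H :: "'m cmap" and h p q :: nat
 assumes G: "is_map G" and L: "leafins k G h p q H"
begin

lemma lf_darts: "h:darts G" "p~:darts G" "q~:darts G" "p~=q" "h~=p" "h~=q"
  "darts H = insert q (insert p (darts G))" using L by (auto simp: leafins_def)

lemma lf_rot: "rot H h = p" "rot H p = rot G h" "rot H q = q" "x~=h==>x~=p==>rot H x = rot G x"
proof -
 have "rot G q = q" using rot_permutes[OF G] lf_darts(3) by (rule permutes_not_in)
 then show "rot H h = p" "rot H p = rot G h" "rot H q = q" "x~=h==>x~=p==>rot H x = rot G x" using ins_apply[OF fin_darts[OF G] rot_permutes[OF G] lf_darts(1,2)] L lf_darts by (auto simp: leafins_def)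
qed

lemma lf_opp: "opp H p = q" "opp H q = p" "x~=p==>x~=q ==> opp H x = opp G x" using L by (auto simp: leafins_def)

lemma lf_labels: "x:darts G ==> cl H x = cl G x" "x:darts G==>dl H x = dl G x"
  "cl H p = cl G h" "cl H q = k" "dl H p = dl G h" "dl H q = dl G h" using L by (auto simp: leafins_def)

lemma lf_is_map: "is_map H"
proof (rule is_mapI)
 show "finite (darts H)" using fin_darts[OF G] lf_darts by simp
 have "rot H permutes insert p (darts G)" using ins_permutes[OF fin_darts[OF G] rot_permutes[OF G] lf_darts(1,2)] L by (simp add: leafins_def)
 then show "rot H permutes darts H" by (rule permutes_subset) (auto simp: lf_darts)
 have inv: "opp H x:darts H & opp H (opp H x) = x & opp H x~=x" if x: "x:darts H" for x
 proof -
  consider "x = p" | "x = q" | "x:darts G" using x lf_darts by auto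
  then show ?thesis
  proof cases
  case 3
  then have "opp G x:darts G" "x~=p" "x~=q" using opp_in[OF G] lf_darts by auto
  moreover from this have "opp G x~=p" "opp G x~=q" using lf_darts by auto
  ultimately show ?thesis using lf_opp(3) opp_opp[OF G] opp_neq[OF G 3] lf_darts(7) by auto
  qed (use lf_opp(1,2) lf_darts in auto)
 qed
 show "opp H permutes darts H"
 proof (rule involution_permutes)
  show "opp H x = x" if "x~:darts H" for x using that lf_darts lf_opp(3)[of x] permutes_not_in[OF opp_permutes[OF G]] by auto
 qed (use inv in blast)
 show "opp H x~=x & opp H (opp H x) = x" if "x:darts H" for x using inv[OF that] by blast
qed

text \<open>The boundary of the face makes a detour along the new edge: the predecessor x0 of h is
  now followed by p, then q, then h.\<close>

lemma lf_face_perm: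
 obtains x0 where "x0:darts G" "face_perm G x0 = h" "face_perm H = ins (ins (face_perm G) x0 p) p q"
proof -
 note D = lf_darts
 obtain x0 where x0: "face_perm G x0 = h" by (metis fp_permutes[OF G] permutes_inverses(1))
 then have x0D: "x0:darts G" using D(1) face_perm_in[OF G] by metis
 note i = ins_apply[OF fin_darts[OF G] fp_permutes[OF G] x0D D(2)]
 have perm: "ins (face_perm G) x0 p permutes insert p (darts G)" by (rule ins_permutes[OF fin_darts[OF G] fp_permutes[OF G] x0D D(2)])
 have fin: "finite (insert p (darts G))" using fin_darts[OF G] by simp
 note j = ins_apply[OF fin perm insertI1, of q]
 have q: "q~:insert p (darts G)" using D by auto
 have "face_perm H x = ins (ins (face_perm G) x0 p) p q x" for x unfolding fp_iff[OF lf_is_map]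
 proof -
  consider "x = q" | "x = p" | "x = x0" | "x~=q" "x~=p" "x~=x0" by blast
  then show "opp H x = rot H (ins (ins (face_perm G) x0 p) p q x)" by (metis j(2)[OF q] i(2) x0 lf_rot(1) lf_opp(2) j(1)[OF q] lf_rot(3) lf_opp(1) D lf_opp(3) j(3)[OF q] i(1) rot_face_perm[OF G] lf_rot(2) i(3) fp_permutes[OF G] permutes_inverses(2) permutes_not_in[OF fp_permutes[OF G]] lf_rot(4))
 qed
 then show thesis using that[OF x0D x0] by blast
qed

lemma lf_faces:
 shows lf_face_old: "y:darts G==>fc H y = (if h:fc G y then insert q (insert p (fc G y)) else fc G y)"
  and lf_face_new: "fc H p = fc H h" "fc H q = fc H h"
  and lf_card_faces: "card (faces H) = card (faces G)"
proof -
 note D = lf_darts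
 obtain x0 where x0: "x0:darts G" "face_perm G x0 = h" "face_perm H = ins (ins (face_perm G) x0 p) p q" by (rule lf_face_perm)
 let ?i = "ins (face_perm G) x0 p"
 note P1 = fin_darts[OF G] fp_permutes[OF G] x0(1) D(2)
 have fin: "finite (insert p (darts G))" using fin_darts[OF G] by simp
 have q: "q~:insert p (darts G)" using D by auto
 note P2 = fin ins_permutes[OF P1] insertI1 q
 have hx: "h:fc G y<->x0:fc G y" for y using fc_face_perm[OF G, of x0] x0(2) fc_eq[OF G] by metis
 show old: "fc H y = (if h:fc G y then insert q (insert p (fc G y)) else fc G y)" if "y:darts G" for y
 proof -
  have "p~:fc G y" using fc_subset[OF G that] D(2) by blast
  moreover have "orbit ?i y = (if x0:fc G y then insert p (fc G y) else fc G y)" using orbit_ins[OF P1 that] by (simp add: face_at_def)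
  moreover have "orbit (ins ?i p q) y = (if p : orbit ?i y then insert q (orbit ?i y) else orbit ?i y)" using that by (intro orbit_ins[OF P2]) auto
  ultimately show ?thesis unfolding hx by (simp add: face_at_def[of H] x0(3))
 qed
 have "{p, q} <= fc H h" using old[OF D(1)] fc_self[OF G, of h] by auto
 then show "fc H p = fc H h" "fc H q = fc H h" using fc_eq[OF lf_is_map] by auto
 show "card (faces H) = card (faces G)" unfolding faces_def face_at_def[abs_def] x0(3) D(7) card_orbits_ins[OF P2] card_orbits_ins[OF P1] ..
qed

lemma lf_vertex: "y:darts G==>vx H y = (if h:vx G y then insert p (vx G y) else vx G y)"
  "vx H p = insert p (vx G h)" "vx H q = {q}"
  "vertices H = insert {q} (insert (insert p (vx G h)) (vertices G - {vx G h}))"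
  "card (vertices H) = Suc (card (vertices G))"
proof -
 note D = lf_darts
 note P = fin_darts[OF G] rot_permutes[OF G] D(1,2)
 have r: "rot H = ins (rot G) h p" using L by (simp add: leafins_def)
 show "y:darts G==>vx H y = (if h:vx G y then insert p (vx G y) else vx G y)" using orbit_ins[OF P] by (simp add: vertex_at_def r)
 show "vx H p = insert p (vx G h)" using orbit_ins_new[OF P] by (simp add: vertex_at_def r)
 show vq: "vx H q = {q}" unfolding vertex_at_def using lf_rot(3) by (rule orbit_eq_singleton_iff[THEN iffD2])
 have im: "vx H ` insert p (darts G) = insert (insert p (vx G h)) (vertices G - {vx G h})" using orbits_ins[OF P] by (simp add: vertex_at_def[abs_def] r vertices_def)
 then show eq: "vertices H = insert {q} (insert (insert p (vx G h)) (vertices G - {vx G h}))" unfolding vertices_def[of H] D(7) using vq by simp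
 have "card (vx H ` insert p (darts G)) = card (vertices G)" using card_orbits_ins[OF P] by (simp add: vertex_at_def[abs_def] r vertices_def)
 moreover have "{q}~:vx H ` insert p (darts G)" using in_verticesD(3)[OF G] D unfolding im by blast
 moreover have "vertices H = insert {q} (vx H ` insert p (darts G))" using eq im by simp
 ultimately show "card (vertices H) = Suc (card (vertices G))" using fin_darts[OF G] by simp
qed

lemma lf_edges: "edges H = insert {p, q} (edges G)" "{p, q}~:edges G"
proof -
 have "{x, opp H x} = {x, opp G x}" if "x:darts G" for x using lf_opp(3)[of x] lf_darts that by metis
 then have "(%x. {x, opp H x}) ` darts G = edges G" by (simp add: edges_def)
 then show "edges H = insert {p, q} (edges G)" unfolding edges_def[of H] lf_darts(7) by (simp add: lf_opp insert_commute)
 show "{p, q}~:edges G" using in_edgesD(2)[OF G] lf_darts by blast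
qed

lemma lf_euler: "has_genus g H<->has_genus g G" "map_degree r H = map_degree r G" using euler_transfer[OF G lf_is_map _ lf_vertex(5) lf_card_faces] fin_darts[OF G] lf_darts by auto

lemma lf_decorated: "decorated N M H<->decorated N M G"
proof (rule decorated_transfer[OF G lf_is_map])
 note D = lf_darts
 show "darts G <= darts H" using D by auto
 show "EX y:darts G. fc H x = fc H y" if "x:darts H" for x using that D lf_face_new by auto
 show "fc H x = fc H y<->fc G x = fc G y" if "x:darts G" "y:darts G" for x y
 proof -
  have 1: "p~:fc G z" "q~:fc G z" if "z:darts G" for z using fc_subset[OF G that] D by auto
  show ?thesis using lf_face_old[OF that(1)] lf_face_old[OF that(2)] 1[OF that(1)] 1[OF that(2)]
  fc_eq[OF G, of h x] fc_eq[OF G, of h y] by (auto dest: insert_ident[THEN iffD1, rotated 2] split: if_splits)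
 qed
qed (rule lf_labels)

lemma lf_connected: "connected_map H <-> connected_map G"
proof -
 note D = lf_darts
 have D0: "darts G~={}" "darts H~={}" using D by auto
 show ?thesis unfolding connected_map_iff[OF G] connected_map_iff[OF lf_is_map]
 proof (intro iffI conjI D0 allI impI; elim conjE)
  fix S assume H: "ALL S. S <= darts H&S~={}&(ALL x:S. rot H x:S & opp H x:S)-->S = darts H"
  and S: "S <= darts G" "S~={}" "ALL x:S. rot G x:S & opp G x:S"
  \<comment> \<open>A closed set of darts of G extends to H by adding both new darts exactly when it
    contains h.\<close>
  let ?T = "S Un (if h:S then {p, q} else {})"
  have cl: "rot H x:?T & opp H x:?T" if "x:?T" for x
  proof (cases "x:S")
  case True
  then have "x~=p" "x~=q" using S(1) D by auto
  then show ?thesis using True S(3) lf_rot lf_opp by (cases "x = h") auto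
  next
  case False
  then have "x = p | x = q" "h:S" using that by (auto split: if_splits)
  then show ?thesis using S(3) lf_rot(2,3) lf_opp(1,2) by auto
  qed
  have "?T = darts H" using cl S D by (intro H[rule_format] conjI) (auto split: if_splits)
  moreover have "?T Int darts G = S" using S(1) D by auto
  ultimately show "S = darts G" using D by auto
 next
  fix S assume G': "ALL S. S <= darts G&S~={}&(ALL x:S. rot G x:S & opp G x:S)-->S = darts G"
  and S: "S <= darts H" "S~={}" "ALL x:S. rot H x:S & opp H x:S"
  have p: "p:S==>rot G h:S" using S(3) lf_rot(2) by metis
  have cl: "rot G x:S Int darts G & opp G x:S Int darts G" if x: "x:S Int darts G" for x by (metis x D S(3) p lf_rot(1,4) lf_opp(3) rot_in[OF G] opp_in[OF G] IntE IntI)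
  obtain x where x: "x:S" using S(2) by blast
  have "S Int darts G~={}" by (metis S(3) lf_opp(2) x p S(1) D rot_in[OF G, of h] IntI empty_iff insertE subsetD)
  then have "S Int darts G = darts G" using cl by (intro G'[rule_format]) auto
  then have "h:S" using D by blast
  then have "p:S" "q:S" using S(3) lf_rot(1) lf_opp(1) by metis+
  then show "S = darts H" using S(1) D \<open>S Int darts G = darts G\<close> by auto
 qed
qed

end

lemma lf_ex:
 assumes G: "is_map (G :: 'm cmap)" "h:darts G"
 obtains p q H where "leafins k G h p q H"
proof -
 obtain p q where f: "p~:darts G" "q~:darts G" "p~=q" using ex_fresh2[OF fin_darts[OF G(1)]] .
 let ?rh = "ins (rot G) h p" and ?sg = "%x. if x = p then q else if x = q then p else opp G x"
 let ?c = "%x. if x = q then k else if x = p then cl G h else cl G x"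
 let ?d = "%x. if x = p | x = q then dl G h else dl G x"
 note i = ins_apply[OF fin_darts[OF G(1)] rot_permutes[OF G(1)] G(2) f(1)]
 have hn: "h~=p" "h~=q" using G f by auto
 have rq: "rot G q = q" "rot G p = p" using permutes_not_in[OF rot_permutes[OF G(1)]] f by auto
 have rp: "?rh permutes insert p (darts G)" by (rule ins_permutes[OF fin_darts[OF G(1)] rot_permutes[OF G(1)] G(2) f(1)])
 have rho: "?rh permutes insert q (insert p (darts G))" using rp by (rule permutes_subset) auto
 have opn: "opp G x~=p" "opp G x~=q" if "x:darts G" for x using f that opp_in[OF G(1), of x] by auto
 have inv: "?sg x~=x&?sg (?sg x) = x&?sg x:insert q (insert p (darts G))" if "x:insert q (insert p (darts G))" for x using that f opp_opp[OF G(1)] opp_neq[OF G(1)] opp_in[OF G(1)] opn by auto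
 have sig: "?sg permutes insert q (insert p (darts G))" using inv permutes_not_in[OF opp_permutes[OF G(1)]] by (intro involution_permutes) auto
 obtain H :: "'m cmap" where H: "is_map H" "darts H = insert q (insert p (darts G))" "rot H = ?rh" "opp H = ?sg"
  "!!x. x:insert q (insert p (darts G)) ==> cl H x = ?c x" "!!x. x:insert q (insert p (darts G))==>dl H x = ?d x"
 proof (rule ex_map[OF _ rho sig, of ?c ?d])
  show "finite (insert q (insert p (darts G)))" using fin_darts[OF G(1)] by simp
  show "?sg x~=x&?sg (?sg x) = x" if "x:insert q (insert p (darts G))" for x using inv[OF that] by blast
  have rn: "rot G x~=q" "rot G x~=p" if "x:darts G" for x using that f rot_in[OF G(1), of x] by auto
  show "?c (?rh x) = ?c x" if x: "x:insert q (insert p (darts G))" for x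
  proof -
  consider "x = q" | "x = p" | "x = h" | "x~=q" "x~=p" "x~=h" "x:darts G" using x by blast
  then show ?thesis by cases (use i rq rn f hn cl_rot[OF G(1)] G(2) in auto)
  qed
  show "?d y = ?d x" if x: "x:insert q (insert p (darts G))" and e: "?sg x = ?rh y" for x y
  proof -
  consider "y = q" | "y = p" | "y = h" | "y~=q" "y~=p" "y~=h" by blast
  then show ?thesis
  proof cases
  case 1 then show ?thesis using e x i(3)[of q] rq hn f opn by (auto split: if_splits)
  next
  case 2
  then have "opp G x = rot G h" "x:darts G" using e x i(2) f rn[OF G(2)] by (auto split: if_splits)
  then have "dl G h = dl G x" using fp_iff[OF G(1)] dl_face_perm[OF G(1)] by metis
  then show ?thesis using 2 \<open>x : darts G\<close> f by auto
  next
  case 3 then show ?thesis using e x i(1) opn hn by (auto split: if_splits)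
  next
  case 4
  then have e': "?sg x = rot G y" using e i(3) by simp
  have "rot G y~=p" "rot G y~=q" using 4 rq rot_inj[OF G(1)] by metis+
  then have "x:darts G" "opp G x = rot G y" using e' x by (auto split: if_splits)
  then have "dl G y = dl G x" using fp_iff[OF G(1)] dl_face_perm[OF G(1)] by metis
  then show ?thesis using 4 \<open>x : darts G\<close> f by auto
  qed
  qed
 qed blast
 have "leafins k G h p q H" using H f G(2) by (auto simp: leafins_def)
 then show thesis by (rule that)
qed

text \<open>Inverse of \<open>leafins\<close>. The condition on p excludes a neighbour that is
  itself univalent: its removal would leave no dart at which the corner could be marked.\<close>

lemma lf_delete:
 assumes H: "is_map (H :: 'm cmap)" and q: "q:darts H" "rot H q = q" and p: "p = opp H q" "rot H p~=p"
 obtains G h where "is_map G" "leafins (cl H q) G h p q H" "rot H h = p"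
proof -
 define D where "D = darts H - {p, q}"
 have pH: "p:darts H" using p q by (simp add: opp_in[OF H])
 have pq: "p~=q" "opp H p = q" using p q opp_neq[OF H] opp_opp[OF H] by auto
 have D: "darts H = insert q (insert p D)" "p~:D" "q~:D" "finite D" using q pH fin_darts[OF H] by (auto simp: D_def)
 obtain h where h: "rot H h = p" by (metis permutes_inverses(1) rot_permutes[OF H])
 have hp: "h~=p" using h p by auto
 have perm: "rot H permutes insert p D"
 proof (rule permutes_superset[OF rot_permutes[OF H]])
  show "rot H x = x" if "x:darts H - insert p D" for x using that q D by auto
 qed
 obtain rh where r: "rh permutes D" "rot H = ins rh h p" "h:D" by (rule ins_delete[where pe' = "rot H" and D = D and p = p and h = h, OF D(4) perm D(2) h hp])
 note i = ins_apply[OF D(4) r(1) r(3) D(2), folded r(2)]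
 let ?sg = "%x. if x = p | x = q then x else opp H x"
 have on: "opp H x~=p" "opp H x~=q" if "x:D" for x using that D p(1) pq(2) opp_opp[OF H, of x] by auto
 have inv: "?sg x~=x&?sg (?sg x) = x&?sg x:D" if "x:D" for x using that on opp_opp[OF H] opp_neq[OF H] opp_in[OF H, of x] D by auto
 have sig: "?sg permutes D" using inv permutes_not_in[OF opp_permutes[OF H]] D by (intro involution_permutes) auto
 have dp: "dl H h = dl H q" "dl H p = dl H q"
 proof -
  have "face_perm H q = h" "face_perm H p = q" using fp_iff[OF H] h p pq q by auto
  then show "dl H h = dl H q" "dl H p = dl H q" using dl_face_perm[OF H] by metis+
 qed
 obtain G :: "'m cmap" where G: "is_map G" "darts G = D" "rot G = rh" "opp G = ?sg"
  "!!x. x:D ==> cl G x = cl H x" "!!x. x:D==>dl G x = dl H x"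
 proof (rule ex_map[OF D(4) r(1) sig, of "cl H" "dl H"])
  show "?sg x~=x&?sg (?sg x) = x" if "x:D" for x using inv[OF that] by blast
  show "cl H (rh x) = cl H x" if "x:D" for x using i that D cl_rot[OF H] h by metis
  show "dl H y = dl H x" if x: "x:D" and e: "?sg x = rh y" for x y
  proof -
  have e': "opp H x = rh y" using e x D(2,3) by (auto split: if_splits)
  have "y~=p" using e' on[OF x] permutes_not_in[OF r(1) D(2)] by metis
  show ?thesis by (metis e' i(2) fp_iff[OF H] dp dl_face_perm[OF H] i(3) \<open>y ~= p\<close>)
  qed
 qed blast
 have "leafins (cl H q) G h p q H" using G D r pq p(1) dp cl_rot[OF H, of h] h by (auto simp: leafins_def)
 then show thesis using that G h by blast
qed

text \<open>An isomorphism that respects h extends to the new edge in one way. Conversely q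
  determines p as its opposite and h as the predecessor of p in the rotation, so the restriction
  respects h.\<close>

lemma lf_iso:
 assumes G: "is_map G" "is_map G'" and L: "leafins k G h p q H" "leafins k G' h' p' q' H'"
 shows "(EX f. is_iso f G G'&f h = h')<->(EX f. is_iso f H H'&f q = q')"
proof -
 note H = lf_is_map[OF G(1) L(1)] lf_is_map[OF G(2) L(2)]
 note D = lf_darts[OF G(1) L(1)] and D' = lf_darts[OF G(2) L(2)]
 note r = lf_rot[OF G(1) L(1)] and r' = lf_rot[OF G(2) L(2)]
 note o = lf_opp[OF G(1) L(1)] and o' = lf_opp[OF G(2) L(2)]
 note l = lf_labels[OF G(1) L(1)] and l' = lf_labels[OF G(2) L(2)]
 note iffG = is_iso_iff[OF G] and iffH = is_iso_iff[OF H]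
 show ?thesis
 proof
  assume "EX f. is_iso f G G'&f h = h'"
  then obtain f where f: "is_iso f G G'" "f h = h'" by blast
  note f1 = f(1)[unfolded iffG]
  define F where "F = f(p := p', q := q')"
  have F: "F p = p'" "F q = q'" "F h = h'" "x:darts G==>F x = f x" for x using D f(2) by (auto simp: F_def)
  have fD: "x:darts G==>f x:darts G'" for x using f1 by (auto dest: bij_betwE)
  have fh: "x:darts G==>f x = h'==>x = h" for x using f1 f(2) D(1) by (auto simp: bij_betw_def dest: inj_onD)
  have "is_iso F H H'" unfolding iffH
  proof (intro conjI ballI)
  show "bij_betw F (darts H) (darts H')" unfolding F_def D(7) D'(7) using f1 D D' by (intro bij_betw_insert2) auto
  have *: "F (rot H x) = rot H' (F x)&F (opp H x) = opp H' (F x) & cl H' (F x) = cl H x&dl H' (F x) = dl H x"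
  if x: "x:darts H" for x
  proof -
  consider "x = p" | "x = q" | "x = h" | "x:darts G" "x~=h" "x~=p" "x~=q" using x D by auto
  then show ?thesis
  proof cases
  case 1
  show ?thesis using f1 D(1) 1 F r r' o o' l l' rot_in[OF G(1)] by auto
  next
  case 2
  show ?thesis using f1 D(1) 2 F r r' o o' l l' by auto
  next
  case 3
  show ?thesis using f1 3 F r(1) r'(1) o(3) o'(3) l(1,2) l'(1,2) D(1,5,6) D'(1,5,6) opp_in[OF G(1)] by auto
  next
  case 4
  have "f (opp G x) = opp G' (f x)" "f (rot G x) = rot G' (f x)" "cl G' (f x) = cl G x" "dl G' (f x) = dl G x" using f1 4 by auto
  moreover have "f x~=h'" "f x~=p'" "f x~=q'" using fh fD D' 4 by auto
  ultimately show ?thesis using 4 F r(4) r'(4) o(3) o'(3) l(1,2) l'(1,2) fD rot_in[OF G(1)] opp_in[OF G(1)] by simp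
  qed
  qed
  fix x assume "x:darts H"
  then show "F (rot H x) = rot H' (F x)" "F (opp H x) = opp H' (F x)" "cl H' (F x) = cl H x" "dl H' (F x) = dl H x" using * by blast+
  qed
  then show "EX f. is_iso f H H'&f q = q'" using F(2) by blast
 next
  assume "EX f. is_iso f H H'&f q = q'"
  then obtain F where F: "is_iso F H H'" "F q = q'" by blast
  note F1 = F(1)[unfolded iffH]
  have qH: "q:darts H" "p:darts H" "h:darts H" using D by auto
  have Fp: "F p = p'" using F1 qH(1) F(2) o(2) o'(2) by metis
  have Fh: "F h = h'" using F1 qH(3) Fp r(1) r'(1) rot_inj[OF H(2)] by auto
  have bij: "bij_betw F (darts G) (darts G')" using bij_betw_remove2[OF _ Fp F(2) D(2,3) D'(2,3) D(4)] F1 unfolding D(7) D'(7) by blast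
  have FD: "x:darts G==>F x:darts G'" for x using bij by (auto dest: bij_betwE)
  have "is_iso F G G'" unfolding iffG
  proof (intro conjI ballI bij)
  fix x assume x: "x:darts G"
  then have xH: "x:darts H" "x~=p" "x~=q" using D by auto
  have Fx: "F x~=p'" "F x~=q'" using FD[OF x] D' by auto
  show "cl G' (F x) = cl G x" "dl G' (F x) = dl G x" using F1 xH(1) l(1,2)[OF x] l'(1,2)[OF FD[OF x]] by auto
  show "F (opp G x) = opp G' (F x)" using F1 xH o(3) o'(3) Fx by metis
  show "F (rot G x) = rot G' (F x)"
  proof (cases "x = h")
  case True
  then show ?thesis using F1 qH(2) Fp Fh r(2) r'(2) by metis
  next
  case False
  then have "F x~=h'" using bij Fh x D(1) by (auto simp: bij_betw_def dest: inj_onD)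
  then show ?thesis using F1 xH r(4)[OF False] r'(4) Fx by metis
  qed
  qed
  then show "EX f. is_iso f G G'&f h = h'" using Fh by blast
 qed
qed

context
 fixes k :: colour and G H :: "'m cmap" and h s t :: nat
 assumes G: "is_map G" and L: "subdiv k G h s t H"
begin

lemma sd_darts: "h:darts G" "s~:darts G" "t~:darts G" "s~=t" "opp G h:darts G" "opp G h~=h"
  "h~=s" "h~=t" "opp G h~=s" "opp G h~=t" "darts H = insert t (insert s (darts G))"
proof -
 show 1: "h:darts G" "s~:darts G" "t~:darts G" "s~=t" "darts H = insert t (insert s (darts G))" using L by (auto simp: subdiv_def)
 show 2: "opp G h:darts G" "opp G h~=h" using 1(1) opp_in[OF G] opp_neq[OF G] by auto
 show "h~=s" "h~=t" "opp G h~=s" "opp G h~=t" using 1 2 by auto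
qed

lemma sd_rot: "rot H s = t" "rot H t = s" "x~=s==>x~=t==>rot H x = rot G x"
proof -
 have 1: "finite (insert s (darts G))" "s:insert s (darts G)" "t~:insert s (darts G)" using fin_darts[OF G] sd_darts by auto
 have 2: "rot G permutes insert s (darts G)" using rot_permutes[OF G] by (rule permutes_subset) auto
 have "rot G s = s" using rot_permutes[OF G] sd_darts(2) by (rule permutes_not_in)
 then show "rot H s = t" "rot H t = s" "x~=s==>x~=t==>rot H x = rot G x" using ins_apply[OF 1(1) 2 1(2,3)] L by (auto simp: subdiv_def)
qed

lemma sd_opp: "opp H h = s" "opp H s = h" "opp H (opp G h) = t" "opp H t = opp G h"
  "x~=h==>x ~= opp G h==>x~=s==>x~=t ==> opp H x = opp G x" using L by (auto simp: subdiv_def)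

lemma sd_labels: "x:darts G ==> cl H x = cl G x" "x:darts G==>dl H x = dl G x"
  "cl H s = k" "cl H t = k" "dl H t = dl G h" "dl H s = dl G (opp G h)" using L by (auto simp: subdiv_def)

lemma sd_is_map: "is_map H"
proof (rule is_mapI)
 note D = sd_darts
 show "finite (darts H)" using fin_darts[OF G] D by simp
 have 1: "finite (insert s (darts G))" "s:insert s (darts G)" "t~:insert s (darts G)" using fin_darts[OF G] sd_darts by auto
 have 2: "rot G permutes insert s (darts G)" using rot_permutes[OF G] by (rule permutes_subset) auto
 show "rot H permutes darts H" using ins_permutes[OF 1(1) 2 1(2,3)] L by (simp add: subdiv_def)
 have inv: "opp H x:darts H & opp H (opp H x) = x & opp H x~=x" if x: "x:darts H" for x
 proof -
  consider "x = h" | "x = opp G h" | "x = s" | "x = t"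
  | "x:darts G" "x~=h" "x ~= opp G h" "x~=s" "x~=t" using x D(11) by auto
  then show ?thesis
  proof cases
  case 5
  then have "opp G x:darts G" "opp G x ~= opp G h" "opp G x~=h" "opp G (opp G x) = x" "opp G x~=x" using opp_in[OF G] opp_opp[OF G] opp_neq[OF G] by metis+
  moreover from this have "opp G x~=s" "opp G x~=t" using D by auto
  ultimately show ?thesis using sd_opp(5) 5 D(11) by auto
  qed (use sd_opp(1-4) D in auto)
 qed
 show "opp H permutes darts H"
 proof (rule involution_permutes)
  show "opp H x = x" if "x~:darts H" for x using that D sd_opp(5)[of x] permutes_not_in[OF opp_permutes[OF G]] by auto
 qed (use inv in blast)
 show "opp H x~=x & opp H (opp H x) = x" if "x:darts H" for x using inv[OF that] by blast
qed

text \<open>On one side t follows h, and on the other side s follows the opposite of h. The two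
  insertions act correctly also when both sides belong to the same face.\<close>

lemma sd_face_perm: "face_perm H = ins (ins (face_perm G) h t) (opp G h) s"
proof
 fix x
 note D = sd_darts
 note i = ins_apply[OF fin_darts[OF G] fp_permutes[OF G] D(1,3)]
 have fin: "finite (insert t (darts G))" using fin_darts[OF G] by simp
 have oh: "opp G h:insert t (darts G)" and st: "s~:insert t (darts G)" using D by auto
 note j = ins_apply[OF fin ins_permutes[OF fin_darts[OF G] fp_permutes[OF G] D(1,3)] oh st]
 show "face_perm H x = ins (ins (face_perm G) h t) (opp G h) s x" unfolding fp_iff[OF sd_is_map]
 proof -
  have rf: "rot H (face_perm G y) = opp G y" if "y~=s" "y~=t" for y by (metis that D face_perm_in[OF G] permutes_not_in[OF fp_permutes[OF G]] sd_rot(3) rot_face_perm[OF G])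
  consider "x = s" | "x = opp G h" | "x = h" | "x = t"
  | "x~=h" "x ~= opp G h" "x~=s" "x~=t" by blast
  then show "opp H x = rot H (ins (ins (face_perm G) h t) (opp G h) s x)"
  proof cases
  case 1
  then have "ins (ins (face_perm G) h t) (opp G h) s x = face_perm G (opp G h)" using j(2) i(3)[of "opp G h"] D by metis
  then show ?thesis using 1 rf[of "opp G h"] D sd_opp(2) opp_opp[OF G] by metis
  next
  case 2 then show ?thesis using j(1) sd_opp(3) sd_rot(1) by metis
  next
  case 3
  then have "ins (ins (face_perm G) h t) (opp G h) s x = t" using j(3)[of h] i(1) D by metis
  then show ?thesis using 3 sd_opp(1) sd_rot(2) by metis
  next
  case 4
  then have "ins (ins (face_perm G) h t) (opp G h) s x = face_perm G h" using j(3)[of t] i(2) D by metis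
  then show ?thesis using 4 rf[of h] D sd_opp(4) by metis
  next
  case 5
  then have "ins (ins (face_perm G) h t) (opp G h) s x = face_perm G x" using j(3)[of x] i(3)[of x] by metis
  then show ?thesis using 5 rf[of x] sd_opp(5) by metis
  qed
 qed
qed

lemma
 shows sd_face_old: "y:darts G==>fc H y = fc G y Un
  (if h:fc G y then {t} else {}) Un (if opp G h:fc G y then {s} else {})"
  and sd_face_new: "fc H t = fc H h" "fc H s = fc H (opp G h)"
  and sd_card_faces: "card (faces H) = card (faces G)"
proof -
 note D = sd_darts
 note P1 = fin_darts[OF G] fp_permutes[OF G] D(1,3)
 have fin: "finite (insert t (darts G))" using fin_darts[OF G] by simp
 have oh: "opp G h:insert t (darts G)" and st: "s~:insert t (darts G)" using D by auto
 note P2 = fin ins_permutes[OF P1] oh st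
 let ?i = "ins (face_perm G) h t"
 show old: "fc H y = fc G y Un
  (if h:fc G y then {t} else {}) Un (if opp G h:fc G y then {s} else {})" if "y:darts G" for y using orbit_ins[OF P1 that] face_at_def that orbit_ins[OF P2] D(10) face_at_def[of H] sd_face_perm by auto
 have "t:fc H h" "s:fc H (opp G h)" using old[OF D(1)] old[OF D(5)] fc_self[OF G] by auto
 then show "fc H t = fc H h" "fc H s = fc H (opp G h)" using fc_eq[OF sd_is_map] by auto
 have "darts H = insert s (insert t (darts G))" using D(11) by auto
 then show "card (faces H) = card (faces G)" unfolding faces_def face_at_def[abs_def] sd_face_perm using card_orbits_ins[OF P2] card_orbits_ins[OF P1] by simp
qed

lemma sd_vertex: "y:darts G==>vx H y = vx G y"
  "vx H s = {s, t}" "vx H t = {s, t}"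
  "vertices H = insert {s, t} (vertices G)" "{s, t}~:vertices G" "card (vertices H) = Suc (card (vertices G))"
proof -
 note D = sd_darts
 show old: "vx H y = vx G y" if y: "y:darts G" for y unfolding vertex_at_def
 proof (rule orbit_cong[OF orbit_self[OF fin_darts[OF G] rot_permutes[OF G]]])
  fix x assume "x : orbit (rot G) y"
  then have "x:darts G" using orbit_in[OF rot_permutes[OF G] y] by auto
  then show "rot H x = rot G x" using D by (intro sd_rot(3)) auto
 qed
 have "vx H s <= {s, t}" unfolding vertex_at_def using sd_rot by (intro orbit_closed_subset) auto
 moreover have "s:vx H s" "t:vx H s" using vx_self[OF sd_is_map] vx_rot[OF sd_is_map] sd_rot(1) by metis+
 ultimately show vs: "vx H s = {s, t}" by auto
 show vt: "vx H t = {s, t}" using vx_rot[OF sd_is_map, of s] sd_rot(1) vs by simp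
 show eq: "vertices H = insert {s, t} (vertices G)" unfolding vertices_def D(11) using vs vt old by auto
 show notin: "{s, t}~:vertices G" using in_verticesD(3)[OF G] D by blast
 show "card (vertices H) = Suc (card (vertices G))" using finite_vertices(1)[OF G] notin by (simp add: eq)
qed

lemma sd_edges: "edges H = insert {h, s} (insert {opp G h, t} (edges G - {{h, opp G h}}))"
 "{h, s}~:edges G" "{opp G h, t}~:edges G" "{h, s}~={opp G h, t}" "{h, opp G h}:edges G"
proof -
 note D = sd_darts
 show "{h, s}~:edges G" "{opp G h, t}~:edges G" using in_edgesD(2)[OF G] D by blast+
 show "{h, s}~={opp G h, t}" using D by auto
 show "{h, opp G h}:edges G" using D(1) by (auto simp: edges_def)
 have e: "{x, opp H x} = {x, opp G x}&{x, opp G x}~={h, opp G h}" if x: "x:darts G - {h, opp G h}" for x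
 proof -
  have "opp H x = opp G x" using x D by (intro sd_opp(5)) auto
  then show ?thesis using x by auto
 qed
 have "edges H = (%x. {x, opp H x}) ` ({h, opp G h, s, t} Un (darts G - {h, opp G h}))" unfolding edges_def using D by (intro arg_cong[of _ _ "image _"]) auto
 also have "... = {{h, s}, {opp G h, t}} Un (%x. {x, opp G x}) ` (darts G - {h, opp G h})" unfolding image_Un using e sd_opp(1-4) by (auto simp: insert_commute)
 also have "(%x. {x, opp G x}) ` (darts G - {h, opp G h}) = edges G - {{h, opp G h}}"
 proof
  show "(%x. {x, opp G x}) ` (darts G - {h, opp G h}) <= edges G - {{h, opp G h}}" using e by (auto simp: edges_def)
  show "edges G - {{h, opp G h}} <= (%x. {x, opp G x}) ` (darts G - {h, opp G h})"
  proof
  fix e assume "e:edges G - {{h, opp G h}}"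
  then obtain x where x: "x:darts G" "e = {x, opp G x}" "e~={h, opp G h}" by (auto simp: edges_def)
  have "x ~= opp G h" using x(2,3) opp_opp[OF G, of h] by auto
  then show "e:(%x. {x, opp G x}) ` (darts G - {h, opp G h})" using x by auto
  qed
 qed
 finally show "edges H = insert {h, s} (insert {opp G h, t} (edges G - {{h, opp G h}}))" by auto
qed

lemma sd_euler: "has_genus g H<->has_genus g G" "map_degree r H = map_degree r G" using euler_transfer[OF G sd_is_map _ sd_vertex(6) sd_card_faces] fin_darts[OF G] sd_darts by auto

lemma sd_decorated: "decorated N M H<->decorated N M G"
proof (rule decorated_transfer[OF G sd_is_map])
 note D = sd_darts
 show "darts G <= darts H" using D by auto
 show "EX y:darts G. fc H x = fc H y" if "x:darts H" for x using that D sd_face_new by auto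
 show "fc H x = fc H y<->fc G x = fc G y" if "x:darts G" "y:darts G" for x y
 proof
  have 1: "fc H z Int darts G = fc G z" if "z:darts G" for z using sd_face_old[OF that] fc_subset[OF G that] D by auto
  show "fc H x = fc H y==>fc G x = fc G y" using 1 that by metis
  show "fc G x = fc G y==>fc H x = fc H y" using sd_face_old that by simp
 qed
qed (rule sd_labels)

lemma sd_connected: "connected_map H <-> connected_map G"
proof -
 note D = sd_darts
 have D0: "darts G~={}" "darts H~={}" using D by auto
 show ?thesis unfolding connected_map_iff[OF G] connected_map_iff[OF sd_is_map]
 proof (intro iffI conjI D0 allI impI; elim conjE)
  fix S assume H: "ALL S. S <= darts H&S~={}&(ALL x:S. rot H x:S & opp H x:S)-->S = darts H"
  and S: "S <= darts G" "S~={}" "ALL x:S. rot G x:S & opp G x:S"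
  let ?T = "S Un (if h:S then {s, t} else {})"
  have oh: "opp G h:S<->h:S" using S(3) opp_opp[OF G] by metis
  have cl: "rot H x:?T & opp H x:?T" if x: "x:?T" for x
  proof (cases "x:S")
  case True
  then have "x~=s" "x~=t" using S(1) D by auto
  then have "rot H x:S" using S(3) True sd_rot(3) by metis
  moreover have "opp H x:?T" using True S(3) oh sd_opp(1,3) sd_opp(5)[OF _ _ \<open>x ~= s\<close> \<open>x ~= t\<close>] by (cases "x = h"; cases "x = opp G h") auto
  ultimately show ?thesis by auto
  next
  case False
  then have "x = s | x = t" "h:S" using x by (auto split: if_splits)
  then show ?thesis using oh sd_rot(1,2) sd_opp(2,4) by auto
  qed
  have "?T = darts H" using cl S D by (intro H[rule_format] conjI) (auto split: if_splits)
  moreover have "?T Int darts G = S" using S(1) D by auto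
  ultimately show "S = darts G" using D by auto
 next
  fix S assume G': "ALL S. S <= darts G&S~={}&(ALL x:S. rot G x:S & opp G x:S)-->S = darts G"
  and S: "S <= darts H" "S~={}" "ALL x:S. rot H x:S & opp H x:S"
  have st: "s:S==>h:S & opp G h:S&t:S" "t:S==>h:S & opp G h:S&s:S" using S(3) sd_rot(1,2) sd_opp(2,4) by metis+
  have hs: "h:S==>s:S" "opp G h:S==>t:S" using S(3) sd_opp(1,3) by metis+
  have cl: "rot G x:S Int darts G & opp G x:S Int darts G" if x: "x:S Int darts G" for x
  proof -
  have n: "x~=s" "x~=t" using x D by auto
  have "rot G x:S" using n x S(3) sd_rot(3) by (metis IntE)
  moreover have "opp G x:S" using n x S(3) st hs opp_opp[OF G] sd_opp(5) by (metis IntE)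
  ultimately show ?thesis using x rot_in[OF G] opp_in[OF G] by auto
  qed
  obtain x where x: "x:S" using S(2) by blast
  have "S Int darts G~={}" using x st S(1) D by auto
  then have "S Int darts G = darts G" using cl by (intro G'[rule_format]) auto
  then have "h:S" using D by blast
  then have "s:S" "t:S" using hs st by blast+
  then show "S = darts H" using S(1) D \<open>S Int darts G = darts G\<close> by auto
 qed
qed

end

lemma sd_ex:
 assumes G: "is_map (G :: 'm cmap)" "h:darts G"
 obtains s t H where "subdiv k G h s t H"
proof -
 obtain s t where f: "s~:darts G" "t~:darts G" "s~=t" using ex_fresh2[OF fin_darts[OF G(1)]] .
 define u where "u = opp G h"
 have u: "u:darts G" "u~=h" "opp G u = h" "opp G h = u" using opp_in[OF G(1)] opp_neq[OF G] opp_opp[OF G(1)] G(2) by (auto simp: u_def)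
 let ?D = "insert t (insert s (darts G))"
 let ?rh = "ins (rot G) s t"
 let ?sg = "%x. if x = h then s else if x = s then h else if x = u then t else if x = t then u else opp G x"
 let ?c = "%x. if x = s | x = t then k else cl G x"
 let ?d = "%x. if x = t then dl G h else if x = s then dl G u else dl G x"
 have n: "h~=s" "h~=t" "u~=s" "u~=t" using f u G by auto
 have 1: "finite (insert s (darts G))" "s:insert s (darts G)" "t~:insert s (darts G)" using fin_darts[OF G(1)] f by auto
 have 2: "rot G permutes insert s (darts G)" using rot_permutes[OF G(1)] by (rule permutes_subset) auto
 have rs: "rot G s = s" "rot G t = t" using permutes_not_in[OF rot_permutes[OF G(1)]] f by auto
 have i: "?rh s = t" "?rh t = s" "!!x. x~=s==>x~=t==>?rh x = rot G x" using ins_apply[OF 1(1) 2 1(2,3)] rs by auto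
 have rho: "?rh permutes ?D" by (rule ins_permutes[OF 1(1) 2 1(2,3)])
 have oo: "opp G x:darts G & opp G x~=h & opp G x~=u & opp G x~=x & opp G x~=s & opp G x~=t & opp G (opp G x) = x"
  if x: "x:darts G" "x~=h" "x~=u" for x by (metis x opp_in[OF G(1)] u opp_opp[OF G(1)] f opp_neq[OF G(1)])
 have inv: "?sg x~=x&?sg (?sg x) = x&?sg x:?D" if x: "x:?D" for x
 proof -
  consider "x = h" | "x = u" | "x = s" | "x = t" | "x:darts G" "x~=h" "x~=u" "x~=s" "x~=t" using x by auto
  then show ?thesis
  proof cases
  case 5 then show ?thesis using oo[OF 5(1-3)] by simp
  qed (use n u f G(2) in auto)
 qed
 have sig: "?sg permutes ?D" using inv permutes_not_in[OF opp_permutes[OF G(1)]] n u G(2) by (intro involution_permutes) auto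
 obtain H :: "'m cmap" where H: "is_map H" "darts H = ?D" "rot H = ?rh" "opp H = ?sg"
  "!!x. x:?D ==> cl H x = ?c x" "!!x. x:?D==>dl H x = ?d x"
 proof (rule ex_map[OF _ rho sig, of ?c ?d])
  show "finite ?D" using fin_darts[OF G(1)] by simp
  show "?sg x~=x&?sg (?sg x) = x" if "x:?D" for x using inv[OF that] by blast
  have rn: "rot G x~=s&rot G x~=t" if "x:darts G" for x using that f rot_in[OF G(1), of x] by auto
  show "?c (?rh x) = ?c x" if x: "x:?D" for x
  proof -
  consider "x = s" | "x = t" | "x~=s" "x~=t" "x:darts G" using x by blast
  then show ?thesis by cases (use i rn cl_rot[OF G(1)] in auto)
  qed
  show "?d y = ?d x" if x: "x:?D" and e: "?sg x = ?rh y" for x y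
  proof -
  have face: "dl G y' = dl G x'" if "opp G x' = rot G y'" for x' y' using that fp_iff[OF G(1)] dl_face_perm[OF G(1)] by metis
  consider "y = s" | "y = t" | "y~=s" "y~=t" by blast
  then show ?thesis
  proof cases
  case 1
  then have "?sg x = t" using e i(1) by simp
  moreover have "x = u"
  proof (rule ccontr)
  assume nx: "x~=u"
  then have nn: "x~=h" "x~=s" "x~=t" using calculation n f by (auto split: if_splits)
  then have "opp G x = t" using calculation nx by simp
  moreover have "x:darts G" using x nn by auto
  ultimately show False using oo[of x] nx nn by metis
  qed
  ultimately show ?thesis using 1 n f by simp
  next
  case 2
  then have "?sg x = s" using e i(2) by simp
  moreover have "x = h"
  proof (rule ccontr)
  assume nx: "x~=h"
  then have nn: "x~=u" "x~=s" "x~=t" using calculation n f by (auto split: if_splits)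
  then have "opp G x = s" using calculation nx by simp
  moreover have "x:darts G" using x nn by auto
  ultimately show False using oo[of x] nx nn by metis
  qed
  ultimately show ?thesis using 2 n f by simp
  next
  case 3
  then have e': "?sg x = rot G y" using e i(3) by simp
  have ry: "rot G y~=s" "rot G y~=t" using 3 rs rot_inj[OF G(1)] by metis+
  then consider "x = s" | "x = t" | "x~=h" "x~=u" "x~=s" "x~=t" using e' by (auto split: if_splits)
  then show ?thesis
  proof cases
  case a: 1
  then have "opp G u = rot G y" using e' n u by simp
  then show ?thesis using a 3 face f by simp
  next
  case a: 2
  then have "opp G h = rot G y" using e' n u f by simp
  then show ?thesis using a 3 face f by simp
  next
  case a: 3
  then have "opp G x = rot G y" using e' by simp
  then show ?thesis using a 3 face by simp
  qed
  qed
  qed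
 qed blast
 have "subdiv k G h s t H" using H f G(2) n u by (auto simp: subdiv_def)
 then show thesis by (rule that)
qed

text \<open>Inverse of \<open>subdiv\<close>. The condition \<open>opp H t ~= s\<close> excludes a
  bivalent vertex whose two darts form a loop: smoothing it would leave a circle without vertex.
  This obstruction is the source of the loop terms in (i).\<close>

lemma sd_delete:
 assumes H: "is_map (H :: 'm cmap)" and t: "t:darts H" "rot H t = s" "rot H s = t" "s~=t" "opp H t~=s"
 obtains G where "is_map G" "subdiv (cl H t) G (opp H s) s t H"
proof -
 define D where "D = darts H - {s, t}"
 define h where "h = opp H s"
 define u where "u = opp H t"
 have sH: "s:darts H" using t rot_in[OF H] by metis
 have D: "darts H = insert t (insert s D)" "s~:D" "t~:D" "finite D" using t sH fin_darts[OF H] by (auto simp: D_def)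
 have hu: "opp H h = s" "opp H u = t" "h~=u" "h~=s" "h~=t" "u~=s" "u~=t" using t sH opp_opp[OF H] opp_neq[OF H] unfolding h_def u_def by metis+
 have huD: "h:D" "u:D" using hu t sH opp_in[OF H] by (auto simp: D_def h_def u_def)
 let ?rh = "%x. if x = s | x = t then x else rot H x"
 let ?sg = "%x. if x = s | x = t then x else if x = h then u else if x = u then h else opp H x"
 have rn: "rot H x~=s&rot H x~=t" if "x:D" for x using that D t rot_inj[OF H] by metis
 have rho: "?rh permutes D"
 proof (rule bij_imp_permutes)
  show "bij_betw ?rh D D"
  proof (rule bij_betw_imageI)
  show inj: "inj_on ?rh D" using D rot_inj[OF H] by (auto simp: inj_on_def)
  have "?rh ` D <= D"
  proof (rule image_subsetI)
  fix x assume x: "x:D"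
  then have "x~=s" "x~=t" using D(2,3) by auto
  moreover have "rot H x:D" using rn[OF x] x rot_in[OF H, of x] by (simp add: D_def)
  ultimately show "?rh x:D" by simp
  qed
  then show "?rh ` D = D" by (intro endo_inj_surj D(4) inj)
  qed
  show "?rh x = x" if "x~:D" for x using that D permutes_not_in[OF rot_permutes[OF H], of x] by auto
 qed
 have ins: "ins ?rh s t = rot H"
 proof
  fix x
  show "ins ?rh s t x = rot H x" using t by (auto simp: ins_def Transposition.transpose_def)
 qed
 have oo: "opp H x:D & opp H x~=h & opp H x~=u & opp H x~=x & opp H (opp H x) = x"
  if x: "x:D" "x~=h" "x~=u" for x
 proof -
  have "x~=s" "x~=t" using x D by auto
  then have "opp H x~=s" "opp H x~=t" "opp H x~=h" "opp H x~=u" using x hu opp_opp[OF H] by metis+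
  then show ?thesis using x opp_in[OF H] opp_opp[OF H] opp_neq[OF H] by (auto simp: D_def)
 qed
 have inv: "?sg x~=x&?sg (?sg x) = x&?sg x:D" if x: "x:D" for x
 proof -
  consider "x = h" | "x = u" | "x~=h" "x~=u" by blast
  then show ?thesis
  proof cases
  case 3
  have "x~=s" "x~=t" "opp H x~=s" "opp H x~=t" using oo[OF x 3] x D(2,3) by auto
  then show ?thesis using oo[OF x 3] 3 by simp
  qed (use hu huD in auto)
 qed
 have sig: "?sg permutes D" using inv permutes_not_in[OF opp_permutes[OF H]] D huD by (intro involution_permutes) auto
 have ds: "dl H s = dl H u" "dl H t = dl H h"
 proof -
  have "face_perm H u = s" "face_perm H h = t" using fp_iff[OF H] hu t by auto
  then show "dl H s = dl H u" "dl H t = dl H h" using dl_face_perm[OF H] by metis+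
 qed
 have face: "dl H y = dl H x" if "opp H x = rot H y" for x y using that fp_iff[OF H] dl_face_perm[OF H] by metis
 obtain G :: "'m cmap" where G: "is_map G" "darts G = D" "rot G = ?rh" "opp G = ?sg"
  "!!x. x:D ==> cl G x = cl H x" "!!x. x:D==>dl G x = dl H x"
 proof (rule ex_map[OF D(4) rho sig, of "cl H" "dl H"])
  show "?sg x~=x&?sg (?sg x) = x" if "x:D" for x using inv[OF that] by blast
  show "cl H (?rh x) = cl H x" if "x:D" for x using that D cl_rot[OF H] by auto
  show "dl H y = dl H x" if x: "x:D" and e: "?sg x = ?rh y" for x y
  proof -
  have y: "y~=s" "y~=t" using e inv[OF x] D by auto
  then have e': "?sg x = rot H y" using e by simp
  consider "x = h" | "x = u" | "x~=h" "x~=u" by blast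
  then show ?thesis
  proof cases
  case 1
  then have "opp H t = rot H y" using e' hu by (simp add: u_def)
  then show ?thesis using face ds 1 by metis
  next
  case 2
  then have "opp H s = rot H y" using e' hu by (simp add: h_def)
  then show ?thesis using face ds 2 by metis
  next
  case 3
  then have "opp H x = rot H y" using e' x D by (auto split: if_splits)
  then show ?thesis by (rule face)
  qed
  qed
 qed blast
 have opp_h: "opp G h = u" using G(4) hu by simp
 have "subdiv (cl H t) G h s t H" unfolding subdiv_def opp_h using G D ins hu huD t ds cl_rot[OF H, of t] h_def u_def by (auto simp: opp_opp[OF H])
 then show thesis using that G(1) by (simp add: h_def)
qed

lemma sd_iso:
 assumes G: "is_map G" "is_map G'" and L: "subdiv k G h s t H" "subdiv k G' h' s' t' H'"
 shows "(EX f. is_iso f G G'&f h = h')<->(EX f. is_iso f H H'&f t = t')"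
proof -
 note H = sd_is_map[OF G(1) L(1)] sd_is_map[OF G(2) L(2)]
 note D = sd_darts[OF G(1) L(1)] and D' = sd_darts[OF G(2) L(2)]
 note r = sd_rot[OF G(1) L(1)] and r' = sd_rot[OF G(2) L(2)]
 note o = sd_opp[OF G(1) L(1)] and o' = sd_opp[OF G(2) L(2)]
 note l = sd_labels[OF G(1) L(1)] and l' = sd_labels[OF G(2) L(2)]
 note iffG = is_iso_iff[OF G] and iffH = is_iso_iff[OF H]
 show ?thesis
 proof
  assume "EX f. is_iso f G G'&f h = h'"
  then obtain f where f: "is_iso f G G'" "f h = h'" by blast
  note f1 = f(1)[unfolded iffG]
  define F where "F = f(s := s', t := t')"
  have F: "F s = s'" "F t = t'" "F h = h'" "x:darts G==>F x = f x" for x using D f(2) by (auto simp: F_def)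
  have fD: "x:darts G==>f x:darts G'" for x using f1 by (auto dest: bij_betwE)
  have inj: "x:darts G==>y:darts G==>f x = f y==>x = y" for x y using f1 by (auto simp: bij_betw_def dest: inj_onD)
  have fo: "f (opp G h) = opp G' h'" and ld: "dl G' h' = dl G h" "dl G' (opp G' h') = dl G (opp G h)" using f1 f(2) D(1,5) by metis+
  have Fo: "F (opp G h) = opp G' h'" using fo F(4) D(5) by simp
  have "is_iso F H H'" unfolding iffH
  proof (intro conjI ballI)
  show "bij_betw F (darts H) (darts H')" unfolding F_def D(11) D'(11) using f1 D D' by (intro bij_betw_insert2) auto
  have *: "F (rot H x) = rot H' (F x)&F (opp H x) = opp H' (F x) & cl H' (F x) = cl H x&dl H' (F x) = dl H x"
  if x: "x:darts H" for x
  proof -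
  consider "x = s" | "x = t" | "x:darts G" "x~=s" "x~=t" using x D by auto
  then show ?thesis
  proof cases
  case 1 then show ?thesis using F(1-3) Fo r(1) r'(1) o(2) o'(2) l(3,6) l'(3,6) ld by simp
  next
  case 2 then show ?thesis using F(1-3) Fo r(2) r'(2) o(4) o'(4) l(4,5) l'(4,5) ld by simp
  next
  case 3
  have fx: "f (opp G x) = opp G' (f x)" "f (rot G x) = rot G' (f x)" "cl G' (f x) = cl G x" "dl G' (f x) = dl G x" using f1 3 by auto
  have n: "f x~=s'" "f x~=t'" "f x:darts G'" using fD[OF 3(1)] D' by auto
  have "F (opp H x) = opp H' (F x)"
  proof -
  consider "x = h" | "x = opp G h" | "x~=h" "x ~= opp G h" by blast
  then show ?thesis
  proof cases
  case a: 1 then show ?thesis using F(1,3) o(1) o'(1) by simp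
  next
  case a: 2 then show ?thesis using F(2) Fo o(3) o'(3) by simp
  next
  case a: 3
  show ?thesis by (metis inj[OF 3(1) D(1)] inj[OF 3(1) D(5)] a f(2) fo o(5)[OF a 3(2,3)] o'(5)[OF _ _ n(1,2)] F(4) 3(1) fx(1) opp_in[OF G(1)])
  qed
  qed
  moreover have "F (rot H x) = rot H' (F x)" using r(3)[OF 3(2,3)] r'(3)[OF n(1,2)] F(4) 3(1) fx(2) rot_in[OF G(1)] by simp
  ultimately show ?thesis using F(4) 3(1) fx l(1,2)[OF 3(1)] l'(1,2)[OF n(3)] by simp
  qed
  qed
  fix x assume "x:darts H"
  then show "F (rot H x) = rot H' (F x)" "F (opp H x) = opp H' (F x)" "cl H' (F x) = cl H x" "dl H' (F x) = dl H x" using * by blast+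
  qed
  then show "EX f. is_iso f H H'&f t = t'" using F(2) by blast
 next
  assume "EX f. is_iso f H H'&f t = t'"
  then obtain F where F: "is_iso F H H'" "F t = t'" by blast
  note F1 = F(1)[unfolded iffH]
  have tH: "t:darts H" "s:darts H" "h:darts H" "opp G h:darts H" using D by auto
  have Fs: "F s = s'" using F1 tH(1) F(2) r(2) r'(2) by metis
  have Fh: "F h = h'" using F1 tH(2) Fs o(2) o'(2) by metis
  have Fo: "F (opp G h) = opp G' h'" using F1 tH(1) F(2) o(4) o'(4) by metis
  have bij: "bij_betw F (darts G) (darts G')" using bij_betw_remove2[OF _ Fs F(2) D(2,3) D'(2,3) D(4)] F1 unfolding D(11) D'(11) by blast
  have FD: "x:darts G==>F x:darts G'" for x using bij by (auto dest: bij_betwE)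
  have inj: "x:darts G==>y:darts G==>F x = F y==>x = y" for x y using bij by (auto simp: bij_betw_def dest: inj_onD)
  have "is_iso F G G'" unfolding iffG
  proof (intro conjI ballI bij)
  fix x assume x: "x:darts G"
  then have xH: "x:darts H" "x~=s" "x~=t" using D by auto
  have Fx: "F x~=s'" "F x~=t'" using FD[OF x] D' by auto
  show "cl G' (F x) = cl G x" "dl G' (F x) = dl G x" using F1 xH(1) l(1,2)[OF x] l'(1,2)[OF FD[OF x]] by auto
  show "F (rot G x) = rot G' (F x)" using F1 xH r(3) r'(3) Fx by metis
  show "F (opp G x) = opp G' (F x)"
  proof -
  consider "x = h" | "x = opp G h" | "x~=h" "x ~= opp G h" by blast
  then show ?thesis
  proof cases
  case 1 then show ?thesis using Fh Fo by simp
  next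
  case 2 then show ?thesis using Fh Fo opp_opp[OF G(1)] opp_opp[OF G(2)] by metis
  next
  case 3
  show ?thesis by (metis inj[OF x D(1)] inj[OF x D(5)] 3 Fh Fo F1 xH(1) o(5)[OF 3 xH(2,3)] o'(5)[OF _ _ Fx])
  qed
  qed
  qed
  then show "EX f. is_iso f G G'&f h = h'" using Fh by blast
 qed
qed

section \<open>Classes of maps with labelled white leaves\<close>

definition black3 :: "'m cmap=>bool" where
 "black3 G<->(ALL h:darts G. cl G h = Black-->3 <= card (vx G h))"

text \<open>The labels that occur are exactly those in I, each at a single dart. Since the rotation
  preserves colours, such a dart is a univalent vertex.\<close>

definition leafy :: "nat set=>nat cmap=>bool" where
 "leafy I G<->(ALL i. i:I<->(EX h:darts G. cl G h = White i)) &
  (ALL h:darts G. ALL h':darts G. ALL i. cl G h = White i & cl G h' = White i-->h = h') &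
  (ALL h:darts G. ALL i. cl G h = White i-->dl G h = Marked i)"

definition core :: "nat=>nat=>'m set=>nat=>int=>'m cmap=>bool" where
 "core r N M g d G<->is_map G & connected_map G&has_genus g G&map_degree r G = d&decorated N M G"

text \<open>All faces marked by M are present, but only those in I contain a leaf. Thus I = {}
  belongs to F and I = M to W; the cases between them arise when derivatives are taken one variable
  at a time. Black vertices have no upper degree bound here.\<close>

definition Wc :: "nat=>nat=>nat set=>nat=>int=>nat set=>nat cmap set" where
 "Wc r N M g d I = {G. core r N M g d G&leafy I G&black3 G&(ALL h:darts G. cl G h~=Square)}"

lemma core_leafins: "is_map G==>leafins k G h p q H ==> core r N M g d H <-> core r N M g d G" unfolding core_def using lf_is_map lf_connected lf_euler lf_decorated by metis

lemma core_subdiv: "is_map G==>subdiv k G h s t H ==> core r N M g d H <-> core r N M g d G" unfolding core_def using sd_is_map sd_connected sd_euler sd_decorated by metis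

lemma coreD:
 assumes "core r N M g d G"
 shows "is_map G" "connected_map G" "map_degree r G = d" "h:darts G==>dl G h:Marked ` M Un Unmarked ` {1..N}"
  "has_genus g G" "decorated N M G"
proof -
 show "is_map G" "connected_map G" "map_degree r G = d" "has_genus g G" and d: "decorated N M G" using assms by (simp_all add: core_def)
 show "h:darts G==>dl G h:Marked ` M Un Unmarked ` {1..N}" using d by (simp add: decorated_iff)
qed

lemma WcD:
 assumes "G:Wc r N M g d I"
 shows "core r N M g d G" "is_map G" "connected_map G" "leafy I G" "black3 G" "h:darts G ==> cl G h~=Square" using assms by (auto simp: Wc_def core_def)

lemma leafy_cl:
 assumes "leafy I G" "h:darts G" "cl G h = White i"
 shows "i:I" "dl G h = Marked i" "h':darts G ==> cl G h' = White i==>h' = h" using assms unfolding leafy_def by blast+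

lemma leafy_rot:
 assumes "is_map G" "leafy I G" "h:darts G" "cl G h = White i"
 shows "rot G h = h" using leafy_cl(3)[OF assms(2-4), of "rot G h"] assms by (simp add: rot_in cl_rot)

text \<open>Let V and E be the numbers of vertices and edges. Black degrees of at least three give 3
  V <= 2 E + 3 c, and the prescribed degree bounds E - V by its absolute value; together they bound
  E.\<close>

lemma darts_bound:
 assumes G: "is_map G" "black3 G" and d: "map_degree r G = d"
  and c: "card {x:vertices G. colour G x~=Black} <= c"
 shows "int (card (darts G)) <= 6 * (\<bar>d\<bar> + int c)"
proof -
 let ?E = "int (card (edges G))" and ?V = "int (card (vertices G))"
 let ?B = "{x:vertices G. colour G x = Black}" and ?C = "{x:vertices G. colour G x~=Black}"
 have fin: "finite (vertices G)" using finite_vertices(1)[OF G(1)] .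
 have "\<Union>(vertices G) = darts G" using in_verticesD(3)[OF G(1)] vx_self[OF G(1)] by (auto simp: vertices_def)
 then have "card (darts G) = card (\<Union>(vertices G))" by simp
 also have "... = sum card (vertices G)"
 proof (rule card_Union_disjoint)
  show "pairwise disjnt (vertices G)" unfolding pairwise_def disjnt_def using in_verticesD(4)[OF G(1)] by blast
  show "finite x" if "x:vertices G" for x using in_verticesD(1)[OF G(1) that] .
 qed
 finally have s: "card (darts G) = sum card (vertices G)" .
 have "(\<Sum>x\<in>?B. 3) <= sum card ?B" using G(2) by (intro sum_mono) (auto simp: black3_def vertices_def cl_def)
 also have "... <= sum card (vertices G)" using fin by (intro sum_mono2) auto
 finally have "3 * card ?B <= card (darts G)" by (simp add: s mult.commute)
 then have "3 * int (card ?B) <= int (card (darts G))" by linarith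
 moreover have "card (vertices G) = card ?B + card ?C" using fin by (subst card_Un_disjoint[symmetric]) (auto intro: arg_cong[of _ _ card])
 ultimately have 1: "3 * ?V <= 2 * ?E + 3 * int c" using card_edges[OF G(1)] c by linarith
 have 2: "\<bar>?E - ?V\<bar> <= \<bar>d\<bar>" unfolding d[symmetric] map_degree_def abs_mult using mult_right_mono[of 1 "\<bar>int r + 1\<bar>" "\<bar>?E - ?V\<bar>"] by simp
 have "?E - ?V <= \<bar>d\<bar>" using 2 by linarith
 moreover have "int (card (darts G)) = 2 * ?E" using card_edges[OF G(1)] by linarith
 ultimately show ?thesis using 1 by (linarith | presburger | (smt (verit)))
qed

text \<open>A non-black vertex is determined by its colour, so there are at most
  \<open>card C\<close> of them and \<open>darts_bound\<close> applies.\<close>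

lemma finite_reps_class:
 assumes A: "!!G. G:A==>is_map G&map_degree r G = d&black3 G&decorated N M G" and M: "finite M" and C: "finite C"
  and cl: "!!G h. G:A==>h:darts G ==> cl G h:insert Black C"
  and uniq: "!!G h h'. G:A==>h:darts G==>h':darts G ==> cl G h = cl G h' ==> cl G h~=Black ==>
  vx G h = vx G h'"
 shows "finite (reps A)"
proof (rule finite_reps[where C = "insert Black C" and E = "Marked ` M Un Unmarked ` {1..N}"
  and K = "nat (6 * (\<bar>d\<bar> + int (card C)))"])
 show "card (darts G) <= nat (6 * (\<bar>d\<bar> + int (card C)))" if G: "G:A" for G
 proof -
  have "card {x:vertices G. colour G x~=Black} <= card C"
  proof (rule card_inj_on_le[of "colour G"])
  show "inj_on (colour G) {x:vertices G. colour G x~=Black}" using uniq[OF G] by (auto simp: inj_on_def vertices_def cl_def)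
  show "colour G ` {x:vertices G. colour G x~=Black} <= C" using cl[OF G] by (auto simp: vertices_def cl_def)
  qed (rule C)
  then show ?thesis using darts_bound[of G r d "card C"] A[OF G] by linarith
 qed
 show "dl G h:Marked ` M Un Unmarked ` {1..N}" if "G:A" "h:darts G" for G h using A[OF that(1)] that(2) by (auto simp: decorated_iff)
qed (use A M C cl in auto)

lemma finite_reps_Wc:
 assumes "finite M" "finite I"
 shows "finite (reps (Wc r N M g d I))"
proof (rule finite_reps_class[where C = "White ` I" and r = r and d = d and N = N and M = M])
 show "cl G h:insert Black (White ` I)" if "G:Wc r N M g d I" "h:darts G" for G h using WcD(4,6)[OF that(1)] that(2) leafy_cl(1) by (cases "cl G h") auto
 show "vx G h = vx G h'" if "G:Wc r N M g d I" "h:darts G" "h':darts G" "cl G h = cl G h'" "cl G h~=Black" for G h h' using WcD(4,6)[OF that(1)] that leafy_cl(3) by (cases "cl G h") metis+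
qed (use assms in \<open>auto simp: Wc_def core_def\<close>)

text \<open>An automorphism preserves colours and so fixes the only dart with colour
  \<open>White i\<close>; by connectedness it is trivial.\<close>

lemma rigid_Wc:
 assumes "G:Wc r N M g d I" "i:I"
 shows "card (automorphisms G) = 1"
proof -
 note G = WcD[OF assms(1)]
 obtain q where q: "q:darts G" "cl G q = White i" using G(4) assms(2) by (auto simp: leafy_def)
 show ?thesis
 proof (rule automorphisms_trivial[OF G(2,3) q(1)])
  fix f assume "is_iso f G G"
  then have "f q:darts G" "cl G (f q) = White i" using q unfolding is_iso_iff[OF G(2,2)] by (auto dest: bij_betwE)
  then show "f q = q" using leafy_cl(3)[OF G(4) q] by blast
 qed
qed

lemma lf_subclass:
 assumes G: "is_map G" and L: "leafins (White i) G h p q H" and i: "i~:I" "dl G h = Marked i" "cl G h = Black"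
 shows "leafy (insert i I) H<->leafy I G"
  and "(ALL x:darts H. cl H x~=Square)<->(ALL x:darts G. cl G x~=Square)"
  and "black3 H<->(ALL x:darts G. cl G x = Black-->3 <= card (vx H x))"
proof -
 note D = lf_darts[OF G L] and l = lf_labels[OF G L]
 have n: "cl G x~=White i" if "leafy I G" "x:darts G" for x using leafy_cl(1)[OF that] i(1) by blast
 show "leafy (insert i I) H<->leafy I G"
 proof
  assume a: "leafy (insert i I) H"
  have n': "cl G x~=White i" if "x:darts G" for x using leafy_cl(3)[OF a, of q i x] that l D by auto
  have "(EX x:darts G. cl G x = White j)<->j:I" for j
  proof (cases "j = i")
  case False
  have "j:insert i I<->(EX x:darts H. cl H x = White j)" using a by (simp only: leafy_def)
  also have "... <-> (EX x:darts G. cl G x = White j)" using l False i(3) D by auto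
  finally show ?thesis using False by auto
  qed (use n' i in auto)
  moreover have "x = y" if "x:darts G" "y:darts G" "cl G x = White j" "cl G y = White j" for x y j using leafy_cl(3)[OF a, of y j x] that l D by auto
  moreover have "dl G x = Marked j" if "x:darts G" "cl G x = White j" for x j using leafy_cl(2)[OF a, of x j] that l D by auto
  ultimately show "leafy I G" unfolding leafy_def by blast
 next
  assume a: "leafy I G"
  have "(EX x:darts H. cl H x = White j)<->j:insert i I" for j using a l i(3) unfolding leafy_def D(7) by auto
  moreover have "x = y" if xy: "x:darts H" "y:darts H" "cl H x = White j" "cl H y = White j" for x y j
  proof -
  have *: "x = q&j = i | x:darts G & cl G x = White j&j~=i" if "x:darts H" "cl H x = White j" for x using that l(1,3,4) i(3) n[OF a, of x] unfolding D(7) by auto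
  show ?thesis using *[OF xy(1,3)] *[OF xy(2,4)] leafy_cl(3)[OF a, of y j x] by auto
  qed
  moreover have "dl H x = Marked j" if "x:darts H" "cl H x = White j" for x j using that l i leafy_cl(2)[OF a] unfolding D(7) by auto
  ultimately show "leafy (insert i I) H" unfolding leafy_def by blast
 qed
 show "(ALL x:darts H. cl H x~=Square)<->(ALL x:darts G. cl G x~=Square)" unfolding D(7) using l i(3) by auto
 have "vx H p = vx H h" "cl H p = cl H h" using lf_rot(1)[OF G L] vx_rot[OF lf_is_map[OF G L], of h] cl_rot[OF lf_is_map[OF G L], of h] by auto
 then show "black3 H<->(ALL x:darts G. cl G x = Black-->3 <= card (vx H x))" unfolding black3_def D(7) using l D(1) by auto
qed

lemma lf_card_vertex:
 assumes G: "is_map G" and L: "leafins k G h p q H" and y: "y:darts G"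
 shows "card (vx H y) = (if h:vx G y then Suc (card (vx G y)) else card (vx G y))"
proof -
 have "finite (vx G y)" "p~:vx G y" using vx_subset[OF G y] fin_darts[OF G] lf_darts[OF G L] finite_subset by blast+
 then show ?thesis by (simp add: lf_vertex(1)[OF G L y])
qed

lemma sd_subclass:
 assumes G: "is_map G" and L: "subdiv Black G h s t H"
 shows "leafy I H<->leafy I G"
  and "(ALL x:darts H. cl H x~=Square)<->(ALL x:darts G. cl G x~=Square)"
proof -
 note D = sd_darts[OF G L] and l = sd_labels[OF G L]
 show "leafy I H<->leafy I G" unfolding leafy_def D(11) using l(1-4) by simp
 show "(ALL x:darts H. cl H x~=Square)<->(ALL x:darts G. cl G x~=Square)" unfolding D(11) using l by auto
qed

definition leaf :: "nat=>'m cmap=>nat" where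
 "leaf i G = (THE q. q:darts G & cl G q = White i)"

lemma leaf_eq: "leafy I G==>q:darts G ==> cl G q = White i==>leaf i G = q" unfolding leaf_def by (rule the_equality) (auto dest: leafy_cl(3))

lemma leaf_in:
 assumes "leafy I G" "i:I"
 shows "leaf i G:darts G" "cl G (leaf i G) = White i"
proof -
 obtain q where "q:darts G" "cl G q = White i" using assms by (auto simp: leafy_def)
 then show "leaf i G:darts G" "cl G (leaf i G) = White i" using leaf_eq[OF assms(1)] by auto
qed

lemma leaf_iso:
 assumes "is_map G" "is_map H" "is_iso f G H" "leafy I G" "leafy I H" "i:I"
 shows "leaf i H = f (leaf i G)"
proof -
 show ?thesis by (metis assms(3) leaf_in[OF assms(4,6)] is_iso_iff[OF assms(1,2)] bij_betwE leaf_eq[OF assms(5)])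
qed

lemma card_vertex_iso:
 assumes "is_map G" "is_map H" "is_iso f G H" "h:darts G"
 shows "card (vx H (f h)) = card (vx G h)" unfolding vx_iso[OF assms] using assms(3) vx_subset[OF assms(1,4)] by (intro card_image) (auto simp: is_iso_def bij_betw_def intro: inj_on_subset)

section \<open>The neighbour of a leaf\<close>

definition nbr :: "nat=>'m cmap=>nat set" where
 "nbr i G = vx G (opp G (leaf i G))"

text \<open>One weight for several purposes: with p = - V' and a black neighbour it is the ordinary
  weight, and for a square neighbour p is the polynomial multiplied to U before taking the residue
  in u.\<close>

definition wl :: "complex poly => complex poly=>(nat => complex)=>(nat => complex)=>nat=>nat cmap => complex" where
 "wl p V lam z i G = wsp p V (cv z lam G) (cv z lam G) G (nbr i G)"

lemma nbr_iso:
 assumes "is_map G" "is_map H" "is_iso f G H" "leafy I G" "leafy I H" "i:I"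
 shows "nbr i H = f ` nbr i G" "card (nbr i H) = card (nbr i G)" "nbr i G:vertices G"
proof -
 note l = leaf_in[OF assms(4,6)]
 have o: "opp G (leaf i G):darts G" using l opp_in[OF assms(1)] by simp
 have "opp H (leaf i H) = f (opp G (leaf i G))" using leaf_iso[OF assms] assms(3) l by (simp add: is_iso_def)
 then show "nbr i H = f ` nbr i G" "card (nbr i H) = card (nbr i G)" using vx_iso[OF assms(1-3) o] card_vertex_iso[OF assms(1-3) o] by (simp_all add: nbr_def)
 show "nbr i G:vertices G" using o by (simp add: nbr_def vertices_def)
qed

lemma wl_iso:
 assumes "is_map G" "is_map H" "is_iso f G H" "leafy I G" "leafy I H" "i:I"
 shows "wl p V lam z i H = wl p V lam z i G" unfolding wl_def nbr_iso(1)[OF assms] using wsp_iso[OF assms(1-3) nbr_iso(3)[OF assms]] .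

text \<open>A leaf lies inside a single face, so both darts of its edge carry the mark i. A white
  neighbour would then have the label i as well, which is already taken by the leaf. If the
  neighbour is univalent, the edge is the whole map.\<close>

lemma leaf_neighbour:
 assumes H: "is_map H" "connected_map H" "leafy I H" and i: "i:I"
 defines "q == leaf i H" and "p == opp H (leaf i H)"
 shows "q:darts H" "cl H q = White i" "rot H q = q" "dl H q = Marked i" "p:darts H" "p~=q"
  "opp H p = q" "dl H p = Marked i" "cl H p~=White j" "rot H p = p==>darts H = {p, q}"
proof -
 show q: "q:darts H" "cl H q = White i" using leaf_in[OF H(3) i] by (auto simp: q_def)
 show r: "rot H q = q" using leafy_rot[OF H(1,3) q] .
 show dq: "dl H q = Marked i" using leafy_cl(2)[OF H(3) q] .
 have pq: "p = opp H q" by (simp add: p_def q_def)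
 show p: "p:darts H" "p~=q" "opp H p = q" using q pq opp_in[OF H(1)] opp_neq[OF H(1)] opp_opp[OF H(1)] by auto
 show dp: "dl H p = Marked i" by (metis fp_iff[OF H(1)] p r dl_face_perm[OF H(1), of p] dq)
 show "rot H p = p==>darts H = {p, q}" using H(2) unfolding connected_map_iff[OF H(1)] using p q r pq by (elim conjE allE[of _ "{p, q}"]) auto
 show "cl H p~=White j"
 proof
  assume c: "cl H p = White j"
  then have "j = i" using leafy_cl(2)[OF H(3) p(1)] dp by simp
  then show False using leafy_cl(3)[OF H(3) q p(1)] c p by simp
 qed
qed

text \<open>The new edge contributes its own weight, and the corner h is split by p into two
  corners; the latter is what \<open>Tc\<close> describes.\<close>

lemma lf_weight:
 assumes G: "is_map G" and L: "leafins k G h p q H" and k: "k~=Black"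
 shows "wsp P V a b H (vx H p) = eiv V (b p) (b q) * Tc P V G a b h (a p) (a h)"
proof -
 note D = lf_darts[OF G L] and v = lf_vertex[OF G L] and e = lf_edges[OF G L]
 have EW: "EW V b H = eiv V (b p) (b q) * EW V b G" unfolding EW_def e(1) using e(2) finite_edges[OF G] D(4) by (simp add: dd_def)
 have q: "{q}~:vertices G" "insert p (vx G h)~:vertices G" "{q}~=insert p (vx G h)" using in_verticesD(3)[OF G] D by blast+
 have "vertices H - {vx H p} = insert {q} (vertices G - {vx G h})" unfolding v(2,4) using q by auto
 moreover have "vw V H a {q} = 1" using lf_labels(4)[OF G L] k v(3) by (simp add: vw_def cl_def)
 moreover have "vw V H a x = vw V G a x" if x: "x:vertices G - {vx G h}" for x
 proof -
  obtain y where y: "y:darts G" "x = vx G y" using x by (auto simp: vertices_def)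
  then have "h~:vx G y" using x vx_eq[OF G, of h y] by auto
  then have "x = vx H y" using v(1)[OF y(1)] y by simp
  then have "colour H x = colour G x" using lf_labels(1)[OF G L y(1)] y by (simp add: cl_def)
  then show ?thesis by (simp add: vw_def)
 qed
 ultimately have P: "(\<Prod>x\<in>vertices H - {vx H p}. vw V H a x) = (\<Prod>x\<in>vertices G - {vx G h}. vw V G a x)" using q(1) finite_vertices(1)[OF G] by simp
 have vh: "finite (vx G h)" "p~:vx G h" "h:vx G h" using vx_subset[OF G D(1)] fin_darts[OF G] D(2) vx_self[OF G] finite_subset by blast+
 have "dd P (vx H p) a = ev P (gg (a p) * gg (a h) * (\<Prod>i\<in>vx G h - {h}. gg (a i)))"
 proof -
  have "(\<Prod>i\<in>vx G h. gg (a i)) = gg (a h) * (\<Prod>i\<in>vx G h - {h}. gg (a i))" using vh(1,3) by (rule prod.remove)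
  then show ?thesis unfolding dd_def v(2) using vh by (simp add: mult.assoc)
 qed
 then show ?thesis by (simp add: wsp_def Tc_def EW P mult_ac)
qed

text \<open>Doubling the corner t of the new bivalent vertex makes it trivalent, with the third
  corner s on the other side of the edge. Hence a side term of G is a corner term of its
  subdivision.\<close>

lemma sd_weight:
 assumes G: "is_map G" and L: "subdiv Black G h s t H" and s: "a s = b (opp G h)" "b s = b (opp G h)"
 shows "Tc P V H a b t (b t) (b h) = Ts P V G a b h (b t) (b h)"
proof -
 note D = sd_darts[OF G L] and v = sd_vertex[OF G L] and e = sd_edges[OF G L]
 have "EW V b H = eiv V (b h) (b s) * eiv V (b (opp G h)) (b t) *
  (\<Prod>e\<in>edges G - {{h, opp G h}}. inverse (dd (pderiv V) e b))" unfolding EW_def e(1) using e(2-4) finite_edges[OF G] D by (simp add: dd_def)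
 moreover have "vertices H - {vx H t} = vertices G" unfolding v(3,4) using v(5) by auto
 moreover have "(\<Prod>x\<in>vertices G. vw V H a x) = (\<Prod>x\<in>vertices G. vw V G a x)"
 proof (rule prod.cong[OF refl])
  fix x assume "x:vertices G"
  then obtain y where y: "y:darts G" "x = vx G y" by (auto simp: vertices_def)
  then have "colour H x = colour G x" using v(1)[OF y(1)] sd_labels(1)[OF G L y(1)] by (simp add: cl_def)
  then show "vw V H a x = vw V G a x" by (simp add: vw_def)
 qed
 moreover have "vx H t - {t} = {s}" unfolding v(3) using D by auto
 ultimately show ?thesis by (simp add: Tc_def Ts_def s mult_ac)
qed

lemma Tc_cong:
 assumes "is_map G" "h:darts G" "!!x. x:darts G==>a x = a' x" "!!x. x:darts G==>b x = b' x"
 shows "Tc P V G a b h x y = Tc P V G a' b' h x y"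
proof -
 have "vx G h <= darts G" using vx_subset[OF assms(1,2)] .
 then have "(\<Prod>i\<in>vx G h - {h}. gg (a i)) = (\<Prod>i\<in>vx G h - {h}. gg (a' i))" using assms(3) by (intro prod.cong) auto
 moreover have "EW V b G = EW V b' G" using assms by (intro EW_cong) auto
 moreover have "(\<Prod>X\<in>vertices G - {vx G h}. vw V G a X) = (\<Prod>X\<in>vertices G - {vx G h}. vw V G a' X)" using assms(3) in_verticesD(3)[OF assms(1)] by (intro prod.cong refl vw_cong) blast
 ultimately show ?thesis by (simp add: Tc_def)
qed

lemma Ts_cong:
 assumes "is_map G" "h:darts G" "!!x. x:darts G==>a x = a' x" "!!x. x:darts G==>b x = b' x"
 shows "Ts P V G a b h x y = Ts P V G a' b' h x y"
proof -
 have "b (opp G h) = b' (opp G h)" using assms opp_in by metis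
 moreover have "(\<Prod>e\<in>edges G - {{h, opp G h}}. inverse (dd (pderiv V) e b)) = (\<Prod>e\<in>edges G - {{h, opp G h}}. inverse (dd (pderiv V) e b'))" using assms(4) in_edgesD(2)[OF assms(1)] by (intro prod.cong refl arg_cong[of _ _ inverse] dd_cong) blast
 moreover have "(\<Prod>X\<in>vertices G. vw V G a X) = (\<Prod>X\<in>vertices G. vw V G a' X)" using assms(3) in_verticesD(3)[OF assms(1)] by (intro prod.cong refl vw_cong) blast
 ultimately show ?thesis by (simp add: Ts_def)
qed

text \<open>Any white vertex in the face marked i would be the leaf with label i, which is
  absent.\<close>

lemma Wc_marked_black:
 assumes "G:Wc r N M g d I" "h:darts G" "dl G h = Marked i" "i~:I"
 shows "cl G h = Black" using WcD(4,6)[OF assms(1)] assms leafy_cl(1,2)[of I G h] by (cases "cl G h") auto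

section \<open>Growing a leaf in a marked face\<close>

text \<open>A neighbour of degree at least four still has degree at least three once the leaf is
  deleted, so the leaf was attached at an ordinary corner of the face marked i. The only lost
  information is that corner.\<close>

lemma transfer_corner:
 assumes i: "i:M" "i~:I" and fin: "finite M" "finite I"
 shows "gsum {H:Wc r N M g d (insert i I). 4 <= card (nbr i H)} (wl P V lam z i) =
  (\<Sum>G\<in>reps (Wc r N M g d I). (\<Sum>h | h:darts G&dl G h = Marked i.
  eiv V (z i) (z i) *
  Tc P V G (cv z lam G) (cv z lam G) h (z i) (z i)) / of_nat (card (automorphisms G)))"
proof (rule gsum_transfer_pointed(2)[where R = "%G h H. EX p q. leafins (White i) G h p q H"])
 let ?A = "Wc r N M g d I" and ?B = "{H:Wc r N M g d (insert i I). 4 <= card (nbr i H)}"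
 show "is_map G" "connected_map G" if "G:?A" for G using WcD[OF that] by blast+
 show "finite (reps ?A)" by (rule finite_reps_Wc[OF fin])
 show "is_map H" "card (automorphisms H) = 1" if "H:?B" for H using that WcD(2) rigid_Wc by blast+
 show "{h. h:darts G&dl G h = Marked i} <= darts G" for G :: "nat cmap" by auto
 show "f h:{h. h:darts G'&dl G' h = Marked i}"
  if "G:?A" "G':?A" "is_iso f G G'" "h:{h. h:darts G&dl G h = Marked i}" for G G' f h using that is_iso_iff[OF WcD(2)[OF that(1)] WcD(2)[OF that(2)]] by (auto dest: bij_betwE)
 show "EX H:?B. EX p q. leafins (White i) G h p q H" if "G:?A" "h:{h. h:darts G&dl G h = Marked i}" for G h
 proof -
  note G = WcD[OF that(1)]
  have h: "h:darts G" "dl G h = Marked i" using that(2) by auto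
  have b: "cl G h = Black" using Wc_marked_black[OF that(1) h i(2)] .
  obtain p q H where L: "leafins (White i) G h p q H" using lf_ex[OF G(2) h(1)] .
  note D = lf_darts[OF G(2) L] and c = lf_subclass[OF G(2) L i(2) h(2) b]
  have "black3 H" unfolding c(3) using G(5) lf_card_vertex[OF G(2) L] by (force simp: black3_def)
  then have HW: "H:Wc r N M g d (insert i I)" using G c(1,2) core_leafins[OF G(2) L] by (auto simp: Wc_def)
  have "leaf i H = q" using D lf_labels(4)[OF G(2) L] by (intro leaf_eq[OF WcD(4)[OF HW]]) auto
  then have "nbr i H = insert p (vx G h)" using lf_opp(2)[OF G(2) L] lf_vertex(2)[OF G(2) L] by (simp add: nbr_def)
  moreover have "p~:vx G h" "finite (vx G h)" using vx_subset[OF G(2) h(1)] fin_darts[OF G(2)] D(2) finite_subset by blast+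
  moreover have "3 <= card (vx G h)" using G(5) h b by (auto simp: black3_def)
  ultimately have "H:?B" using HW by simp
  then show ?thesis using L by blast
 qed
 show "EX G:?A. EX h:{h. h:darts G&dl G h = Marked i}. EX p q. leafins (White i) G h p q H" if H': "H:?B" for H
 proof -
  have HW: "H:Wc r N M g d (insert i I)" and c4: "4 <= card (nbr i H)" using H' by auto
  note H = WcD[OF HW]
  define q where "q = leaf i H"
  define p where "p = opp H q"
  note n = leaf_neighbour[OF H(2-4) insertI1, folded q_def, folded p_def]
  have "cl H p = Black" using n(9) H(6)[OF n(5)] by (cases "cl H p") auto
  then have r: "rot H p~=p" using H(5) n(5) card_orbit_ge_3[OF fin_darts[OF H(2)] rot_permutes[OF H(2)], of p] by (auto simp: black3_def vertex_at_def)
  obtain G h where G: "is_map G" "leafins (cl H q) G h p q H" "rot H h = p" using lf_delete[OF H(2) n(1,3) p_def r] by metis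
  have L: "leafins (White i) G h p q H" using G(2) n(2) by simp
  note D = lf_darts[OF G(1) L] and l = lf_labels[OF G(1) L]
  have h: "cl G h = Black" "dl G h = Marked i" using l(3,6) \<open>cl H p = Black\<close> n(4) by auto
  note c = lf_subclass[OF G(1) L i(2) h(2,1)]
  have nb: "nbr i H = insert p (vx G h)" using lf_vertex(2)[OF G(1) L] by (simp add: nbr_def q_def[symmetric] p_def[symmetric])
  have "black3 G" unfolding black3_def
  proof (intro ballI impI)
  fix x assume x: "x:darts G" "cl G x = Black"
  show "3 <= card (vx G x)"
  proof (cases "h:vx G x")
  case True
  then have "vx G x = vx G h" using vx_eq[OF G(1)] by auto
  moreover have "card (insert p (vx G h)) <= Suc (card (vx G h))" by (rule card_insert_le_m1) simp_all
  ultimately show ?thesis using c4 nb by simp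
  next
  case False
  then show ?thesis using c(3) H(5) x lf_card_vertex[OF G(1) L x(1)] by auto
  qed
  qed
  then have "G:?A" using G(1) H c(1,2) core_leafins[OF G(1) L] by (auto simp: Wc_def)
  then show ?thesis using h D(1) L by blast
 qed
 show "(EX f. is_iso f H H')<->(EX f. is_iso f G G'&f h = h')"
  if A: "G:?A" "G':?A" and h: "h:{h. h:darts G&dl G h = Marked i}" "h':{h. h:darts G'&dl G' h = Marked i}"
  and B: "H:?B" "H':?B" and R: "EX p q. leafins (White i) G h p q H" "EX p q. leafins (White i) G' h' p q H'"
  for G h H G' h' H'
 proof -
  obtain p q where L: "leafins (White i) G h p q H" using R(1) by blast
  obtain p' q' where L': "leafins (White i) G' h' p' q' H'" using R(2) by blast
  note G = WcD(2)[OF A(1)] WcD(2)[OF A(2)]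
  have HW: "H:Wc r N M g d (insert i I)" "H':Wc r N M g d (insert i I)" using B by auto
  have "leaf i H = q" using lf_darts[OF G(1) L] lf_labels(4)[OF G(1) L] by (intro leaf_eq[OF WcD(4)[OF HW(1)]]) auto
  moreover have "leaf i H' = q'" using lf_darts[OF G(2) L'] lf_labels(4)[OF G(2) L'] by (intro leaf_eq[OF WcD(4)[OF HW(2)]]) auto
  ultimately have "(EX f. is_iso f H H')<->(EX f. is_iso f H H'&f q = q')" using leaf_iso[OF WcD(2)[OF HW(1)] WcD(2)[OF HW(2)] _ WcD(4)[OF HW(1)] WcD(4)[OF HW(2)] insertI1] by auto
  then show ?thesis using lf_iso[OF G L L'] by simp
 qed
 show "wl P V lam z i H = eiv V (z i) (z i) *
  Tc P V G (cv z lam G) (cv z lam G) h (z i) (z i)"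
  if A: "G:?A" and h: "h:{h. h:darts G&dl G h = Marked i}" and B: "H:?B"
  and R: "EX p q. leafins (White i) G h p q H" for G h H
 proof -
  obtain p q where L: "leafins (White i) G h p q H" using R by blast
  note G = WcD(2)[OF A] and D = lf_darts[OF G L] and l = lf_labels[OF G L]
  have nb: "nbr i H = vx H p" using D l(4) B WcD(4) leaf_eq[of "insert i I"] lf_opp(2)[OF G L] nbr_def by blast
  let ?c = "cv z lam H"
  have c: "?c p = z i" "?c q = z i" "?c h = z i" "x:darts G==>?c x = cv z lam G x" for x using l h by (simp_all add: cv_dl)
  show ?thesis unfolding wl_def nb lf_weight[OF G L, of P V ?c ?c, simplified] c(1-3) using Tc_cong[OF G D(1), of ?c "cv z lam G" ?c "cv z lam G"] c(4) by simp
 qed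
 show "wl P V lam z i H = wl P V lam z i H'" if "H:?B" "H':?B" "is_iso f H H'" for H H' f using wl_iso[OF _ _ that(3), of "insert i I" i P V lam z] that(1,2) WcD(2,4) by auto
qed

text \<open>For a trivalent neighbour: its two darts other than the one towards the leaf form an
  edge.\<close>

definition looped :: "nat=>'m cmap=>bool" where
 "looped i H<->(let p = opp H (leaf i H) in opp H (rot H p) = rot H (rot H p))"

lemma orbit_card_3:
 assumes "finite D" "pe permutes D" "card (orbit pe p) = 3"
 shows "pe (pe (pe p)) = p" "pe p~=p" "pe (pe p)~=p" "pe (pe p)~=pe p"
proof -
 note e = orbit_enum[OF assms(1,2), of 3 p, OF assms(3)[symmetric]]
 show "pe (pe (pe p)) = p" using e(3) by (simp add: numeral_3_eq_3)
 show "pe p~=p" using inj_onD[OF e(2), of 1 0] by auto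
 show "pe (pe p)~=p" using inj_onD[OF e(2), of 2 0] by (auto simp: numeral_2_eq_2)
 show "pe (pe p)~=pe p" using inj_onD[OF e(2), of 2 1] by (auto simp: numeral_2_eq_2)
qed

lemma leaf_iso_ex:
 assumes "is_map H" "is_map H'" "leafy I H" "leafy I H'" "i:I"
 shows "(EX f. is_iso f H H')<->(EX f. is_iso f H H'&f (leaf i H) = leaf i H')" using leaf_iso[OF assms(1,2) _ assms(3-5)] by auto

text \<open>A trivalent neighbour becomes bivalent when the leaf is deleted and is then smoothed
  away; what remains is a map with a marked side of the face i. The intermediate map K lies outside
  the class because of its bivalent black vertex.\<close>

lemma transfer_side:
 assumes i: "i:M" "i~:I" and fin: "finite M" "finite I"
 shows "gsum {H:Wc r N M g d (insert i I). card (nbr i H) = 3 & ~ looped i H} (wl P V lam z i) =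
  (\<Sum>G\<in>reps (Wc r N M g d I). (\<Sum>h | h:darts G&dl G h = Marked i.
  eiv V (z i) (z i) *
  Ts P V G (cv z lam G) (cv z lam G) h (z i) (z i)) / of_nat (card (automorphisms G)))"
proof (rule gsum_transfer_pointed(2)[where
  R = "%G h H. EX s t p q K. subdiv Black G h s t K&leafins (White i) K t p q H"])
 let ?A = "Wc r N M g d I" and ?B = "{H:Wc r N M g d (insert i I). card (nbr i H) = 3 & ~ looped i H}"
 show "is_map G" "connected_map G" if "G:?A" for G using WcD[OF that] by blast+
 show "finite (reps ?A)" by (rule finite_reps_Wc[OF fin])
 show "is_map H" "card (automorphisms H) = 1" if "H:?B" for H using that WcD(2) rigid_Wc by blast+
 show "{h. h:darts G&dl G h = Marked i} <= darts G" for G :: "nat cmap" by auto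
 show "f h:{h. h:darts G'&dl G' h = Marked i}"
  if "G:?A" "G':?A" "is_iso f G G'" "h:{h. h:darts G&dl G h = Marked i}" for G G' f h using that is_iso_iff[OF WcD(2)[OF that(1)] WcD(2)[OF that(2)]] by (auto dest: bij_betwE)
 show "EX H:?B. EX s t p q K. subdiv Black G h s t K&leafins (White i) K t p q H"
  if A: "G:?A" and h': "h:{h. h:darts G&dl G h = Marked i}" for G h
 proof -
  note G = WcD[OF A]
  have h: "h:darts G" "dl G h = Marked i" using h' by auto
  obtain s t K where S: "subdiv Black G h s t K" using sd_ex[OF G(2) h(1)] .
  note DS = sd_darts[OF G(2) S] and K = sd_is_map[OF G(2) S] and ls = sd_labels[OF G(2) S]
  have t: "t:darts K" "dl K t = Marked i" "cl K t = Black" using DS ls h by auto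
  obtain p q H where L: "leafins (White i) K t p q H" using lf_ex[OF K t(1)] .
  note D = lf_darts[OF K L] and c = lf_subclass[OF K L i(2) t(2,3)] and cs = sd_subclass[OF G(2) S]
  and v = lf_vertex[OF K L] and vs = sd_vertex[OF G(2) S]
  have p3: "card (insert p {s, t}) = 3" using D DS by auto
  have "black3 H" unfolding c(3)
  proof (intro ballI impI)
  fix x assume x: "x:darts K" "cl K x = Black"
  show "3 <= card (vx H x)"
  proof (cases "t:vx K x")
  case True
  then have "vx K x = {s, t}" using vx_eq[OF K] vs(3) by auto
  then show ?thesis using v(1)[OF x(1)] True p3 by simp
  next
  case False
  then have "x~=s" "x~=t" using vs(2,3) by auto
  then have xG: "x:darts G" using x DS by auto
  then have "3 <= card (vx G x)" using G(5) x ls(1) by (auto simp: black3_def)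
  then show ?thesis using v(1)[OF x(1)] False vs(1)[OF xG] by simp
  qed
  qed
  then have HW: "H:Wc r N M g d (insert i I)" using G c(1,2) cs core_leafins[OF K L] core_subdiv[OF G(2) S] by (auto simp: Wc_def)
  have lf: "leaf i H = q" using D lf_labels(4)[OF K L] by (intro leaf_eq[OF WcD(4)[OF HW]]) auto
  then have op: "opp H (leaf i H) = p" using lf_opp(2)[OF K L] by simp
  then have "card (nbr i H) = 3" using v(2) vs(3) p3 by (simp add: nbr_def)
  moreover have "~ looped i H"
  proof -
  have n: "s~=t" "s~=p" "s~=q" using D(2,3) DS(4,11) by auto
  have "rot H p = s" using lf_rot(2)[OF K L] sd_rot(2)[OF G(2) S] by simp
  moreover have "rot H s = t" using lf_rot(4)[OF K L n(1,2)] sd_rot(1)[OF G(2) S] by simp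
  moreover have "opp H s = h" using lf_opp(3)[OF K L n(2,3)] sd_opp(2)[OF G(2) S] by simp
  ultimately have "rot H p = s" "rot H s = t" "opp H s = h" by blast+
  then show ?thesis using op DS(8) by (simp add: looped_def)
  qed
  ultimately have "H:?B" using HW by simp
  then show ?thesis using S L by blast
 qed
 show "EX G:?A. EX h:{h. h:darts G&dl G h = Marked i}. EX s t p q K. subdiv Black G h s t K&leafins (White i) K t p q H"
  if H': "H:?B" for H
 proof -
  have HW: "H:Wc r N M g d (insert i I)" and c3: "card (nbr i H) = 3" and nl: "~ looped i H" using H' by auto
  note H = WcD[OF HW]
  define q where "q = leaf i H"
  define p where "p = opp H q"
  note n = leaf_neighbour[OF H(2-4) insertI1, folded q_def, folded p_def]
  have bp: "cl H p = Black" using n(9) H(6)[OF n(5)] by (cases "cl H p") auto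
  have "card (orbit (rot H) p) = 3" using c3 by (simp add: nbr_def q_def[symmetric] p_def[symmetric] vertex_at_def)
  note o3 = orbit_card_3[OF fin_darts[OF H(2)] rot_permutes[OF H(2)] this]
  define s where "s = rot H p"
  define t where "t = rot H s"
  have r: "rot H t = p" "s~=p" "t~=p" "t~=s" using o3 by (auto simp: s_def t_def)
  have os: "opp H s~=t" using nl by (simp add: looped_def q_def[symmetric] p_def[symmetric] s_def t_def)
  obtain K h where K': "is_map K" "leafins (cl H q) K h p q H" "rot H h = p" using lf_delete[OF H(2) n(1,3) p_def, OF r(2)[unfolded s_def]] by metis
  have L: "leafins (White i) K t p q H" using K'(3) r(1) rot_inj[OF H(2)] K'(2) n(2) by auto
  note K = K'(1) and D = lf_darts[OF K'(1) L] and l = lf_labels[OF K'(1) L]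
  have t: "cl K t = Black" "dl K t = Marked i" using l(3,6) bp n(4) by auto
  note c = lf_subclass[OF K L i(2) t(2,1)]
  have rK: "rot K t = s" using lf_rot(2)[OF K L] s_def by simp
  have sD: "s:darts K" using rK rot_in[OF K] D(1) by metis
  have sp: "s~=p" "s~=q" using sD D by auto
  have rK2: "rot K s = t" using lf_rot(4)[OF K L, of s] r(4) sp t_def by simp
  \<comment> \<open>The assumption that the neighbour is not looped is exactly the condition under
    which the bivalent vertex can be smoothed.\<close>
  have ot: "opp K t~=s" using lf_opp(3)[OF K L sp] os opp_opp[OF K] by auto
  obtain G where G: "is_map G" "subdiv (cl K t) G (opp K s) s t K" using sd_delete[OF K D(1) rK rK2 r(4)[symmetric] ot] by metis
  have S: "subdiv Black G (opp K s) s t K" using G(2) t(1) by simp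
  note DS = sd_darts[OF G(1) S] and ls = sd_labels[OF G(1) S] and vs = sd_vertex[OF G(1) S]
  and cs = sd_subclass[OF G(1) S]
  have "black3 G" unfolding black3_def
  proof (intro ballI impI)
  fix x assume x: "x:darts G" "cl G x = Black"
  have xK: "x:darts K" using x DS by auto
  have "card (vx H x) = card (vx G x)" using vs(1)[OF x(1)] vx_subset[OF G(1) x(1)] DS lf_vertex(1)[OF K L xK] by auto
  then show "3 <= card (vx G x)" using c(3) H(5) xK x ls(1) by auto
  qed
  then have "G:?A" using G(1) H c(1,2) cs core_leafins[OF K L] core_subdiv[OF G(1) S] by (auto simp: Wc_def)
  moreover have "dl G (opp K s) = Marked i" using ls(5) t(2) by simp
  ultimately show ?thesis using DS(1) S L by blast
 qed
 show "(EX f. is_iso f H H')<->(EX f. is_iso f G G'&f h = h')"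
  if A: "G:?A" "G':?A"
  and B: "H:?B" "H':?B" and R: "EX s t p q K. subdiv Black G h s t K&leafins (White i) K t p q H"
  "EX s t p q K. subdiv Black G' h' s t K&leafins (White i) K t p q H'"
  for G h H G' h' H'
 proof -
  obtain s t p q K where S: "subdiv Black G h s t K" and L: "leafins (White i) K t p q H" using R(1) by blast
  obtain s' t' p' q' K' where S': "subdiv Black G' h' s' t' K'" and L': "leafins (White i) K' t' p' q' H'" using R(2) by blast
  note G = WcD(2)[OF A(1)] WcD(2)[OF A(2)]
  note K = sd_is_map[OF G(1) S] sd_is_map[OF G(2) S']
  have HW: "H:Wc r N M g d (insert i I)" "H':Wc r N M g d (insert i I)" using B by auto
  have "leaf i H = q" using lf_darts[OF K(1) L] lf_labels(4)[OF K(1) L] by (intro leaf_eq[OF WcD(4)[OF HW(1)]]) auto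
  moreover have "leaf i H' = q'" using lf_darts[OF K(2) L'] lf_labels(4)[OF K(2) L'] by (intro leaf_eq[OF WcD(4)[OF HW(2)]]) auto
  ultimately have "(EX f. is_iso f H H')<->(EX f. is_iso f H H'&f q = q')" using leaf_iso_ex[OF WcD(2)[OF HW(1)] WcD(2)[OF HW(2)] WcD(4)[OF HW(1)] WcD(4)[OF HW(2)] insertI1] by simp
  then show ?thesis using lf_iso[OF K L L'] sd_iso[OF G S S'] by simp
 qed
 show "wl P V lam z i H = eiv V (z i) (z i) *
  Ts P V G (cv z lam G) (cv z lam G) h (z i) (z i)"
  if A: "G:?A" and h: "h:{h. h:darts G&dl G h = Marked i}" and B: "H:?B"
  and R: "EX s t p q K. subdiv Black G h s t K&leafins (White i) K t p q H" for G h H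
 proof -
  obtain s t p q K where S: "subdiv Black G h s t K" and L: "leafins (White i) K t p q H" using R by blast
  note G = WcD(2)[OF A] and DS = sd_darts[OF WcD(2)[OF A] S] and ls = sd_labels[OF WcD(2)[OF A] S]
  note K = sd_is_map[OF G S]
  note D = lf_darts[OF K L] and l = lf_labels[OF K L]
  have nb: "nbr i H = vx H p" using D l(4) B WcD(4) leaf_eq[of "insert i I"] lf_opp(2)[OF K L] nbr_def by blast
  let ?c = "cv z lam H"
  have cG: "?c x = cv z lam G x" if "x:darts G" for x using that l(2)[of x] ls(2)[of x] DS(11) by (simp add: cv_dl)
  have c: "?c p = z i" "?c q = z i" "?c h = z i" "?c t = z i" using l ls h DS cG[OF DS(1)] by (simp_all add: cv_dl)
  have "dl H s = dl H (opp G h)" using l(2)[of s] l(2)[of "opp G h"] ls(2,6) DS by simp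
  then have cs: "?c s = ?c (opp G h)" by (simp add: cv_dl)
  have "wl P V lam z i H = eiv V (?c p) (?c q) * Tc P V K ?c ?c t (?c t) (?c h)" unfolding wl_def nb using lf_weight[OF K L, of P V ?c ?c] c by simp
  also have "Tc P V K ?c ?c t (?c t) (?c h) = Ts P V G ?c ?c h (?c t) (?c h)" by (rule sd_weight[where a = ?c and b = ?c, OF G S cs cs])
  also have "... = Ts P V G (cv z lam G) (cv z lam G) h (?c t) (?c h)" by (rule Ts_cong[OF G DS(1)]) (simp_all add: cG)
  finally show ?thesis by (simp add: c)
 qed
 show "wl P V lam z i H = wl P V lam z i H'" if "H:?B" "H':?B" "is_iso f H H'" for H H' f using wl_iso[OF _ _ that(3), of "insert i I" i P V lam z] that(1,2) WcD(2,4) by auto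
qed

text \<open>A leaf q joined by p to a vertex with a loop {a, b}. The dart a alone bounds the inner
  face; the other three darts bound the outer one.\<close>

definition loop_shape :: "'m cmap=>nat=>nat=>nat=>nat=>bool" where
 "loop_shape H q p a b<->darts H = {q, p, a, b}&distinct [q, p, a, b]&rot H q = q&rot H p = a &
  rot H a = b&rot H b = p & opp H q = p & opp H p = q & opp H a = b & opp H b = a"

context
 fixes H :: "'m cmap" and q p a b :: nat
 assumes H: "is_map H" and S: "loop_shape H q p a b"
begin

lemma loop_face_perm: "face_perm H p = q" "face_perm H q = b" "face_perm H b = p" "face_perm H a = a" using S fp_iff[OF H] by (auto simp: loop_shape_def)

lemma loop_vx: "vx H q = {q}" "x:{p, a, b}==>vx H x = {p, a, b}"
proof -
 show "vx H q = {q}" using S by (simp add: vertex_at_def orbit_eq_singleton_iff loop_shape_def)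
 have "vx H a = vx H p" "vx H b = vx H p" using S vx_rot[OF H, of p] vx_rot[OF H, of a] by (auto simp: loop_shape_def)
 moreover have "vx H p <= {p, a, b}" unfolding vertex_at_def by (rule orbit_closed_subset) (use S in \<open>auto simp: loop_shape_def\<close>)
 moreover have "{p, a, b} <= vx H p" using calculation(1,2) vx_self[OF H] by auto
 ultimately show "x:{p, a, b}==>vx H x = {p, a, b}" by auto
qed

lemma loop_fc: "fc H a = {a}" "x:{p, q, b}==>fc H x = {p, q, b}"
proof -
 show "fc H a = {a}" using loop_face_perm by (simp add: face_at_def orbit_eq_singleton_iff)
 have "fc H q = fc H p" "fc H b = fc H p" using loop_face_perm fc_face_perm[OF H] by metis+
 moreover have "fc H p <= {p, q, b}" unfolding face_at_def by (rule orbit_closed_subset) (use loop_face_perm in auto)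
 moreover have "{p, q, b} <= fc H p" using calculation(1,2) fc_self[OF H] by auto
 ultimately show "x:{p, q, b}==>fc H x = {p, q, b}" by auto
qed

lemma loop_cells: "vertices H = {{q}, {p, a, b}}" "edges H = {{p, q}, {a, b}}" "faces H = {{a}, {p, q, b}}"
proof -
 have D: "darts H = {q, p, a, b}" and o: "opp H q = p" "opp H p = q" "opp H a = b" "opp H b = a" using S by (auto simp: loop_shape_def)
 note v = loop_vx(1) loop_vx(2)[of p, simplified] loop_vx(2)[of a, simplified] loop_vx(2)[of b, simplified]
 note f = loop_fc(1) loop_fc(2)[of p, simplified] loop_fc(2)[of q, simplified] loop_fc(2)[of b, simplified]
 show "vertices H = {{q}, {p, a, b}}" unfolding vertices_def D by (simp add: v)
 have "edges H = {{q, p}, {p, q}, {a, b}, {b, a}}" unfolding edges_def D by (simp add: o)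
 then show "edges H = {{p, q}, {a, b}}" by (simp add: insert_commute)
 have "faces H = {{p, q, b}, {a}}" unfolding faces_def D by (simp add: f insert_commute)
 then show "faces H = {{a}, {p, q, b}}" by (simp add: insert_commute)
qed

text \<open>Two vertices, two edges and two faces: genus 0 and degree 0. The decoration conditions
  reduce to the two faces, the outer one being marked.\<close>

lemma loop_core:
 "core r N M g d H<->g = 0&d = 0&dl H a~=dl H p&{dl H a, dl H p} <= Marked ` M Un Unmarked ` {1..N} &
  (ALL m:M. Marked m:{dl H a, dl H p})" if "dl H p:Marked ` M"
proof -
 have dist: "distinct [q, p, a, b]" using S by (simp add: loop_shape_def)
 have D: "darts H = {q, p, a, b}" using S by (simp add: loop_shape_def)
 have card: "card (vertices H) = 2" "card (edges H) = 2" "card (faces H) = 2" unfolding loop_cells using dist by (auto simp: card_insert_if doubleton_eq_iff)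
 have "connected_map H" unfolding connected_map_iff[OF H]
 proof (intro conjI allI impI)
  fix T assume T: "T <= darts H&T~={}&(ALL x:T. rot H x:T & opp H x:T)"
  then obtain x where "x:T" "x:{q, p, a, b}" using D by auto
  moreover have step: "q:T==>p:T" "p:T==>q:T&a:T" "a:T==>b:T" "b:T==>p:T" using T S unfolding loop_shape_def by metis+
  ultimately show "T = darts H" using T unfolding D by blast
 qed (use D in auto)
 moreover have "has_genus g H<->g = 0" by (auto simp: has_genus_def card)
 moreover have "map_degree r H = 0" by (simp add: map_degree_def card)
 moreover have dq: "dl H q = dl H p" "dl H b = dl H p" using loop_face_perm dl_face_perm[OF H] by metis+
 moreover have "decorated N M H<->dl H a~=dl H p&{dl H a, dl H p} <= Marked ` M Un Unmarked ` {1..N} &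
  (ALL m:M. Marked m:{dl H a, dl H p})"
 proof -
  have mem: "dl H p:Marked ` M" using that .
  have ne: "fc H a~=fc H p" using loop_fc dist by auto
  have same: "fc H q = fc H p" "fc H b = fc H p" using loop_fc by auto
  have 1: "(ALL h:darts H. dl H h:X)<->{dl H a, dl H p} <= X" for X by (auto simp: dq D)
  have 2: "(EX h:darts H. dl H h = c) <-> c:{dl H a, dl H p}" for c by (auto simp: dq D)
  have 3: "(ALL m:M. ALL h:darts H. ALL h':darts H. dl H h = Marked m&dl H h' = Marked m-->fc H h = fc H h') <->
  dl H a~=dl H p" (is "?L<->_")
  proof
  assume l: ?L
  obtain i where "i:M" "dl H p = Marked i" using mem by blast
  then show "dl H a~=dl H p" using l ne D by auto
  next
  assume r: "dl H a~=dl H p"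
  have fc: "fc H x = fc H y" if "x:darts H" "y:darts H" "dl H x = dl H y" for x y using that r same dq unfolding D by (elim insertE) simp_all
  show ?L by (intro ballI impI, elim conjE, rule fc) simp_all
  qed
  show ?thesis unfolding decorated_iff 1 2 3 by blast
 qed
 ultimately show ?thesis unfolding core_def using H by auto
qed

end

lemma loop_iso:
 assumes "is_map H" "is_map H'" "loop_shape H q p a b" "loop_shape H' q' p' a' b'"
  and "cl H q = cl H' q'" "cl H p = cl H' p'" "dl H p = dl H' p'" "dl H a = dl H' a'"
 shows "EX f. is_iso f H H'"
proof -
 note S = assms(3)[unfolded loop_shape_def] and S' = assms(4)[unfolded loop_shape_def]
 have D: "darts H = {q, p, a, b}" and D': "darts H' = {q', p', a', b'}" using S S' by blast+
 have dist: "q'~=p'" "q'~=a'" "q'~=b'" "p'~=a'" "p'~=b'" "a'~=b'" using S' by auto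
 have r: "rot H q = q" "rot H p = a" "rot H a = b" "rot H b = p" "opp H q = p" "opp H p = q" "opp H a = b" "opp H b = a" using S by blast+
 have r': "rot H' q' = q'" "rot H' p' = a'" "rot H' a' = b'" "rot H' b' = p'" "opp H' q' = p'" "opp H' p' = q'" "opp H' a' = b'" "opp H' b' = a'" using S' by blast+
 define f where "f = id(q := q', p := p', a := a', b := b')"
 have f: "f q = q'" "f p = p'" "f a = a'" "f b = b'" using S by (auto simp: f_def)
 have c: "cl H a = cl H p" "cl H b = cl H p" "cl H' a' = cl H' p'" "cl H' b' = cl H' p'" using S S' cl_rot[OF assms(1)] cl_rot[OF assms(2)] by metis+
 have d: "dl H q = dl H p" "dl H b = dl H p" "dl H' q' = dl H' p'" "dl H' b' = dl H' p'" using loop_face_perm[OF assms(1,3)] loop_face_perm[OF assms(2,4)] dl_face_perm[OF assms(1)] dl_face_perm[OF assms(2)] by metis+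
 have "is_iso f H H'" unfolding is_iso_iff[OF assms(1,2)]
 proof (intro conjI ballI)
  have im: "f ` darts H = darts H'" unfolding D D' by (simp add: f)
  have "card (darts H) = 4" "card (darts H') = 4" unfolding D D' using S dist by auto
  then have "inj_on f (darts H)" using im D by (intro eq_card_imp_inj_on) simp_all
  then show "bij_betw f (darts H) (darts H')" using im by (simp add: bij_betw_def)
  fix x assume "x:darts H"
  then consider "x = q" | "x = p" | "x = a" | "x = b" using D by auto
  then have "f (rot H x) = rot H' (f x)&f (opp H x) = opp H' (f x) & cl H' (f x) = cl H x&dl H' (f x) = dl H x" by cases (simp_all add: r r' f c d assms(5-8))
  then show "f (rot H x) = rot H' (f x)" "f (opp H x) = opp H' (f x)" "cl H' (f x) = cl H x" "dl H' (f x) = dl H x" by blast+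
 qed
 then show ?thesis by blast
qed

lemma loop_ex:
 obtains H :: "'m cmap" where "is_map H" "loop_shape H 0 1 2 3" "cl H 0 = k" "!!x. x:{1, 2, 3} ==> cl H x = Black"
  "dl H 2 = \<beta>" "!!x. x:{0, 1, 3}==>dl H x = ga"
proof -
 let ?D = "{0, 1, 2, 3} :: nat set"
 let ?rh = "%x::nat. if x = 1 then 2 else if x = 2 then 3 else if x = 3 then 1 else x"
 let ?sg = "%x::nat. if x = 0 then 1 else if x = 1 then 0 else if x = 2 then 3 else if x = 3 then 2 else x"
 have rho: "?rh permutes ?D" by (rule bij_imp_permutes) (auto simp: bij_betw_def inj_on_def)
 have sig: "?sg permutes ?D" by (rule involution_permutes) auto
 obtain H :: "'m cmap" where H: "is_map H" "darts H = ?D" "rot H = ?rh" "opp H = ?sg"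
  "!!x. x:?D ==> cl H x = (if x = 0 then k else Black)" "!!x. x:?D==>dl H x = (if x = 2 then \<beta> else ga)"
 proof (rule ex_map[OF _ rho sig, of "%x. if x = 0 then k else Black" "%x. if x = 2 then \<beta> else ga"])
  show "(if y = 2 then \<beta> else ga) = (if h = 2 then \<beta> else ga)" if "h:?D" "?sg h = ?rh y" for h y using that by (elim insertE) (simp_all split: if_splits)
 qed auto
 have S: "loop_shape H 0 1 2 3" unfolding loop_shape_def H(2-4) by auto
 show thesis
 proof (rule that[OF H(1) S])
  show "cl H 0 = k" "dl H 2 = \<beta>" using H(5)[of 0] H(6)[of 2] by simp_all
  show "cl H x = Black" if "x:{1, 2, 3}" for x using H(5)[of x] that by (elim insertE) simp_all
  show "dl H x = ga" if "x:{0, 1, 3}" for x using H(6)[of x] that by (elim insertE) simp_all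
 qed
qed

text \<open>The possible decorations of the inner face of the loop. No leaf besides the new one can
  exist, so I is empty, and every mark other than i has to sit on the inner face. Either M = {i}
  with an unmarked inner face, which gives the sum over the \<lambda>'s, or M has one further mark,
  which gives the two-point term.\<close>

definition loop_labels :: "nat=>nat set=>nat=>int=>nat set=>nat=>nat decoration set" where
 "loop_labels N M g d I i = (if g = 0&d = 0&I = {} then
  {\<beta> : Marked ` M Un Unmarked ` {1..N}. \<beta> ~= Marked i&(ALL m:M. m = i | Marked m = \<beta>)} else {})"

text \<open>The map is determined by the decoration of its inner face, and different decorations
  give nonisomorphic maps; all blocks of \<open>gsum_transfer\<close> are singletons.\<close>

lemma transfer_loop:
 assumes i: "i:M" "i~:I" and fin: "finite M"
 shows "gsum {H:Wc r N M g d (insert i I). card (nbr i H) = 3&looped i H} (wl P V lam z i) =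
  (\<Sum>\<beta>\<in>loop_labels N M g d I i. eiv V (z i) (z i) *
  eiv V (z i) (dec_value z lam \<beta>) * ev P (gg (z i) * gg (z i) * gg (dec_value z lam \<beta>)))"
proof -
 let ?B = "{H:Wc r N M g d (insert i I). card (nbr i H) = 3&looped i H}"
 define X where "X = loop_labels N M g d I i"
 define R where "R \<beta> H<->dl H (rot H (opp H (leaf i H))) = \<beta>" for \<beta> :: "nat decoration" and H
 have shape: "EX q p a b. loop_shape H q p a b&leaf i H = q & opp H q = p & cl H q = White i & cl H p = Black &
  dl H p = Marked i&I = {}&dl H a:X" if H': "H:?B" for H
 proof -
  have HW: "H:Wc r N M g d (insert i I)" and c3: "card (nbr i H) = 3" and nl: "looped i H" using H' by auto
  note H = WcD[OF HW]
  define q where "q = leaf i H"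
  define p where "p = opp H q"
  note n = leaf_neighbour[OF H(2-4) insertI1, folded q_def, folded p_def]
  have bp: "cl H p = Black" using n(9) H(6)[OF n(5)] by (cases "cl H p") auto
  have "card (orbit (rot H) p) = 3" using c3 by (simp add: nbr_def q_def[symmetric] p_def[symmetric] vertex_at_def)
  note o3 = orbit_card_3[OF fin_darts[OF H(2)] rot_permutes[OF H(2)] this]
  define a where "a = rot H p"
  define b where "b = rot H a"
  have r: "rot H b = p" "a~=p" "b~=p" "b~=a" using o3 by (auto simp: a_def b_def)
  have oa: "opp H a = b" using nl by (simp add: looped_def q_def[symmetric] p_def[symmetric] a_def b_def)
  have ob: "opp H b = a" using oa opp_opp[OF H(2)] by metis
  have qn: "q~=a" "q~=b" using n(3,6) r rot_inj[OF H(2)] a_def b_def by metis+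
  have aD: "a:darts H" "b:darts H" using n(5) rot_in[OF H(2)] by (simp_all add: a_def b_def)
  have "{q, p, a, b} = darts H" using H(3) unfolding connected_map_iff[OF H(2)] by (elim conjE allE[of _ "{q, p, a, b}"]) (use n r oa ob aD a_def b_def p_def in auto)
  then have S: "loop_shape H q p a b" unfolding loop_shape_def using n r oa ob qn a_def b_def p_def by auto
  have ca: "cl H a = Black" "cl H b = Black" using bp cl_rot[OF H(2)] a_def b_def by metis+
  \<comment> \<open>Among the four darts only q is white, so every label present is the label of
    q.\<close>
  have I0: "j = i" if "j:insert i I" for j
  proof -
  note x = leaf_in[OF H(4) \<open>j : insert i I\<close>]
  then have "leaf j H = q" using bp ca \<open>{q, p, a, b} = darts H\<close> by auto
  then show ?thesis using x n(2) by simp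
  qed
  then have I: "I = {}" using i(2) by blast
  have "dl H a:X" using n(8) i loop_core[OF H(2) S, of M r N g d] H(1) I X_def loop_labels_def by auto
  then show ?thesis by (intro exI[of _ q] exI[of _ p] exI[of _ a] exI[of _ b]) (use S bp n(2,8) I q_def p_def in auto)
 qed
 have ex: "EX H:?B. R \<beta> H" if b: "\<beta> : X" for \<beta>
 proof -
  obtain H :: "nat cmap" where H: "is_map H" "loop_shape H 0 1 2 3" "cl H 0 = White i" "!!x. x:{1, 2, 3} ==> cl H x = Black"
  "dl H 2 = \<beta>" "!!x. x:{0, 1, 3}==>dl H x = Marked i" using loop_ex[of "White i" \<beta> "Marked i"] by blast
  have I: "I = {}" using b by (auto simp: X_def loop_labels_def split: if_splits)
  have D: "darts H = {0, 1, 2, 3}" using H(2) by (simp add: loop_shape_def)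
  have lf: "leafy (insert i I) H" unfolding leafy_def D I using H(3,4,6) by auto
  have co: "core r N M g d H" using loop_core[OF H(1,2), of M r N g d] H(5,6) i b by (auto simp: X_def loop_labels_def split: if_splits)
  have b3: "black3 H" unfolding black3_def D using H(3) loop_vx(2)[OF H(1,2)] by auto
  have W: "H:Wc r N M g d (insert i I)" unfolding Wc_def using co lf b3 D H(3,4) by auto
  have l: "leaf i H = 0" using lf D H(3) by (intro leaf_eq[OF lf]) auto
  have o: "opp H 0 = 1" "rot H 1 = 2" "rot H 2 = 3" "opp H 2 = 3" using H(2) by (auto simp: loop_shape_def)
  have "card (nbr i H) = 3" using loop_vx(2)[OF H(1,2), of 1] by (simp add: nbr_def l o)
  moreover have "looped i H" unfolding looped_def Let_def l o ..
  ultimately show ?thesis using W H(5) l o by (auto simp: R_def)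
 qed
 have "gsum ?B (wl P V lam z i) = (\<Sum>\<beta>\<in>X. (eiv V (z i) (z i) *
  eiv V (z i) (dec_value z lam \<beta>) * ev P (gg (z i) * gg (z i) * gg (dec_value z lam \<beta>)))
  / of_nat (card {\<beta>}))"
 proof (rule gsum_transfer(2)[where R = R and Q = "%x. {x}"])
  show "is_map H" "card (automorphisms H) = 1" if "H:?B" for H using that WcD(2) rigid_Wc by blast+
  show "finite X" using fin by (auto simp: X_def loop_labels_def)
  show "EX H:?B. R \<beta> H" if "\<beta> : X" for \<beta> by (rule ex[OF that])
  show "EX \<beta>:X. R \<beta> H" if "H:?B" for H using shape[OF that] by (auto simp: R_def loop_shape_def)
  show "(EX f. is_iso f H H')<->\<beta>':{\<beta>}" if B: "H:?B" "H':?B" and RR: "R \<beta> H" "R \<beta>' H'" for \<beta> H \<beta>' H'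
  proof -
  have HW: "H:Wc r N M g d (insert i I)" "H':Wc r N M g d (insert i I)" using B by auto
  note m = WcD(2)[OF HW(1)] WcD(2)[OF HW(2)]
  obtain q p a b where S: "loop_shape H q p a b" "leaf i H = q" "opp H q = p" "cl H q = White i" "cl H p = Black" "dl H p = Marked i" using shape[OF B(1)] by blast
  obtain q' p' a' b' where S': "loop_shape H' q' p' a' b'" "leaf i H' = q'" "opp H' q' = p'" "cl H' q' = White i" "cl H' p' = Black" "dl H' p' = Marked i" using shape[OF B(2)] by blast
  have d: "dl H a = \<beta>" "dl H' a' = \<beta>'" using RR S S' by (auto simp: R_def loop_shape_def)
  show ?thesis
  proof
  assume "EX f. is_iso f H H'"
  then obtain f where f: "is_iso f H H'" by blast
  have "f q = q'" using leaf_iso[OF m f WcD(4)[OF HW(1)] WcD(4)[OF HW(2)] insertI1] S S' by simp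
  moreover have "q:darts H" "p:darts H" "a:darts H" "rot H p = a" "rot H' p' = a'" using S(1) S'(1) by (auto simp: loop_shape_def)
  ultimately have "f a = a'" using f S(3) S'(3) unfolding is_iso_iff[OF m] by metis
  then show "\<beta>':{\<beta>}" using f \<open>a : darts H\<close> d unfolding is_iso_iff[OF m] by force
  next
  assume "\<beta>':{\<beta>}"
  then show "EX f. is_iso f H H'" using loop_iso[OF m S(1) S'(1)] S S' d by simp
  qed
  qed
  show "wl P V lam z i H = eiv V (z i) (z i) *
  eiv V (z i) (dec_value z lam \<beta>) * ev P (gg (z i) * gg (z i) * gg (dec_value z lam \<beta>))"
  if B: "H:?B" and RR: "R \<beta> H" for \<beta> H
  proof -
  have m: "is_map H" using B WcD(2) by blast
  obtain q p a b where S: "loop_shape H q p a b" "leaf i H = q" "opp H q = p" "cl H q = White i" "dl H p = Marked i" using shape[OF B] by blast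
  have dist: "q~=p" "q~=a" "q~=b" "p~=a" "p~=b" "a~=b" using S(1) by (auto simp: loop_shape_def)
  have d: "dl H a = \<beta>" using RR S by (auto simp: R_def loop_shape_def)
  have dq: "dl H q = Marked i" "dl H b = Marked i" using loop_face_perm[OF m S(1)] dl_face_perm[OF m] S(5) by metis+
  have nb: "nbr i H = {p, a, b}" using loop_vx(2)[OF m S(1)] S by (simp add: nbr_def)
  let ?c = "cv z lam H"
  have c: "?c q = z i" "?c p = z i" "?c a = dec_value z lam \<beta>" "?c b = z i" using S d dq by (simp_all add: cv_dl)
  have "vertices H - {{p, a, b}} = {{q}}" unfolding loop_cells[OF m S(1)] using dist by auto
  moreover have "vw V H ?c {q} = 1" using S(4) loop_vx(1)[OF m S(1)] by (simp add: vw_def cl_def)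
  moreover have "{p, q}~={a, b}" using dist by auto
  ultimately show ?thesis using dist by (simp add: wl_def wsp_def nb EW_def loop_cells(2)[OF m S(1)] dd_def c mult_ac)
  qed
  show "wl P V lam z i H = wl P V lam z i H'" if "H:?B" "H':?B" "is_iso f H H'" for H H' f using wl_iso[OF _ _ that(3), of "insert i I" i P V lam z] that(1,2) WcD(2,4) by auto
 qed auto
 then show ?thesis by (simp add: X_def)
qed

lemma Wc_nbr_ge_3:
 assumes "H:Wc r N M g d I" "i:I"
 shows "3 <= card (nbr i H)" "colour H (nbr i H) = Black" "nbr i H:vertices H"
proof -
 note H = WcD[OF assms(1)]
 note n = leaf_neighbour[OF H(2-4) assms(2)]
 have b: "cl H (opp H (leaf i H)) = Black" using n(9) H(6)[OF n(5)] by (cases "cl H (opp H (leaf i H))") auto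
 then show "3 <= card (nbr i H)" using H(5) n(5) by (auto simp: black3_def nbr_def)
 show "colour H (nbr i H) = Black" using b by (simp add: nbr_def cl_def)
 show "nbr i H:vertices H" using n(5) by (simp add: nbr_def vertices_def)
qed

lemma iso_invariantI:
 assumes "!!G H f. G:A==>H:A==>is_iso f G H==>P G==>P H" "!!G. G:A==>is_map G"
  and "G:A" "H:A" "is_iso f G H"
 shows "P G<->P H" using assms is_iso_inv[OF assms(2) assms(2)] by metis

text \<open>The three possible neighbours combined: degree at least four, trivalent, and trivalent
  with a loop. P is arbitrary because (i) uses - V' whereas (iv) uses (u - z1) V'.\<close>

lemma gsum_leaf:
 assumes i: "i:M" "i~:I" and fin: "finite M" "finite I"
  and x_def: "x = z i"
 shows "gsum (Wc r N M g d (insert i I)) (wl P V lam z i) =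
  eiv V x x * (\<Sum>G\<in>reps (Wc r N M g d I). (\<Sum>h | h:darts G&dl G h = Marked i.
  Tc P V G (cv z lam G) (cv z lam G) h x x +
  Ts P V G (cv z lam G) (cv z lam G) h x x) / of_nat (card (automorphisms G))) +
  (\<Sum>\<beta>\<in>loop_labels N M g d I i. eiv V x x *
  eiv V x (dec_value z lam \<beta>) * ev P (gg x * gg x * gg (dec_value z lam \<beta>)))"
proof -
 let ?W = "Wc r N M g d (insert i I)" and ?w = "wl P V lam z i"
 have fW: "finite (reps ?W)" using fin by (intro finite_reps_Wc) auto
 have m: "is_map G" if "G:?W" for G using WcD(2)[OF that] .
 have nb: "card (nbr i H) = card (nbr i G)" "looped i G==>looped i H" if "G:?W" "H:?W" "is_iso f G H" for G H f
 proof -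
  note W = WcD[OF that(1)] and W' = WcD[OF that(2)]
  show "card (nbr i H) = card (nbr i G)" by (rule nbr_iso(2)[OF W(2) W'(2) that(3) W(4) W'(4) insertI1])
  have l: "leaf i H = f (leaf i G)" by (rule leaf_iso[OF W(2) W'(2) that(3) W(4) W'(4) insertI1])
  define p where "p = opp G (leaf i G)"
  have D: "leaf i G:darts G" "p:darts G" "rot G p:darts G" "rot G (rot G p):darts G" using leaf_in[OF W(4) insertI1] W(2) by (simp_all add: p_def opp_in rot_in)
  have c: "f (rot G h) = rot H (f h)" "f (opp G h) = opp H (f h)" if "h:darts G" for h using \<open>is_iso f G H\<close> that by (auto simp: is_iso_def)
  show "looped i H" if "looped i G" using that D c unfolding looped_def l Let_def p_def[symmetric] by (metis p_def)
 qed
 have 1: "gsum ?W ?w = gsum {H:?W. 4 <= card (nbr i H)} ?w + gsum {H:?W. ~ 4 <= card (nbr i H)} ?w" using nb(1) by (intro gsum_split[OF fW]) metis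
 have e: "{H:?W. ~ 4 <= card (nbr i H)} = {H:?W. card (nbr i H) = 3}" using Wc_nbr_ge_3(1)[OF _ insertI1] by force
 have r3: "reps {H:?W. card (nbr i H) = 3} = {H:reps ?W. card (nbr i H) = 3}" by (rule reps_Collect) (use nb(1) in metis)
 have 2: "gsum {H:?W. card (nbr i H) = 3} ?w =
  gsum {H:{H:?W. card (nbr i H) = 3}. looped i H} ?w + gsum {H:{H:?W. card (nbr i H) = 3}. ~ looped i H} ?w"
 proof (rule gsum_split)
  show "finite (reps {H:?W. card (nbr i H) = 3})" unfolding r3 using fW by simp
  show "looped i G<->looped i H" if "G:{H:?W. card (nbr i H) = 3}" "H:{H:?W. card (nbr i H) = 3}" "is_iso f G H" for G H f
  proof (rule iso_invariantI[where A = ?W])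
  show "G:?W" "H:?W" "is_iso f G H" using that by auto
  qed (use nb(2) m in blast)+
 qed
 have 3: "{H:{H:?W. card (nbr i H) = 3}. looped i H} = {H:?W. card (nbr i H) = 3&looped i H}"
  "{H:{H:?W. card (nbr i H) = 3}. ~ looped i H} = {H:?W. card (nbr i H) = 3 & ~ looped i H}" by auto
 show ?thesis unfolding 1 e 2 3 transfer_corner[OF i fin] transfer_side[OF i fin] transfer_loop[OF i fin(1)] x_def by (simp add: sum_distrib_left sum.distrib add_divide_distrib distrib_left sum_divide_distrib mult.assoc)
qed

section \<open>Maps with a square vertex next to a leaf\<close>

text \<open>All square darts lie at one vertex; its existence follows from the last condition, which
  places it at the other end of the edge of leaf i.\<close>

definition Uc :: "nat=>nat=>nat set=>nat=>int=>nat set=>nat=>nat cmap set" where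
 "Uc r N M g d I i = {G. core r N M g d G&leafy I G&black3 G &
  (ALL h:darts G. ALL h':darts G. cl G h = Square & cl G h' = Square-->vx G h = vx G h') &
  cl G (opp G (leaf i G)) = Square}"

lemma UcD:
 assumes "G:Uc r N M g d I i"
 shows "core r N M g d G" "is_map G" "connected_map G" "leafy I G" "black3 G"
  "h:darts G==>h':darts G ==> cl G h = Square ==> cl G h' = Square==>vx G h = vx G h'"
  "cl G (opp G (leaf i G)) = Square"
proof -
 show "core r N M g d G" "leafy I G" "black3 G" "cl G (opp G (leaf i G)) = Square"
  "h:darts G==>h':darts G ==> cl G h = Square ==> cl G h' = Square==>vx G h = vx G h'" using assms unfolding Uc_def by blast+
 then show "is_map G" "connected_map G" by (auto simp: core_def)
qed

lemma Uc_square: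
 assumes "G:Uc r N M g d I i" "i:I"
 shows "nbr i G:vertices G" "colour G (nbr i G) = Square"
  "x:darts G ==> cl G x = Square<->x:nbr i G"
  "y:vertices G ==> colour G y = Square==>y = nbr i G"
proof -
 note G = UcD[OF assms(1)]
 have p: "opp G (leaf i G):darts G" using leaf_in[OF G(4) assms(2)] opp_in[OF G(2)] by simp
 show v: "nbr i G:vertices G" using p by (simp add: nbr_def vertices_def)
 show "colour G (nbr i G) = Square" using G(7) by (simp add: nbr_def cl_def)
 show sq: "x:darts G ==> cl G x = Square<->x:nbr i G" for x using G(6)[OF _ p _ G(7), of x] vx_eq[OF G(2), of x "opp G (leaf i G)"] cl_vertex[OF G(2), of x] G(7) by (auto simp: nbr_def)
 show "y:vertices G ==> colour G y = Square==>y = nbr i G" using G(6)[OF _ p _ G(7)] by (auto simp: vertices_def nbr_def cl_def)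
qed

lemma rigid_Uc:
 assumes "G:Uc r N M g d I i" "i:I"
 shows "card (automorphisms G) = 1"
proof -
 note G = UcD[OF assms(1)]
 show ?thesis by (metis automorphisms_trivial[OF G(2,3) leaf_in(1)[OF G(4) assms(2)]] leaf_iso[OF G(2,2) _ G(4,4) assms(2)])
qed

lemma finite_reps_Uc:
 assumes "finite M" "finite I"
 shows "finite (reps (Uc r N M g d I i))"
proof (rule finite_reps_class[where C = "insert Square (White ` I)" and r = r and d = d and N = N and M = M])
 show "cl G h:insert Black (insert Square (White ` I))" if "G:Uc r N M g d I i" "h:darts G" for G h using UcD(4)[OF that(1)] that(2) leafy_cl(1) by (cases "cl G h") auto
 show "vx G h = vx G h'" if "G:Uc r N M g d I i" "h:darts G" "h':darts G" "cl G h = cl G h'" "cl G h~=Black" for G h h' using UcD(4,6)[OF that(1)] that leafy_cl(3) by (cases "cl G h") metis+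
qed (use assms in \<open>auto simp: Uc_def core_def\<close>)

lemma nbr_iso_Uc:
 assumes "G:Uc r N M g d I i" "H:Uc r N M g d I i" "is_iso f G H" "i:I"
 shows "card (nbr i H) = card (nbr i G)" "wl P V lam z i H = wl P V lam z i G" by (rule nbr_iso(2)[OF UcD(2)[OF assms(1)] UcD(2)[OF assms(2)] assms(3) UcD(4)[OF assms(1)] UcD(4)[OF assms(2)] assms(4)],
  rule wl_iso[OF UcD(2)[OF assms(1)] UcD(2)[OF assms(2)] assms(3) UcD(4)[OF assms(1)] UcD(4)[OF assms(2)] assms(4)])

definition recolour :: "nat set => colour=>'m cmap=>'m cmap=>bool" where
 "recolour X k G H<->darts H = darts G&rot H = rot G & opp H = opp G &
  (ALL x:darts G. dl H x = dl G x & cl H x = (if x:X then k else cl G x))"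

lemma recolour_ex:
 assumes "is_map (G :: 'm cmap)" "X:vertices G"
 obtains H where "is_map H" "recolour X k G H"
proof -
 obtain H :: "'m cmap" where "is_map H" "darts H = darts G" "rot H = rot G" "opp H = opp G"
  "!!h. h:darts G ==> cl H h = (if h:X then k else cl G h)" "!!h. h:darts G==>dl H h = dl G h"
 proof (rule ex_map[OF fin_darts[OF assms(1)] rot_permutes[OF assms(1)] opp_permutes[OF assms(1)], of
  "%h. if h:X then k else cl G h" "dl G"])
  show "opp G h~=h & opp G (opp G h) = h" if "h:darts G" for h using that opp_neq[OF assms(1)] opp_opp[OF assms(1)] by auto
  have "rot G h:X<->h:X" for h
  proof -
  obtain y where "X = vx G y" using assms(2) by (auto simp: vertices_def)
  then show ?thesis using vx_eq[OF assms(1)] vx_rot[OF assms(1)] by simp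
  qed
  then show "(if rot G h:X then k else cl G (rot G h)) = (if h:X then k else cl G h)" for h using cl_rot[OF assms(1)] by simp
  show "dl G y = dl G h" if "opp G h = rot G y" for h y using that fp_iff[OF assms(1)] dl_face_perm[OF assms(1)] by metis
 qed blast
 then show thesis using that[of H] by (auto simp: recolour_def)
qed

context
 fixes X :: "nat set" and k :: colour and G H :: "nat cmap"
 assumes G: "is_map G" and H: "is_map H" and R: "recolour X k G H"
begin

lemma recolour_simps: "darts H = darts G" "rot H = rot G" "opp H = opp G"
  "x:darts G==>dl H x = dl G x" "x:darts G ==> cl H x = (if x:X then k else cl G x)" using R by (auto simp: recolour_def)

lemma recolour_cells: "vx H = vx G" "fc H = fc G" "vertices H = vertices G" "edges H = edges G" "faces H = faces G"
proof -
 show 1: "vx H = vx G" "fc H = fc G" unfolding vertex_at_def[abs_def] face_at_def[abs_def] face_perm_def recolour_simps(2,3) by (rule refl)+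
 show "vertices H = vertices G" "edges H = edges G" "faces H = faces G" unfolding vertices_def edges_def faces_def 1 recolour_simps(1,3) by simp_all
qed

lemma recolour_core: "core r N M g d H <-> core r N M g d G"
proof -
 have "connected_map H <-> connected_map G" unfolding connected_map_iff[OF G] connected_map_iff[OF H] recolour_simps(1-3) ..
 moreover have "has_genus g H<->has_genus g G" "map_degree r H = map_degree r G" by (simp_all add: has_genus_def map_degree_def recolour_cells)
 moreover have "decorated N M H<->decorated N M G" using recolour_simps(4) by (simp add: decorated_iff recolour_cells recolour_simps(1))
 ultimately show ?thesis using G H by (simp add: core_def)
qed

lemma recolour_leafy:
 assumes "!!i. k~=White i" "!!x i. x:X ==> cl G x~=White i"
 shows "leafy I H<->leafy I G"
proof -
 have "cl H x = White i <-> cl G x = White i" if "x:darts G" for x i using recolour_simps(5)[OF that] assms by auto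
 then show ?thesis using recolour_simps(4) by (simp add: leafy_def recolour_simps(1))
qed

lemma recolour_leaf:
 assumes "!!i. k~=White i" "!!x i. x:X ==> cl G x~=White i" "leafy I G" "i:I"
 shows "leaf i H = leaf i G" "nbr i H = nbr i G"
proof -
 have "leafy I H" using recolour_leafy[OF assms(1,2)] assms(3) by simp
 moreover have "cl H (leaf i G) = White i" "leaf i G:darts H" using recolour_simps(5)[of "leaf i G"] leaf_in[OF assms(3,4)] assms(2) by (auto simp: recolour_simps(1))
 ultimately show l: "leaf i H = leaf i G" using leaf_eq by blast
 show "nbr i H = nbr i G" by (simp add: nbr_def l recolour_simps(3) recolour_cells)
qed

end

text \<open>From degree three on, a square vertex can be painted black and back. The weight
  \<open>wl\<close> does not notice, since it replaces the factor of the neighbour anyway. Leaf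
  labels make both sides rigid, so the leaf serves as the distinguished dart.\<close>

lemma transfer_recolour:
 assumes i: "i:I" and fin: "finite M" "finite I"
 shows "gsum {H:Uc r N M g d I i. 3 <= card (nbr i H)} (wl P V lam z i) = gsum (Wc r N M g d I) (wl P V lam z i)"
proof -
 let ?A = "Wc r N M g d I" and ?B = "{H:Uc r N M g d I i. 3 <= card (nbr i H)}"
 have nb: "cl G x = Black" if "G:?A" "x:nbr i G" for G x by (metis that cl_vertex[OF WcD(2)[OF that(1)]] nbr_def Wc_nbr_ge_3(2)[OF that(1) i] cl_def)
 have "gsum ?B (wl P V lam z i) = (\<Sum>G\<in>reps ?A. (\<Sum>h\<in>{leaf i G}. wl P V lam z i G) / of_nat (card (automorphisms G)))"
 proof (rule gsum_transfer_pointed(2)[where R = "%G h H. recolour (nbr i G) Square G H"])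
  show "is_map G" "connected_map G" if "G:?A" for G using WcD[OF that] by blast+
  show "finite (reps ?A)" by (rule finite_reps_Wc[OF fin])
  show "is_map H" "card (automorphisms H) = 1" if "H:?B" for H using that UcD(2) rigid_Uc[OF _ i] by blast+
  show "{leaf i G} <= darts G" if "G:?A" for G using leaf_in[OF WcD(4)[OF that] i] by simp
  show "f h:{leaf i G'}" if "G:?A" "G':?A" "is_iso f G G'" "h:{leaf i G}" for G G' f h using leaf_iso[OF WcD(2)[OF that(1)] WcD(2)[OF that(2)] that(3) WcD(4)[OF that(1)] WcD(4)[OF that(2)] i] that(4) by simp
  show "EX H:?B. recolour (nbr i G) Square G H" if A: "G:?A" for G
  proof -
  note G = WcD[OF A]
  obtain H where H: "is_map H" "recolour (nbr i G) Square G H" using recolour_ex[OF G(2) Wc_nbr_ge_3(3)[OF A i]] by blast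
  note s = recolour_simps[OF G(2) H] and c = recolour_cells[OF G(2) H]
  have nw: "cl G x~=White j" if "x:nbr i G" for x j using nb[OF A that] by simp
  have lf: "leafy I H" "leaf i H = leaf i G" "nbr i H = nbr i G" using recolour_leafy[OF G(2) H _ nw] recolour_leaf[OF G(2) H _ nw G(4) i] G(4) by auto
  have p: "opp G (leaf i G):darts G" "opp G (leaf i G):nbr i G" using leaf_in[OF G(4) i] opp_in[OF G(2)] vx_self[OF G(2)] by (auto simp: nbr_def)
  have sq: "cl H x = Square<->x:nbr i G" if "x:darts G" for x using s(5)[OF that] G(6)[OF that] by auto
  have "black3 H" unfolding black3_def s(1) c(1)
  proof (intro ballI impI)
  fix x assume x: "x:darts G" "cl H x = Black"
  then have "cl G x = Black" using s(5)[OF x(1)] by (auto split: if_splits)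
  then show "3 <= card (vx G x)" using G(5) x(1) by (auto simp: black3_def)
  qed
  moreover have "vx H x = vx H y" if "x:darts H" "y:darts H" "cl H x = Square" "cl H y = Square" for x y using that sq vx_eq[OF G(2)] by (simp add: s(1) c(1) nbr_def)
  moreover have "cl H (opp H (leaf i H)) = Square" using sq[OF p(1)] p(2) by (simp add: lf s(3))
  moreover have "core r N M g d H" using recolour_core[OF G(2) H] G(1) by simp
  ultimately have "H:Uc r N M g d I i" unfolding Uc_def using lf(1) by blast
  then show ?thesis using Wc_nbr_ge_3(1)[OF A i] lf(3) H(2) by auto
  qed
  show "EX G:?A. EX h:{leaf i G}. recolour (nbr i G) Square G H" if B: "H:?B" for H
  proof -
  have HU: "H:Uc r N M g d I i" and c3: "3 <= card (nbr i H)" using B by auto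
  note H = UcD[OF HU] and sq = Uc_square[OF HU i]
  obtain G where G: "is_map G" "recolour (nbr i H) Black H G" using recolour_ex[OF H(2) sq(1)] by blast
  note s = recolour_simps[OF H(2) G] and c = recolour_cells[OF H(2) G]
  have nsub: "nbr i H <= darts H" using in_verticesD(3)[OF H(2) sq(1)] .
  have nw: "cl H x~=White j" if "x:nbr i H" for x j using sq(3)[of x] that nsub by auto
  have lf: "leafy I G" "leaf i G = leaf i H" "nbr i G = nbr i H" using recolour_leafy[OF H(2) G _ nw] recolour_leaf[OF H(2) G _ nw H(4) i] H(4) by auto
  have "black3 G" unfolding black3_def s(1) c(1)
  proof (intro ballI impI)
  fix x assume x: "x:darts H" "cl G x = Black"
  show "3 <= card (vx H x)" by (metis vx_eq[OF H(2)] nbr_def c3 s(5)[OF x(1)] x H(5) black3_def)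
  qed
  moreover have "cl G x~=Square" if "x:darts G" for x using s(5)[of x] sq(3)[of x] that by (auto simp: s(1))
  moreover have "core r N M g d G" using recolour_core[OF H(2) G] H(1) by simp
  ultimately have "G:?A" unfolding Wc_def using lf(1) by blast
  moreover have "recolour (nbr i G) Square G H" unfolding recolour_def lf(3) using s sq(3) by auto
  ultimately show ?thesis by blast
  qed
  show "(EX f. is_iso f H H')<->(EX f. is_iso f G G'&f h = h')"
  if A: "G:?A" "G':?A" and h: "h:{leaf i G}" "h':{leaf i G'}" and B: "H:?B" "H':?B"
  and R: "recolour (nbr i G) Square G H" "recolour (nbr i G') Square G' H'" for G h H G' h' H'
  proof -
  note G = WcD[OF A(1)] and G' = WcD[OF A(2)]
  have HU: "H:Uc r N M g d I i" "H':Uc r N M g d I i" using B by auto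
  note H = UcD[OF HU(1)] and H' = UcD[OF HU(2)]
  note s = recolour_simps[OF G(2) H(2) R(1)] and s' = recolour_simps[OF G'(2) H'(2) R(2)]
  have nw: "cl G x~=White j" if "x:nbr i G" for x j using nb[OF A(1) that] by simp
  have nw': "cl G' x~=White j" if "x:nbr i G'" for x j using nb[OF A(2) that] by simp
  have n: "nbr i H = nbr i G" "nbr i H' = nbr i G'" using recolour_leaf(2)[OF G(2) H(2) R(1) _ nw G(4) i] recolour_leaf(2)[OF G'(2) H'(2) R(2) _ nw' G'(4) i] by auto
  have imp: "f x:nbr i G'<->x:nbr i G" if "nbr i G' = f ` nbr i G" "bij_betw f (darts G) (darts G')" "x:darts G" for f x
  proof -
  have "nbr i G <= darts G" using in_verticesD(3)[OF G(2) Wc_nbr_ge_3(3)[OF A(1) i]] .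
  then show ?thesis using that by (auto simp: bij_betw_def dest: inj_onD)
  qed
  have "is_iso f H H'<->is_iso f G G'" for f
  proof
  assume f: "is_iso f G G'"
  have "nbr i G' = f ` nbr i G" by (rule nbr_iso(1)[OF G(2) G'(2) f G(4) G'(4) i])
  note e = imp[OF this]
  show "is_iso f H H'" using f e s(4,5) s'(4,5) unfolding is_iso_iff[OF G(2) G'(2)] is_iso_iff[OF H(2) H'(2)] s(1-3) s'(1-3) by (auto dest: bij_betwE)
  next
  assume f: "is_iso f H H'"
  have "nbr i H' = f ` nbr i H" by (rule nbr_iso(1)[OF H(2) H'(2) f H(4) H'(4) i])
  note e = imp[OF this[unfolded n]]
  have *: "cl G' (f x) = cl G x" if x: "x:darts G" "f x:darts G'" "cl H' (f x) = cl H x" "f x:nbr i G'<->x:nbr i G" for x using s(5)[OF x(1)] s'(5)[OF x(2)] x(3,4) nb[OF A(1)] nb[OF A(2)] by (cases "x:nbr i G") auto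
  show "is_iso f G G'" using f e s(4) s'(4) * unfolding is_iso_iff[OF G(2) G'(2)] is_iso_iff[OF H(2) H'(2)] s(1-3) s'(1-3) by (auto dest: bij_betwE)
  qed
  then show ?thesis using leaf_iso_ex[OF G(2) G'(2) G(4) G'(4) i] h by auto
  qed
  show "wl P V lam z i H = wl P V lam z i G" if A: "G:?A" and B: "H:?B" and R: "recolour (nbr i G) Square G H" for G H
  proof -
  note G = WcD[OF A]
  have H: "is_map H" using B UcD(2) by blast
  note s = recolour_simps[OF G(2) H R] and c = recolour_cells[OF G(2) H R]
  have nw: "cl G x~=White j" if "x:nbr i G" for x j using nb[OF A that] by simp
  have n: "nbr i H = nbr i G" using recolour_leaf(2)[OF G(2) H R _ nw G(4) i] by auto
  have cv: "cv z lam H x = cv z lam G x" if "x:darts G" for x using s(4)[OF that] by (simp add: cv_dl)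
  have "EW V (cv z lam H) H = EW V (cv z lam G) G" using EW_cong[OF G(2) cv, of "%x. x" V] EW_cong[OF G(2), of "cv z lam H" "cv z lam G"] cv by (simp add: EW_def c(4))
  moreover have "vw V H (cv z lam H) x = vw V G (cv z lam G) x" if x: "x:vertices G - {nbr i G}" for x
  proof -
  obtain y where y: "y:darts G" "x = vx G y" using x by (auto simp: vertices_def)
  have "y~:nbr i G" using x y vx_eq[OF G(2)] by (auto simp: nbr_def)
  then have "colour H x = colour G x" using s(5)[OF y(1)] y by (simp add: cl_def c(1))
  moreover have "dd (pderiv V) x (cv z lam H) = dd (pderiv V) x (cv z lam G)" using in_verticesD(3)[OF G(2), of x] x cv by (intro dd_cong) auto
  ultimately show ?thesis by (simp add: vw_def)
  qed
  moreover have "dd P (nbr i G) (cv z lam H) = dd P (nbr i G) (cv z lam G)" using in_verticesD(3)[OF G(2) Wc_nbr_ge_3(3)[OF A i]] cv by (intro dd_cong) auto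
  ultimately show ?thesis by (simp add: wl_def wsp_def n c(3))
  qed
  show "wl P V lam z i H = wl P V lam z i H'" if "H:?B" "H':?B" "is_iso f H H'" for H H' f using nbr_iso_Uc(2)[OF _ _ that(3) i] that by auto
 qed
 then show ?thesis by (simp add: gsum_def)
qed

text \<open>A bivalent square vertex subdivides the edge of the leaf. Both halves lie entirely in
  the face marked i, so one of the two equal edge weights is the edge of the smaller map and the
  other one remains as a factor 1/V''.\<close>

lemma transfer_subdiv_square:
 assumes i: "i:I" and fin: "finite M" "finite I" and nz: "ev (pderiv V) (gg (z i) * gg (z i))~=0"
 shows "gsum {H:Uc r N M g d I i. card (nbr i H) = 2} (wl P V lam z i) =
  eiv V (z i) (z i) * ev P (gg (z i) * gg (z i)) *
  gsum (Wc r N M g d I) (%G. wtc V z lam G)"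
proof -
 let ?A = "Wc r N M g d I" and ?B = "{H:Uc r N M g d I i. card (nbr i H) = 2}"
 let ?w = "%G. eiv V (z i) (z i) * ev P (gg (z i) * gg (z i)) * wtc V z lam G"
 have lfH: "leafy I H&leaf i H = leaf i G&nbr i H = {s, t}"
  if A: "G:?A" and S: "subdiv Square G (leaf i G) s t H" for G s t H
 proof -
  note G = WcD[OF A] and D = sd_darts[OF WcD(2)[OF A] S] and l = sd_labels[OF WcD(2)[OF A] S]
  have lf: "leafy I H" unfolding leafy_def D(11) using G(4)[unfolded leafy_def] l(1-4) by simp
  have "leaf i H = leaf i G" using leaf_in[OF G(4) i] l(1) D(11) by (intro leaf_eq[OF lf]) auto
  moreover have "opp H (leaf i G) = s" using sd_opp(1)[OF G(2) S] .
  ultimately show ?thesis using sd_vertex(2)[OF G(2) S] lf by (simp add: nbr_def)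
 qed
 have "gsum ?B (wl P V lam z i) = (\<Sum>G\<in>reps ?A. (\<Sum>h\<in>{leaf i G}. ?w G) / of_nat (card (automorphisms G)))"
 proof (rule gsum_transfer_pointed(2)[where R = "%G h H. EX s t. subdiv Square G h s t H"])
  show "is_map G" "connected_map G" if "G:?A" for G using WcD[OF that] by blast+
  show "finite (reps ?A)" by (rule finite_reps_Wc[OF fin])
  show "is_map H" "card (automorphisms H) = 1" if "H:?B" for H using that UcD(2) rigid_Uc[OF _ i] by blast+
  show "{leaf i G} <= darts G" if "G:?A" for G using leaf_in[OF WcD(4)[OF that] i] by simp
  show "f h:{leaf i G'}" if "G:?A" "G':?A" "is_iso f G G'" "h:{leaf i G}" for G G' f h using leaf_iso[OF WcD(2)[OF that(1)] WcD(2)[OF that(2)] that(3) WcD(4)[OF that(1)] WcD(4)[OF that(2)] i] that(4) by simp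
  show "EX H:?B. EX s t. subdiv Square G h s t H" if A: "G:?A" and h: "h:{leaf i G}" for G h
  proof -
  note G = WcD[OF A]
  obtain s t H where S: "subdiv Square G (leaf i G) s t H" using sd_ex[OF G(2) leaf_in(1)[OF G(4) i]] .
  note D = sd_darts[OF G(2) S] and l = sd_labels[OF G(2) S] and v = sd_vertex[OF G(2) S]
  note lf = lfH[OF A S]
  have "black3 H" unfolding black3_def D(11) using l(1-4) G(5) v(1) by (simp add: black3_def)
  moreover have "vx H x = vx H y" if "x:darts H" "y:darts H" "cl H x = Square" "cl H y = Square" for x y using that l(1-4) G(6) v(2,3) unfolding D(11) by auto
  moreover have "cl H (opp H (leaf i H)) = Square" using lf sd_opp(1)[OF G(2) S] l(3) by simp
  moreover have "core r N M g d H" using core_subdiv[OF G(2) S] G(1) by simp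
  ultimately have "H:Uc r N M g d I i" unfolding Uc_def using lf by blast
  then have "H:?B" using lf D(4) by simp
  then show ?thesis using S h by blast
  qed
  show "EX G:?A. EX h:{leaf i G}. EX s t. subdiv Square G h s t H" if B: "H:?B" for H
  proof -
  have HU: "H:Uc r N M g d I i" and c2: "card (nbr i H) = 2" using B by auto
  note H = UcD[OF HU] and sq = Uc_square[OF HU i]
  define q where "q = leaf i H"
  define s where "s = opp H q"
  define t where "t = rot H s"
  note n = leaf_neighbour[OF H(2-4) i, folded q_def, folded s_def]
  have nb: "nbr i H = orbit (rot H) s" by (simp add: nbr_def q_def[symmetric] s_def[symmetric] vertex_at_def)
  note e = orbit_enum[OF fin_darts[OF H(2)] rot_permutes[OF H(2)], of 2 s, unfolded nb[symmetric], OF c2[symmetric]]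
  have r: "rot H t = s" "t~=s" using e(3) inj_onD[OF e(2), of 1 0] by (auto simp: numeral_2_eq_2 t_def)
  have nbt: "nbr i H = {s, t}" using e(1) by (auto simp: numeral_2_eq_2 t_def lessThan_Suc)
  have tD: "t:darts H" using n(5) rot_in[OF H(2)] by (simp add: t_def)
  have tq: "t~=q" using n(3) r n(6) by metis
  have ct: "cl H t = Square" using sq(3)[OF tD] nbt by simp
  obtain G where G: "is_map G" "subdiv (cl H t) G (opp H s) s t H" by (metis tq n(7) opp_opp[OF H(2)] sd_delete[OF H(2) tD r(1) t_def[symmetric] r(2)[symmetric]])
  have S: "subdiv Square G q s t H" using G(2) ct n(7) by simp
  note D = sd_darts[OF G(1) S] and l = sd_labels[OF G(1) S] and v = sd_vertex[OF G(1) S]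
  have lf: "leafy I G" using H(4) unfolding leafy_def D(11) using l(1-4) by simp
  have q: "leaf i G = q" using D(1) l(1)[of q] n(2) by (intro leaf_eq[OF lf]) auto
  have "black3 G" unfolding black3_def using H(5)[unfolded black3_def] D(11) l(1) v(1) by force
  moreover have "cl G x~=Square" if "x:darts G" for x using sq(3)[of x] l(1)[OF that] that D(2,3,11) nbt by auto
  moreover have "core r N M g d G" using core_subdiv[OF G(1) S] H(1) by simp
  ultimately have "G:?A" unfolding Wc_def using lf by blast
  then show ?thesis using S q by blast
  qed
  show "(EX f. is_iso f H H')<->(EX f. is_iso f G G'&f h = h')"
  if A: "G:?A" "G':?A" and h: "h:{leaf i G}" "h':{leaf i G'}" and B: "H:?B" "H':?B"
  and R: "EX s t. subdiv Square G h s t H" "EX s t. subdiv Square G' h' s t H'" for G h H G' h' H'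
  proof -
  have hh: "h = leaf i G" "h' = leaf i G'" using h by auto
  obtain s t where S: "subdiv Square G (leaf i G) s t H" using R(1) hh by blast
  obtain s' t' where S': "subdiv Square G' (leaf i G') s' t' H'" using R(2) hh by blast
  note G = WcD[OF A(1)] and G' = WcD[OF A(2)]
  note m = sd_is_map[OF G(2) S] sd_is_map[OF G'(2) S']
  note l = lfH[OF A(1) S] and l' = lfH[OF A(2) S']
  have r: "opp H (leaf i H) = s" "rot H s = t" "opp H' (leaf i H') = s'" "rot H' s' = t'" using sd_opp(1)[OF G(2) S] sd_rot(1)[OF G(2) S] sd_opp(1)[OF G'(2) S'] sd_rot(1)[OF G'(2) S'] l l' by simp_all
  have lm: "leaf i H:darts H" "s:darts H" using leaf_in[of I H i] l i sd_darts(11)[OF G(2) S] by auto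
  have "f t = t'" if f: "is_iso f H H'" for f by (metis leaf_iso[OF m f _ _ i] l l' f lm(1) r is_iso_def lm(2))
  then have "(EX f. is_iso f H H')<->(EX f. is_iso f H H'&f t = t')" by auto
  then show ?thesis using sd_iso[OF G(2) G'(2) S S'] hh by simp
  qed
  show "wl P V lam z i H = ?w G" if A: "G:?A" and h: "h:{leaf i G}" and B: "H:?B" and R: "EX s t. subdiv Square G h s t H" for G h H
  proof -
  obtain s t where S: "subdiv Square G (leaf i G) s t H" using R h by blast
  note G = WcD[OF A] and D = sd_darts[OF WcD(2)[OF A] S] and l = sd_labels[OF WcD(2)[OF A] S]
  and v = sd_vertex[OF WcD(2)[OF A] S] and e = sd_edges[OF WcD(2)[OF A] S]
  let ?c = "cv z lam H" and ?d = "cv z lam G" and ?q = "leaf i G"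
  have cv: "?c x = ?d x" if "x:darts G" for x using l(2)[OF that] by (simp add: cv_dl)
  note n = leaf_neighbour[OF G(2-4) i]
  have d: "?d ?q = z i" "?d (opp G ?q) = z i" using n(4,8) by (simp_all add: cv_dl)
  then have c: "?c ?q = z i" "?c (opp G ?q) = z i" "?c s = z i" "?c t = z i" using cv[OF D(1)] cv[OF D(5)] l(5,6) n(4,8) by (simp_all add: cv_dl)
  let ?D = "ev (pderiv V) (gg (z i) * gg (z i))"
  let ?R = "\<Prod>e\<in>edges G - {{?q, opp G ?q}}. inverse (dd (pderiv V) e ?d)"
  have "(\<Prod>e\<in>edges G - {{?q, opp G ?q}}. inverse (dd (pderiv V) e ?c)) = ?R" using in_edgesD(2)[OF G(2)] cv by (intro prod.cong refl arg_cong[of _ _ inverse] dd_cong) blast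
  then have E: "EW V ?c H = inverse ?D * inverse ?D * ?R" unfolding EW_def e(1) using e(2-4) finite_edges[OF G(2)] D c by (simp add: dd_def)
  have "EW V ?d G = inverse ?D * ?R" unfolding EW_def prod.remove[OF finite_edges[OF G(2)] e(5)] using D(6) d by (simp add: dd_def eq_commute)
  then have E': "EW V ?c H = inverse ?D * EW V ?d G" using E by simp
  have "vertices H - {{s, t}} = vertices G" unfolding v(4) using v(5) by auto
  moreover have "vw V H ?c x = vw V G ?d x" if x: "x:vertices G" for x
  proof -
  obtain y where y: "y:darts G" "x = vx G y" using x by (auto simp: vertices_def)
  then have "colour H x = colour G x" using v(1)[OF y(1)] l(1)[OF y(1)] by (simp add: cl_def)
  moreover have "dd (pderiv V) x ?c = dd (pderiv V) x ?d" using in_verticesD(3)[OF G(2) x] cv by (intro dd_cong) auto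
  ultimately show ?thesis by (simp add: vw_def)
  qed
  ultimately have "(\<Prod>x\<in>vertices H - {{s, t}}. vw V H ?c x) = (\<Prod>x\<in>vertices G. vw V G ?d x)" by simp
  then show ?thesis using lfH[OF A S] D(4) c by (simp add: wl_def wsp_def wt_def E' dd_def mult_ac)
  qed
  show "wl P V lam z i H = wl P V lam z i H'" if "H:?B" "H':?B" "is_iso f H H'" for H H' f using nbr_iso_Uc(2)[OF _ _ that(3) i] that by auto
 qed
 then show ?thesis by (simp add: gsum_def sum_distrib_left)
qed

lemma stick_core:
 assumes H: "is_map H" and S: "darts H = {q, p}" "q~=p" "rot H q = q" "rot H p = p" "opp H q = p" "opp H p = q"
 shows "core r N M g d H<->g = 0&d = - (int r + 1)&dl H p:Marked ` M Un Unmarked ` {1..N}&(ALL m:M. Marked m = dl H p)"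
  "vertices H = {{q}, {p}}" "edges H = {{p, q}}" "vx H p = {p}" "vx H q = {q}" "dl H q = dl H p"
proof -
 show v: "vx H p = {p}" "vx H q = {q}" using S by (simp_all add: vertex_at_def orbit_eq_singleton_iff)
 show vs: "vertices H = {{q}, {p}}" unfolding vertices_def S(1) by (simp add: v)
 show es: "edges H = {{p, q}}" unfolding edges_def S(1) by (simp add: S insert_commute)
 have fpq: "fc H q = fc H p" by (metis fp_iff[OF H] S fc_face_perm[OF H])
 then show dq: "dl H q = dl H p" by (simp add: dl_def)
 have fs: "faces H = {fc H p}" unfolding faces_def S(1) by (simp add: fpq)
 have "connected_map H" unfolding connected_map_iff[OF H]
 proof (intro conjI allI impI)
  fix T assume T: "T <= darts H&T~={}&(ALL x:T. rot H x:T & opp H x:T)"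
  then obtain x where "x:T" "x = q | x = p" using S(1) by auto
  then have "q:T&p:T" using T S(5,6) by metis
  then show "T = darts H" using T S(1) by auto
 qed (use S in auto)
 moreover have "has_genus g H<->g = 0" using S(2) by (auto simp: has_genus_def vs es fs)
 moreover have "map_degree r H = - (int r + 1)" using S(2) by (simp add: map_degree_def vs es)
 moreover have "decorated N M H<->dl H p:Marked ` M Un Unmarked ` {1..N}&(ALL m:M. Marked m = dl H p)"
 proof -
  have 1: "(ALL h:darts H. dl H h:X)<->dl H p:X" for X by (auto simp: dq S(1))
  have 2: "(EX h:darts H. dl H h = c) <-> c = dl H p" for c by (auto simp: dq S(1))
  have 3: "fc H x = fc H y" if "x:darts H" "y:darts H" for x y using that fpq unfolding S(1) by (elim insertE) simp_all
  show ?thesis unfolding decorated_iff 1 2 using 3 by blast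
 qed
 ultimately show "core r N M g d H<->g = 0&d = - (int r + 1)&dl H p:Marked ` M Un Unmarked ` {1..N}&(ALL m:M. Marked m = dl H p)" unfolding core_def using H by auto
qed

text \<open>A univalent square vertex makes the map a single edge with two vertices and one face, so
  its degree is - (r + 1). This is the origin of the term with the power r + 1 of \<alpha> in (iii)
  and (v).\<close>

lemma transfer_stick:
 assumes i: "i:I" "i:M"
 shows "gsum {H:Uc r N M g d I i. card (nbr i H) = 1} (wl P V lam z i) =
  (if g = 0&d = - (int r + 1)&I = {i}&M = {i} then eiv V (z i) (z i) * ev P (gg (z i)) else 0)"
proof -
 let ?B = "{H:Uc r N M g d I i. card (nbr i H) = 1}"
 \<comment> \<open>There is at most one such map up to isomorphism, so the recipes form a set with
   one element or the empty set.\<close>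
 define X where "X = (if g = 0&d = - (int r + 1)&I = {i}&M = {i} then {()} else {})"
 have shape: "EX q p. darts H = {q, p}&q~=p&rot H q = q&rot H p = p & opp H q = p & opp H p = q&leaf i H = q &
  cl H q = White i & cl H p = Square&dl H p = Marked i&():X" if B: "H:?B" for H
 proof -
  have HU: "H:Uc r N M g d I i" and c1: "card (nbr i H) = 1" using B by auto
  note H = UcD[OF HU]
  define q where "q = leaf i H"
  define p where "p = opp H q"
  note n = leaf_neighbour[OF H(2-4) i(1), folded q_def, folded p_def]
  have nb: "nbr i H = orbit (rot H) p" by (simp add: nbr_def q_def[symmetric] p_def[symmetric] vertex_at_def)
  have "(rot H ^^ 1) p = p" using orbit_enum(3)[OF fin_darts[OF H(2)] rot_permutes[OF H(2)], of 1 p, unfolded nb[symmetric], OF c1[symmetric]] .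
  then have r: "rot H p = p" by simp
  have D: "darts H = {q, p}" using n(10)[OF r] by auto
  have cp: "cl H p = Square" using H(7) by (simp add: q_def[symmetric] p_def[symmetric])
  note s = stick_core[OF H(2) D n(6)[symmetric] n(3) r p_def[symmetric] n(7)]
  have "I = {i}"
  proof -
  have "j = i" if "j:I" for j using leaf_in[OF H(4) that] D n(2) cp by auto
  then show ?thesis using i(1) by blast
  qed
  moreover have "ALL m:M. Marked m = dl H p" using s(1)[THEN iffD1, OF H(1)] by blast
  then have "m = i" if "m:M" for m using that n(8) by (metis decoration.inject(1))
  then have "M = {i}" using i(2) by blast
  ultimately have "():X" using s(1)[THEN iffD1, OF H(1)] by (simp add: X_def)
  then show ?thesis by (intro exI[of _ q] exI[of _ p]) (use D n(2,3,6-8) r cp q_def[symmetric] p_def[symmetric] \<open>() : X\<close> in simp_all)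
 qed
 have "gsum ?B (wl P V lam z i) = (\<Sum>x\<in>X. eiv V (z i) (z i) * ev P (gg (z i)) / of_nat (card {x}))"
 proof (rule gsum_transfer(2)[where R = "%x H. True" and Q = "%x. {x}"])
  show "is_map H" "card (automorphisms H) = 1" if "H:?B" for H using that UcD(2) rigid_Uc i by blast+
  show "finite X" by (simp add: X_def)
  show "EX x:X. True" if "H:?B" for H using shape[OF that] by blast
  show "EX H:?B. True" if x: "x:X" for x
  proof -
  have XX: "g = 0" "d = - (int r + 1)" "I = {i}" "M = {i}" using x by (auto simp: X_def split: if_splits)
  let ?D = "{0, 1} :: nat set" and ?sg = "%x::nat. if x = 0 then 1 else if x = 1 then 0 else x"
  have sig: "?sg permutes ?D" by (rule involution_permutes) auto
  obtain H :: "nat cmap" where H: "is_map H" "darts H = ?D" "rot H = id" "opp H = ?sg"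
  "!!x. x:?D ==> cl H x = (if x = 0 then White i else Square)" "!!x. x:?D==>dl H x = Marked i" by (rule ex_map[OF _ permutes_id sig, of "%x. if x = 0 then White i else Square" "%_. Marked i"]) auto
  note s = stick_core[OF H(1), of 0 1]
  have c: "core r N M g d H" using s(1)[of r N M g d] H XX by simp
  have lf: "leafy I H" unfolding leafy_def H(2) XX(3) using H(5,6) by auto
  have l: "leaf i H = 0" using H(2,5) by (intro leaf_eq[OF lf]) auto
  have b3: "black3 H" unfolding black3_def H(2) using H(5) by auto
  have "vx H x = vx H y" if "x:darts H" "y:darts H" "cl H x = Square" "cl H y = Square" for x y using that H(2,5) by (auto split: if_splits)
  moreover have "cl H (opp H (leaf i H)) = Square" using l H(4,5) by simp
  ultimately have "H:Uc r N M g d I i" unfolding Uc_def using c lf b3 by blast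
  moreover have "card (nbr i H) = 1" using s(4) H by (simp add: nbr_def l)
  ultimately show ?thesis by auto
  qed
  show "(EX f. is_iso f H H')<->x':{x}" if B: "H:?B" "H':?B" for x x' :: unit and H H'
  proof -
  obtain q p where S: "darts H = {q, p}" "q~=p" "rot H q = q" "rot H p = p" "opp H q = p" "opp H p = q"
  "cl H q = White i" "cl H p = Square" "dl H p = Marked i" using shape[OF B(1)] by blast
  obtain q' p' where S': "darts H' = {q', p'}" "q'~=p'" "rot H' q' = q'" "rot H' p' = p'" "opp H' q' = p'" "opp H' p' = q'"
  "cl H' q' = White i" "cl H' p' = Square" "dl H' p' = Marked i" using shape[OF B(2)] by blast
  have m: "is_map H" "is_map H'" using B UcD(2) by blast+
  have dq: "dl H q = Marked i" "dl H' q' = Marked i" using stick_core(6)[OF m(1) S(1-6)] stick_core(6)[OF m(2) S'(1-6)] S(9) S'(9) by simp_all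
  have "is_iso (id(q := q', p := p')) H H'" unfolding is_iso_iff[OF m] using S S' dq by (auto simp: bij_betw_def inj_on_def)
  then have "EX f. is_iso f H H'" by blast
  moreover have "x' = x" by (metis unit_eq)
  ultimately show ?thesis by simp
  qed
  show "wl P V lam z i H = eiv V (z i) (z i) * ev P (gg (z i))" if B: "H:?B" for H
  proof -
  obtain q p where S: "darts H = {q, p}" "q~=p" "rot H q = q" "rot H p = p" "opp H q = p" "opp H p = q"
  "leaf i H = q" "cl H q = White i" "cl H p = Square" "dl H p = Marked i" using shape[OF B] by blast
  have m: "is_map H" using B UcD(2) by blast
  note s = stick_core[OF m S(1-6)]
  have nb: "nbr i H = {p}" using S s(4) by (simp add: nbr_def)
  have "vertices H - {{p}} = {{q}}" unfolding s(2) using S(2) by auto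
  moreover have "vw V H (cv z lam H) {q} = 1" using S(8) s(5) by (simp add: vw_def cl_def)
  ultimately show ?thesis using S(2,10) s(6) by (simp add: wl_def wsp_def nb EW_def s(3) dd_def cv_dl)
  qed
  show "wl P V lam z i H = wl P V lam z i H'" if "H:?B" "H':?B" "is_iso f H H'" for H H' f using nbr_iso_Uc(2)[OF _ _ that(3) i(1)] that by auto
 qed auto
 then show ?thesis by (simp add: X_def)
qed

section \<open>From the prescribed classes to sums without degree bound\<close>

definition bounded_degree :: "nat=>'m cmap=>bool" where
 "bounded_degree r G<->(ALL x:vertices G. colour G x = Black --> card x <= r + 1)"

lemma
 assumes "is_map G" "is_map H" "is_iso f G H"
 shows map_degree_iso: "map_degree r H = map_degree r G"
  and bounded_degree_iso: "bounded_degree r H<->bounded_degree r G"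
proof -
 have i: "inj_on ((`) f) (vertices G)" "inj_on ((`) f) (edges G)" using inj_image_iso[OF assms] in_verticesD(3)[OF assms(1)] in_edgesD(2)[OF assms(1)] by (auto intro: inj_on_subset)
 then show "map_degree r H = map_degree r G" unfolding map_degree_def edges_iso[OF assms] vertices_iso[OF assms] by (simp add: card_image)
 have "card (f ` x) = card x" if "x:vertices G" for x using assms(3) in_verticesD(3)[OF assms(1) that] by (intro card_image) (auto simp: is_iso_def bij_betw_def intro: inj_on_subset)
 then show "bounded_degree r H<->bounded_degree r G" unfolding bounded_degree_def vertices_iso[OF assms] using assms(3) by (auto simp: is_iso_def)
qed

lemma gen_coeff_gsum:
 assumes "!!G. G:A==>is_map G"
 shows "gen_coeff r A w d = gsum {G:A. map_degree r G = d} w"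
proof -
 have "reps {G:A. map_degree r G = d} = {G:reps A. map_degree r G = d}" by (rule reps_Collect) (metis assms map_degree_iso)
 then show ?thesis by (simp add: gen_coeff_def gsum_def)
qed

lemma black3_vertices: "black3 G<->(ALL x:vertices G. colour G x = Black-->3 <= card x)" by (simp add: black3_def vertices_def cl_def)

lemma white_leafy:
 assumes G: "is_map G"
 shows "white_labelled n G&white_leaves G<->leafy {1..n} G"
proof
 assume a: "white_labelled n G&white_leaves G"
 have 1: "i:{1..n}<->(EX h:darts G. cl G h = White i)" for i using a unfolding white_labelled_def vertices_def cl_def by (auto simp: image_iff)
 have 2: "h = h'" if h: "h:darts G" "h':darts G" "cl G h = White i" "cl G h' = White i" for h h' i
 proof -
  have "\<exists>!x. x:vertices G & colour G x = White i" using a 1 h unfolding white_labelled_def by blast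
  then have "vx G h = vx G h'" using h unfolding vertices_def cl_def by blast
  moreover have "card (vx G h) = 1" using a h unfolding white_leaves_def cl_def by blast
  ultimately show ?thesis using vx_self[OF G, of h] vx_self[OF G, of h'] by (metis card_1_singletonE singletonD)
 qed
 show "leafy {1..n} G" unfolding leafy_def using 1 2 a unfolding white_leaves_def cl_def[symmetric] dl_def[symmetric] by blast
next
 assume a: "leafy {1..n} G"
 have v: "vx G h = {h}" if "h:darts G" "cl G h = White i" for h i using leafy_rot[OF G a that] by (simp add: vertex_at_def orbit_eq_singleton_iff)
 have wl: "white_leaves G" unfolding white_leaves_def cl_def[symmetric] dl_def[symmetric] using v leafy_cl(2)[OF a] by simp
 have ex: "\<exists>!x. x:vertices G & colour G x = White i" if i: "i:{1..n}" for i
 proof -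
  note l = leaf_in[OF a i]
  show ?thesis
  proof (rule ex1I[of _ "vx G (leaf i G)"])
  show "vx G (leaf i G):vertices G & colour G (vx G (leaf i G)) = White i" using l by (simp add: vertices_def cl_def)
  fix x assume "x:vertices G & colour G x = White i"
  then obtain h where "h:darts G" "x = vx G h" "cl G h = White i" by (auto simp: vertices_def cl_def)
  then show "x = vx G (leaf i G)" using leaf_eq[OF a] by metis
  qed
 qed
 have inn: "i:{1..n}" if "x:vertices G" "colour G x = White i" for x i using that leafy_cl(1)[OF a] by (auto simp: vertices_def cl_def)
 have "white_labelled n G" unfolding white_labelled_def by (intro conjI ballI allI impI; (rule inn ex; assumption))
 then show "white_labelled n G&white_leaves G" using wl by blast
qed

text \<open>That a face touches at most one white vertex is automatic: a face containing the leaf i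
  is marked i, and this mark determines the leaf.\<close>

lemma coloured_leafy:
 assumes "is_map G" "leafy I G"
 shows "coloured_map r g G <-> connected_map G&has_genus g G&black3 G&bounded_degree r G"
proof -
 have "vx G h = vx G h'" if "h:darts G" "h':darts G" "fc G h = fc G h'"
  "cl G h = White i" "cl G h' = White j" for h h' i j
 proof -
  have "dl G h = dl G h'" using that(3) by (simp add: dl_def)
  then have "i = j" using leafy_cl(2)[OF assms(2)] that by force
  then show ?thesis using leafy_cl(3)[OF assms(2)] that by metis
 qed
 then show ?thesis unfolding coloured_map_def black3_vertices bounded_degree_def cl_def[symmetric] using assms(1) by blast
qed

lemma maps_W_eq: "{G:maps_W r N g n. map_degree r G = d} = {G:Wc r N {1..n} g d {1..n}. bounded_degree r G}"
proof -
 have "G:maps_W r N g n&map_degree r G = d<->G:Wc r N {1..n} g d {1..n}&bounded_degree r G" for G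
 proof (cases "is_map G")
  case True
  have "(ALL x:vertices G. colour G x~=Square)<->(ALL h:darts G. cl G h~=Square)" by (simp add: vertices_def cl_def)
  then show ?thesis using white_leafy[OF True] coloured_leafy[OF True, of "{1..n}" r g] True unfolding maps_W_def Wc_def core_def by blast
 qed (auto simp: maps_W_def Wc_def core_def coloured_map_def)
 then show ?thesis by blast
qed

lemma maps_F_eq: "{G:maps_F r N g n. map_degree r G = d} = {G:Wc r N {1..n} g d {}. bounded_degree r G}"
proof -
 have "G:maps_F r N g n&map_degree r G = d<->G:Wc r N {1..n} g d {}&bounded_degree r G" for G
 proof (cases "is_map G")
  case True
  have "(ALL x:vertices G. colour G x = Black)<->(ALL h:darts G. cl G h = Black)" by (simp add: vertices_def cl_def)
  also have "... <-> leafy {} G&(ALL h:darts G. cl G h~=Square)" (is "_<->?R")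
  proof
  assume r: ?R
  show "ALL h:darts G. cl G h = Black"
  proof
  fix h assume "h:darts G"
  then show "cl G h = Black" using r leafy_cl(1)[of "{}" G h] by (cases "cl G h") auto
  qed
  qed (auto simp: leafy_def)
  finally show ?thesis using coloured_leafy[OF True, of "{}" r g] True unfolding maps_F_def Wc_def core_def by blast
 qed (auto simp: maps_F_def Wc_def core_def coloured_map_def)
 then show ?thesis by blast
qed

lemma maps_U_eq:
 assumes n: "n >= 1"
 shows "{G:maps_U r N g n. map_degree r G = d} = {G:Uc r N {1..n} g d {1..n} 1. bounded_degree r G}"
proof -
 have "G:maps_U r N g n&map_degree r G = d<->G:Uc r N {1..n} g d {1..n} 1&bounded_degree r G" for G
 proof (cases "is_map G&leafy {1..n} G")
  case True
  then have m: "is_map G" and lf: "leafy {1..n} G" by auto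
  have 1: "1:{1..n}" using n by simp
  note l = leaf_in[OF lf 1]
  have o: "opp G (leaf 1 G):darts G" using l opp_in[OF m] by simp
  have a: "(EX h:darts G. cl G h = White 1 & cl G (opp G h) = Square) <-> cl G (opp G (leaf 1 G)) = Square" using l leaf_eq[OF lf, of _ 1] by metis
  have b: "(\<exists>!x. x:vertices G & colour G x = Square) <->
  (ALL h:darts G. ALL h':darts G. cl G h = Square & cl G h' = Square-->vx G h = vx G h')"
  if "cl G (opp G (leaf 1 G)) = Square" using that o unfolding vertices_def cl_def by blast
  have "(\<exists>!x. x:vertices G & colour G x = Square) &
  (EX h:darts G. colour G (vx G h) = White 1 & colour G (vx G (opp G h)) = Square) <->
  (ALL h:darts G. ALL h':darts G. cl G h = Square & cl G h' = Square-->vx G h = vx G h') &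
  cl G (opp G (leaf 1 G)) = Square" unfolding cl_def[symmetric] a using b by argo
  then show ?thesis using white_leafy[OF m, of n] coloured_leafy[OF m lf, of r g] m lf unfolding maps_U_def Uc_def core_def mem_Collect_eq by blast
 next
  case False
  then show ?thesis using white_leafy[of G n] unfolding maps_U_def Uc_def core_def coloured_map_def by blast
 qed
 then show ?thesis by blast
qed

lemma vw_unbounded:
 assumes "is_map G" "degree (pderiv V) <= r" "x:vertices G" "colour G x = Black" "~ card x <= r + 1"
 shows "vw V G a x = 0" using assms(2,4,5) in_verticesD(1)[OF assms(1,3)] by (simp add: vw_def dd_zero)

lemma wt_unbounded:
 assumes "is_map G" "degree (pderiv V) <= r" "~ bounded_degree r G"
 shows "wt V a b G = 0"
proof -
 obtain x where "x:vertices G" "colour G x = Black" "~ card x <= r + 1" using assms(3) by (auto simp: bounded_degree_def)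
 then have "(\<Prod>x\<in>vertices G. vw V G a x) = 0" using vw_unbounded[OF assms(1,2)] finite_vertices(1)[OF assms(1)] by (intro prod_zero) auto
 then show ?thesis by (simp add: wt_def)
qed

text \<open>Maps with a black vertex of too large degree have weight zero, so adding them changes
  nothing; without the bound the classes are stable under attaching leaves.\<close>

lemma gsum_bounded:
 assumes "finite (reps A)" "!!G. G:A==>is_map G"
  "!!G. G:A ==> ~ bounded_degree r G==>w G = 0"
 shows "gsum {G:A. bounded_degree r G} w = gsum A w"
proof (rule gsum_mono_class[OF assms(1)])
 show "bounded_degree r G<->bounded_degree r H" if "G:A" "H:A" "is_iso f G H" for G H f using bounded_degree_iso[OF assms(2)[OF that(1)] assms(2)[OF that(2)] that(3)] by simp
qed (rule assms(3))

section \<open>Derivatives of the generating functions\<close>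

definition Wsum :: "nat=>nat => complex poly=>(nat => complex)=>nat set=>nat=>int=>nat set=>(nat => complex) => complex"
 where "Wsum r N V lam M g d J z =
  gsum (Wc r N M g d J) (%G. wtc V z lam G)"

text \<open>The part of the weight that does not involve u: everything except the factor of the
  square vertex.\<close>

definition cU :: "complex poly=>(nat => complex)=>(nat => complex)=>nat cmap => complex" where
 "cU V lam z G = EW V (cv z lam G) G * (\<Prod>x\<in>vertices G - {nbr 1 G}. vw V G (cv z lam G) x)"

text \<open>For a = b the denominator is V''(a). Otherwise its product with a - b is the difference
  of two values of V', which are distinct.\<close>

lemma nonzero_generic:
 assumes "generic V N lam I z" "nondegenerate V N lam"
 shows "nonzero_on V (z ` I Un lam ` {1..N})" unfolding nonzero_on_def
proof (intro ballI)
 fix a b assume ab: "a:z ` I Un lam ` {1..N}" "b:z ` I Un lam ` {1..N}"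
 show "ev (pderiv V) (gg a * gg b)~=0"
 proof (cases "a = b")
  case True
  then show ?thesis using ab assms unfolding ev_gg_gg[of "pderiv V"] True by (auto simp: generic_def nondegenerate_def ev_gg_gg)
 next
  case False
  have "poly (pderiv V) a~=poly (pderiv V) b"
  proof -
  from ab consider (1) i j where "i:I" "j:I" "a = z i" "b = z j" | (2) i j where "i:I" "j:{1..N}" "a = z i" "b = lam j"
  | (3) i j where "i:{1..N}" "j:I" "a = lam i" "b = z j" | (4) i j where "i:{1..N}" "j:{1..N}" "a = lam i" "b = lam j" by blast
  then show ?thesis
  proof cases
  case 1
  then show ?thesis using assms(1) False unfolding generic_def by (metis inj_onD)
  next
  case 2 then show ?thesis using assms(1) by (auto simp: generic_def)
  next
  case 3 then show ?thesis using assms(1) unfolding generic_def by metis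
  next
  case 4 then show ?thesis using assms(2) False by (auto simp: nondegenerate_def)
  qed
  qed
  then show ?thesis using ev_gg_diff[of a b "pderiv V"] by auto
 qed
qed

lemma cv_in:
 assumes "core r N M g d G" "h:darts G"
 shows "cv z lam G h:z ` M Un lam ` {1..N}" using coreD(4)[OF assms] by (auto simp: cv_dl)

lemma wt_cong:
 assumes "is_map G" "!!x. x:darts G==>a x = a' x" "!!x. x:darts G==>b x = b' x"
 shows "wt V a b G = wt V a' b' G"
proof -
 have "EW V b G = EW V b' G" using assms by (intro EW_cong) auto
 moreover have "(\<Prod>X\<in>vertices G. vw V G a X) = (\<Prod>X\<in>vertices G. vw V G a' X)" using assms(2) in_verticesD(3)[OF assms(1)] by (intro prod.cong refl vw_cong) blast
 ultimately show ?thesis by (simp add: wt_def)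
qed

text \<open>Genericity is an open condition in each variable. This allows an identity between
  functions of generic points to be differentiated.\<close>

lemma generic_eventually:
 assumes "generic V N lam I z" "finite I" "i:I"
 shows "\<forall>\<^sub>F x in nhds (z i). generic V N lam I (z(i := x))"
proof -
 have ne: "\<forall>\<^sub>F x in nhds (z i). poly p x ~= c" if "poly p (z i) ~= c" for p c by (rule tendsto_imp_eventually_ne[OF _ that]) (intro tendsto_poly filterlim_ident)
 have 1: "\<forall>\<^sub>F x in nhds (z i). poly (pderiv (pderiv V)) x~=0" using assms by (intro ne) (auto simp: generic_def)
 have 2: "\<forall>\<^sub>F x in nhds (z i). ALL j:I - {i}. poly (pderiv V) x~=poly (pderiv V) (z j)" using assms by (intro eventually_ball_finite ballI ne) (auto simp: generic_def dest: inj_onD)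
 have 3: "\<forall>\<^sub>F x in nhds (z i). ALL j:{1..N}. poly (pderiv V) x~=poly (pderiv V) (lam j)" using assms by (intro eventually_ball_finite ballI ne) (auto simp: generic_def)
 show ?thesis using 1 2 3
 proof eventually_elim
  case (elim x)
  have "inj_on (%j. poly (pderiv V) ((z(i := x)) j)) I"
  proof (rule inj_onI)
  fix a b assume ab: "a:I" "b:I" "poly (pderiv V) ((z(i := x)) a) = poly (pderiv V) ((z(i := x)) b)"
  show "a = b"
  proof (cases "a = i | b = i")
  case True then show ?thesis using ab elim(2) by (metis Diff_iff fun_upd_apply singletonD)
  next
  case False then show ?thesis using ab assms(1) by (auto simp: generic_def dest: inj_onD)
  qed
  qed
  then show ?case using elim assms(1) by (auto simp: generic_def)
 qed
qed

lemma wl_black: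
 assumes "H:Wc r N M g d I" "i:I"
 shows "wl (pderiv V) V lam z i H = - wtc V z lam H" unfolding wl_def using Wc_nbr_ge_3(2,3)[OF assms] WcD(2)[OF assms(1)] by (intro wsp_black)

lemma gsum_wl_black:
 assumes "i:I"
 shows "gsum (Wc r N M g d I) (wl (pderiv V) V lam z i) = - Wsum r N V lam M g d I z"
  and "gsum (Wc r N M g d I) (wl (- pderiv V) V lam z i) = Wsum r N V lam M g d I z"
proof -
 have 1: "gsum (Wc r N M g d I) (wl (pderiv V) V lam z i) =
  gsum (Wc r N M g d I) (%H. - wtc V z lam H)" by (rule gsum_cong) (rule wl_black[OF _ assms])
 then show "gsum (Wc r N M g d I) (wl (pderiv V) V lam z i) = - Wsum r N V lam M g d I z" by (simp add: gsum_def Wsum_def sum_negf)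
 have "wl (- pderiv V) V lam z i = (%H. - wl (pderiv V) V lam z i H)" by (simp add: wl_def wsp_uminus fun_eq_iff)
 then have "gsum (Wc r N M g d I) (wl (- pderiv V) V lam z i) = - gsum (Wc r N M g d I) (wl (pderiv V) V lam z i)" by (simp add: gsum_def sum_negf)
 then show "gsum (Wc r N M g d I) (wl (- pderiv V) V lam z i) = Wsum r N V lam M g d I z" using \<open>gsum (Wc r N M g d I) (wl (pderiv V) V lam z i) = - Wsum r N V lam M g d I z\<close> by simp
qed

text \<open>The variable z i enters a map only through its single face marked i, and that face
  touches only black vertices since i has no leaf yet. The derivative of each weight is then the sum
  over the corners and sides of this face.\<close>

lemma Wsum_has_derivative:
 assumes z: "generic V N lam M z" "nondegenerate V N lam" and i: "i:M" "i~:J" and fin: "finite M" "finite J"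
 shows "((%x. Wsum r N V lam M g d J (z(i := x))) has_field_derivative
  (\<Sum>G\<in>reps (Wc r N M g d J). (\<Sum>h | h:darts G&dl G h = Marked i.
  Tc (- pderiv V) V G (cv z lam G) (cv z lam G) h (z i) (z i) +
  Ts (- pderiv V) V G (cv z lam G) (cv z lam G) h (z i) (z i)) / of_nat (card (automorphisms G)))) (at (z i))" unfolding Wsum_def gsum_def
proof (intro DERIV_sum DERIV_cdivide)
 fix G assume "G:reps (Wc r N M g d J)"
 then have GW: "G:Wc r N M g d J" by (rule representatives_subset)
 note G = WcD[OF GW]
 let ?v = "cv z lam G"
 define F where "F = {h. h:darts G&dl G h = Marked i}"
 have dec: "decorated N M G" using G(1) by (simp add: core_def)
 then obtain b where b: "b:darts G" "dl G b = Marked i" using i unfolding decorated_iff by blast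
 have F: "F = fc G b"
 proof
  show "F <= fc G b"
  proof
  fix h assume "h:F"
  then have "fc G h = fc G b" using dec b i unfolding decorated_iff F_def by blast
  then show "h:fc G b" using fc_eq[OF G(2)] by simp
  qed
  show "fc G b <= F" using fc_subset[OF G(2) b(1)] dl_face[OF G(2)] b(2) by (auto simp: F_def)
 qed
 define S where "S = z ` M Un lam ` {1..N}"
 have nz: "nonzero_on V S" unfolding S_def by (rule nonzero_generic[OF z])
 have x0: "z i:S" using i by (auto simp: S_def)
 have vS: "?v h:S" if "h:darts G - F" for h using cv_in[OF G(1), of h z lam] that by (auto simp: S_def)
 have a: "(%h. if h:F then z i else ?v h) = ?v" by (auto simp: F_def cv_dl)
 have black: "cl G h = Black" if "h:F" for h using Wc_marked_black[OF GW _ _ i(2)] that by (auto simp: F_def)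
 have "((%x. wt V (%h. if h:F then x else ?v h) (%h. if h:F then x else ?v h) G) has_field_derivative
  (\<Sum>h\<in>F. Tc (- pderiv V) V G ?v ?v h (z i) (z i) + Ts (- pderiv V) V G ?v ?v h (z i) (z i))) (at (z i))" using wt_has_derivative[where v = ?v, OF G(2) b(1) F nz x0 vS, unfolded a] black by (simp cong: sum.cong)
 moreover have "wt V (%h. if h:F then x else ?v h) (%h. if h:F then x else ?v h) G =
  wtc V (z(i := x)) lam G" for x
 proof -
  have "(if h:F then x else ?v h) = cv (z(i := x)) lam G h" if "h:darts G" for h using that by (cases "dl G h") (auto simp: F_def cv_dl)
  then show ?thesis by (intro wt_cong[OF G(2)]) auto
 qed
 ultimately show "((%x. wtc V (z(i := x)) lam G) has_field_derivative
  (\<Sum>h | h:darts G&dl G h = Marked i. Tc (- pderiv V) V G ?v ?v h (z i) (z i) + Ts (- pderiv V) V G ?v ?v h (z i) (z i))) (at (z i))" by (simp add: F_def)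
qed

text \<open>The weight of the loop map in closed form, which is the exceptional summand of (i). With
  D the divided difference at x, y and E the one at x, x, y, the two-point recursion gives (x - y) E
  = V''(x) - D, and the fraction splits.\<close>

lemma loop_weight:
 assumes "poly (pderiv V) x~=poly (pderiv V) y" "poly (pderiv (pderiv V)) x~=0"
 shows "eiv V x x * eiv V x y * ev (- pderiv V) (gg x * gg x * gg y) =
  1 / (poly (pderiv (pderiv V)) x * (x - y)) - 1 / (poly (pderiv V) x - poly (pderiv V) y)"
proof -
 let ?V2 = "poly (pderiv (pderiv V)) x"
 define D where "D = ev (pderiv V) (gg x * gg y)"
 define E where "E = ev (pderiv V) (gg x * gg x * gg y)"
 have xy: "x - y~=0" using assms(1) by auto
 have D: "(x - y) * D = poly (pderiv V) x - poly (pderiv V) y" unfolding D_def by (rule ev_gg_diff)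
 then have D0: "D~=0" using assms(1) by auto
 have "(x - y) * E = ev (pderiv V) (gg x * gg x) - ev (pderiv V) (gg y * gg x)" unfolding E_def using ev_gg_diff_mult[of x y "pderiv V" "gg x"] by (simp add: mult_ac)
 then have E: "(x - y) * E = ?V2 - D" by (simp add: ev_gg_gg D_def mult.commute)
 have E': "E = (?V2 - D) / (x - y)" using E xy by (simp add: field_simps)
 have "inverse ?V2 * inverse D * (- E) = 1 / (?V2 * (x - y)) - 1 / ((x - y) * D)"
 proof -
  have "inverse a * inverse b * (- ((a - b) / s)) = 1 / (a * s) - 1 / (s * b)" if "a~=0" "b~=0" "s~=0" for a b s :: complex using that by (simp add: field_simps)
  then show ?thesis unfolding E' using xy D0 assms(2) by blast
 qed
 then show ?thesis by (simp add: ev_gg_gg ev_uminus D_def[symmetric] E_def[symmetric] D)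
qed

text \<open>The neighbour of leaf i is black, so the weight is \<open>wl\<close> for - V'. Its
  expansion in \<open>gsum_leaf\<close> has the derivative as main part, multiplied by the weight
  1/V'' of the new edge, and the loops as remainder.\<close>

lemma Wsum_step:
 assumes z: "generic V N lam M z" "nondegenerate V N lam" and i: "i:M" "i~:J" and fin: "finite M" "finite J"
 shows "Wsum r N V lam M g d (insert i J) z = weighted_partial V i (Wsum r N V lam M g d J) z +
  (\<Sum>\<beta>\<in>loop_labels N M g d J i. 1 / (poly (pderiv (pderiv V)) (z i) * (z i - dec_value z lam \<beta>)) -
  1 / (poly (pderiv V) (z i) - poly (pderiv V) (dec_value z lam \<beta>)))"
proof -
 have V2: "poly (pderiv (pderiv V)) (z i)~=0" using z i by (auto simp: generic_def)
 have "(\<Sum>\<beta>\<in>loop_labels N M g d J i. eiv V (z i) (z i) *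
  eiv V (z i) (dec_value z lam \<beta>) * ev (- pderiv V) (gg (z i) * gg (z i) * gg (dec_value z lam \<beta>))) =
  (\<Sum>\<beta>\<in>loop_labels N M g d J i. 1 / (poly (pderiv (pderiv V)) (z i) * (z i - dec_value z lam \<beta>)) -
  1 / (poly (pderiv V) (z i) - poly (pderiv V) (dec_value z lam \<beta>)))"
 proof (intro sum.cong refl loop_weight V2)
  fix \<beta> assume b: "\<beta> : loop_labels N M g d J i"
  show "poly (pderiv V) (z i)~=poly (pderiv V) (dec_value z lam \<beta>)"
  proof (cases \<beta>)
  case (Marked j)
  then have "j:M" "j~=i" using b by (auto simp: loop_labels_def split: if_splits)
  then show ?thesis using z(1) i Marked by (auto simp: generic_def dest: inj_onD)
  next
  case (Unmarked j)
  then have "j:{1..N}" using b by (auto simp: loop_labels_def split: if_splits)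
  then show ?thesis using z(1) i Unmarked by (auto simp: generic_def)
  qed
 qed
 moreover have W: "Wsum r N V lam M g d (insert i J) z = gsum (Wc r N M g d (insert i J)) (wl (- pderiv V) V lam z i)" by (rule gsum_wl_black(2)[symmetric]) simp
 ultimately show ?thesis unfolding W gsum_leaf[OF i fin refl] weighted_partial_def DERIV_imp_deriv[OF Wsum_has_derivative[OF z i fin]] by (simp add: ev_gg_gg inverse_eq_divide)
qed

lemma weighted_partial_cong:
 assumes "generic V N lam M z" "finite M" "i:M" "!!y. generic V N lam M y==>f y = f' y"
 shows "weighted_partial V i f z = weighted_partial V i f' z" unfolding weighted_partial_def using generic_eventually[OF assms(1-3)] assms(4) by (intro arg_cong2[of _ _ _ _ "(*)"] deriv_cong_ev refl) (auto elim: eventually_mono)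

context
 fixes r N g n :: nat and lam :: "nat => complex" and V :: "complex poly"
 assumes deg: "degree (pderiv V) <= r" and nd: "nondegenerate V N lam" and n: "n >= 1"
begin

lemma gen_W_nth: "fls_nth (gen_W r V N lam g n z) d = Wsum r N V lam {1..n} g d {1..n} z"
proof -
 have "fls_nth (gen_W r V N lam g n z) d = gsum {G:maps_W r N g n. map_degree r G = d} (weight V lam z 0)" unfolding nth_gen by (rule gen_coeff_gsum) (simp add: maps_W_def coloured_map_def)
 also have "... = gsum {G:Wc r N {1..n} g d {1..n}. bounded_degree r G} (%G. wtc V z lam G)" unfolding maps_W_eq by (rule gsum_cong) (auto intro!: weight_eq_wt dest: WcD)
 also have "... = Wsum r N V lam {1..n} g d {1..n} z" unfolding Wsum_def by (rule gsum_bounded) (auto intro: finite_reps_Wc WcD(2) wt_unbounded[OF _ deg])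
 finally show ?thesis .
qed

lemma gen_F_nth: "fls_nth (gen_F r V N lam g n z) d = Wsum r N V lam {1..n} g d {} z"
proof -
 have "fls_nth (gen_F r V N lam g n z) d = gsum {G:maps_F r N g n. map_degree r G = d} (weight V lam z 0)" unfolding nth_gen by (rule gen_coeff_gsum) (simp add: maps_F_def coloured_map_def)
 also have "... = gsum {G:Wc r N {1..n} g d {}. bounded_degree r G} (%G. wtc V z lam G)" unfolding maps_F_eq by (rule gsum_cong) (auto intro!: weight_eq_wt dest: WcD)
 also have "... = Wsum r N V lam {1..n} g d {} z" unfolding Wsum_def by (rule gsum_bounded) (auto intro: finite_reps_Wc WcD(2) wt_unbounded[OF _ deg])
 finally show ?thesis .
qed

text \<open>Leaves are added in the order n, n - 1, ..., because \<open>foldr\<close> applies the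
  derivative with the largest index before the others. The induction runs downwards and rewrites
  under the remaining derivatives on the open set of generic points.\<close>

lemma foldr_partial:
 assumes nl: "!!i. i:{1..n}==>loop_labels N {1..n} g d {Suc i..n} i = {}" and "generic V N lam {1..n} z" "m <= n"
 shows "Wsum r N V lam {1..n} g d {Suc m..n} z = foldr (weighted_partial V) [Suc m..<n+1] (Wsum r N V lam {1..n} g d {}) z" using assms(3,2)
proof (induction m arbitrary: z rule: inc_induct)
 case (step m)
 have m: "Suc m:{1..n}" "Suc m~:{Suc (Suc m)..n}" "[Suc m..<n+1] = Suc m # [Suc (Suc m)..<n+1]"
  "insert (Suc m) {Suc (Suc m)..n} = {Suc m..n}" using step(2) by (auto simp: upt_conv_Cons)
 have "Wsum r N V lam {1..n} g d {Suc m..n} z = weighted_partial V (Suc m) (Wsum r N V lam {1..n} g d {Suc (Suc m)..n}) z" using Wsum_step[OF step(4) nd m(1,2), of r g d] nl[OF m(1)] m(4) by simp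
 also have "... = weighted_partial V (Suc m) (foldr (weighted_partial V) [Suc (Suc m)..<n+1] (Wsum r N V lam {1..n} g d {})) z" by (rule weighted_partial_cong[OF step(4) _ m(1) step(3)]) simp_all
 finally show ?case unfolding m(3) by simp
qed simp

text \<open>A loop can only appear when the first leaf is added, at degree 0 and genus 0, and with
  at most two marks in all. This confines the exceptional terms to n = 1 and n = 2.\<close>

lemma part_i:
 assumes z: "generic V N lam {1..n} z"
 shows "fls_nth (gen_W r V N lam g n z) d =
  foldr (weighted_partial V) [1..<n+1] (%y. fls_nth (gen_F r V N lam g n y) d) z +
  fls_nth (if g = 0&n = 2 then fls_const
  (1 / (poly (pderiv (pderiv V)) (z 1) * poly (pderiv (pderiv V)) (z 2) * (z 1 - z 2)\<^sup>2)
  - 1 / (poly (pderiv V) (z 1) - poly (pderiv V) (z 2))\<^sup>2) else 0) d +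
  fls_nth (if g = 0&n = 1 then fls_const
  (\<Sum>j=1..N. 1 / (poly (pderiv (pderiv V)) (z 1) * (z 1 - lam j))
  - 1 / (poly (pderiv V) (z 1) - poly (pderiv V) (lam j))) else 0) d"
proof -
 let ?W = "Wsum r N V lam {1..n} g d"
 let ?L = "%i z \<beta>. 1 / (poly (pderiv (pderiv V)) (z i) * (z i - dec_value z lam \<beta>)) -
  1 / (poly (pderiv V) (z i) - poly (pderiv V) (dec_value z lam \<beta>))"
 consider (1) "g = 0&d = 0&n = 1" | (2) "g = 0&d = 0&n = 2" | (3) "~ (g = 0&d = 0) | n >= 3" using n by linarith
 then show ?thesis
 proof cases
  case 1
  then have n1: "n = 1" by simp
  have "loop_labels N {1..n} g d {} 1 = Unmarked ` {1..N}" using 1 by (auto simp: loop_labels_def)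
  then have "?W {1} z = weighted_partial V 1 (?W {}) z + (\<Sum>j=1..N. ?L 1 z (Unmarked j))" using Wsum_step[OF z nd, of 1 "{}" r g d] n1 by (simp add: sum.reindex inj_on_def)
  then show ?thesis unfolding gen_W_nth gen_F_nth using 1 n1 by simp
 next
  case 2
  then have n2: "n = 2" by simp
  have S: "{1..n} = {1, 2}" using n2 by auto
  have l2: "loop_labels N {1..n} g d {} 2 = {Marked 1}" using 2 unfolding S by (auto simp: loop_labels_def)
  have l1: "loop_labels N {1..n} g d {2} 1 = {}" by (auto simp: loop_labels_def)
  \<comment> \<open>Leaf 2 is added to a map without leaves; the inner face of the loop then has to
    carry the remaining mark 1.\<close>
  have s2: "?W {2} y = weighted_partial V 2 (?W {}) y + ?L 2 y (Marked 1)" if "generic V N lam {1..n} y" for y using Wsum_step[OF that nd, of 2 "{}" r g d] l2 n2 by simp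
  have s1: "?W {1, 2} z = weighted_partial V 1 (?W {2}) z" using Wsum_step[OF z nd, of 1 "{2}" r g d] l1 n2 by simp
  let ?V1 = "pderiv V" and ?V2 = "pderiv (pderiv V)"
  have gen: "poly ?V2 (z 1)~=0" "poly ?V2 (z 2)~=0" "poly ?V1 (z 2) - poly ?V1 (z 1)~=0"
  proof -
  have "inj_on (%i. poly ?V1 (z i)) {1, 2}" "ALL i:{1, 2}. poly ?V2 (z i)~=0" using z unfolding generic_def S by blast+
  then show "poly ?V2 (z 1)~=0" "poly ?V2 (z 2)~=0" "poly ?V1 (z 2) - poly ?V1 (z 1)~=0" by (simp_all add: inj_on_def)
  qed
  then have z12: "z 2 - z 1~=0" by auto
  have dW: "((%x. ?W {2} (z(1 := x))) has_field_derivative deriv (%x. ?W {2} (z(1 := x))) (z 1)) (at (z 1))"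
  proof -
  have "1:{1..n}" "1~:{2::nat}" "finite {1..n}" "finite {2::nat}" using n2 by auto
  note W = Wsum_has_derivative[OF z nd this, of r g d]
  show ?thesis unfolding DERIV_imp_deriv[OF W] by (rule W)
  qed
  \<comment> \<open>The derivative in z1 of the exceptional summand created by leaf 2. Division by
    V''(z1) turns it into the symmetric two-point term.\<close>
  let ?D = "1 / (poly ?V2 (z 2) * (z 2 - z 1)\<^sup>2) - poly ?V2 (z 1) / (poly ?V1 (z 2) - poly ?V1 (z 1))\<^sup>2"
  have dL: "((%x. ?L 2 (z(1 := x)) (Marked 1)) has_field_derivative ?D) (at (z 1))"
  proof -
  have "((%x. 1 / (poly ?V2 (z 2) * (z 2 - x))) has_field_derivative 1 / (poly ?V2 (z 2) * (z 2 - z 1)\<^sup>2)) (at (z 1))"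
  proof -
  have "z 2~=z 1" using z12 by auto
  then show ?thesis using gen(2) by (auto intro!: derivative_eq_intros simp: power2_eq_square divide_simps)
  qed
  moreover have "((%x. 1 / (poly ?V1 (z 2) - poly ?V1 x)) has_field_derivative
  poly ?V2 (z 1) / (poly ?V1 (z 2) - poly ?V1 (z 1))\<^sup>2) (at (z 1))" using gen by (auto intro!: derivative_eq_intros poly_DERIV simp: power2_eq_square)
  ultimately show ?thesis by (simp add: DERIV_diff)
  qed
  have "((%x. ?W {2} (z(1 := x)) - ?L 2 (z(1 := x)) (Marked 1)) has_field_derivative
  deriv (%x. ?W {2} (z(1 := x))) (z 1) - ?D) (at (z 1))" by (rule DERIV_diff[OF dW dL])
  \<comment> \<open>The identity \<open>s2\<close> has to hold for all x near z1, not just at the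
    point, in order to be differentiated.\<close>
  moreover have "deriv (%x. weighted_partial V 2 (?W {}) (z(1 := x))) (z 1) =
  deriv (%x. ?W {2} (z(1 := x)) - ?L 2 (z(1 := x)) (Marked 1)) (z 1)"
  proof (rule deriv_cong_ev[OF _ refl])
  have "\<forall>\<^sub>F x in nhds (z 1). generic V N lam {1..n} (z(1 := x))" by (rule generic_eventually[OF z]) (use n2 in auto)
  then show "\<forall>\<^sub>F x in nhds (z 1). weighted_partial V 2 (?W {}) (z(1 := x)) = ?W {2} (z(1 := x)) - ?L 2 (z(1 := x)) (Marked 1)"
  proof eventually_elim
  case (elim x)
  show ?case using s2[OF elim] by (simp only: add_diff_cancel_right')
  qed
  qed
  ultimately have "deriv (%x. ?W {2} (z(1 := x))) (z 1) = deriv (%x. weighted_partial V 2 (?W {}) (z(1 := x))) (z 1) + ?D" by (simp add: DERIV_imp_deriv)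
  then have "?W {1, 2} z = weighted_partial V 1 (weighted_partial V 2 (?W {})) z + 1 / poly ?V2 (z 1) * ?D" unfolding s1 weighted_partial_def[of V 1] by (simp add: distrib_left)
  moreover have "1 / poly ?V2 (z 1) * ?D = 1 / (poly ?V2 (z 1) * poly ?V2 (z 2) * (z 1 - z 2)\<^sup>2) - 1 / (poly ?V1 (z 1) - poly ?V1 (z 2))\<^sup>2" using gen by (simp add: right_diff_distrib power2_commute[of "z 2"] power2_commute[of "poly ?V1 (z 2)"] mult.assoc)
  moreover have "[1..<n+1] = [1, 2]" using n2 by (simp add: upt_rec)
  ultimately show ?thesis unfolding gen_W_nth gen_F_nth using 2 S by simp
 next
  case 3
  have nl: "loop_labels N {1..n} g d {Suc i..n} i = {}" if "i:{1..n}" for i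
  proof (cases "g = 0&d = 0&{Suc i..n} = {}")
  case True
  then have "i = n" "n >= 3" using 3 that by auto
  then have "~ (ALL m:{1..n}. m = i | Marked m = \<beta>)" for \<beta> :: "nat decoration"
  proof -
  have "1:{1..n}" "2:{1..n}" "1~=i" "2~=i" using \<open>i = n\<close> \<open>n >= 3\<close> by auto
  then show ?thesis by (metis decoration.inject(1) numeral_eq_one_iff semiring_norm(85))
  qed
  then show ?thesis by (auto simp: loop_labels_def)
  qed (auto simp: loop_labels_def)
  show ?thesis using foldr_partial[OF nl z] gen_W_nth gen_F_nth 3 by auto
 qed
qed

end

section \<open>Residues and the limit at infinity of U\<close>

text \<open>Each factor 1/(u - a) is asymptotic to 1/u, so the product times the square of u behaves
  like the power of 1/u with exponent \<open>card C - 2\<close>.\<close>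

lemma tendsto_square_fractions:
 assumes "finite C" "2 <= card C"
 shows "((%u. u\<^sup>2 * (\<Prod>h\<in>C. 1 / (u - a h))) \<longlongrightarrow> (if card C = 2 then 1 else 0 :: complex)) at_infinity"
proof -
 have inv: "((%u. 1 / u) \<longlongrightarrow> (0::complex)) at_infinity" using tendsto_inverse_0[where 'a = complex] by (simp add: divide_inverse)
 have nz: "\<forall>\<^sub>F u in at_infinity. (u::complex)~=0" by (metis (mono_tags, lifting) eventually_at_infinity norm_zero not_one_le_zero)
 have "((%u. 1 / (1 - b * (1 / u))) \<longlongrightarrow> (1::complex)) at_infinity" for b using tendsto_divide[OF tendsto_const tendsto_diff[OF tendsto_const tendsto_mult[OF tendsto_const inv]], of 1 b 1] by simp
 then have L: "((%u. (\<Prod>h\<in>C. 1 / (1 - a h * (1 / u))) * (1 / u) ^ (card C - 2)) \<longlongrightarrow> (\<Prod>h\<in>C. 1) * 0 ^ (card C - 2)) at_infinity" using inv by (intro tendsto_mult tendsto_prod tendsto_power) auto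
 have c: "(\<Prod>h\<in>C. 1) * 0 ^ (card C - 2) = (if card C = 2 then 1 else 0 :: complex)" using assms(2) by (auto simp: power_0_left)
 have E: "\<forall>\<^sub>F u in at_infinity. (\<Prod>h\<in>C. 1 / (1 - a h * (1 / u))) * (1 / u) ^ (card C - 2) = u\<^sup>2 * (\<Prod>h\<in>C. 1 / (u - a h))" using nz
 proof eventually_elim
  case (elim u)
  have e: "1 / (1 - a h * (1 / u)) = u * (1 / (u - a h))" for h using elim by (cases "u = a h") (auto simp: divide_simps)
  have "(\<Prod>h\<in>C. 1 / (1 - a h * (1 / u))) = u ^ card C * (\<Prod>h\<in>C. 1 / (u - a h))" unfolding e prod.distrib prod_constant ..
  moreover have "u ^ card C = u\<^sup>2 * u ^ (card C - 2)" using assms(2) by (metis le_add_diff_inverse power_add)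
  ultimately show ?case using elim by (simp add: power_one_over field_simps)
 qed
 show ?thesis using Lim_transform_eventually[OF L E] unfolding c .
qed

context
 fixes r N g n :: nat and lam :: "nat => complex" and V :: "complex poly" and d :: int and z :: "nat => complex"
 assumes deg: "degree (pderiv V) <= r" and nd: "nondegenerate V N lam" and n: "n >= 1" and z: "generic V N lam {1..n} z"
begin

lemma one_in: "1:{1..n}" using n by simp

lemma ev_nz: "ev (pderiv V) (gg (z 1) * gg (z 1))~=0" "poly (pderiv (pderiv V)) (z 1)~=0" using z n by (auto simp: generic_def ev_gg_gg)

text \<open>At a fixed order U is a finite sum of rational functions of u, with all dependence on u
  in the fractions at the square vertex. The automorphism factors are 1.\<close>

lemma gen_U_nth: "fls_nth (gen_U r V N lam g n u z) d =
 (\<Sum>G\<in>reps (Uc r N {1..n} g d {1..n} 1). cU V lam z G * (\<Prod>h\<in>nbr 1 G. 1 / (u - cv z lam G h)))"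
proof -
 let ?U = "Uc r N {1..n} g d {1..n} 1" and ?w = "%G. cU V lam z G * (\<Prod>h\<in>nbr 1 G. 1 / (u - cv z lam G h))"
 have "fls_nth (gen_U r V N lam g n u z) d = gsum {G:maps_U r N g n. map_degree r G = d} (weight V lam z u)" unfolding nth_gen by (rule gen_coeff_gsum) (simp add: maps_U_def coloured_map_def)
 also have "... = gsum {G:?U. bounded_degree r G} ?w" unfolding maps_U_eq[OF n]
 proof (rule gsum_cong)
  fix G assume "G:{G:?U. bounded_degree r G}"
  then have G: "G:?U" by simp
  show "weight V lam z u G = ?w G" unfolding cU_def by (rule weight_square[OF UcD(2)[OF G] Uc_square(1)[OF G one_in] Uc_square(2)[OF G one_in] Uc_square(4)[OF G one_in]])
 qed
 also have "... = gsum ?U ?w"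
 proof (rule gsum_bounded)
  show "finite (reps ?U)" by (intro finite_reps_Uc) auto
  show "is_map G" if "G:?U" for G using UcD(2)[OF that] .
  show "?w G = 0" if G: "G:?U" and b: "~ bounded_degree r G" for G
  proof -
  obtain x where x: "x:vertices G" "colour G x = Black" "~ card x <= r + 1" using b by (auto simp: bounded_degree_def)
  then have "x:vertices G - {nbr 1 G}" using Uc_square(2)[OF G one_in] by auto
  then have "(\<Prod>x\<in>vertices G - {nbr 1 G}. vw V G (cv z lam G) x) = 0" using vw_unbounded[OF UcD(2)[OF G] deg x] finite_vertices(1)[OF UcD(2)[OF G]] by (intro prod_zero) auto
  then show ?thesis by (simp add: cU_def)
  qed
 qed
 also have "... = (\<Sum>G\<in>reps ?U. ?w G)" unfolding gsum_def by (rule sum.cong) (auto simp: rigid_Uc[OF _ one_in] dest: representatives_subset)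
 finally show ?thesis .
qed

lemma gsum_U_cU: "gsum (Uc r N {1..n} g d {1..n} 1) (wl P V lam z 1) =
 (\<Sum>G\<in>reps (Uc r N {1..n} g d {1..n} 1). cU V lam z G * dd P (nbr 1 G) (cv z lam G))" unfolding gsum_def by (rule sum.cong) (auto simp: rigid_Uc[OF _ one_in] wl_def wsp_def cU_def dest: representatives_subset)

lemma finite_U: "finite (reps (Uc r N {1..n} g d {1..n} 1))" by (intro finite_reps_Uc) auto

lemma nbr_U:
 assumes "G:Uc r N {1..n} g d {1..n} 1"
 shows "finite (nbr 1 G)" "1 <= card (nbr 1 G)" using in_verticesD(1,2)[OF UcD(2)[OF assms] Uc_square(1)[OF assms one_in]] by (auto simp: Suc_le_eq card_gt_0_iff)

lemma gsum_U_split: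
 "gsum (Uc r N {1..n} g d {1..n} 1) w = gsum {G:Uc r N {1..n} g d {1..n} 1. card (nbr 1 G) = 1} w +
  gsum {G:Uc r N {1..n} g d {1..n} 1. card (nbr 1 G) = 2} w + gsum {G:Uc r N {1..n} g d {1..n} 1. 3 <= card (nbr 1 G)} w"
proof -
 let ?U = "Uc r N {1..n} g d {1..n} 1"
 have nb: "card (nbr 1 H) = card (nbr 1 G)" if "G:?U" "H:?U" "is_iso f G H" for G H f using nbr_iso_Uc(1)[OF that one_in] .
 have 1: "gsum ?U w = gsum {G:?U. card (nbr 1 G) = 1} w + gsum {G:?U. ~ card (nbr 1 G) = 1} w" by (rule gsum_split[OF finite_U]) (metis nb)
 have r: "reps {G:?U. ~ card (nbr 1 G) = 1} = {G:reps ?U. ~ card (nbr 1 G) = 1}" by (rule reps_Collect) (metis nb)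
 have 2: "gsum {G:?U. ~ card (nbr 1 G) = 1} w = gsum {G:{G:?U. ~ card (nbr 1 G) = 1}. card (nbr 1 G) = 2} w +
  gsum {G:{G:?U. ~ card (nbr 1 G) = 1}. ~ card (nbr 1 G) = 2} w"
 proof (rule gsum_split)
  show "finite (reps {G:?U. ~ card (nbr 1 G) = 1})" unfolding r using finite_U by simp
  show "card (nbr 1 G) = 2 <-> card (nbr 1 H) = 2" if "G:{G:?U. ~ card (nbr 1 G) = 1}" "H:{G:?U. ~ card (nbr 1 G) = 1}" "is_iso f G H" for G H f using nb[OF _ _ that(3)] that(1,2) by auto
 qed
 have "{G:{G:?U. ~ card (nbr 1 G) = 1}. card (nbr 1 G) = 2} = {G:?U. card (nbr 1 G) = 2}" by auto
 moreover have "{G:{G:?U. ~ card (nbr 1 G) = 1}. ~ card (nbr 1 G) = 2} = {G:?U. 3 <= card (nbr 1 G)}" using nbr_U(2) by force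
 ultimately show ?thesis using 1 2 by simp
qed

lemma interval_eq_single: "{1..n} = {1}<->n = 1"
proof
 assume "{1..n} = {1}"
 moreover have "n:{1..n}" using n by simp
 ultimately show "n = 1" by blast
qed simp

text \<open>The square vertex has degree one, two, or at least three. Its divided difference of P
  has one or two equal points z1 in the two small cases, giving P(z1) and P'(z1), and in the last
  case it can be recoloured.\<close>

lemma gsum_U_wl:
 "gsum (Uc r N {1..n} g d {1..n} 1) (wl P V lam z 1) =
  (if g = 0&d = - (int r + 1)&n = 1 then poly P (z 1) / poly (pderiv (pderiv V)) (z 1) else 0) +
  poly (pderiv P) (z 1) / poly (pderiv (pderiv V)) (z 1) * Wsum r N V lam {1..n} g d {1..n} z +
  gsum (Wc r N {1..n} g d {1..n}) (wl P V lam z 1)"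
proof -
 have fin: "finite {1..n}" by simp
 show ?thesis unfolding gsum_U_split transfer_stick[OF one_in one_in] transfer_subdiv_square[where z = z and i = 1, OF one_in fin fin ev_nz(1)]
  transfer_recolour[OF one_in fin fin] interval_eq_single by (simp add: ev_gg ev_gg_gg Wsum_def inverse_eq_divide)
qed

lemma residue_gen_U:
 "- residue_at_infinity (%u. fls_nth (fls_const (poly P u) * gen_U r V N lam g n u z) d) =
  gsum (Uc r N {1..n} g d {1..n} 1) (wl P V lam z 1)" unfolding fls_mult_const_nth gen_U_nth gsum_U_cU by (rule residue_sum_fractions[OF finite_U]) (rule nbr_U(1)[OF representatives_subset])

text \<open>For P = V' the squares of degree two contribute W, since P'(z1)/V''(z1) = 1, and the
  larger ones contribute - W because the divided difference of V' is minus the weight of a black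
  vertex. Only the single edge survives.\<close>

lemma part_iii:
 "- residue_at_infinity (%u. fls_nth (fls_const (poly (pderiv V) u) * gen_U r V N lam g n u z) d) =
  fls_nth (if g = 0&n = 1
  then fls_const (poly (pderiv V) (z 1) / poly (pderiv (pderiv V)) (z 1)) * fls_X_inv ^ (r + 1)
  else 0) d" unfolding residue_gen_U gsum_U_wl gsum_wl_black(1)[OF one_in] using ev_nz(2) by (auto simp del: power_Suc)

text \<open>For P = (u - z1) V' the single edge vanishes since P(z1) = 0, and degree two gives
  V'(z1)/V''(z1) times W. In the remaining sum corner and side terms cancel, and each of the N loops
  with an unmarked inner face contributes 1/V''(z1).\<close>

lemma part_iv:
 "- residue_at_infinity (%u. fls_nth (fls_const (poly (pderiv V) u * (u - z 1)) * gen_U r V N lam g n u z) d) =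
  fls_nth (fls_const (poly (pderiv V) (z 1) / poly (pderiv (pderiv V)) (z 1)) * gen_W r V N lam g n z
  + (if g = 0&n = 1 then fls_const (of_nat N / poly (pderiv (pderiv V)) (z 1)) else 0)) d"
proof -
 let ?x = "z 1" and ?V1 = "pderiv V" and ?V2 = "poly (pderiv (pderiv V)) (z 1)"
 define P where "P = [:- ?x, 1:] * ?V1"
 have P: "poly P u = poly ?V1 u * (u - ?x)" for u by (simp add: P_def algebra_simps)
 have dP: "poly (pderiv P) ?x = poly ?V1 ?x" unfolding P_def pderiv_mult by (simp add: pderiv_pCons)
 have ins1: "insert 1 {2..n} = {1..n}" using n by auto
 have nz: "nonzero_on V (z ` {1..n} Un lam ` {1..N})" by (rule nonzero_generic[OF z nd])
 have "gsum (Wc r N {1..n} g d {1..n}) (wl P V lam z 1) = (if g = 0&d = 0&n = 1 then of_nat N / ?V2 else 0)"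
 proof -
  \<comment> \<open>The factor u - z1 removes one of the two equal points. The doubled corner
    thereby returns to the corner of G with the sign opposite to a black vertex, and the broken edge
    returns to the edge of G; the two terms are minus and plus the weight of G.\<close>
  have TT: "Tc P V G (cv z lam G) (cv z lam G) h ?x ?x + Ts P V G (cv z lam G) (cv z lam G) h ?x ?x = 0"
  if GW: "G:Wc r N {1..n} g d {2..n}" and h: "h:darts G" "dl G h = Marked 1" for G h
  proof -
  note G = WcD[OF GW]
  let ?c = "cv z lam G"
  have ch: "?c h = ?x" using h by (simp add: cv_dl)
  have b: "cl G h = Black" using Wc_marked_black[OF GW h] by simp
  let ?v = "vx G h"
  have v: "?v:vertices G" "finite ?v" "h:?v" using h(1) vx_self[OF G(2)] in_verticesD(1)[OF G(2)] by (auto simp: vertices_def)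
  have "ev P (gg ?x * gg ?x * (\<Prod>i\<in>?v - {h}. gg (?c i))) = ev ?V1 (gg ?x * (\<Prod>i\<in>?v - {h}. gg (?c i)))" unfolding P_def mult.assoc by (rule ev_shift) simp
  also have "gg ?x * (\<Prod>i\<in>?v - {h}. gg (?c i)) = (\<Prod>i\<in>?v. gg (?c i))" using prod.remove[OF v(2,3), of "%i. gg (?c i)"] ch by simp
  finally have "Tc P V G ?c ?c h ?x ?x = - wt V ?c ?c G" unfolding Tc_def wt_def prod.remove[OF finite_vertices(1)[OF G(2)] v(1)] using b by (simp add: vw_def cl_def dd_def)
  moreover have "Ts P V G ?c ?c h ?x ?x = wt V ?c ?c G"
  proof -
  let ?k = "opp G h"
  let ?D = "ev ?V1 (gg ?x * gg (?c ?k))"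
  have "?D~=0" using nz cv_in[OF G(1), of ?k z lam] h(1) opp_in[OF G(2)] one_in unfolding nonzero_on_def by blast
  moreover have "ev P (gg ?x * gg ?x * gg (?c ?k)) = ?D" unfolding P_def mult.assoc by (rule ev_shift) simp
  moreover have "{h, ?k}:edges G" using h(1) by (auto simp: edges_def)
  moreover have "dd ?V1 {h, ?k} ?c = ?D" using dd_edge[OF G(2) h(1)] ch by simp
  ultimately show ?thesis unfolding Ts_def wt_def EW_def by (simp add: prod.remove[OF finite_edges[OF G(2)], of "{h, ?k}"])
  qed
  ultimately show ?thesis by simp
  qed
  have fin: "finite {1..n}" "finite {2..n}" by simp_all
  have "gsum (Wc r N {1..n} g d {1..n}) (wl P V lam z 1) = (\<Sum>\<beta>\<in>loop_labels N {1..n} g d {2..n} 1. 1 / ?V2)"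
  proof -
  have "1~:{2..n}" by simp
  note L = gsum_leaf[OF one_in this fin refl, of r N g d P V lam z, unfolded ins1]
  have "(\<Sum>G\<in>reps (Wc r N {1..n} g d {2..n}). (\<Sum>h | h:darts G&dl G h = Marked 1.
  Tc P V G (cv z lam G) (cv z lam G) h ?x ?x + Ts P V G (cv z lam G) (cv z lam G) h ?x ?x) /
  of_nat (card (automorphisms G))) = 0"
  proof (intro sum.neutral ballI)
  fix G assume "G:reps (Wc r N {1..n} g d {2..n})"
  then have "G:Wc r N {1..n} g d {2..n}" by (rule representatives_subset)
  then have "(\<Sum>h | h:darts G&dl G h = Marked 1. Tc P V G (cv z lam G) (cv z lam G) h ?x ?x +
  Ts P V G (cv z lam G) (cv z lam G) h ?x ?x) = 0" using TT by (intro sum.neutral) blast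
  then show "(\<Sum>h | h:darts G&dl G h = Marked 1. Tc P V G (cv z lam G) (cv z lam G) h ?x ?x +
  Ts P V G (cv z lam G) (cv z lam G) h ?x ?x) / of_nat (card (automorphisms G)) = 0" by simp
  qed
  moreover have "inverse (ev ?V1 (gg ?x * gg ?x)) * inverse (ev ?V1 (gg ?x * gg (dec_value z lam \<beta>))) *
  ev P (gg ?x * gg ?x * gg (dec_value z lam \<beta>)) = 1 / ?V2" if b: "\<beta> : loop_labels N {1..n} g d {2..n} 1" for \<beta>
  proof -
  have "dec_value z lam \<beta> : z ` {1..n} Un lam ` {1..N}" using b by (auto simp: loop_labels_def split: if_splits)
  then have "ev ?V1 (gg ?x * gg (dec_value z lam \<beta>))~=0" using nz one_in unfolding nonzero_on_def by blast
  moreover have "ev P (gg ?x * gg ?x * gg (dec_value z lam \<beta>)) = ev ?V1 (gg ?x * gg (dec_value z lam \<beta>))" unfolding P_def mult.assoc by (rule ev_shift) simp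
  ultimately show ?thesis by (simp add: ev_gg_gg inverse_eq_divide)
  qed
  ultimately show ?thesis unfolding L by (simp cong: sum.cong)
  qed
  moreover have "loop_labels N {1..n} g d {2..n} 1 = (if g = 0&d = 0&n = 1 then Unmarked ` {1..N} else {})"
  proof (cases "n = 1")
  case False
  then have "2:{2..n}" using n by auto
  then have "{2..n}~={}" by blast
  then show ?thesis using False by (simp add: loop_labels_def)
  qed (auto simp: loop_labels_def)
  ultimately show ?thesis by (simp add: card_image inj_on_def)
 qed
 moreover have res: "- residue_at_infinity (%u. fls_nth (fls_const (poly ?V1 u * (u - ?x)) * gen_U r V N lam g n u z) d) =
  gsum (Uc r N {1..n} g d {1..n} 1) (wl P V lam z 1)" using residue_gen_U[of P] by (simp only: P)
 ultimately show ?thesis unfolding res gsum_U_wl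
  fls_plus_nth fls_mult_const_nth gen_W_nth[OF deg nd n] dP by (auto simp: P)
qed

text \<open>Squares of degree one are removed exactly by the subtracted term, squares of degree two
  survive the limit, and those of higher degree vanish in it.\<close>

lemma part_v:
 "((%u. fls_nth (fls_const (u\<^sup>2) * (gen_U r V N lam g n u z
  - (if g = 0&n = 1
  then fls_const (1 / (poly (pderiv (pderiv V)) (z 1) * (u - z 1))) * fls_X_inv ^ (r + 1)
  else 0))) d)
  \<longlongrightarrow> fls_nth (fls_const (1 / poly (pderiv (pderiv V)) (z 1)) * gen_W r V N lam g n z) d) at_infinity"
proof -
 let ?U = "Uc r N {1..n} g d {1..n} 1" and ?c = "cv z lam" and ?V2 = "poly (pderiv (pderiv V)) (z 1)"
 let ?R = "reps ?U" and ?\<delta> = "if g = 0&d = - (int r + 1)&n = 1 then 1 / ?V2 else 0"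
 have UU: "G:?R==>G:?U" for G by (rule representatives_subset)
 let ?R1 = "{G:?R. card (nbr 1 G) = 1}" and ?R2 = "{G:?R. 2 <= card (nbr 1 G)}"
 have R: "?R = ?R1 Un ?R2" "?R1 Int ?R2 = {}" using nbr_U(2)[OF UU] by force+
 have nb: "card (nbr 1 H) = card (nbr 1 G)" if "G:?U" "H:?U" "is_iso f G H" for G H f using nbr_iso_Uc(1)[OF that one_in] .
 have rep: "reps {G:?U. card (nbr 1 G) = k} = {G:?R. card (nbr 1 G) = k}" for k by (rule reps_Collect) (metis nb)
 have gs: "gsum {G:?U. card (nbr 1 G) = k} (wl P V lam z 1) = (\<Sum>G\<in>{G:?R. card (nbr 1 G) = k}. cU V lam z G * dd P (nbr 1 G) (?c G))" for k P unfolding gsum_def rep by (rule sum.cong) (auto simp: rigid_Uc[OF UU one_in] wl_def wsp_def cU_def)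
 have corner: "?c G h = z 1" if G: "G:?R1" and h: "h:nbr 1 G" for G h
 proof -
  have GU: "G:?U" using G UU by auto
  note n = leaf_neighbour[OF UcD(2-4)[OF GU] one_in]
  have "opp G (leaf 1 G):nbr 1 G" using vx_self[OF UcD(2)[OF GU]] by (simp add: nbr_def)
  moreover have "card (nbr 1 G) = 1" using G by simp
  ultimately have "h = opp G (leaf 1 G)" using h by (metis card_1_singletonE singletonD)
  then show ?thesis using n(8) by (simp add: cv_dl)
 qed
 have stick: "(\<Sum>G\<in>?R1. cU V lam z G) = ?\<delta>"
 proof -
  \<comment> \<open>The constant polynomial 1 has divided difference 1 at one point, so the transfer
    formula for arbitrary P evaluates the plain sum.\<close>
  have "(\<Sum>G\<in>?R1. cU V lam z G) = (\<Sum>G\<in>?R1. cU V lam z G * dd [:1:] (nbr 1 G) (?c G))"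
  proof (rule sum.cong[OF refl])
  fix G assume "G:?R1"
  then obtain h where "nbr 1 G = {h}" by (metis (mono_tags, lifting) card_1_singletonE mem_Collect_eq)
  then show "cU V lam z G = cU V lam z G * dd [:1:] (nbr 1 G) (?c G)" by (simp add: dd_def ev_gg)
  qed
  also have "... = ?\<delta>" unfolding gs[symmetric] transfer_stick[OF one_in one_in] interval_eq_single by (simp add: ev_gg ev_gg_gg inverse_eq_divide)
  finally show ?thesis .
 qed
 have two: "(\<Sum>G\<in>{G:?R. card (nbr 1 G) = 2}. cU V lam z G) = 1 / ?V2 * Wsum r N V lam {1..n} g d {1..n} z"
 proof -
  \<comment> \<open>Likewise the polynomial u has divided difference 1 at two points.\<close>
  have "(\<Sum>G\<in>{G:?R. card (nbr 1 G) = 2}. cU V lam z G) =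
  (\<Sum>G\<in>{G:?R. card (nbr 1 G) = 2}. cU V lam z G * dd [:0, 1:] (nbr 1 G) (?c G))"
  proof (rule sum.cong[OF refl])
  fix G assume "G:{G:?R. card (nbr 1 G) = 2}"
  then obtain a b where "nbr 1 G = {a, b}" "a~=b" by (auto simp: card_2_iff)
  then have "dd [:0, 1:] (nbr 1 G) (?c G) = 1" by (simp add: dd_def ev_def fps_mult_nth numeral_2_eq_2)
  then show "cU V lam z G = cU V lam z G * dd [:0, 1:] (nbr 1 G) (?c G)" by simp
  qed
  also have "... = 1 / ?V2 * Wsum r N V lam {1..n} g d {1..n} z"
  proof -
  have fin: "finite {1..n}" by simp
  have "poly (pderiv [:0, 1:]) (z 1) = 1" by (simp add: pderiv_pCons)
  then show ?thesis unfolding gs[symmetric] transfer_subdiv_square[where z = z and i = 1, OF one_in fin fin ev_nz(1)] by (simp add: ev_gg_gg Wsum_def inverse_eq_divide)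
  qed
  finally show ?thesis .
 qed
 have eqn: "fls_nth (fls_const (u\<^sup>2) * (gen_U r V N lam g n u z
  - (if g = 0&n = 1
  then fls_const (1 / (?V2 * (u - z 1))) * fls_X_inv ^ (r + 1)
  else 0))) d = (\<Sum>G\<in>?R2. cU V lam z G * (u\<^sup>2 * (\<Prod>h\<in>nbr 1 G. 1 / (u - ?c G h))))" for u
 proof -
  have "(\<Prod>h\<in>nbr 1 G. 1 / (u - ?c G h)) = 1 / (u - z 1)" if G: "G:?R1" for G
  proof -
  obtain h where "nbr 1 G = {h}" using G by (metis (mono_tags, lifting) card_1_singletonE mem_Collect_eq)
  then show ?thesis using corner[OF G, of h] by simp
  qed
  then have "(\<Sum>G\<in>?R1. cU V lam z G * (\<Prod>h\<in>nbr 1 G. 1 / (u - ?c G h))) = ?\<delta> * (1 / (u - z 1))" unfolding stick[symmetric] sum_distrib_right by (intro sum.cong) auto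
  moreover have "(\<Sum>G\<in>?R. cU V lam z G * (\<Prod>h\<in>nbr 1 G. 1 / (u - ?c G h))) =
  (\<Sum>G\<in>?R1. cU V lam z G * (\<Prod>h\<in>nbr 1 G. 1 / (u - ?c G h))) + (\<Sum>G\<in>?R2. cU V lam z G * (\<Prod>h\<in>nbr 1 G. 1 / (u - ?c G h)))" using R finite_U by (metis (no_types, lifting) finite_Un sum.union_disjoint)
  moreover have "fls_nth (if g = 0&n = 1 then fls_const (1 / (?V2 * (u - z 1))) * fls_X_inv ^ (r + 1) else 0) d = ?\<delta> * (1 / (u - z 1))" by (auto simp del: power_Suc)
  ultimately have "fls_nth (gen_U r V N lam g n u z
  - (if g = 0&n = 1
  then fls_const (1 / (?V2 * (u - z 1))) * fls_X_inv ^ (r + 1)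
  else 0)) d = (\<Sum>G\<in>?R2. cU V lam z G * (\<Prod>h\<in>nbr 1 G. 1 / (u - ?c G h)))" unfolding fls_minus_nth gen_U_nth by simp
  then show ?thesis unfolding fls_mult_const_nth by (simp add: sum_distrib_left mult_ac)
 qed
 have L: "((%u. \<Sum>G\<in>?R2. cU V lam z G * (u\<^sup>2 * (\<Prod>h\<in>nbr 1 G. 1 / (u - ?c G h))))
  \<longlongrightarrow> (\<Sum>G\<in>?R2. cU V lam z G * (if card (nbr 1 G) = 2 then 1 else 0))) at_infinity" using nbr_U(1)[OF UU] by (intro tendsto_sum tendsto_mult tendsto_const tendsto_square_fractions) auto
 have S: "(\<Sum>G\<in>?R2. cU V lam z G * (if card (nbr 1 G) = 2 then 1 else 0)) = (\<Sum>G\<in>{G:?R. card (nbr 1 G) = 2}. cU V lam z G)" using finite_U by (intro sum.mono_neutral_cong_right) auto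
 have "fls_nth (fls_const (1 / ?V2) * gen_W r V N lam g n z) d = (\<Sum>G\<in>?R2. cU V lam z G * (if card (nbr 1 G) = 2 then 1 else 0))" unfolding S two fls_mult_const_nth gen_W_nth[OF deg nd n] ..
 then show ?thesis unfolding eqn using L by (simp only:)
qed

end

section \<open>The order of darts along the boundary of a face\<close>

lemma pre_props:
 assumes G: "is_map G" and h: "h:fc G b"
 defines "Y == insert h (pre G b h)" and "F == fc G b"
 shows "h~:pre G b h" "Y <= F" "b:Y" "h = b==>pre G b h = {}"
  "x:pre G b h==>face_perm G x:Y"
  "x:F - pre G b h==>face_perm G x:F - Y | face_perm G x = b"
  "h~=b==>x:F==>face_perm G x = h==>x:pre G b h"
proof -
 define L where "L = card F"
 define f where "f t = (face_perm G ^^ t) b" for t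
 note en = face_enum[OF G L_def[unfolded F_def], folded F_def f_def]
 have inj: "f s = f t<->s = t" if "s < L" "t < L" for s t using en(2) that by (auto simp: inj_on_def)
 have Suc: "face_perm G (f t) = f (Suc t)" and f0: "f 0 = b" for t by (simp_all add: f_def)
 have fL: "f L = b" using orbit_enum(3)[OF fin_darts[OF G] fp_permutes[OF G] L_def[unfolded F_def face_at_def]] by (simp add: f_def)
 obtain j where j: "j < L" "h = f j" using h en(1) by (auto simp: F_def)
 have p: "pre G b h = f ` {..<j}" using pre_funpow[OF G, of j b] j by (simp add: f_def L_def F_def)
 have "{..j} = insert j {..<j}" by auto
 then have Y: "Y = f ` {..j}" unfolding Y_def p using j(2) by simp
 show "h~:pre G b h"
 proof
  assume "h:pre G b h"
  then have "f j:f ` {..<j}" using p j(2) by simp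
  then obtain t where "t < j" "f j = f t" by auto
  then show False using inj[of j t] j(1) by auto
 qed
 show "Y <= F" unfolding Y using j(1) en(1) by auto
 show "b:Y" unfolding Y using f0 by force
 show "h = b==>pre G b h = {}" using inj[of j 0] j f0 en(3) p by auto
 show "x:pre G b h==>face_perm G x:Y" unfolding p Y by (auto simp: Suc)
 show "face_perm G x:F - Y | face_perm G x = b" if x: "x:F - pre G b h"
 proof -
  obtain t where t: "t < L" "x = f t" using x en(1) by auto
  then have "j <= t" using x p by (cases "t < j") auto
  show ?thesis
  proof (cases "Suc t = L")
  case False
  then have "Suc t < L" using t by simp
  moreover from this have "f (Suc t)~=f s" if "s <= j" for s using inj[of "Suc t" s] that \<open>j <= t\<close> by auto
  ultimately show ?thesis using t(2) Suc en(1) unfolding Y by auto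
  qed (use t Suc fL in simp)
 qed
 show "x:pre G b h" if hb: "h~=b" and x: "x:F" "face_perm G x = h"
 proof -
  obtain t where t: "t < L" "x = f t" using x en(1) by auto
  have "Suc t~=L" using t x(2) Suc fL hb by auto
  then have "Suc t = j" using inj[of "Suc t" j] t j x(2) Suc by auto
  then show ?thesis using t p by auto
 qed
qed

text \<open>Recognizes an initial segment without counting: a set that contains b and can be left
  only at h, whose complement in the face can be left only at b, consists of the darts before h.
  This is how the order is followed through surgery.\<close>

lemma pre_unique:
 assumes G: "is_map G" and S: "S Un T = fc G b" "S Int T = {}" "b:S" "h:T"
  "!!x. x:S==>face_perm G x:S | face_perm G x = h" "!!x. x:T==>face_perm G x:T | face_perm G x = b"
 shows "pre G b h = S"
proof -
 define L where "L = card (fc G b)"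
 define f where "f t = (face_perm G ^^ t) b" for t
 note en = face_enum[OF G L_def, folded f_def]
 have inj: "f s = f t<->s = t" if "s < L" "t < L" for s t using en(2) that by (auto simp: inj_on_def)
 have Suc: "face_perm G (f t) = f (Suc t)" and f0: "f 0 = b" for t by (simp_all add: f_def)
 obtain j where j: "j < L" "h = f j" using S(1,4) en(1) by blast
 have 1: "f t:S" if "t < j" for t using that
 proof (induction t)
  case (Suc t)
  show ?case using inj[of "Suc t" j] j S(5)[of "f t"] Suc \<open>!!t. face_perm G (f t) = f (Suc t)\<close> by auto
 qed (use f0 S(3) in simp)
 have 2: "f (j + t):T" if "j + t < L" for t using that
 proof (induction t)
  case (Suc t)
  show ?case using inj[of "Suc (j + t)" 0] f0 S(6)[of "f (j + t)"] Suc \<open>!!t. face_perm G (f t) = f (Suc t)\<close> by auto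
 qed (use j S(4) in simp)
 have "f t:S<->t < j" if "t < L" for t using 1[of t] 2[of "t - j"] that S(2) by (cases "t < j") auto
 note iff = this
 have "S = f ` {..<j}"
 proof (intro set_eqI iffI)
  fix x assume x: "x:S"
  then obtain t where "t < L" "x = f t" using S(1) en(1) by blast
  then show "x:f ` {..<j}" using iff[of t] x by auto
 qed (use 1 in auto)
 then show ?thesis using pre_funpow[OF G, of j b] j by (simp add: f_def L_def)
qed

text \<open>The new edge is traversed just before h, along p and then along q, so exactly p joins
  the darts that were before h.\<close>

lemma lf_pre:
 assumes G: "is_map G" and L: "leafins k G h p q H" and h: "h:fc G b" "h~=b" and b: "b:darts G"
 shows "pre H b q = insert p (pre G b h)" "fc H b = insert q (insert p (fc G b))"
proof -
 note D = lf_darts[OF G L] and H = lf_is_map[OF G L]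
 note P = pre_props[OF G h(1)]
 have hb: "h:fc G b" by (rule h(1))
 show fb: "fc H b = insert q (insert p (fc G b))" using lf_face_old[OF G L b] h(1) by simp
 have F: "fc G b <= darts G" by (rule fc_subset[OF G b])
 have fp: "face_perm H p = q" "face_perm H q = h" using fp_iff[OF H] lf_opp[OF G L] lf_rot[OF G L] by auto
 have fo: "face_perm H x = (if face_perm G x = h then p else face_perm G x)" if x: "x:darts G" for x
 proof -
  have n: "x~=p" "x~=q" using x D by auto
  show ?thesis by (metis x D face_perm_in[OF G] fp_iff[OF H] lf_opp(3)[OF G L n] lf_rot[OF G L] rot_face_perm[OF G, of x])
 qed
 show "pre H b q = insert p (pre G b h)"
 proof (rule pre_unique[OF H, where T = "insert q (fc G b - pre G b h)"])
  show "insert p (pre G b h) Un insert q (fc G b - pre G b h) = fc H b" using P(2) fb by auto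
  show "insert p (pre G b h) Int insert q (fc G b - pre G b h) = {}" using P(2) F D by auto
  show "b:insert p (pre G b h)" using P(3) h(2) by auto
  show "face_perm H x:insert p (pre G b h) | face_perm H x = q" if "x:insert p (pre G b h)" for x
  proof (cases "x = p")
  case False
  then have x: "x:pre G b h" using that by simp
  then have "x:darts G" using P(2) F by blast
  then show ?thesis using fo[of x] P(5)[OF x] by auto
  qed (use fp in simp)
  show "face_perm H x:insert q (fc G b - pre G b h) | face_perm H x = b" if x: "x:insert q (fc G b - pre G b h)" for x
  proof (cases "x = q")
  case False
  then have x': "x:fc G b - pre G b h" using x by simp
  then have "face_perm G x~=h" using P(7)[OF h(2), of x] by auto
  then show ?thesis using P(6)[OF x'] fo[of x] x' F by auto
  qed (use fp P(1) h(1) in auto)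
 qed simp
qed

text \<open>The new dart t comes right after h. If the other side of the edge belongs to the same
  face and has been passed already, then its second half s has been passed as well.\<close>

lemma sd_pre:
 assumes G: "is_map G" and L: "subdiv k G h s t H" and h: "h:fc G b" and b: "b:darts G"
 defines "Y == insert h (pre G b h)"
 shows "pre H b t = Y Un (if opp G h:Y then {s} else {})" "t:fc H b" "t~=b"
  "fc H b Int darts G = fc G b" "s:fc H b <-> opp G h:fc G b"
proof -
 note D = sd_darts[OF G L] and H = sd_is_map[OF G L]
 note P = pre_props[OF G h, folded Y_def]
 let ?u = "opp G h" and ?F = "fc G b"
 have F: "?F <= darts G" by (rule fc_subset[OF G b])
 have fb: "fc H b = ?F Un {t} Un (if ?u:?F then {s} else {})" using sd_face_old[OF G L b] h by simp
 show tb: "t:fc H b" "t~=b" using fb b D by auto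
 show "fc H b Int darts G = ?F" "s:fc H b<->?u:?F" using fb F D by auto
 have fp: "face_perm H h = t" "face_perm H ?u = s" "face_perm H t = face_perm G h" "face_perm H s = face_perm G ?u"
  and fo: "x:darts G==>x~=h==>x~=?u==>face_perm H x = face_perm G x" for x
 proof -
  have rf: "rot H (face_perm G y) = opp G y" if y: "y:darts G" for y
  proof -
  have "face_perm G y:darts G" using y face_perm_in[OF G] by simp
  then have "face_perm G y~=s" "face_perm G y~=t" using D by auto
  then show ?thesis using sd_rot(3)[OF G L] rot_face_perm[OF G] by metis
  qed
  show "face_perm H h = t" "face_perm H ?u = s" using fp_iff[OF H] sd_opp(1,3)[OF G L] sd_rot(1,2)[OF G L] by auto
  show "face_perm H t = face_perm G h" "face_perm H s = face_perm G ?u" using fp_iff[OF H] sd_opp(2,4)[OF G L] rf[OF D(1)] rf[OF D(5)] opp_opp[OF G] by auto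
  show "face_perm H x = face_perm G x" if x: "x:darts G" "x~=h" "x~=?u"
  proof -
  show ?thesis using x D fp_iff[OF H] sd_opp(5)[OF G L x(2,3)] rf[OF x(1)] by auto
  qed
 qed
 have stepY: "face_perm G x:Y" if "x:Y" "x~=h" for x using P(5) that by (auto simp: Y_def)
 have stepT: "face_perm G x:?F - Y | face_perm G x = b" if "x:?F - Y | x = h" for x using P(6)[of x] P(1) that h by (auto simp: Y_def)
 have hY: "h:Y" by (simp add: Y_def)
 show "pre H b t = Y Un (if ?u:Y then {s} else {})"
 proof (rule pre_unique[OF H, where T = "insert t (?F - Y) Un (if ?u:?F - Y then {s} else {})"])
  show "Y Un (if ?u:Y then {s} else {}) Un (insert t (?F - Y) Un (if ?u:?F - Y then {s} else {})) = fc H b" using P(2) fb by auto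
  show "(Y Un (if ?u:Y then {s} else {})) Int (insert t (?F - Y) Un (if ?u:?F - Y then {s} else {})) = {}" using P(2) F D by auto
  show "b:Y Un (if ?u:Y then {s} else {})" using P(3) by auto
  show "face_perm H x:Y Un (if ?u:Y then {s} else {}) | face_perm H x = t" if x: "x:Y Un (if ?u:Y then {s} else {})" for x
  proof -
  consider "x = h" | "x = ?u" "?u:Y" | "x = s" "?u:Y" | "x:Y" "x~=h" "x~=?u" using x by (auto split: if_splits)
  then show ?thesis
  proof cases
  case 3 then show ?thesis using fp(4) stepY[of ?u] D(6) by simp
  next
  case 4 then show ?thesis using fo[of x] stepY[of x] P(2) F by auto
  qed (use fp in auto)
  qed
  show "face_perm H x:insert t (?F - Y) Un (if ?u:?F - Y then {s} else {}) | face_perm H x = b"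
  if x: "x:insert t (?F - Y) Un (if ?u:?F - Y then {s} else {})" for x
  proof -
  consider "x = t" | "x = ?u" "?u:?F - Y" | "x = s" "?u:?F - Y" | "x:?F - Y" "x~=?u" using x by (auto split: if_splits)
  then show ?thesis
  proof cases
  case 1 then show ?thesis using fp(3) stepT[of h] by auto
  next
  case 3 then show ?thesis using fp(4) stepT[of ?u] by auto
  next
  case 4
  then have "x~=h" "x:darts G" using hY F by auto
  then show ?thesis using fo[of x] 4 stepT[of x] by auto
  qed (use fp in auto)
  qed
 qed simp
qed

section \<open>Merging a univalent vertex into another vertex of the same face\<close>

text \<open>The free end q of an edge is attached to the vertex of b, right after b. This cuts their
  common face: the darts from b up to the predecessor of q form a new face decorated \<beta>, and
  the rest keeps the old decoration.\<close>

definition glue :: "'m decoration=>'m cmap=>nat=>nat=>'m cmap=>bool" where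
 "glue \<beta> K b q H<->b:darts K&q:darts K&b~=q&rot K q = q&q:fc K b &
  darts H = darts K & opp H = opp K&rot H = ins (rot K) b q &
  (ALL x:darts K. cl H x = (if x = q then cl K b else cl K x)&dl H x = (if x:pre K b q then \<beta> else dl K x))"

context
 fixes \<beta> :: "'m decoration" and K H :: "'m cmap" and b q :: nat
 assumes K: "is_map K" and L: "glue \<beta> K b q H"
begin

lemma glue_simps: "b:darts K" "q:darts K" "b~=q" "rot K q = q" "q:fc K b"
  "darts H = darts K" "opp H = opp K" "rot H = rot K \<circ> swp b q"
  "x:darts K ==> cl H x = (if x = q then cl K b else cl K x)"
  "x:darts K==>dl H x = (if x:pre K b q then \<beta> else dl K x)" using L by (auto simp: glue_def ins_def)

lemma glue_rot: "rot H b = q" "rot H q = rot K b" "x~=b==>x~=q==>rot H x = rot K x" unfolding glue_simps(8) using glue_simps(4) by auto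

lemma glue_is_map: "is_map H"
proof (rule is_mapI)
 show "rot H permutes darts H" unfolding glue_simps(6,8) using rot_permutes[OF K] glue_simps(1,2) by (intro permutes_compose permutes_swap_id)
qed (use glue_simps(6,7) fin_darts[OF K] opp_permutes[OF K] opp_neq[OF K] opp_opp[OF K] in auto)

lemma glue_face_perm: "face_perm H = swp b q \<circ> face_perm K"
proof
 fix x
 show "face_perm H x = (swp b q \<circ> face_perm K) x" using glue_simps(7,8) rot_face_perm[OF K] fp_iff[OF glue_is_map] by auto
qed

text \<open>The face permutation is composed with the transposition of b and q, so
  \<open>orbit_split\<close> applies at the position of q.\<close>

lemma glue_faces: "fc H b = pre K b q" "fc H q = fc K b - pre K b q"
  "y~:fc K b==>fc H y = fc K y" "card (faces H) = Suc (card (faces K))"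
  "fc H b Int fc H q = {}"
proof -
 define Lk where "Lk = card (fc K b)"
 note en = face_enum[OF K Lk_def]
 obtain j where j: "j < Lk" "q = (face_perm K ^^ j) b" using glue_simps(5) en(1) by auto
 have "j~=0" using j(2) glue_simps(3) by (cases j) auto
 then have j0: "0 < j" "j < card (orbit (face_perm K) b)" using j by (auto simp: Lk_def face_at_def)
 note S = orbit_split[OF fin_darts[OF K] fp_permutes[OF K] glue_simps(1) j0, folded j(2), folded glue_face_perm, folded face_at_def]
 have p: "pre K b q = (%t. (face_perm K ^^ t) b) ` {..<j}" using pre_funpow[OF K, of j b] j by (simp add: Lk_def)
 show 1: "fc H b = pre K b q" unfolding S(1) p ..
 have **: "(%t. (face_perm K ^^ t) b) ` {j..<Lk} = (%t. (face_perm K ^^ t) b) ` {..<Lk} - (%t. (face_perm K ^^ t) b) ` {..<j}"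
 proof -
  have *: "{j..<Lk} = {..<Lk} - {..<j}" by auto
  show ?thesis unfolding * by (rule inj_on_image_set_diff[OF en(2)]) (use j in auto)
 qed
 show 2: "fc H q = fc K b - pre K b q" unfolding S(2)[folded Lk_def] ** p en(1)[symmetric] by (rule refl)
 show "y~:fc K b==>fc H y = fc K y" by (rule S(3))
 show "card (faces H) = Suc (card (faces K))" using S(7) by (simp add: faces_def glue_simps(6) face_at_def[abs_def])
 show "fc H b Int fc H q = {}" using 1 2 by auto
qed

lemma glue_vertex: "x:darts K==>x~=q==>vx H x = (if b:vx K x then insert q (vx K x) else vx K x)"
  "vx K q = {q}" "vx H q = vx H b"
  "vertices K = insert {q} (vx K ` (darts K - {q}))" "{q}~:vx K ` (darts K - {q})"
  "vertices H = insert (insert q (vx K b)) (vx K ` (darts K - {q}) - {vx K b})"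
  "card (vertices K) = Suc (card (vertices H))"
proof -
 let ?D = "darts K - {q}"
 have perm: "rot K permutes ?D" by (rule permutes_superset[OF rot_permutes[OF K]]) (use glue_simps(4) in auto)
 have fin: "finite ?D" using fin_darts[OF K] by simp
 have D: "insert q ?D = darts K" "b:?D" "q~:?D" using glue_simps(1-3) by auto
 have r: "rot H = ins (rot K) b q" using L by (simp add: glue_def)
 note P = fin perm D(2,3)
 show "x:darts K==>x~=q==>vx H x = (if b:vx K x then insert q (vx K x) else vx K x)" using orbit_ins[OF P, of x] by (simp add: vertex_at_def r)
 show vq: "vx K q = {q}" using glue_simps(4) by (simp add: vertex_at_def orbit_eq_singleton_iff)
 show "vx H q = vx H b" using vx_rot[OF glue_is_map, of b] glue_rot(1) by simp
 show vK: "vertices K = insert {q} (vx K ` ?D)" by (metis vertices_def D(1) image_insert vq)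
 show n: "{q}~:vx K ` ?D" using vx_self[OF K] by fastforce
 have "vertices H = orbit (ins (rot K) b q) ` insert q ?D" by (simp only: vertices_def vertex_at_def[abs_def] r glue_simps(6) D(1))
 then show "vertices H = insert (insert q (vx K b)) (vx K ` ?D - {vx K b})"
  and "card (vertices K) = Suc (card (vertices H))" unfolding vK using orbits_ins[OF P] card_orbits_ins[OF P] n fin by (simp_all add: vertex_at_def[abs_def])
qed

lemma glue_edges: "edges H = edges K" unfolding edges_def glue_simps(6,7) ..

text \<open>One vertex less and one face more at the same number of edges: the genus stays, and the
  degree rises by r + 1.\<close>

lemma glue_euler: "has_genus g H<->has_genus g K" "map_degree r H = map_degree r K + (int r + 1)" using glue_faces(4) glue_vertex(7) by (auto simp: has_genus_def map_degree_def glue_edges algebra_simps)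

text \<open>Before the merge b and q are joined through their common face, afterwards through their
  common vertex. Hence the closed sets of darts are the same.\<close>

lemma glue_connected: "connected_map H <-> connected_map K"
proof -
 have orb: "orbit pe x <= S" if "x:S" "ALL y:S. pe y:S" for pe x S using that by (intro orbit_closed_subset) auto
 have inv: "y:S" if "pe permutes darts K" "ALL y:S. pe y:S" "pe y:S" for pe y S
 proof -
  have "orbit pe (pe y) = orbit pe y" using orbit_eq_of_mem[OF fin_darts[OF K] that(1) orbit.base] .
  then show ?thesis using orb[OF that(3,2)] orbit_self[OF fin_darts[OF K] that(1), of y] by auto
 qed
 have face: "face_perm K y:S" if S: "ALL x:S. rot K x:S & opp K x:S" and y: "y:S" for S y
 proof (rule inv[OF rot_permutes[OF K]])
  show "rot K (face_perm K y):S" using S y rot_face_perm[OF K] by metis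
 qed (use S in blast)
 have "(ALL x:S. rot K x:S & opp K x:S)<->(ALL x:S. rot H x:S & opp H x:S)" (is "?K<->?H") for S
 proof
  assume S: ?K
  have "b:S<->q:S" using face[OF S] orb[of b S "face_perm K"] orb[of q S "face_perm K"] glue_simps(5) fc_eq[OF K, of q b] fc_self[OF K, of b] face_at_def by blast
  then show ?H using S glue_rot glue_simps(7) by metis
 next
  assume S: ?H
  show ?K by (metis S glue_rot glue_simps(4,7))
 qed
 then show ?thesis unfolding connected_map_iff[OF K] connected_map_iff[OF glue_is_map] glue_simps(6) by simp
qed

text \<open>The face marked \<nu> is cut into one marked \<mu> and one still marked \<nu>; both
  parts are nonempty because the first contains b and the second q.\<close>

lemma glue_decorated:
 assumes nu: "dl K b = Marked \<nu>" and b: "\<beta> = Marked \<mu>" and M: "\<nu> : M" "\<mu> ~: M" and n: "!!x. x:darts K==>dl K x~=Marked \<mu>"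
 shows "decorated N (insert \<mu> M) H<->decorated N M K"
proof -
 note gl = glue_simps(10) and fs = glue_faces
 have F: "fc K b <= darts K" by (rule fc_subset[OF K glue_simps(1)])
 have dF: "dl K x = Marked \<nu>" if "x:fc K b" for x using dl_face[OF K that] nu by simp
 have pF: "pre K b q <= fc K b" "q:fc K b - pre K b q" "b:pre K b q" using pre_props(1-3)[OF K glue_simps(5)] glue_simps(3,5) by auto
 have lab: "dl H x = Marked \<mu> <-> x:pre K b q" if "x:darts K" for x using gl[OF that] b n[OF that] by auto
 have lab': "dl H x = Marked m<->dl K x = Marked m&x~:pre K b q" if "x:darts K" "m~=\<mu>" for x m using gl[OF that(1)] b that(2) by auto
 have mn: "\<mu> ~= \<nu>" using M by auto
 have 1: "(ALL h:darts H. dl H h:Marked ` insert \<mu> M Un Unmarked ` {1..N})<->(ALL h:darts K. dl K h:Marked ` M Un Unmarked ` {1..N})"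
  (is "?L<->?R")
 proof
  assume l: ?L
  show ?R
  proof
  fix x assume x: "x:darts K"
  show "dl K x:Marked ` M Un Unmarked ` {1..N}"
  proof (cases "x:pre K b q")
  case True then show ?thesis using dF pF(1) M(1) by blast
  next
  case False
  then have "dl K x:Marked ` insert \<mu> M Un Unmarked ` {1..N}" using bspec[OF l, of x] gl[OF x] x glue_simps(6) by simp
  then show ?thesis using n[OF x] by auto
  qed
  qed
 next
  assume ?R then show ?L using gl b unfolding glue_simps(6) by auto
 qed
 have 2: "(ALL m:insert \<mu> M. EX h:darts H. dl H h = Marked m)<->(ALL m:M. EX h:darts K. dl K h = Marked m)" (is "?L<->?R")
 proof
  assume l: ?L
  show ?R
  proof
  fix m assume m: "m:M"
  then obtain h where "h:darts H" "dl H h = Marked m" using l by blast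
  then show "EX h:darts K. dl K h = Marked m" using lab'[of h m] m M(2) unfolding glue_simps(6) by metis
  qed
 next
  assume r: ?R
  show ?L
  proof
  fix m assume m: "m:insert \<mu> M"
  consider "m = \<mu>" | "m = \<nu>" "m~=\<mu>" | "m~=\<mu>" "m~=\<nu>" "m:M" using m by auto
  then show "EX h:darts H. dl H h = Marked m" unfolding glue_simps(6)
  proof cases
  case 1 then show "EX h:darts K. dl H h = Marked m" using lab glue_simps(1) pF(3) by auto
  next
  case 2 then show "EX h:darts K. dl H h = Marked m" using lab'[of q m] glue_simps(2) pF(2) dF by auto
  next
  case 3
  then obtain h where h: "h:darts K" "dl K h = Marked m" using r by blast
  then have "h~:pre K b q" using dF pF(1) 3(2) by force
  then show "EX h:darts K. dl H h = Marked m" using lab'[of h m] h 3(1) by auto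
  qed
  qed
 qed
 have face_eq: "fc H x = fc H y<->fc K x = fc K y" if "x~:fc K b" "y~:fc K b" for x y using fs(3) that by simp
 have 3: "(ALL m:insert \<mu> M. ALL h:darts H. ALL h':darts H. dl H h = Marked m&dl H h' = Marked m-->fc H h = fc H h') <->
  (ALL m:M. ALL h:darts K. ALL h':darts K. dl K h = Marked m&dl K h' = Marked m-->fc K h = fc K h')" (is "?L<->?R")
 proof
  assume l: ?L
  have key: "x:fc K b" if x: "x:darts K" "dl K x = Marked \<nu>" for x
  proof (rule ccontr)
  assume nx: "x~:fc K b"
  then have "dl H x = Marked \<nu>" "dl H q = Marked \<nu>" using lab' x mn pF dF glue_simps(2) by auto
  then have "fc H x = fc H q" using l[rule_format, OF insertI2[OF M(1)], of x q] x(1) glue_simps(2,6) by simp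
  then show False using fs(2,3) nx fc_self[OF K, of x] by auto
  qed
  show ?R
  proof (intro ballI impI, elim conjE)
  fix m x y assume m: "m:M" "x:darts K" "y:darts K" "dl K x = Marked m" "dl K y = Marked m"
  show "fc K x = fc K y"
  proof (cases "m = \<nu>")
  case True then show ?thesis using key m fc_eq[OF K] by metis
  next
  case False
  then have nf: "x~:fc K b" "y~:fc K b" using dF m by auto
  then have "dl H x = Marked m" "dl H y = Marked m" using lab' m M(2) pF(1) by (metis subsetD)+
  then have "fc H x = fc H y" using l m(1-3) glue_simps(6) by blast
  then show ?thesis using face_eq nf by simp
  qed
  qed
 next
  assume r: ?R
  show ?L unfolding glue_simps(6)
  proof (intro ballI impI, elim conjE)
  fix m x y assume m: "m:insert \<mu> M" "x:darts K" "y:darts K" "dl H x = Marked m" "dl H y = Marked m"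
  show "fc H x = fc H y"
  proof (cases "m = \<mu>")
  case True
  then have "x:fc H b" "y:fc H b" using lab m fs(1) by auto
  then show ?thesis using fc_eq[OF glue_is_map] by metis
  next
  case False
  then have k: "dl K x = Marked m" "dl K y = Marked m" "x~:pre K b q" "y~:pre K b q" using lab' m by auto
  then have e: "fc K x = fc K y" using r m False by blast
  show ?thesis
  proof (cases "x:fc K b")
  case True
  then have "y:fc K b" using e fc_eq[OF K] by metis
  then have "x:fc H q" "y:fc H q" using True k fs(2) by auto
  then show ?thesis using fc_eq[OF glue_is_map] by metis
  next
  case False
  then have "y~:fc K b" using e fc_eq[OF K] by metis
  then show ?thesis using face_eq False e by simp
  qed
  qed
  qed
 qed
 show ?thesis unfolding decorated_iff 1 2 3 ..
qed

lemma glue_core: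
 assumes "dl K b = Marked \<nu>" "\<beta> = Marked \<mu>" "\<nu> : M" "\<mu> ~: M" "!!x. x:darts K==>dl K x~=Marked \<mu>"
 shows "core r N (insert \<mu> M) g (d + (int r + 1)) H <-> core r N M g d K" unfolding core_def using glue_decorated[OF assms] glue_connected glue_euler glue_is_map K by simp

text \<open>Only vertices of factor 1 are merged and edges do not change, so the weight is that of
  K. It is written with the factor of the black vertex at p singled out, ready for
  \<open>lf_weight\<close>.\<close>

lemma glue_weight:
 assumes w: "cl K q~=Black" "cl K b~=Black" and p: "p:darts K" "cl K p = Black"
 shows "wt V a c H = wsp (- pderiv V) V a c K (vx K p)"
proof -
 note v = glue_vertex and m = glue_is_map
 let ?R = "vx K ` (darts K - {q})"
 have fin: "finite ?R" using fin_darts[OF K] by simp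
 have bR: "vx K b:?R" using glue_simps(1,3) by auto
 have wb: "vw V K a (vx K b) = 1" "vw V K a {q} = 1" using w v(2) by (auto simp: vw_def cl_def)
 have nb: "b~:vx K y==>y:darts K==>y~=q==>vx H y = vx K y" for y using v(1) by simp
 have hb: "vx H b = insert q (vx K b)" using v(1)[OF glue_simps(1,3)] vx_self[OF K] by simp
 then have wb': "vw V H a (insert q (vx K b)) = 1" using w(2) glue_simps(9)[OF glue_simps(1)] glue_simps(3) by (auto simp: vw_def cl_def)
 have same: "vw V H a x = vw V K a x" if x: "x:?R - {vx K b}" for x
 proof -
  obtain y where y: "y:darts K" "y~=q" "x = vx K y" using x by auto
  then have "vx H y = x" using nb x vx_eq[OF K] by auto
  then have "colour H x = colour K x" using glue_simps(9)[OF y(1)] y by (auto simp: cl_def)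
  then show ?thesis by (simp add: vw_def)
 qed
 have "insert q (vx K b)~:?R - {vx K b}"
 proof
  assume "insert q (vx K b):?R - {vx K b}"
  then obtain y where "y~=q" "insert q (vx K b) = vx K y" by auto
  then show False using vx_eq[OF K, of q y] v(2) vx_self[OF K, of y] by auto
 qed
 then have "(\<Prod>x\<in>vertices H. vw V H a x) = (\<Prod>x\<in>?R - {vx K b}. vw V K a x)" unfolding v(6) using fin wb' same by simp
 also have "... = (\<Prod>x\<in>vertices K. vw V K a x)" unfolding v(4) using fin v(5) wb by (simp add: prod.remove[OF fin bR])
 finally have "wt V a c H = wt V a c K" by (simp add: wt_def EW_def glue_edges)
 also have "... = wsp (- pderiv V) V a c K (vx K p)" using wsp_black[OF K, of "vx K p"] p by (simp add: wsp_uminus vertices_def cl_def)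
 finally show ?thesis .
qed

end

lemma glue_ex:
 assumes K: "is_map (K :: 'm cmap)" "b:darts K" "q:darts K" "b~=q" "rot K q = q" "q:fc K b"
 obtains H where "glue \<beta> K b q H"
proof -
 let ?rh = "ins (rot K) b q" and ?c = "%x. if x = q then cl K b else cl K x" and ?d = "%x. if x:pre K b q then \<beta> else dl K x"
 have r: "?rh b = q" "?rh q = rot K b" "!!x. x~=b==>x~=q==>?rh x = rot K x" using K(5) by (auto simp: ins_def)
 have rho: "?rh permutes darts K" unfolding ins_def using rot_permutes[OF K(1)] K(2,3) by (intro permutes_compose permutes_swap_id)
 have rq: "rot K x = q<->x = q" for x using K(5) rot_inj[OF K(1)] by metis
 note P = pre_props[OF K(1,6)]
 have pF: "pre K b q <= fc K b" "b:pre K b q" using P(2,3) K(4) by auto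
 obtain H :: "'m cmap" where H: "is_map H" "darts H = darts K" "rot H = ?rh" "opp H = opp K"
  "!!h. h:darts K ==> cl H h = ?c h" "!!h. h:darts K==>dl H h = ?d h"
 proof (rule ex_map[OF fin_darts[OF K(1)] rho opp_permutes[OF K(1)], of ?c ?d])
  show "opp K h~=h & opp K (opp K h) = h" if "h:darts K" for h using that opp_neq[OF K(1)] opp_opp[OF K(1)] by auto
  show "?c (?rh h) = ?c h" if "h:darts K" for h using r rq cl_rot[OF K(1)] K(4) by (cases "h = b"; cases "h = q") auto
  show "?d y = ?d h" if h: "h:darts K" and e: "opp K h = ?rh y" for h y
  proof -
  have d: "dl K x = dl K b" if "x:fc K b" for x using dl_face[OF K(1) that] .
  consider "y = b" | "y = q" | "y~=b" "y~=q" by blast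
  then show ?thesis
  proof cases
  case 1
  then have fh: "face_perm K h = q" using e r(1) K(5) fp_iff[OF K(1)] by metis
  then have "h:fc K b" using K(6) fc_face_perm[OF K(1)] fc_eq[OF K(1)] by metis
  then have "h:pre K b q" using P(7) K(4) fh by auto
  then show ?thesis using 1 pF(2) by simp
  next
  case 2
  then have fh: "face_perm K h = b" using e r(2) fp_iff[OF K(1)] by metis
  then have hF: "h:fc K b" using fc_face_perm[OF K(1)] fc_eq[OF K(1)] by metis
  have "h~:pre K b q"
  proof
  assume "h:pre K b q"
  define Lk where "Lk = card (fc K b)"
  note en = face_enum[OF K(1) Lk_def]
  obtain j where j: "j < Lk" "q = (face_perm K ^^ j) b" using K(6) en(1) by auto
  then obtain t where t: "t < j" "h = (face_perm K ^^ t) b" using pre_funpow[OF K(1), of j b] \<open>h : pre K b q\<close> by (auto simp: Lk_def)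
  then have "(face_perm K ^^ Suc t) b = (face_perm K ^^ 0) b" using fh by simp
  then show False using inj_onD[OF en(2), of "Suc t" 0] t j by auto
  qed
  then show ?thesis using 2 P(1) d[OF hF] d[OF K(6)] by simp
  next
  case 3
  then have fh: "face_perm K h = y" using e r(3) fp_iff[OF K(1)] by metis
  then have dy: "dl K y = dl K h" using dl_face_perm[OF K(1)] by metis
  have "y:pre K b q<->h:pre K b q" using P(5)[of h] P(6)[of h] fh 3 fc_face_perm[OF K(1)] fc_eq[OF K(1)] pF(1) by blast
  then show ?thesis using dy by simp
  qed
  qed
 qed blast
 have "glue \<beta> K b q H" unfolding glue_def using H K by auto
 then show thesis by (rule that)
qed

text \<open>Detaching q from its vertex merges two faces, which have to be different; for a white
  vertex this is the star constraint. The merged face takes the decoration of the face of q, and k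
  is a free colour for the detached vertex.\<close>

lemma glue_undo:
 assumes H: "is_map (H :: 'm cmap)" "b:darts H" "rot H b = q" "b~=q" "q~:fc H b"
 obtains K where "is_map K" "glue (dl H b) K b q H" "cl K q = k" "dl K b = dl H q"
proof -
 have q: "q:darts H" using H(2,3) rot_in[OF H(1)] by metis
 let ?rh = "rot H \<circ> swp b q" and ?c = "%x. if x = q then k else cl H x" and ?d = "%x. if x:fc H b then dl H q else dl H x"
 have rho: "?rh permutes darts H" using rot_permutes[OF H(1)] H(2) q by (intro permutes_compose permutes_swap_id)
 have r: "?rh q = q" "?rh b = rot H q" "!!x. x~=b==>x~=q==>?rh x = rot H x" using H(3) by auto
 have rq: "rot H x = q<->x = b" for x using H(3) rot_inj[OF H(1)] by metis
 obtain K :: "'m cmap" where K: "is_map K" "darts K = darts H" "rot K = ?rh" "opp K = opp H"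
  "!!h. h:darts H ==> cl K h = ?c h" "!!h. h:darts H==>dl K h = ?d h"
 proof (rule ex_map[OF fin_darts[OF H(1)] rho opp_permutes[OF H(1)], of ?c ?d])
  show "opp H h~=h & opp H (opp H h) = h" if "h:darts H" for h using that opp_neq[OF H(1)] opp_opp[OF H(1)] by auto
  show "?c (?rh h) = ?c h" if "h:darts H" for h
  proof -
  have cq: "cl H q = cl H b" using cl_rot[OF H(1), of b] H(3) by simp
  consider "h = q" | "h = b" | "h~=b" "h~=q" by blast
  then show ?thesis
  proof cases
  case 2 then show ?thesis using r(2) rq[of q] H(4) cl_rot[OF H(1), of q] cq by auto
  next
  case 3 then show ?thesis using r(3)[OF 3] rq[of h] cl_rot[OF H(1), of h] by auto
  qed (use r(1) in simp)
  qed
  show "?d y = ?d h" if h: "h:darts H" and e: "opp H h = ?rh y" for h y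
  proof -
  have f: "face_perm H h = swp b q y" using e fp_iff[OF H(1)] by simp
  have d: "dl H (swp b q y) = dl H h" "swp b q y:fc H b<->h:fc H b" using f dl_face_perm[OF H(1)] fc_face_perm[OF H(1)] fc_eq[OF H(1)] by metis+
  have bb: "b:fc H b" by (rule fc_self[OF H(1)])
  consider "y = b" | "y = q" | "y~=b" "y~=q" by blast
  then show ?thesis by cases (use d H(5) bb in simp_all)
  qed
 qed blast
 have fK: "face_perm K = swp b q \<circ> face_perm H" using K(3,4) rot_face_perm[OF H(1)] fp_iff[OF K(1)] by auto
 obtain j where j: "0 < j" "j < card (fc K b)" "(face_perm K ^^ j) b = q" using orbit_merge[OF fin_darts[OF H(1)] fp_permutes[OF H(1)] H(2) q H(5)[unfolded face_at_def]] unfolding fK face_at_def by blast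
 have qF: "q:fc K b" using face_enum(1)[OF K(1) refl, of b] j by auto
 have "face_perm H = swp b q \<circ> face_perm K" unfolding fK by (auto simp: fun_eq_iff)
 then have "fc H b = pre K b q" using orbit_split(1)[OF fin_darts[OF K(1)] fp_permutes[OF K(1)] _ j(1) j(2)[unfolded face_at_def]] H(2) pre_funpow[OF K(1) j(2)] by (simp add: face_at_def[of H] j(3) K(2))
 note pre = this[symmetric]
 have cq: "cl H q = cl H b" using cl_rot[OF H(1), of b] H(3) by simp
 have "rot H = ins (rot K) b q" unfolding K(3) ins_def by (auto simp: fun_eq_iff)
 then have "glue (dl H b) K b q H" unfolding glue_def pre using K(2,4-6) H(2,4) q qF r(1) K(3) cq dl_face[OF H(1), of _ b] by auto
 moreover have "cl K q = k" "dl K b = dl H q" using K(5)[OF q] K(6)[OF H(2)] fc_self[OF H(1), of b] by auto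
 ultimately show thesis using that K(1) by blast
qed

text \<open>Both maps have the same darts, and each rotation is obtained from the other by the
  transposition of b and q. A bijection that respects b and q therefore respects both structures or
  neither.\<close>

lemma glue_iso:
 assumes m: "is_map K" "is_map K'" and L: "glue \<beta> K b q H" "glue \<beta> K' b' q' H'" and e: "dl K b = dl K' b'" "cl K q = cl K' q'"
 shows "(EX f. is_iso f K K'&f b = b'&f q = q')<->(EX f. is_iso f H H'&f b = b'&f q = q')"
proof -
 note H = glue_is_map[OF m(1) L(1)] glue_is_map[OF m(2) L(2)]
 note s = glue_simps[OF m(1) L(1)] and s' = glue_simps[OF m(2) L(2)]
 note fb = glue_faces(1)[OF m(1) L(1)] and fb' = glue_faces(1)[OF m(2) L(2)]
 have dK: "dl K x = (if x:fc H b then dl K b else dl H x)" if "x:darts K" for x using s(10)[OF that] pre_props(2)[OF m(1) s(5)] dl_face[OF m(1), of x b] fb by auto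
 have dK': "dl K' x = (if x:fc H' b' then dl K' b' else dl H' x)" if "x:darts K'" for x using s'(10)[OF that] pre_props(2)[OF m(2) s'(5)] dl_face[OF m(2), of x b'] fb' by auto
 have "is_iso f K K'<->is_iso f H H'" if fq: "f b = b'" "f q = q'" for f
 proof (cases "bij_betw f (darts K) (darts K')&(ALL x:darts K. f (rot H x) = rot H' (f x)&f (opp K x) = opp K' (f x))")
  case True
  then have bij: "bij_betw f (darts K) (darts K')" and c: "!!x. x:darts K==>f (rot H x) = rot H' (f x)&f (opp H x) = opp H' (f x)" using s(7) s'(7) by auto
  have fD: "f x:darts K'" if "x:darts K" for x using bij that by (auto dest: bij_betwE)
  have inj: "f x = f y<->x = y" if "x:darts K" "y:darts K" for x y using bij that by (auto simp: bij_betw_def inj_on_def)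
  have rK: "rot K x = rot H (swp b q x)" for x unfolding s(8) by simp
  have rK': "rot K' x = rot H' (swp b' q' x)" for x unfolding s'(8) by simp
  have sw: "f (swp b q x) = swp b' q' (f x)" "swp b q x:darts K" if "x:darts K" for x using inj[OF that s(1)] inj[OF that s(2)] fq s(1,2) that by (auto simp: Transposition.transpose_def)
  have "f (rot K x) = rot K' (f x)" if "x:darts K" for x unfolding rK rK' using sw[OF that] c by simp
  moreover have "cl K' (f x) = cl K x <-> cl H' (f x) = cl H x" if all: "!!x. x:darts K ==> cl K' (f x) = cl K x | cl H' (f x) = cl H x" and "x:darts K" for x using s(9)[OF \<open>x : darts K\<close>] s'(9)[OF fD[OF \<open>x : darts K\<close>]] inj[OF \<open>x : darts K\<close> s(2)] fq e(2) using all[OF s(1)] s(9)[OF s(1)] s'(9)[OF s'(1)] s(3) s'(3) by auto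
  moreover have "f x:fc H' b'<->x:fc H b" if x: "x:darts K" for x
  proof -
  have "f ` fc H b = fc H' b'" unfolding face_at_def fq(1)[symmetric] by (rule orbit_image[OF fp_permutes[OF H(1)] commute_face_perm[OF H]]) (use c s(1,6) in auto)
  moreover have "fc H b <= darts K" using fc_subset[OF H(1)] s(1,6) by auto
  ultimately show ?thesis using inj x by blast
  qed
  moreover have "dl K' (f x) = dl K x<->dl H' (f x) = dl H x" if x: "x:darts K" for x using dK[OF x] dK'[OF fD[OF x]] s(10)[OF x] s'(10)[OF fD[OF x]] fb fb' calculation(3)[OF x] e(1) by (cases "x:fc H b") simp_all
  ultimately show ?thesis unfolding is_iso_iff[OF m] is_iso_iff[OF H] s(6,7) s'(6,7) using bij c s(7) s'(7) by metis
 next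
  case False
  have "is_iso f K K'==>f (rot H x) = rot H' (f x)" if i: "is_iso f K K'" and x: "x:darts K" for x
  proof -
  have bij: "bij_betw f (darts K) (darts K')" and c: "!!x. x:darts K==>f (rot K x) = rot K' (f x)" using i unfolding is_iso_iff[OF m] by auto
  have inj: "f x = f y<->x = y" if "x:darts K" "y:darts K" for x y using bij that by (auto simp: bij_betw_def inj_on_def)
  show ?thesis using inj[OF x s(1)] inj[OF x s(2)] fq s(1,2) x s(8) s'(8) c by auto
  qed
  then show ?thesis using False s(6,7) s'(6,7) unfolding is_iso_iff[OF m] is_iso_iff[OF H] by metis
 qed
 then show ?thesis by blast
qed

section \<open>White vertices under the star constraint\<close>

text \<open>\<open>c i j\<close> is the dart of the i-th white vertex whose corner lies in the face
  decorated (i, j). Decorations increase clockwise, so the counterclockwise rotation lowers j, and j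
  = 1 is followed by the last index. The star constraint is implicit in the distinct
  decorations.\<close>

definition star_chart :: "(nat=>nat)=>nat=>(nat \<times> nat) cmap=>(nat=>nat=>nat)=>bool" where
 "star_chart k n G c<->(ALL i:{1..n}. ALL j:{1..k i}. c i j:darts G & cl G (c i j) = White i &
  dl G (c i j) = Marked (i, j)&rot G (c i j) = c i (if j = 1 then k i else j - 1)) &
  (ALL h:darts G. ALL i. cl G h = White i-->i:{1..n}&(EX j:{1..k i}. h = c i j))"

definition star :: "(nat=>nat)=>nat=>(nat \<times> nat) cmap=>bool" where
 "star k n G<->(EX c. star_chart k n G c)"

lemma star_chartD:
 assumes "star_chart k n G c"
 shows "i:{1..n}==>j:{1..k i} ==> c i j:darts G & cl G (c i j) = White i &
  dl G (c i j) = Marked (i, j)&rot G (c i j) = c i (if j = 1 then k i else j - 1)"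
  "h:darts G ==> cl G h = White i==>i:{1..n}&(EX j:{1..k i}. h = c i j)" using assms unfolding star_chart_def by blast+

lemma starI:
 assumes "!!i j. i:{1..n}==>j:{1..k i} ==> c i j:darts G & cl G (c i j) = White i &
  dl G (c i j) = Marked (i, j)&rot G (c i j) = c i (if j = 1 then k i else j - 1)"
  "!!h i. h:darts G ==> cl G h = White i==>i:{1..n}&(EX j:{1..k i}. h = c i j)"
 shows "star k n G" unfolding star_def star_chart_def using assms by (intro exI[of _ c]) blast

lemma star_white:
 assumes "star k n G" "h:darts G" "cl G h = White i"
 shows "i:{1..n}" "EX j:{1..k i}. dl G h = Marked (i, j)"
proof -
 obtain c where "star_chart k n G c" using assms(1) unfolding star_def by blast
 note c = star_chartD[OF this]
 show i: "i:{1..n}" using c(2)[OF assms(2,3)] by blast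
 obtain j where "j:{1..k i}" "h = c i j" using c(2)[OF assms(2,3)] by blast
 then show "EX j:{1..k i}. dl G h = Marked (i, j)" using c(1)[OF i] by blast
qed

lemma star_uniq:
 assumes "star k n G" "h:darts G" "h':darts G" "cl G h = White i" "cl G h' = White i'" "dl G h = dl G h'"
 shows "h = h'"
proof -
 obtain c where "star_chart k n G c" using assms(1) unfolding star_def by blast
 note c = star_chartD[OF this]
 obtain j where j: "i:{1..n}" "j:{1..k i}" "h = c i j" using c(2)[OF assms(2,4)] by blast
 obtain j' where j': "i':{1..n}" "j':{1..k i'}" "h' = c i' j'" using c(2)[OF assms(3,5)] by blast
 show ?thesis using c(1)[OF j(1,2)] c(1)[OF j'(1,2)] assms(6) j(3) j'(3) by auto
qed

lemma star_vertex:
 assumes G: "is_map G" and "star k n G" "h:darts G" "h':darts G" "cl G h = White i" "cl G h' = White i"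
 shows "vx G h = vx G h'"
proof -
 obtain c where "star_chart k n G c" using assms(2) unfolding star_def by blast
 note c = star_chartD[OF this]
 have i: "i:{1..n}" using c(2)[OF assms(3,5)] by blast
 have v: "j:{1..k i}==>vx G (c i j) = vx G (c i 1)" for j
 proof (induction j)
  case (Suc j)
  show ?case
  proof (cases "j = 0")
  case False
  then have "rot G (c i (Suc j)) = c i j" using c(1)[OF i Suc.prems] by simp
  then have "vx G (c i (Suc j)) = vx G (c i j)" using vx_rot[OF G, of "c i (Suc j)"] by simp
  then show ?thesis using Suc False by simp
  qed simp
 qed simp
 obtain j j' where "j:{1..k i}" "h = c i j" "j':{1..k i}" "h' = c i j'" using c(2)[OF assms(3,5)] c(2)[OF assms(4,6)] by blast
 then show ?thesis using v by metis
qed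

definition wd :: "nat=>nat=>(nat \<times> nat) cmap=>nat" where
 "wd i j G = (THE h. h:darts G & cl G h = White i&dl G h = Marked (i, j))"

lemma wd_eq: "star k n G==>h:darts G ==> cl G h = White i==>dl G h = Marked (i, j)==>wd i j G = h" unfolding wd_def by (rule the_equality) (auto intro: star_uniq)

lemma wd_in:
 assumes "star k n G" "i:{1..n}" "j:{1..k i}"
 shows "wd i j G:darts G" "cl G (wd i j G) = White i" "dl G (wd i j G) = Marked (i, j)"
proof -
 obtain h where "h:darts G" "cl G h = White i" "dl G h = Marked (i, j)" using star_chartD(1) assms unfolding star_def by meson
 then show "wd i j G:darts G" "cl G (wd i j G) = White i" "dl G (wd i j G) = Marked (i, j)" using wd_eq[OF assms(1)] by auto
qed

lemma wd_iso:
 assumes "is_map G" "is_map H" "is_iso f G H" "star k n G" "star k n H" "i:{1..n}" "j:{1..k i}"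
 shows "f (wd i j G) = wd i j H"
proof -
 have "f (wd i j G):darts H" "cl H (f (wd i j G)) = White i" "dl H (f (wd i j G)) = Marked (i, j)" using assms(3) wd_in[OF assms(4,6,7)] unfolding is_iso_iff[OF assms(1,2)] by (auto dest: bij_betwE)
 then show ?thesis using wd_eq[OF assms(5)] by simp
qed

lemma star_vertex_image:
 assumes G: "is_map G" and st: "star k n G" and h: "h:darts G" "cl G h = White i"
 shows "vx G h = (%j. wd i j G) ` {1..k i}" "inj_on (%j. wd i j G) {1..k i}"
proof -
 have i: "i:{1..n}" using star_white(1)[OF st h] .
 note w = wd_in[OF st i]
 show "inj_on (%j. wd i j G) {1..k i}"
 proof (rule inj_onI)
  fix j j' assume "j:{1..k i}" "j':{1..k i}" "wd i j G = wd i j' G"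
  then have "Marked (i, j) = Marked (i, j')" using w(3) by metis
  then show "j = j'" by simp
 qed
 show "vx G h = (%j. wd i j G) ` {1..k i}"
 proof
  show "vx G h <= (%j. wd i j G) ` {1..k i}"
  proof
  fix y assume y: "y:vx G h"
  then have y': "y:darts G" "cl G y = White i" using vx_subset[OF G h(1)] cl_vertex[OF G y] h(2) by auto
  then obtain j where "j:{1..k i}" "dl G y = Marked (i, j)" using star_white(2)[OF st] by blast
  then show "y:(%j. wd i j G) ` {1..k i}" using wd_eq[OF st y'] by blast
  qed
  show "(%j. wd i j G) ` {1..k i} <= vx G h"
  proof (rule image_subsetI)
  fix j assume "j:{1..k i}"
  then show "wd i j G:vx G h" using star_vertex[OF G st w(1) h(1) w(2) h(2)] vx_self[OF G, of "wd i j G"] by simp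
  qed
 qed
qed

lemma star_inv_rot:
 assumes G: "is_map G" and st: "star k n G" and i: "i:{1..n}" and k: "1 <= k i"
 shows "j:{1..k i}==>(inv (rot G) ^^ (j - 1)) (wd i 1 G) = wd i j G"
proof (induction j)
 case (Suc j)
 obtain c where "star_chart k n G c" using st unfolding star_def by blast
 note c = star_chartD[OF this]
 have w: "wd i j G = c i j" if "j:{1..k i}" for j using c(1)[OF i that] by (intro wd_eq[OF st]) auto
 show ?case
 proof (cases "j = 0")
  case False
  then have j: "j:{1..k i}" using Suc.prems by simp
  have "inv (rot G) (wd i j G) = wd i (Suc j) G" using c(1)[OF i Suc.prems] False w[OF Suc.prems] w[OF j] permutes_inv_eq[OF rot_permutes[OF G]] by auto
  moreover obtain j' where "j = Suc j'" using False by (cases j) auto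
  ultimately show ?thesis using Suc.IH[OF j] by simp
 qed simp
qed simp

text \<open>From a chart, distinct marks show that the corners lie in distinct faces. Conversely a
  chart is read off by turning clockwise from the corner marked (i, 1); it closes up after k i steps
  because this is the degree, and injectivity of the marks makes it exhaust the vertex.\<close>

lemma star_iff:
 assumes G: "is_map G" and k: "ALL i:{1..n}. k i >= 1"
 shows "star k n G<->white_labelled n G&(ALL x:vertices G. ALL m. colour G x = White m -->
  star_constraint G x & card x = k m &
  (EX h:x. ALL i:{1..k m}. decor G (fc G ((inv (rot G) ^^ (i - 1)) h)) = Marked (m, i)))" (is "_<->?R")
proof
 assume st: "star k n G"
 have "white_labelled n G" unfolding white_labelled_def
 proof (intro conjI ballI allI impI)
  show "i:{1..n}" if "x:vertices G" "colour G x = White i" for x i using that star_white(1)[OF st] by (auto simp: vertices_def cl_def)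
  fix i assume i: "i:{1..n}"
  have "1:{1..k i}" using k i by auto
  note w = wd_in[OF st i this]
  show "\<exists>!x. x:vertices G & colour G x = White i"
  proof (rule ex1I[of _ "vx G (wd i 1 G)"])
  show "vx G (wd i 1 G):vertices G & colour G (vx G (wd i 1 G)) = White i" using w by (simp add: vertices_def cl_def)
  fix x assume "x:vertices G & colour G x = White i"
  then obtain h where "h:darts G" "x = vx G h" "cl G h = White i" by (auto simp: vertices_def cl_def)
  then show "x = vx G (wd i 1 G)" using star_vertex[OF G st _ w(1) _ w(2)] by simp
  qed
 qed
 moreover have "star_constraint G x & card x = k m &
  (EX h:x. ALL i:{1..k m}. decor G (fc G ((inv (rot G) ^^ (i - 1)) h)) = Marked (m, i))"
  if x: "x:vertices G" "colour G x = White m" for x m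
 proof -
  obtain h where h: "h:darts G" "x = vx G h" "cl G h = White m" using x by (auto simp: vertices_def cl_def)
  note v = star_vertex_image[OF G st h(1,3), folded h(2)]
  have m: "m:{1..n}" using star_white(1)[OF st h(1,3)] .
  note w = wd_in[OF st m]
  have "inj_on (fc G) x"
  proof (rule inj_onI)
  fix y y' assume y: "y:x" "y':x" "fc G y = fc G y'"
  then obtain j j' where "j:{1..k m}" "y = wd m j G" "j':{1..k m}" "y' = wd m j' G" unfolding v(1) by blast
  moreover have "dl G y = dl G y'" using y(3) by (simp add: dl_def)
  ultimately show "y = y'" using star_uniq[OF st w(1) w(1) w(2) w(2)] by metis
  qed
  moreover have "card x = k m" using card_image[OF v(2)] v(1) by simp
  moreover have "1:{1..k m}" using k m by auto
  moreover from this have "ALL i:{1..k m}. decor G (fc G ((inv (rot G) ^^ (i - 1)) (wd m 1 G))) = Marked (m, i)" using star_inv_rot[OF G st m] w(3) by (simp add: dl_def)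
  ultimately show ?thesis unfolding star_constraint_def using v(1) by blast
 qed
 ultimately show ?R by blast
next
 assume R: ?R
 let ?rh = "inv (rot G)"
 have bij: "bij (rot G)" using rot_permutes[OF G] permutes_bij by blast
 have "EX h:darts G. cl G h = White i & card (vx G h) = k i&(ALL j:{1..k i}. dl G ((?rh ^^ (j - 1)) h) = Marked (i, j))"
  if i: "i:{1..n}" for i
 proof -
  obtain x where x: "x:vertices G" "colour G x = White i" using R i unfolding white_labelled_def by blast
  then obtain h where h: "h:x" "ALL j:{1..k i}. dl G ((?rh ^^ (j - 1)) h) = Marked (i, j)" "card x = k i" using R unfolding dl_def by blast
  have "h:darts G" "x = vx G h" using in_verticesD(3,4)[OF G x(1)] h(1) by auto
  then show ?thesis using h x(2) by (auto simp: cl_def)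
 qed
 then obtain t where t: "!!i. i:{1..n}==>t i:darts G & cl G (t i) = White i & card (vx G (t i)) = k i &
  (ALL j:{1..k i}. dl G ((?rh ^^ (j - 1)) (t i)) = Marked (i, j))" by metis
 have ri: "rot G (?rh y) = y" for y using permutes_inverses(1)[OF rot_permutes[OF G]] .
 have vi: "vx G ((?rh ^^ s) y) = vx G y" for s y
 proof (induction s)
  case (Suc s)
  show ?case using vx_rot[OF G, of "?rh ((?rh ^^ s) y)"] Suc by (simp add: ri)
 qed simp
 let ?c = "%i j. (?rh ^^ (j - 1)) (t i)"
 have cD: "?c i j:darts G" "cl G (?c i j) = White i" "?c i j:vx G (t i)" if "i:{1..n}" for i j
 proof -
  show v: "?c i j:vx G (t i)" using vi vx_self[OF G] by metis
  show "?c i j:darts G" "cl G (?c i j) = White i" using vx_subset[OF G] cl_vertex[OF G v] t[OF that] v by auto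
 qed
 show "star k n G"
 proof (rule starI[where c = ?c])
  fix i j assume i: "i:{1..n}" and j: "j:{1..k i}"
  have "rot G (?c i j) = ?c i (if j = 1 then k i else j - 1)"
  proof (cases "j = 1")
  case True
  have "(rot G ^^ k i) (t i) = t i" using orbit_enum(3)[OF fin_darts[OF G] rot_permutes[OF G], of "k i" "t i"] t[OF i] by (simp add: vertex_at_def)
  moreover have "k i = Suc (k i - 1)" using k i by fastforce
  ultimately have "(rot G ^^ (k i - 1)) (rot G (t i)) = t i" by (metis funpow_Suc_right comp_apply)
  moreover have "(?rh ^^ s) ((rot G ^^ s) y) = y" for s y using inv_fn_o_fn_is_id[OF bij] by (metis comp_apply)
  ultimately have "?c i (k i) = rot G (t i)" by metis
  then show ?thesis using True by simp
  next
  case False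
  then have "2 <= j" using j by auto
  then have "j - 1 = Suc (j - 1 - 1)" by simp
  then have "?c i j = ?rh (?c i (j - 1))" by (metis funpow.simps(2) comp_apply)
  then show ?thesis using False ri by simp
  qed
  then show "?c i j:darts G & cl G (?c i j) = White i&dl G (?c i j) = Marked (i, j) &
  rot G (?c i j) = ?c i (if j = 1 then k i else j - 1)" using cD[OF i] t[OF i] j by blast
 next
  fix h i assume h: "h:darts G" "cl G h = White i"
  then have vx: "vx G h:vertices G" "colour G (vx G h) = White i" by (auto simp: vertices_def cl_def)
  then have i: "i:{1..n}" using R unfolding white_labelled_def by blast
  note ti = t[OF i]
  have "vx G (t i):vertices G" "colour G (vx G (t i)) = White i" using ti by (auto simp: vertices_def cl_def)
  then have e: "vx G h = vx G (t i)" using R i vx unfolding white_labelled_def by blast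
  have "?c i ` {1..k i} = vx G (t i)"
  proof (rule card_subset_eq)
  show "finite (vx G (t i))" using vx_subset[OF G] ti fin_darts[OF G] finite_subset by blast
  show "?c i ` {1..k i} <= vx G (t i)" using cD(3)[OF i] by blast
  have "inj_on (?c i) {1..k i}"
  proof (rule inj_onI)
  fix j j' assume "j:{1..k i}" "j':{1..k i}" "?c i j = ?c i j'"
  then have "Marked (i, j) = Marked (i, j')" using ti by metis
  then show "j = j'" by simp
  qed
  then show "card (?c i ` {1..k i}) = card (vx G (t i))" using card_image ti by fastforce
  qed
  then show "i:{1..n}&(EX j:{1..k i}. h = ?c i j)" using i e vx_self[OF G, of h] by blast
 qed
qed

definition Sc :: "nat=>nat=>nat=>nat=>int=>(nat=>nat)=>(nat \<times> nat) cmap set" where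
 "Sc r N g n d k = {G. core r N (SIGMA i:{1..n}. {1..k i}) g d G&black3 G&(ALL h:darts G. cl G h~=Square)&star k n G}"

lemma ScD:
 assumes "G:Sc r N g n d k"
 shows "core r N (SIGMA i:{1..n}. {1..k i}) g d G" "is_map G" "connected_map G" "black3 G" "star k n G" "h:darts G ==> cl G h~=Square" using assms by (auto simp: Sc_def core_def)

lemma maps_S_eq:
 assumes k: "ALL i:{1..n}. k i >= 1"
 shows "{G:maps_S r N g n k. map_degree r G = d} = {G:Sc r N g n d k. bounded_degree r G}"
proof -
 have "G:maps_S r N g n k&map_degree r G = d<->G:Sc r N g n d k&bounded_degree r G" for G
 proof (cases "is_map G&star k n G")
  case True
  then have m: "is_map G" and st: "star k n G" by auto
  have "vx G h = vx G h'" if "h:darts G" "h':darts G" "fc G h = fc G h'"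
  "cl G h = White i" "cl G h' = White j" for h h' i j
  proof -
  show ?thesis by (metis dl_def star_uniq[OF st that(1,2,4,5)] that)
  qed
  then have "coloured_map r g G <-> connected_map G&has_genus g G&black3 G&bounded_degree r G" unfolding coloured_map_def black3_vertices bounded_degree_def cl_def[symmetric] using m by blast
  moreover have "(ALL x:vertices G. colour G x~=Square)<->(ALL h:darts G. cl G h~=Square)" by (simp add: vertices_def cl_def)
  ultimately show ?thesis using st m star_iff[OF m k] unfolding maps_S_def Sc_def core_def mem_Collect_eq by blast
 next
  case False
  then show ?thesis using star_iff[of G n k, OF _ k] unfolding maps_S_def Sc_def core_def coloured_map_def mem_Collect_eq by blast
 qed
 then show ?thesis by blast
qed

lemma finite_reps_Sc: "finite (reps (Sc r N g n d k))"
proof (rule finite_reps_class[where C = "White ` {1..n}" and r = r and d = d and N = N and M = "SIGMA i:{1..n}. {1..k i}"])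
 show "cl G h:insert Black (White ` {1..n})" if "G:Sc r N g n d k" "h:darts G" for G h using ScD(5,6)[OF that(1)] that(2) star_white(1) by (cases "cl G h") blast+
 show "vx G h = vx G h'" if "G:Sc r N g n d k" "h:darts G" "h':darts G" "cl G h = cl G h'" "cl G h~=Black" for G h h' using ScD(2,5,6)[OF that(1)] that star_vertex by (cases "cl G h") metis+
qed (auto simp: Sc_def core_def)

lemma rigid_Sc:
 assumes "G:Sc r N g n d k" "n >= 1" "k 1 >= 1"
 shows "card (automorphisms G) = 1"
proof -
 note G = ScD[OF assms(1)]
 have w: "1:{1..n}" "1:{1..k 1}" using assms by auto
 show ?thesis by (rule automorphisms_trivial[OF G(2,3) wd_in(1)[OF G(5) w]]) (rule wd_iso[OF G(2,2) _ G(5,5) w])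
qed

text \<open>Merging q into the white vertex renumbers two darts: b moves from index l to l + 1, and
  q takes over l. The square colour of q keeps it out of the chart of K.\<close>

lemma glue_star:
 assumes K: "is_map K" and L: "glue (Marked (m, Suc l)) K b q H" and m: "m:{1..n}" and l: "1 <= l"
  and b: "cl K b = White m" "dl K b = Marked (m, l)" "cl K q = Square"
 shows "star (k(m := Suc l)) n H<->star (k(m := l)) n K"
proof -
 note s = glue_simps[OF K L] and r = glue_rot[OF K L]
 have P: "q~:pre K b q" "b:pre K b q" "pre K b q <= fc K b" using pre_props(1-3)[OF K s(5)] s(3) by auto
 have df: "dl K x = Marked (m, l)" if "x:fc K b" for x using dl_face[OF K that] b(2) by simp
 have Hq: "cl H q = White m" "dl H q = Marked (m, l)" using s(9,10)[OF s(2)] P(1) b(1) df[OF s(5)] by auto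
 have Hb: "cl H b = White m" "dl H b = Marked (m, Suc l)" using s(9,10)[OF s(1)] P(2) b(1) s(3) by auto
 let ?k = "k(m := l)" and ?k' = "k(m := Suc l)"
 show ?thesis
 proof
  assume st: "star ?k' n H"
  obtain c where "star_chart ?k' n H c" using st unfolding star_def by blast
  note c = star_chartD[OF this]
  have lr: "l:{1..?k' m}" "Suc l:{1..?k' m}" using l by auto
  have cq: "c m l = q" and cb: "c m (Suc l) = b" using star_uniq[OF st] c(1)[OF m lr(1)] c(1)[OF m lr(2)] Hq Hb s(1,2,6) by metis+
  define c' where "c' i j = (if i = m&j = l then b else c i j)" for i j
  show "star ?k n K"
  proof (rule starI[where c = c'])
  fix i j assume i: "i:{1..n}" and j: "j:{1..?k i}"
  show "c' i j:darts K & cl K (c' i j) = White i&dl K (c' i j) = Marked (i, j)&rot K (c' i j) = c' i (if j = 1 then ?k i else j - 1)"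
  proof (cases "i = m&j = l")
  case True
  have "rot K b = c m (if l = 1 then Suc l else l - 1)" using c(1)[OF m lr(1)] cq r(2) by simp
  also have "... = c' m (if l = 1 then l else l - 1)" using cb l by (auto simp: c'_def)
  finally show ?thesis using True b s(1) by (simp add: c'_def)
  next
  case False
  have j': "j:{1..?k' i}" using j by (auto split: if_splits)
  note x = c(1)[OF i j']
  have n: "Marked (i, j)~=Marked (m, l)" "Marked (i, j)~=Marked (m, Suc l)" using False j by auto
  then have nb: "c i j~=b" "c i j~=q" using x Hb(2) Hq(2) by metis+
  have xD: "c i j:darts K" using x s(6) by simp
  have "c i j~:pre K b q" using s(10)[OF xD] x n(2) by auto
  then have "dl K (c i j) = Marked (i, j)" "cl K (c i j) = White i" using s(9,10)[OF xD] x nb(2) by auto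
  moreover have "rot K (c i j) = c' i (if j = 1 then ?k i else j - 1)" using x r(3)[OF nb] cb j False by (auto simp: c'_def)
  moreover have "c' i j = c i j" using False by (auto simp: c'_def)
  ultimately show ?thesis using xD by simp
  qed
  next
  fix h i assume h: "h:darts K" "cl K h = White i"
  then have hq: "h~=q" using b(3) by auto
  then have "cl H h = White i" using s(9)[OF h(1)] h(2) by simp
  then obtain j where i: "i:{1..n}" and j: "j:{1..?k' i}" "h = c i j" using c(2)[of h i] h(1) s(6) by blast
  have "EX j:{1..?k i}. h = c' i j"
  proof (cases "h = b")
  case True
  then have "i = m" using h(2) b(1) by simp
  then show ?thesis using True l by (intro bexI[of _ l]) (auto simp: c'_def)
  next
  case False
  then have "~ (i = m&j = l)" "~ (i = m&j = Suc l)" using cq cb j(2) hq by auto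
  then show ?thesis using j by (intro bexI[of _ j]) (auto simp: c'_def split: if_splits)
  qed
  then show "i:{1..n}&(EX j:{1..?k i}. h = c' i j)" using i by blast
  qed
 next
  assume st: "star ?k n K"
  obtain c where "star_chart ?k n K c" using st unfolding star_def by blast
  note c = star_chartD[OF this]
  have lr: "l:{1..?k m}" using l by auto
  have cb: "c m l = b" using star_uniq[OF st] c(1)[OF m lr] b s(1) by metis
  define c' where "c' i j = (if i = m&j = l then q else if i = m&j = Suc l then b else c i j)" for i j
  show "star ?k' n H"
  proof (rule starI[where c = c'])
  fix i j assume i: "i:{1..n}" and j: "j:{1..?k' i}"
  consider "i = m" "j = l" | "i = m" "j = Suc l" | "~ (i = m&j = l)" "~ (i = m&j = Suc l)" by blast
  then show "c' i j:darts H & cl H (c' i j) = White i&dl H (c' i j) = Marked (i, j)&rot H (c' i j) = c' i (if j = 1 then ?k' i else j - 1)"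
  proof cases
  case 1
  have "rot H q = c m (if l = 1 then l else l - 1)" using c(1)[OF m lr] cb r(2) by simp
  also have "... = c' m (if l = 1 then Suc l else l - 1)" using cb l by (auto simp: c'_def)
  finally show ?thesis using 1 Hq s(2,6) by (simp add: c'_def)
  next
  case 2
  then show ?thesis using Hb s(1,6) r(1) l by (simp add: c'_def)
  next
  case 3
  then have j': "j:{1..?k i}" using j by (auto split: if_splits)
  note x = c(1)[OF i j']
  have n: "Marked (i, j)~=Marked (m, l)" using 3 by auto
  then have nb: "c i j~=b" "c i j~=q" using x b by (metis, metis colour.distinct(5))
  have "c i j~:pre K b q" using df P(3) x n by (metis subsetD)
  then have "dl H (c i j) = Marked (i, j)" "cl H (c i j) = White i" using s(9,10)[of "c i j"] x nb(2) by auto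
  moreover have "rot H (c i j) = c' i (if j = 1 then ?k' i else j - 1)" using x r(3)[OF nb] cb j' 3 by (auto simp: c'_def)
  moreover have "c' i j = c i j" using 3 by (auto simp: c'_def)
  ultimately show ?thesis using x s(6) by simp
  qed
  next
  fix h i assume h: "h:darts H" "cl H h = White i"
  show "i:{1..n}&(EX j:{1..?k' i}. h = c' i j)"
  proof (cases "h = q | h = b")
  case True
  then have "i = m" using h(2) Hq(1) Hb(1) by auto
  moreover from True have "h = c' m l | h = c' m (Suc l)" by (auto simp: c'_def)
  ultimately show ?thesis using m l by auto
  next
  case False
  then have "cl K h = White i" using s(9)[of h] h s(6) by simp
  then obtain j where i: "i:{1..n}" and j: "j:{1..?k i}" "h = c i j" using c(2)[of h i] h(1) s(6) by blast
  have "~ (i = m&j = l)" using cb j(2) False by auto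
  then show ?thesis using i j by (intro conjI bexI[of _ j]) (auto simp: c'_def split: if_splits)
  qed
  qed
 qed
qed

lemma star_transfer:
 assumes "darts G <= darts K" "!!x. x:darts G ==> cl K x = cl G x&dl K x = dl G x"
  and new: "!!x i. x:darts K - darts G ==> cl K x~=White i"
  and rot: "!!x i. x:darts G ==> cl G x = White i==>rot K x = rot G x"
 shows "star k n K<->star k n G"
proof -
 have w: "x:darts K & cl K x = White i<->x:darts G & cl G x = White i" for x i using assms(1) assms(2)[of x] new[of x i] by (cases "x:darts G") auto
 have "star_chart k n K c<->star_chart k n G c" for c
 proof -
  have "(c i j:darts K & cl K (c i j) = White i&dl K (c i j) = Marked (i, j)&rot K (c i j) = e) <->
  (c i j:darts G & cl G (c i j) = White i&dl G (c i j) = Marked (i, j)&rot G (c i j) = e)" for i j e using w[of "c i j" i] assms(2)[of "c i j"] rot[of "c i j" i] by auto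
  moreover have "(ALL h:darts K. ALL i. cl K h = White i-->T h i)<->(ALL h:darts G. ALL i. cl G h = White i-->T h i)" for T using w by blast
  ultimately show ?thesis unfolding star_chart_def by simp
 qed
 then show ?thesis by (simp add: star_def)
qed

lemma lf_black3:
 assumes G: "is_map G" and L: "leafins k G h p q K" and k: "k~=Black"
 shows "black3 K<->(ALL x:darts G. cl G x = Black-->3 <= card (vx K x))"
proof -
 have "vx K p = vx K h" "cl K p = cl K h" using lf_rot(1)[OF G L] vx_rot[OF lf_is_map[OF G L], of h] cl_rot[OF lf_is_map[OF G L], of h] by auto
 then show ?thesis unfolding black3_def lf_darts(7)[OF G L] using lf_labels[OF G L] lf_darts(1)[OF G L] k by auto
qed

lemma marked_face:
 assumes "is_map G" "decorated N M G" "x:darts G" "y:darts G" "dl G x = Marked \<mu>" "dl G y = Marked \<mu>" "\<mu> : M"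
 shows "x:fc G y" using assms unfolding decorated_iff fc_eq[OF assms(1)] by blast

lemma glue_black_vertex:
 assumes K: "is_map K" and L: "glue \<beta> K b q H" and x: "x:darts K" "cl K x = Black" "cl K b~=Black" "cl K q~=Black"
 shows "vx H x = vx K x" "cl H x = Black"
proof -
 have "x~=q" "b~:vx K x" using x cl_vertex[OF K, of b x] by auto
 then show "vx H x = vx K x" "cl H x = Black" using glue_vertex(1)[OF K L x(1)] glue_simps(9)[OF K L x(1)] x(2) by auto
qed

lemma glue_black3:
 assumes K: "is_map K" and L: "glue \<beta> K b q H" and w: "cl K b~=Black" "cl K q~=Black"
 shows "black3 H<->black3 K"
proof -
 have "cl H x = Black <-> cl K x = Black" if "x:darts K" for x using glue_simps(9)[OF K L that] w by auto
 then show ?thesis unfolding black3_def glue_simps(6)[OF K L] using glue_black_vertex[OF K L _ _ w] by auto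
qed

section \<open>Growing an edge from a white vertex into a face\<close>

text \<open>The state just before the merge: the face (m, l) contains the white dart b and a
  univalent vertex q. The square colour serves only to tell q apart; no square vertex remains
  afterwards.\<close>

definition pendant :: "nat=>nat=>(nat \<times> nat) cmap=>nat=>nat=>bool" where
 "pendant m l K b q<->b:darts K & cl K b = White m&dl K b = Marked (m, l)&q:darts K&rot K q = q &
  dl K q = Marked (m, l)&(ALL x:darts K. cl K x = Square<->x = q)"

context
 fixes r N g n m l :: nat and k :: "nat=>nat" and d :: int
 assumes m: "m:{1..n}" and l: "1 <= l"
begin

lemma chord_labels:
 "(SIGMA i:{1..n}. {1..(k(m := Suc l)) i}) = insert (m, Suc l) (SIGMA i:{1..n}. {1..(k(m := l)) i})"
 "(m, Suc l)~:(SIGMA i:{1..n}. {1..(k(m := l)) i})" "(m, l):(SIGMA i:{1..n}. {1..(k(m := l)) i})"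
 "(m, Suc l):(SIGMA i:{1..n}. {1..(k(m := Suc l)) i})" using m l by (auto split: if_splits)

lemma chord_iff:
 assumes K: "is_map K" and p: "pendant m l K b q" and L: "glue (Marked (m, Suc l)) K b q H"
  and new: "!!x. x:darts K==>dl K x~=Marked (m, Suc l)"
 shows "H:Sc r N g n (d + (int r + 1)) (k(m := Suc l)) <->
  core r N (SIGMA i:{1..n}. {1..(k(m := l)) i}) g d K&black3 K&star (k(m := l)) n K"
proof -
 note p = p[unfolded pendant_def]
 have w: "cl K b = White m" "dl K b = Marked (m, l)" "cl K q = Square" using p by auto
 have "cl H x~=Square" if "x:darts K" for x using glue_simps(9)[OF K L that] p that w by auto
 then have "ALL h:darts H. cl H h~=Square" "black3 H<->black3 K" using glue_black3[OF K L] w glue_simps(6)[OF K L] by auto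
 moreover have "core r N (insert (m, Suc l) (SIGMA i:{1..n}. {1..(k(m := l)) i})) g (d + (int r + 1)) H <->
  core r N (SIGMA i:{1..n}. {1..(k(m := l)) i}) g d K" by (rule glue_core[OF K L w(2) refl chord_labels(3,2) new])
 ultimately show ?thesis unfolding Sc_def mem_Collect_eq chord_labels(1) using glue_star[OF K L m l w] by blast
qed

lemma chord_wd:
 assumes K: "is_map K" and p: "pendant m l K b q" and L: "glue (Marked (m, Suc l)) K b q H"
  and H: "star (k(m := Suc l)) n H"
 shows "wd m l H = q" "wd m (Suc l) H = b"
proof -
 note s = glue_simps[OF K L] and p = p[unfolded pendant_def]
 have P: "q~:pre K b q" "b:pre K b q" using pre_props(1,3)[OF K s(5)] s(3) by auto
 show "wd m l H = q" using s(9,10)[OF s(2)] P p s(6) by (intro wd_eq[OF H]) auto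
 show "wd m (Suc l) H = b" using s(9,10)[OF s(1)] P p s(3,6) by (intro wd_eq[OF H]) auto
qed

text \<open>In H the darts q and b are recovered from their decorations (m, l) and (m, l + 1), so
  every isomorphism respects them. In K the dart b is recovered from its decoration, but q has to be
  prescribed.\<close>

lemma chord_iso:
 assumes K: "is_map K" "is_map K'" "star (k(m := l)) n K" "star (k(m := l)) n K'" and p: "pendant m l K b q" "pendant m l K' b' q'"
  and L: "glue (Marked (m, Suc l)) K b q H" "glue (Marked (m, Suc l)) K' b' q' H'"
  and H: "star (k(m := Suc l)) n H" "star (k(m := Suc l)) n H'"
 shows "(EX f. is_iso f H H')<->(EX f. is_iso f K K'&f q = q')"
proof -
 note M = glue_is_map[OF K(1) L(1)] glue_is_map[OF K(2) L(2)]
 note w = chord_wd[OF K(1) p(1) L(1) H(1)] and w' = chord_wd[OF K(2) p(2) L(2) H(2)]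
 have r: "l:{1..(k(m := Suc l)) m}" "Suc l:{1..(k(m := Suc l)) m}" "l:{1..(k(m := l)) m}" using l by auto
 have f: "f b = b'" "f q = q'" if "is_iso f H H'" for f using wd_iso[OF M that H m r(1)] wd_iso[OF M that H m r(2)] w w' by auto
 have "wd m l K = b" "wd m l K' = b'" using p wd_eq[OF K(3)] wd_eq[OF K(4)] by (auto simp: pendant_def)
 then have fb: "f b = b'" if "is_iso f K K'" for f using wd_iso[OF K(1,2) that K(3,4) m r(3)] by auto
 have "dl K b = dl K' b'" "cl K q = cl K' q'" using p by (auto simp: pendant_def)
 note i = glue_iso[OF K(1,2) L this]
 have "(EX f. is_iso f H H')<->(EX f. is_iso f H H'&f b = b'&f q = q')" using f by blast
 also have "... <-> (EX f. is_iso f K K'&f b = b'&f q = q')" using i by (rule sym)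
 also have "... <-> (EX f. is_iso f K K'&f q = q')" using fb by blast
 finally show ?thesis .
qed

text \<open>The dart with decoration (m, l) is detached from the white vertex; its face merges with
  the one decorated (m, l + 1), which follows clockwise. The far end of the detached edge turns out
  to be black.\<close>

lemma chord_delete:
 assumes H: "H:Sc r N g n (d + (int r + 1)) (k(m := Suc l))" and gn: "(g, n)~=(0, 1)" and k: "ALL i:{1..n}. 1 <= k i"
 obtains K b q where "core r N (SIGMA i:{1..n}. {1..(k(m := l)) i}) g d K" "black3 K" "star (k(m := l)) n K"
  "pendant m l K b q" "glue (Marked (m, Suc l)) K b q H" "cl K (opp K q) = Black"
proof -
 note H' = ScD[OF H]
 have rng: "l:{1..(k(m := Suc l)) m}" "Suc l:{1..(k(m := Suc l)) m}" using l by auto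
 obtain c where "star_chart (k(m := Suc l)) n H c" using H'(5) unfolding star_def by blast
 note c = star_chartD(1)[OF this m rng(1)] star_chartD(1)[OF this m rng(2)]
 define b where "b = c m (Suc l)"
 define q where "q = c m l"
 have q: "q:darts H" "cl H q = White m" "dl H q = Marked (m, l)" and b: "b:darts H" "cl H b = White m" "dl H b = Marked (m, Suc l)"
  and rb: "rot H b = q" using c l by (auto simp: b_def q_def)
 have bq: "b~=q" using q(3) b(3) by auto
 have qf: "q~:fc H b" using dl_face[OF H'(2), of q b] q(3) b(3) by auto
 obtain K where K: "is_map K" "glue (dl H b) K b q H" "cl K q = Square" "dl K b = dl H q" using glue_undo[where k = Square, OF H'(2) b(1) rb bq qf] by blast
 have L: "glue (Marked (m, Suc l)) K b q H" using K(2) b(3) by simp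
 note s = glue_simps[OF K(1) L]
 have P: "pre K b q <= fc K b" using pre_props(2)[OF K(1) s(5)] by auto
 have dK: "dl K b = Marked (m, l)" using K(4) q(3) by simp
 have cK: "cl K x = cl H x" if "x:darts K" "x~=q" for x using s(9)[OF that(1)] that(2) by simp
 have "cl K x = Square<->x = q" if "x:darts K" for x using cK[OF that] H'(6)[of x] K(3) that s(6) by (cases "x = q") auto
 moreover have "dl K q = Marked (m, l)" using dl_face[OF K(1) s(5)] dK by simp
 ultimately have p: "pendant m l K b q" unfolding pendant_def using s(1,2,4) dK cK[OF s(1) s(3)] b(2) by simp
 have new: "dl K x~=Marked (m, Suc l)" if x: "x:darts K" for x
 proof (cases "x:pre K b q")
  case True then show ?thesis using P dl_face[OF K(1), of x b] dK by auto
 next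
  case False
  then have "x~:fc H b" using glue_faces(1)[OF K(1) L] by simp
  then have "dl H x~=Marked (m, Suc l)" using marked_face[OF H'(2) coreD(6)[OF H'(1)] _ b(1) _ b(3) chord_labels(4), of x] x s(6) by auto
  then show ?thesis using s(10)[OF x] False by simp
 qed
 define p where "p = opp H q"
 have pD: "p:darts H" "p~=q" "opp H p = q" using q(1) opp_in[OF H'(2)] opp_neq[OF H'(2)] opp_opp[OF H'(2)] by (auto simp: p_def)
 \<comment> \<open>This is where (g, n) = (0, 1) is excluded. A white far end would lie in the face
   of b, hence be b itself; then the map is one vertex with one loop, which is planar with n =
   1.\<close>
 have "cl H p = Black"
 proof (rule ccontr)
  assume "cl H p~=Black"
  then obtain i where i: "cl H p = White i" using H'(6)[OF pD(1)] by (cases "cl H p") auto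
  have "face_perm H p = b" using fp_iff[OF H'(2)] pD(3) rb by simp
  then have "dl H b = dl H p" using dl_face_perm[OF H'(2), of p] by simp
  then have pb: "p = b" using star_uniq[OF H'(5) pD(1) b(1) i b(2)] by simp
  define y where "y = face_perm H q"
  have ry: "rot H y = b" using rot_face_perm[OF H'(2), of q] pb by (simp add: y_def p_def)
  have "dl H y = dl H q" using dl_face_perm[OF H'(2), of q] by (simp add: y_def)
  moreover have "cl H y = White m" using cl_rot[OF H'(2), of y] ry b(2) by simp
  moreover have "y:darts H" using face_perm_in[OF H'(2), of q] q(1) by (simp add: y_def)
  ultimately have "y = q" using star_uniq[OF H'(5) _ q(1) _ q(2)] by blast
  then have rq: "rot H q = b" using ry by simp
  have ob: "opp H b = q" "opp H q = b" using pb pD(3) by (auto simp: p_def)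
  have "S <= darts H&S~={}&(ALL x:S. rot H x:S & opp H x:S)-->S = darts H" for S using H'(3) unfolding connected_map_iff[OF H'(2)] by blast
  from this[of "{b, q}"] have D: "darts H = {b, q}" using rb rq ob b(1) q(1) by auto
  have "i = m" if "i:{1..n}" for i
  proof -
  have "1:{1..(k(m := Suc l)) i}" using k that by auto
  then have "wd i 1 H:darts H" "cl H (wd i 1 H) = White i" using wd_in[OF H'(5) that] by auto
  then show ?thesis using D b(2) q(2) by auto
  qed
  from this[of 1] this[of n] have n1: "n = 1" using m by auto
  have "vx H q = vx H b" using vx_rot[OF H'(2), of b] rb by simp
  then have "card (vertices H) = 1" by (simp add: vertices_def D)
  moreover have "edges H = {{b, q}}" unfolding edges_def D using ob by auto
  moreover have "fc H q~=fc H b" using q(3) b(3) by (auto simp: dl_def)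
  then have "card (faces H) = 2" by (simp add: faces_def D)
  ultimately have "g = 0" using coreD(5)[OF H'(1)] by (simp add: has_genus_def)
  then show False using n1 gn by simp
 qed
 then have "cl K (opp K q) = Black" using s(7) cK[of p] pD s(6) by (simp add: p_def)
 then show thesis using that chord_iff[OF K(1) p L new] H p L by blast
qed

text \<open>Common frame for the two ways in which the new edge can start. Q states that K arises
  from G by growing an edge from h to a pendant q, and S is the set of degrees of its black end: at
  least four for a corner, three for a side.\<close>

lemma transfer_chord:
 fixes Q :: "(nat \<times> nat) cmap=>nat=>nat=>(nat \<times> nat) cmap=>bool" and S :: "nat set"
 assumes gn: "(g, n)~=(0, 1)" and k: "ALL i:{1..n}. 1 <= k i"
 defines "A == Sc r N g n d (k(m := l))"
  and "B == {H:Sc r N g n (d + (int r + 1)) (k(m := Suc l)). card (vx H (opp H (wd m l H))):S}"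
 assumes P: "!!G. G:A==>P G <= darts G"
  and Pinv: "!!G G' f h. G:A==>G':A==>is_iso f G G'==>h:P G==>f h:P G'"
  and ex: "!!G h. G:A==>h:P G==>EX q K. Q G h q K"
  and Q: "!!G h q K. G:A==>h:P G==>Q G h q K ==> core r N (SIGMA i:{1..n}. {1..(k(m := l)) i}) g d K&black3 K &
  star (k(m := l)) n K&pendant m l K (wd m l G) q & cl K (opp K q) = Black & card (vx K (opp K q)):S"
  and del: "!!K b q. core r N (SIGMA i:{1..n}. {1..(k(m := l)) i}) g d K==>black3 K==>star (k(m := l)) n K ==>
  pendant m l K b q ==> cl K (opp K q) = Black ==> card (vx K (opp K q)):S==>EX G:A. EX h:P G. Q G h q K"
  and iso: "!!G h q K G' h' q' K'. G:A==>G':A==>h:P G==>h':P G'==>Q G h q K==>Q G' h' q' K' ==>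
  (EX f. is_iso f K K'&f q = q')<->(EX f. is_iso f G G'&f h = h')"
  and w: "!!G h q K H. G:A==>h:P G==>Q G h q K==>glue (Marked (m, Suc l)) K (wd m l G) q H ==>
  wtc V z lam H = w' G h"
 shows "gsum B (%H. wtc V z lam H) =
  (\<Sum>G\<in>reps A. (\<Sum>h\<in>P G. w' G h) / of_nat (card (automorphisms G)))"
proof (rule gsum_transfer_pointed(2)[where R = "%G h H. EX q K. Q G h q K&glue (Marked (m, Suc l)) K (wd m l G) q H"])
 have n1: "n >= 1" "(k(m := Suc l)) 1 >= 1" using m k by auto
 have lr: "l:{1..(k(m := l)) m}" using l by auto
 have HS: "H:Sc r N g n (d + (int r + 1)) (k(m := Suc l))" if "H:B" for H using that by (simp add: B_def)
 show "is_map G" "connected_map G" if "G:A" for G using that ScD(2,3) unfolding A_def by blast+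
 show "finite (reps A)" unfolding A_def by (rule finite_reps_Sc)
 show "is_map H" "card (automorphisms H) = 1" if "H:B" for H using ScD(2)[OF HS[OF that]] rigid_Sc[OF HS[OF that] n1] by blast+
 have vp: "vx H (opp H (wd m l H)) = vx K (opp K q)"
  if "is_map K" "pendant m l K b q" "glue (Marked (m, Suc l)) K b q H" "star (k(m := Suc l)) n H" "cl K (opp K q) = Black" for K b q H
 proof -
  have "cl K b~=Black" "cl K q~=Black" "q:darts K" using that(2) by (auto simp: pendant_def)
  then show ?thesis using glue_black_vertex(1)[OF that(1,3) _ that(5)] opp_in[OF that(1)] chord_wd(1)[OF that(1-4)] glue_simps(7)[OF that(1,3)] by simp
 qed
 have new: "dl K x~=Marked (m, Suc l)" if "core r N (SIGMA i:{1..n}. {1..(k(m := l)) i}) g d K" "x:darts K" for K x using coreD(4)[OF that] chord_labels(2) by auto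
 show "EX H:B. EX q K. Q G h q K&glue (Marked (m, Suc l)) K (wd m l G) q H" if GA: "G:A" and h: "h:P G" for G h
 proof -
  obtain q K where QK: "Q G h q K" using ex[OF GA h] by blast
  note K = Q[OF GA h QK]
  have KM: "is_map K" using K coreD(1) by blast
  have p: "pendant m l K (wd m l G) q" using K by blast
  note p' = p[unfolded pendant_def]
  have "q:fc K (wd m l G)" using marked_face[OF KM _ _ _ _ _ chord_labels(3), of N q "wd m l G"] coreD(6) K p' by blast
  moreover have "wd m l G~=q" using p' by auto
  ultimately obtain H where L: "glue (Marked (m, Suc l)) K (wd m l G) q H" using glue_ex[OF KM, of "wd m l G" q] p' by metis
  have H: "H:Sc r N g n (d + (int r + 1)) (k(m := Suc l))" using chord_iff[OF KM p L new] K by blast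
  then have "H:B" unfolding B_def using vp[OF KM p L ScD(5)[OF H]] K by simp
  then show ?thesis using QK L by blast
 qed
 show "EX G:A. EX h:P G. EX q K. Q G h q K&glue (Marked (m, Suc l)) K (wd m l G) q H" if HB: "H:B" for H
 proof -
  note H = HS[OF HB]
  obtain K b q where K: "core r N (SIGMA i:{1..n}. {1..(k(m := l)) i}) g d K" "black3 K" "star (k(m := l)) n K"
  "pendant m l K b q" and L: "glue (Marked (m, Suc l)) K b q H" and bl: "cl K (opp K q) = Black" using chord_delete[OF H gn k] by metis
  have "card (vx K (opp K q)):S" using vp[OF coreD(1)[OF K(1)] K(4) L ScD(5)[OF H] bl] HB by (simp add: B_def)
  then obtain G h where G: "G:A" "h:P G" "Q G h q K" using del[OF K bl] by blast
  have "wd m l K = b" using K(4) wd_eq[OF K(3)] by (simp add: pendant_def)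
  moreover have "wd m l K = wd m l G" using Q[OF G] wd_eq[OF K(3)] by (simp add: pendant_def)
  ultimately have "glue (Marked (m, Suc l)) K (wd m l G) q H" using L by simp
  then show ?thesis using G by blast
 qed
 show "(EX f. is_iso f H H')<->(EX f. is_iso f G G'&f h = h')"
  if A: "G:A" "G':A" and h: "h:P G" "h':P G'" and B: "H:B" "H':B"
  and R: "EX q K. Q G h q K&glue (Marked (m, Suc l)) K (wd m l G) q H" "EX q K. Q G' h' q K&glue (Marked (m, Suc l)) K (wd m l G') q H'"
  for G h H G' h' H'
 proof -
  obtain q K where K: "Q G h q K" "glue (Marked (m, Suc l)) K (wd m l G) q H" using R(1) by blast
  obtain q' K' where K': "Q G' h' q' K'" "glue (Marked (m, Suc l)) K' (wd m l G') q' H'" using R(2) by blast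
  note q = Q[OF A(1) h(1) K(1)] and q' = Q[OF A(2) h(2) K'(1)]
  have "is_map K" "is_map K'" using q q' coreD(1) by blast+
  then show ?thesis using chord_iso[OF _ _ _ _ _ _ K(2) K'(2) ScD(5)[OF HS[OF B(1)]] ScD(5)[OF HS[OF B(2)]]] q q' iso[OF A h K(1) K'(1)] by blast
 qed
 show "wtc V z lam H = w' G h"
  if "G:A" "h:P G" "EX q K. Q G h q K&glue (Marked (m, Suc l)) K (wd m l G) q H" for G h H using w[OF that(1,2)] that(3) by blast
 show "wtc V z lam H = wtc V z lam H'"
  if "H:B" "H':B" "is_iso f H H'" for H H' f using wt_iso[OF ScD(2)[OF HS[OF that(1)]] ScD(2)[OF HS[OF that(2)]] that(3)] by simp
qed (use P Pinv in auto)

end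

lemma lf_star:
 assumes G: "is_map G" and L: "leafins Square G h p q K" and h: "cl G h = Black"
 shows "star k n K<->star k n G"
proof (rule star_transfer)
 note D = lf_darts[OF G L] and lb = lf_labels[OF G L]
 show "darts G <= darts K" using D by auto
 show "cl K x = cl G x&dl K x = dl G x" if "x:darts G" for x using lb(1,2)[OF that] by blast
 show "cl K x~=White i" if "x:darts K - darts G" for x i using that D(7) lb(3,4) h by auto
 show "rot K x = rot G x" if "x:darts G" "cl G x = White i" for x i
 proof -
  have "x~=h" "x~=p" using that D h by auto
  then show ?thesis by (rule lf_rot(4)[OF G L])
 qed
qed

lemma sd_star:
 assumes G: "is_map G" and L: "subdiv Black G h s t K"
 shows "star k n K<->star k n G"
proof (rule star_transfer)
 note D = sd_darts[OF G L] and lb = sd_labels[OF G L]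
 show "darts G <= darts K" using D by auto
 show "cl K x = cl G x&dl K x = dl G x" if "x:darts G" for x using lb(1,2)[OF that] by blast
 show "cl K x~=White i" if "x:darts K - darts G" for x i using that D(11) lb(3,4) by auto
 show "rot K x = rot G x" if "x:darts G" "cl G x = White i" for x i using sd_rot(3)[OF G L, of x] that D by auto
qed

lemma lf_pendant:
 assumes G: "is_map G" and L: "leafins Square G h p q K" and h: "cl G h = Black" "dl G h = Marked (m, l)"
  and b: "b:darts G" "cl G b = White m" "dl G b = Marked (m, l)" and sq: "ALL x:darts G. cl G x~=Square"
 shows "pendant m l K b q"
proof -
 note D = lf_darts[OF G L] and lb = lf_labels[OF G L]
 have "cl K x = Square<->x = q" if "x:darts K" for x using that lb(1)[of x] lb(3,4) sq h(1) D unfolding D(7) by auto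
 then show ?thesis unfolding pendant_def using D lb(4,6) lb(1,2)[OF b(1)] lf_rot(3)[OF G L] b h(2) by simp
qed

lemma Tc_commute: "Tc P V G a b h x y = Tc P V G a b h y x" by (simp add: Tc_def mult.commute)

text \<open>The value at the side h itself is replaced by x and y, so only the other values count.
  This reconciles the telescope, where h is not yet switched, with the merged map, where it
  is.\<close>

lemma Ts_side:
 assumes G: "is_map G" "h:darts G" and b: "!!x. x:darts G==>x~=h==>b x = b' x"
 shows "Ts P V G a b h x y = Ts P V G a b' h x y"
proof -
 have "b (opp G h) = b' (opp G h)" using b opp_in[OF G(1)] opp_neq[OF G] G(2) by simp
 moreover have "inverse (dd (pderiv V) e b) = inverse (dd (pderiv V) e b')" if e: "e:edges G - {{h, opp G h}}" for e
 proof -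
  have "b x = b' x" if "x:e" for x using in_edgesD(3)[OF G(1), of e h] e in_edgesD(2)[OF G(1), of e] that b by blast
  then show ?thesis using dd_cong[of e b b'] by metis
 qed
 ultimately show ?thesis by (simp add: Ts_def)
qed

text \<open>The face (m, l) partially switched to the value of (m, l + 1). When A consists of the
  darts before h, this is exactly the decoration that cutting the face produces on the old
  darts.\<close>

definition cva :: "(nat \<times> nat => complex)=>(nat => complex)=>nat=>nat=>(nat \<times> nat) cmap=>nat set=>nat => complex" where
 "cva z lam m l G A = asg (fc G (wd m l G)) (z (m, l)) (z (m, Suc l)) (cv z lam G) A"

definition Ssum :: "nat=>nat => complex poly=>(nat => complex)=>nat=>nat=>int=>(nat=>nat)=>(nat \<times> nat => complex) => complex"
 where "Ssum r N V lam g n d k z = gsum (Sc r N g n d k) (%G. wtc V z lam G)"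

context
 fixes r N g n m l :: nat and k :: "nat=>nat" and d :: int and z :: "nat \<times> nat => complex" and V :: "complex poly" and lam :: "nat => complex"
 assumes m: "m:{1..n}" and l: "1 <= l"
begin

lemma Sc_wd:
 assumes G: "G:Sc r N g n d (k(m := l))"
 shows "wd m l G:darts G" "cl G (wd m l G) = White m" "dl G (wd m l G) = Marked (m, l)"
  "x:fc G (wd m l G)<->x:darts G&dl G x = Marked (m, l)"
proof -
 note G' = ScD[OF G]
 have "l:{1..(k(m := l)) m}" using l by auto
 note w = wd_in[OF G'(5) m this]
 then show "wd m l G:darts G" "cl G (wd m l G) = White m" "dl G (wd m l G) = Marked (m, l)" by blast+
 show "x:fc G (wd m l G)<->x:darts G&dl G x = Marked (m, l)" using marked_face[OF G'(2) coreD(6)[OF G'(1)] _ w(1) _ w(3) chord_labels(3)[OF m l]]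
  dl_face[OF G'(2), of x "wd m l G"] fc_subset[OF G'(2) w(1)] w(3) by auto
qed

lemma Sc_wd_iso:
 assumes "G:Sc r N g n d (k(m := l))" "G':Sc r N g n d (k(m := l))" "is_iso f G G'" "h:fc G (wd m l G)"
 shows "f h:fc G' (wd m l G')" "cl G' (f h) = cl G h"
proof -
 have h: "h:darts G" "dl G h = Marked (m, l)" using assms(4) Sc_wd(4)[OF assms(1)] by auto
 then have "f h:darts G'" "dl G' (f h) = dl G h" "cl G' (f h) = cl G h" using assms(3) unfolding is_iso_iff[OF ScD(2)[OF assms(1)] ScD(2)[OF assms(2)]] by (auto dest: bij_betwE)
 then show "f h:fc G' (wd m l G')" "cl G' (f h) = cl G h" using Sc_wd(4)[OF assms(2)] h by auto
qed

lemma cva_glue: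
 assumes G: "G:Sc r N g n d (k(m := l))" and K: "is_map K" and L: "glue (Marked (m, Suc l)) K b q H"
  and x: "x:darts G" "x:darts K" "dl K x = dl G x" "x:pre K b q<->x:A" and A: "A <= fc G (wd m l G)"
 shows "cv z lam H x = cva z lam m l G A x"
proof -
 have "dl H x = (if x:A then Marked (m, Suc l) else dl G x)" using glue_simps(10)[OF K L x(2)] x(3,4) by simp
 then show ?thesis using Sc_wd(4)[OF G, of x] x(1) A by (auto simp: cva_def asg_def cv_dl)
qed

text \<open>The edge starts at a black corner h of the face (m, l) and ends at the white dart.
  Cutting along it gives the darts before h the new label, so the weight of the result is the corner
  term of the telescope times the weight of an edge between the two parts.\<close>

lemma transfer_chord_corner:
 assumes gn: "(g, n)~=(0, 1)" and k: "ALL i:{1..n}. 1 <= k i"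
 shows "gsum {H:Sc r N g n (d + (int r + 1)) (k(m := Suc l)). card (vx H (opp H (wd m l H))):{4..}}
  (%H. wtc V z lam H) =
  (\<Sum>G\<in>reps (Sc r N g n d (k(m := l))). (\<Sum>h\<in>{h:fc G (wd m l G). cl G h = Black}.
  eiv V (z (m, l)) (z (m, Suc l)) *
  Tc (- pderiv V) V G (cva z lam m l G (pre G (wd m l G) h)) (cva z lam m l G (pre G (wd m l G) h)) h (z (m, l)) (z (m, Suc l)))
  / of_nat (card (automorphisms G)))"
proof (rule transfer_chord[OF m l gn k, where Q = "%G h q K. EX p. leafins Square G h p q K"])
 let ?A = "Sc r N g n d (k(m := l))" and ?P = "%G. {h:fc G (wd m l G). cl G h = Black}"
 show "?P G <= darts G" if "G:?A" for G using Sc_wd(4)[OF that] by blast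
 show "f h:?P G'" if "G:?A" "G':?A" "is_iso f G G'" "h:?P G" for G G' f h using Sc_wd_iso[OF that(1-3)] that(4) by auto
 show "EX q K p. leafins Square G h p q K" if "G:?A" "h:?P G" for G h using lf_ex[OF ScD(2)[OF that(1)], of h] Sc_wd(4)[OF that(1), of h] that(2) by blast
 show "core r N (SIGMA i:{1..n}. {1..(k(m := l)) i}) g d K&black3 K&star (k(m := l)) n K&pendant m l K (wd m l G) q &
  cl K (opp K q) = Black & card (vx K (opp K q)):{4..}"
  if A: "G:?A" and h: "h:?P G" and "EX p. leafins Square G h p q K" for G h q K
 proof -
  obtain p where L: "leafins Square G h p q K" using \<open>EX p. leafins Square G h p q K\<close> by blast
  note G = ScD[OF A] and w = Sc_wd[OF A]
  note D = lf_darts[OF G(2) L]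
  have h: "cl G h = Black" "dl G h = Marked (m, l)" using h w(4) by auto
  have v: "vx K p = insert p (vx G h)" "opp K q = p" using lf_vertex(2)[OF G(2) L] lf_opp(2)[OF G(2) L] by auto
  have "finite (vx G h)" "p~:vx G h" using vx_subset[OF G(2) D(1)] fin_darts[OF G(2)] D(2) finite_subset by blast+
  moreover have "3 <= card (vx G h)" using G(4) h(1) D(1) by (auto simp: black3_def)
  ultimately have "card (vx K (opp K q)):{4..}" using v by simp
  moreover have "black3 K" unfolding lf_black3[OF G(2) L colour.distinct(4)] using G(4) lf_card_vertex[OF G(2) L] by (force simp: black3_def)
  moreover have "cl K (opp K q) = Black" using v(2) lf_labels(3)[OF G(2) L] h by simp
  ultimately show ?thesis using core_leafins[OF G(2) L] G(1,5) lf_star[OF G(2) L h(1)] lf_pendant[OF G(2) L h w(1-3)] G(6) by blast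
 qed
 show "EX G:?A. EX h:?P G. EX p. leafins Square G h p q K"
  if K: "core r N (SIGMA i:{1..n}. {1..(k(m := l)) i}) g d K" "black3 K" "star (k(m := l)) n K" "pendant m l K b q"
  "cl K (opp K q) = Black" "card (vx K (opp K q)):{4..}" for K b q
 proof -
  note KM = coreD(1)[OF K(1)] and p = K(4)[unfolded pendant_def]
  have "rot K (opp K q) ~= opp K q" by (metis p opp_in[OF KM] K(2,5) card_orbit_ge_3[OF fin_darts[OF KM] rot_permutes[OF KM], of "opp K q"] black3_def vertex_at_def)
  then obtain G h where G: "is_map G" "leafins (cl K q) G h (opp K q) q K" using lf_delete[OF KM, of q "opp K q"] p by metis
  have L: "leafins Square G h (opp K q) q K" using p G(2) by auto
  note D = lf_darts[OF G(1) L] and lb = lf_labels[OF G(1) L]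
  have h: "cl G h = Black" "dl G h = Marked (m, l)" using lb(3,6) K(5) p by auto
  have "black3 G" unfolding black3_def
  proof (intro ballI impI)
  fix x assume x: "x:darts G" "cl G x = Black"
  show "3 <= card (vx G x)"
  proof (cases "h:vx G x")
  case True
  then have "vx G x = vx G h" using vx_eq[OF G(1)] by auto
  moreover have "card (insert (opp K q) (vx G h)) <= Suc (card (vx G h))" by (rule card_insert_le_m1) simp_all
  ultimately show ?thesis using K(6) lf_vertex(2)[OF G(1) L] by simp
  next
  case False
  show ?thesis using K(2) x lb(1)[OF x(1)] D(7) black3_def lf_card_vertex[OF G(1) L x(1)] False by force
  qed
  qed
  moreover have "cl G x~=Square" if x: "x:darts G" for x
  proof -
  show ?thesis using x D(3,7) lb(1)[OF x] p by auto
  qed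
  ultimately have "G:?A" using core_leafins[OF G(1) L] K(1,3) lf_star[OF G(1) L h(1)] by (simp add: Sc_def)
  moreover from this have "h:?P G" using Sc_wd(4) h D(1) by auto
  ultimately show ?thesis using L by blast
 qed
 show "(EX f. is_iso f K K'&f q = q')<->(EX f. is_iso f G G'&f h = h')"
  if A: "G:?A" "G':?A" and "EX p. leafins Square G h p q K" "EX p. leafins Square G' h' p q' K'" for G h q K G' h' q' K' using that lf_iso[OF ScD(2)[OF A(1)] ScD(2)[OF A(2)]] by blast
 show "wtc V z lam H = eiv V (z (m, l)) (z (m, Suc l)) *
  Tc (- pderiv V) V G (cva z lam m l G (pre G (wd m l G) h)) (cva z lam m l G (pre G (wd m l G) h)) h (z (m, l)) (z (m, Suc l))"
  if A: "G:?A" and h: "h:?P G" and "EX p. leafins Square G h p q K" and gl: "glue (Marked (m, Suc l)) K (wd m l G) q H" for G h q K H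
 proof -
  obtain p where L: "leafins Square G h p q K" using \<open>EX p. leafins Square G h p q K\<close> by blast
  note G = ScD[OF A] and w = Sc_wd[OF A]
  note D = lf_darts[OF G(2) L] and lb = lf_labels[OF G(2) L] and K = lf_is_map[OF G(2) L]
  let ?b = "wd m l G" and ?c = "cv z lam H"
  have h: "cl G h = Black" "dl G h = Marked (m, l)" "h:fc G ?b" using h w(4) by auto
  have hb: "h~=?b" using h w(2) by auto
  note P = lf_pre(1)[OF G(2) L h(3) hb w(1)] and Q = pre_props[OF G(2) h(3)]
  have cG: "?c x = cva z lam m l G (pre G ?b h) x" if "x:darts G" for x by (rule cva_glue[OF A K gl that]) (use that P D Q(2) lb(2) in auto)
  have "?c p = z (m, Suc l)" "?c q = z (m, l)" using glue_simps(10)[OF K gl, of p] glue_simps(10)[OF K gl, of q] P D lb(6) h(2) pre_props(1)[OF K glue_simps(5)[OF K gl]] by (simp_all add: cv_dl)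
  moreover have "?c h = z (m, l)" using cG[OF D(1)] Q(1) h(3) by (simp add: cva_def asg_def)
  moreover have "wt V ?c ?c H = wsp (- pderiv V) V ?c ?c K (vx K p)" by (rule glue_weight[OF K gl]) (use lb w D h in auto)
  ultimately have "wt V ?c ?c H = eiv V (z (m, Suc l)) (z (m, l)) *
  Tc (- pderiv V) V G ?c ?c h (z (m, Suc l)) (z (m, l))" using lf_weight[OF G(2) L, of "- pderiv V" V ?c ?c] by simp
  then show ?thesis unfolding Tc_commute[of _ _ _ _ _ _ "z (m, Suc l)"] mult.commute[of "gg (z (m, Suc l))"] using Tc_cong[OF G(2) D(1), of ?c _ ?c] cG by metis
 qed
qed

text \<open>As for corners, with the edge starting at a trivalent vertex inserted on the side h.
  Here h itself lies before the new edge and is switched, in agreement with the order of corner and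
  side in the telescope.\<close>

lemma transfer_chord_side:
 assumes gn: "(g, n)~=(0, 1)" and k: "ALL i:{1..n}. 1 <= k i"
 shows "gsum {H:Sc r N g n (d + (int r + 1)) (k(m := Suc l)). card (vx H (opp H (wd m l H))):{3}}
  (%H. wtc V z lam H) =
  (\<Sum>G\<in>reps (Sc r N g n d (k(m := l))). (\<Sum>h\<in>fc G (wd m l G).
  eiv V (z (m, l)) (z (m, Suc l)) *
  Ts (- pderiv V) V G (cva z lam m l G (insert h (pre G (wd m l G) h))) (cva z lam m l G (pre G (wd m l G) h)) h (z (m, l)) (z (m, Suc l)))
  / of_nat (card (automorphisms G)))"
proof (rule transfer_chord[OF m l gn k, where Q = "%G h q K. EX s t p T. subdiv Black G h s t T&leafins Square T t p q K"])
 let ?A = "Sc r N g n d (k(m := l))" and ?P = "%G. fc G (wd m l G)"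
 show "?P G <= darts G" if "G:?A" for G using Sc_wd(4)[OF that] by blast
 show "f h:?P G'" if "G:?A" "G':?A" "is_iso f G G'" "h:?P G" for G G' f h using Sc_wd_iso(1)[OF that] .
 show "EX q K s t p T. subdiv Black G h s t T&leafins Square T t p q K" if A: "G:?A" and "h:?P G" for G h
 proof -
  have h: "h:darts G" using Sc_wd(4)[OF A] that(2) by blast
  obtain s t T where S: "subdiv Black G h s t T" using sd_ex[OF ScD(2)[OF A] h] .
  have "t:darts T" using sd_darts(11)[OF ScD(2)[OF A] S] by simp
  then show ?thesis using lf_ex[OF sd_is_map[OF ScD(2)[OF A] S], of t] S by metis
 qed
 show "core r N (SIGMA i:{1..n}. {1..(k(m := l)) i}) g d K&black3 K&star (k(m := l)) n K&pendant m l K (wd m l G) q &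
  cl K (opp K q) = Black & card (vx K (opp K q)):{3}"
  if A: "G:?A" and h: "h:?P G" and R: "EX s t p T. subdiv Black G h s t T&leafins Square T t p q K" for G h q K
 proof -
  obtain s t p T where S: "subdiv Black G h s t T" and L: "leafins Square T t p q K" using R by blast
  note G = ScD[OF A] and w = Sc_wd[OF A]
  note DS = sd_darts[OF G(2) S] and T = sd_is_map[OF G(2) S] and ls = sd_labels[OF G(2) S] and vs = sd_vertex[OF G(2) S]
  note D = lf_darts[OF T L] and v = lf_vertex[OF T L]
  have t: "cl T t = Black" "dl T t = Marked (m, l)" using ls h w(4) by auto
  have b: "wd m l G:darts T" "cl T (wd m l G) = White m" "dl T (wd m l G) = Marked (m, l)" using w(1-3) ls(1,2) DS(11) by auto
  have sq: "ALL x:darts T. cl T x~=Square" unfolding DS(11) using G(6) ls(1,3,4) by auto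
  have p3: "card (insert p {s, t}) = 3" using D DS by auto
  have op: "opp K q = p" using lf_opp(2)[OF T L] .
  have "black3 K" unfolding lf_black3[OF T L colour.distinct(4)]
  proof (intro ballI impI)
  fix x assume x: "x:darts T" "cl T x = Black"
  show "3 <= card (vx K x)"
  proof (cases "t:vx T x")
  case True
  then have "vx T x = {s, t}" using vx_eq[OF T] vs(3) by auto
  then show ?thesis using v(1)[OF x(1)] True p3 by simp
  next
  case False
  then have "x~=s" "x~=t" using vs(2,3) by auto
  then have xG: "x:darts G" using x DS by auto
  then have "3 <= card (vx G x)" using G(4) x ls(1) by (auto simp: black3_def)
  then show ?thesis using v(1)[OF x(1)] False vs(1)[OF xG] by simp
  qed
  qed
  moreover have "card (vx K (opp K q)):{3}" using op v(2) vs(3) p3 by simp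
  moreover have "cl K (opp K q) = Black" using op lf_labels(3)[OF T L] t by simp
  moreover have "core r N (SIGMA i:{1..n}. {1..(k(m := l)) i}) g d K" using core_leafins[OF T L] core_subdiv[OF G(2) S] G(1) by blast
  moreover have "star (k(m := l)) n K" using lf_star[OF T L t(1)] sd_star[OF G(2) S] G(5) by blast
  ultimately show ?thesis using lf_pendant[OF T L t b sq] by blast
 qed
 show "EX G:?A. EX h:?P G. EX s t p T. subdiv Black G h s t T&leafins Square T t p q K"
  if K: "core r N (SIGMA i:{1..n}. {1..(k(m := l)) i}) g d K" "black3 K" "star (k(m := l)) n K" "pendant m l K b q"
  "cl K (opp K q) = Black" "card (vx K (opp K q)):{3}" for K b q
 proof -
  note KM = coreD(1)[OF K(1)] and pd = K(4)[unfolded pendant_def]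
  have sq: "cl K q = Square" "!!x. x:darts K==>x~=q ==> cl K x~=Square" using pd by blast+
  define p where "p = opp K q"
  have pD: "p:darts K" "opp K p = q" using pd opp_in[OF KM] opp_opp[OF KM] by (auto simp: p_def)
  have "card (orbit (rot K) p) = 3" using K(6) by (simp add: p_def vertex_at_def)
  note o3 = orbit_card_3[OF fin_darts[OF KM] rot_permutes[OF KM] this]
  define s where "s = rot K p"
  define t where "t = rot K s"
  have r: "rot K t = p" "s~=p" "t~=p" "t~=s" using o3 by (auto simp: s_def t_def)
  have cb: "cl K p = Black" "cl K s = Black" "cl K t = Black" using K(5) cl_rot[OF KM] by (auto simp: p_def s_def t_def)
  \<comment> \<open>No loop term arises: if s and t formed an edge, the four darts p, q, s, t would
    be the whole map, with no place for the white dart b.\<close>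
  have os: "opp K s~=t"
  proof
  assume ot: "opp K s = t"
  then have ot': "opp K t = s" using opp_opp[OF KM, of s] by simp
  have "S <= darts K&S~={}&(ALL x:S. rot K x:S & opp K x:S)-->S = darts K" for S using coreD(2)[OF K(1)] unfolding connected_map_iff[OF KM] by blast
  from this[of "{p, q, s, t}"] have "darts K = {p, q, s, t}" using pD pd r ot ot' rot_in[OF KM] by (simp add: s_def[symmetric] t_def[symmetric] p_def[symmetric]) (metis s_def t_def)
  then show False using pd cb sq(1) by auto
  qed
  obtain T h where T': "is_map T" "leafins (cl K q) T h p q K" "rot K h = p" using lf_delete[OF KM, of q p] pd r(2) p_def s_def by metis
  have L: "leafins Square T t p q K" using T'(3) r(1) rot_inj[OF KM] T'(2) sq(1) by auto
  note T = T'(1) and D = lf_darts[OF T'(1) L] and lb = lf_labels[OF T'(1) L]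
  have t: "cl T t = Black" "dl T t = Marked (m, l)" using lb(3,6) cb pd by auto
  have rT: "rot T t = s" using lf_rot(2)[OF T L] s_def by simp
  have sD: "s:darts T" using rT rot_in[OF T] D(1) by metis
  have sp: "s~=p" "s~=q" using sD D by auto
  have sh: "s~=t" using r(4) by simp
  have rT2: "rot T s = t" using lf_rot(4)[OF T L sh sp(1)] t_def by simp
  have ot: "opp T t~=s" using lf_opp(3)[OF T L sp] os opp_opp[OF T] by auto
  obtain G where G: "is_map G" "subdiv (cl T t) G (opp T s) s t T" using sd_delete[OF T D(1) rT rT2 sh ot] by metis
  have S: "subdiv Black G (opp T s) s t T" using G(2) t(1) by simp
  note DS = sd_darts[OF G(1) S] and ls = sd_labels[OF G(1) S] and vs = sd_vertex[OF G(1) S]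
  have "black3 G" unfolding black3_def
  proof (intro ballI impI)
  fix x assume x: "x:darts G" "cl G x = Black"
  have xT: "x:darts T" using x DS by auto
  have "card (vx K x) = card (vx G x)" using vs(1)[OF x(1)] vx_subset[OF G(1) x(1)] DS lf_vertex(1)[OF T L xT] by auto
  moreover have "3 <= card (vx K x)" using K(2) x lb(1)[OF xT] ls(1)[OF x(1)] xT D(7) by (simp add: black3_def)
  ultimately show "3 <= card (vx G x)" by simp
  qed
  moreover have "cl G x~=Square" if x: "x:darts G" for x
  proof -
  have xT: "x:darts T" using x DS by simp
  then have "x:darts K" "x~=q" using D(3,7) by auto
  then show ?thesis using sq(2)[of x] lb(1)[OF xT] ls(1)[OF x] by simp
  qed
  ultimately have GA: "G:?A" using core_leafins[OF T L] core_subdiv[OF G(1) S] K(1,3) lf_star[OF T L t(1)] sd_star[OF G(1) S] by (simp add: Sc_def)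
  moreover have "dl G (opp T s) = Marked (m, l)" using ls(5) t(2) by simp
  then have "opp T s:?P G" using Sc_wd(4)[OF GA] DS(1) by blast
  ultimately show ?thesis using S L by blast
 qed
 show "(EX f. is_iso f K K'&f q = q')<->(EX f. is_iso f G G'&f h = h')"
  if A: "G:?A" "G':?A" and R: "EX s t p T. subdiv Black G h s t T&leafins Square T t p q K"
  "EX s t p T. subdiv Black G' h' s t T&leafins Square T t p q' K'" for G h q K G' h' q' K'
 proof -
  obtain s t p T where S: "subdiv Black G h s t T" "leafins Square T t p q K" using R(1) by blast
  obtain s' t' p' T' where S': "subdiv Black G' h' s' t' T'" "leafins Square T' t' p' q' K'" using R(2) by blast
  note G = ScD(2)[OF A(1)] ScD(2)[OF A(2)]
  show ?thesis using lf_iso[OF sd_is_map[OF G(1) S(1)] sd_is_map[OF G(2) S'(1)] S(2) S'(2)] sd_iso[OF G S(1) S'(1)] by simp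
 qed
 show "wtc V z lam H = eiv V (z (m, l)) (z (m, Suc l)) *
  Ts (- pderiv V) V G (cva z lam m l G (insert h (pre G (wd m l G) h))) (cva z lam m l G (pre G (wd m l G) h)) h (z (m, l)) (z (m, Suc l))"
  if A: "G:?A" and h: "h:?P G" and R: "EX s t p T. subdiv Black G h s t T&leafins Square T t p q K"
  and gl: "glue (Marked (m, Suc l)) K (wd m l G) q H" for G h q K H
 proof -
  obtain s t p T where S: "subdiv Black G h s t T" and L: "leafins Square T t p q K" using R by blast
  note G = ScD[OF A] and w = Sc_wd[OF A]
  note DS = sd_darts[OF G(2) S] and ls = sd_labels[OF G(2) S] and T = sd_is_map[OF G(2) S]
  note D = lf_darts[OF T L] and lb = lf_labels[OF T L] and K = lf_is_map[OF T L]
  let ?b = "wd m l G" and ?c = "cv z lam H"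
  define Y where "Y = insert h (pre G ?b h)"
  have hd: "dl G h = Marked (m, l)" using h w(4) by auto
  note PT = sd_pre[OF G(2) S h w(1), folded Y_def] and Q = pre_props[OF G(2) h, folded Y_def]
  have bT: "?b:darts T" using w(1) DS(11) by simp
  note P = lf_pre(1)[OF T L PT(2,3) bT]
  have tp: "t~:pre T ?b t" by (rule pre_props(1)[OF T PT(2)])
  have FG: "fc G ?b <= darts G" using w(4) by auto
  have pk: "x:pre K ?b q<->x = p | x:Y | (x = s & opp G h:Y)" for x unfolding P PT(1) by auto
  have lH: "dl H x = (if x:pre K ?b q then Marked (m, Suc l) else dl K x)" if "x:darts K" for x using glue_simps(10)[OF K gl that] .
  have old: "x:darts T" "x:darts K" "dl K x = dl G x" "x:pre K ?b q<->x:Y" if x: "x:darts G" for x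
  proof -
  show xT: "x:darts T" using x DS(11) by simp
  then show "x:darts K" using D(7) by simp
  show "dl K x = dl G x" using lb(2)[OF xT] ls(2)[OF x] by simp
  show "x:pre K ?b q<->x:Y" using xT x D(2) DS(2) pk by auto
  qed
  have cG: "?c x = cva z lam m l G Y x" if x: "x:darts G" for x by (rule cva_glue[OF A K gl x old(2-4)[OF x] Q(2)])
  have Kin: "p:darts K" "q:darts K" "t:darts K" "s:darts K" using D(7) DS(11) by auto
  have sT: "s:darts T" "t:darts T" using DS(11) by auto
  have ns: "s~=p" using sT D(2) by auto
  have nt: "t~:Y" "t~=s" "t~=p" using Q(2) FG DS(3,4) D by auto
  have nq: "q~:pre K ?b q" by (rule pre_props(1)[OF K glue_simps(5)[OF K gl]])
  have sY: "s~:Y" using Q(2) FG DS(2) by auto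
  have c: "?c p = z (m, Suc l)" "?c q = z (m, l)" "?c t = z (m, l)" using lH[OF Kin(1)] lH[OF Kin(2)] lH[OF Kin(3)] pk[of p] pk[of t] nq nt lb(2)[OF sT(2)] lb(6) ls(5) hd by (simp_all add: cv_dl)
  have ch: "?c h = z (m, Suc l)" using cG[OF DS(1)] h by (simp add: cva_def asg_def Y_def)
  have oK: "opp G h:darts K" "dl K (opp G h) = dl G (opp G h)" "opp G h:pre K ?b q <-> opp G h:Y" using old[OF DS(5)] by auto
  have cs: "?c s = ?c (opp G h)" by (metis lH[OF Kin(4)] lH[OF oK(1)] pk[of s] sY ns oK lb(2)[OF sT(1)] ls(6) cv_dl)
  have bw: "cl K ?b = White m" using lb(1)[OF bT] ls(1)[OF w(1)] w(2) by simp
  have "wt V ?c ?c H = wsp (- pderiv V) V ?c ?c K (vx K p)" by (rule glue_weight[OF K gl]) (use lb(3,4) ls(4) bw Kin in auto)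
  also have "... = eiv V (?c p) (?c q) * Tc (- pderiv V) V T ?c ?c t (?c p) (?c t)" by (rule lf_weight[OF T L]) simp
  also have "Tc (- pderiv V) V T ?c ?c t (?c p) (?c t) = Tc (- pderiv V) V T ?c ?c t (?c t) (?c h)" unfolding c ch by (rule Tc_commute)
  also have "... = Ts (- pderiv V) V G ?c ?c h (?c t) (?c h)" by (rule sd_weight[where a = ?c and b = ?c, OF G(2) S cs cs])
  also have "... = Ts (- pderiv V) V G (cva z lam m l G Y) (cva z lam m l G Y) h (?c t) (?c h)" by (rule Ts_cong[OF G(2) DS(1)]) (simp_all add: cG)
  also have "... = Ts (- pderiv V) V G (cva z lam m l G Y) (cva z lam m l G (pre G ?b h)) h (?c t) (?c h)" by (rule Ts_side[OF G(2) DS(1)]) (auto simp: cva_def asg_def Y_def)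
  finally show ?thesis unfolding c ch Y_def by (simp add: mult.commute)
 qed
qed

end

text \<open>The maps with one more corner at the white vertex m are sorted by where the edge marked
  (m, l) ends. Their sum is the telescope from z(m, l) to z(m, l + 1) over the face (m, l) of the
  smaller maps, each term carrying the weight of that edge.\<close>

lemma chord_recursion:
 assumes m: "m:{1..n}" and l: "1 <= l" and gn: "(g, n)~=(0, 1)" and k: "ALL i:{1..n}. 1 <= k i"
  and nz: "nonzero_on V (z ` (SIGMA i:{1..n}. {1..(k(m := Suc l)) i}) Un lam ` {1..N})"
 shows "(poly (pderiv V) (z (m, l)) - poly (pderiv V) (z (m, Suc l))) * Ssum r N V lam g n (d + (int r + 1)) (k(m := Suc l)) z =
  Ssum r N V lam g n d (k(m := l)) z - Ssum r N V lam g n d (k(m := l)) (z((m, l) := z (m, Suc l)))"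
proof -
 let ?B = "Sc r N g n (d + (int r + 1)) (k(m := Suc l))" and ?A = "Sc r N g n d (k(m := l))"
 let ?w = "%z H. wtc V z lam H" and ?D = "%H. card (vx H (opp H (wd m l H)))"
 define x where "x = z (m, l)"
 define y where "y = z (m, Suc l)"
 define c where "c = eiv V x y"
 define X where "X G = (\<Sum>h\<in>{h:fc G (wd m l G). cl G h = Black}.
  c * Tc (- pderiv V) V G (cva z lam m l G (pre G (wd m l G) h)) (cva z lam m l G (pre G (wd m l G) h)) h x y) +
  (\<Sum>h\<in>fc G (wd m l G).
  c * Ts (- pderiv V) V G (cva z lam m l G (insert h (pre G (wd m l G) h))) (cva z lam m l G (pre G (wd m l G) h)) h x y)" for G
 define S where "S = z ` (SIGMA i:{1..n}. {1..(k(m := Suc l)) i}) Un lam ` {1..N}"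
 have lab: "(m, l):(SIGMA i:{1..n}. {1..(k(m := Suc l)) i})" "(m, Suc l):(SIGMA i:{1..n}. {1..(k(m := Suc l)) i})" using m l by auto
 have xyS: "x:S" "y:S" unfolding x_def y_def S_def using lab by blast+
 have e0: "ev (pderiv V) (gg x * gg y)~=0" using nz[folded S_def] xyS by (simp add: nonzero_on_def)
 have q: "wd m l H:darts H" "f (wd m l H) = wd m l H'"
  if "H:?B" "H':?B" "is_iso f H H'" for f H H'
 proof -
  have r: "l:{1..(k(m := Suc l)) m}" using l by auto
  show "wd m l H:darts H" "f (wd m l H) = wd m l H'" using wd_in(1)[OF ScD(5)[OF that(1)] m r] wd_iso[OF ScD(2)[OF that(1)] ScD(2)[OF that(2)] that(3) ScD(5)[OF that(1)] ScD(5)[OF that(2)] m r] by blast+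
 qed
 have inv: "?D H = ?D H'" if H: "H:?B" "H':?B" "is_iso f H H'" for f H H'
 proof -
  have "f (opp H (wd m l H)) = opp H' (wd m l H')" using H(3) q[OF H] by (simp add: is_iso_def)
  then show ?thesis using card_vertex_iso[OF ScD(2)[OF H(1)] ScD(2)[OF H(2)] H(3), of "opp H (wd m l H)"] q(1)[OF H] opp_in[OF ScD(2)[OF H(1)]] by simp
 qed
 \<comment> \<open>The far end is black, so the cases of degree three and of degree at least four
   are exhaustive.\<close>
 have ge3: "3 <= ?D H" if H: "H:?B" for H
 proof -
  obtain K b q where K: "core r N (SIGMA i:{1..n}. {1..(k(m := l)) i}) g d K" "pendant m l K b q"
  "glue (Marked (m, Suc l)) K b q H" "cl K (opp K q) = Black" using chord_delete[OF m l H gn k] by metis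
  note p = K(2)[unfolded pendant_def] and KM = coreD(1)[OF K(1)]
  have o: "opp K q:darts K" using p opp_in[OF KM] by simp
  have "cl K b~=Black" "cl K q~=Black" using p by auto
  then have "cl H (opp K q) = Black" using glue_black_vertex(2)[OF KM K(3) o K(4)] by blast
  moreover have "opp H (wd m l H) = opp K q" using chord_wd(1)[OF m l KM K(2,3) ScD(5)[OF H]] glue_simps(7)[OF KM K(3)] by simp
  ultimately show ?thesis using ScD(4)[OF H] o glue_simps(6)[OF KM K(3)] by (simp add: black3_def)
 qed
 have three: "{H:?B. ~ ?D H:{4..}} = {H:?B. ?D H:{3}}" using ge3 by fastforce
 have "gsum ?B (?w z) = gsum {H:?B. ?D H:{4..}} (?w z) + gsum {H:?B. ~ ?D H:{4..}} (?w z)" by (rule gsum_split[OF finite_reps_Sc], drule (2) inv, simp only:)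
 also have "... = gsum {H:?B. ?D H:{4..}} (?w z) + gsum {H:?B. ?D H:{3}} (?w z)" by (simp only: three)
 also have "... = (\<Sum>G\<in>reps ?A.
  X G
  / of_nat (card (automorphisms G)))" unfolding transfer_chord_corner[OF m l gn k] transfer_chord_side[OF m l gn k] X_def c_def x_def y_def by (simp only: sum.distrib[symmetric] add_divide_distrib)
 finally have B: "Ssum r N V lam g n (d + (int r + 1)) (k(m := Suc l)) z = ..." by (simp add: Ssum_def)
 have tele: "(poly (pderiv V) x - poly (pderiv V) y) *
  X G =
  ?w z G - ?w (z((m, l) := y)) G" if G: "G:?A" for G
 proof -
  note G' = ScD[OF G] and w = Sc_wd[OF m l G]
  define b where "b = wd m l G"
  define F where "F = fc G b"
  let ?v = "cv z lam G"
  let ?c = "%A. asg F x y ?v A"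
  have cv: "cva z lam m l G A = ?c A" for A by (simp add: cva_def F_def b_def x_def y_def)
  have F: "h:F<->h:darts G&dl G h = Marked (m, l)" for h using w(4) by (simp add: F_def b_def)
  then have fin: "finite F" using fin_darts[OF G'(2)] finite_subset[of F] by blast
  have vS: "?v h:S" if "h:darts G - F" for h using cv_in[OF G'(1), of h z lam] that unfolding S_def by (auto split: if_splits)
  have "?w z G = wt V (?c {}) (?c {}) G" by (rule wt_cong[OF G'(2)]) (auto simp: asg_def F cv_dl x_def)
  moreover have "?w (z((m, l) := y)) G = wt V (?c F) (?c F) G"
  proof (rule wt_cong[OF G'(2)])
  show "cv (z((m, l) := y)) lam G h = ?c F h" if "h:darts G" for h using that by (cases "dl G h") (auto simp: asg_def F cv_dl)
  then show "cv (z((m, l) := y)) lam G h = ?c F h" if "h:darts G" for h using that .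
  qed
  ultimately have t: "?w z G - ?w (z((m, l) := y)) G = (x - y) * (\<Sum>h\<in>F. (if cl G h = Black then
  Tc (- pderiv V) V G (?c (pre G b h)) (?c (pre G b h)) h x y else 0) +
  Ts (- pderiv V) V G (?c (insert h (pre G b h))) (?c (pre G b h)) h x y)" using wt_telescope[OF G'(2) w(1)[folded b_def] F_def nz[folded S_def] xyS vS] by simp
  \<comment> \<open>The weight of the new edge converts the factor x - y of the telescope into the
    difference of the values of V' that appears in (ii).\<close>
  have "(poly (pderiv V) x - poly (pderiv V) y) * c = x - y" using e0 by (simp add: ev_gg_diff[symmetric] c_def)
  then have *: "(poly (pderiv V) x - poly (pderiv V) y) * (c * s) = (x - y) * s" for s by (metis mult.assoc)
  show ?thesis unfolding t X_def cv b_def[symmetric] F_def[symmetric] sum_distrib_left[symmetric] sum.inter_filter[OF fin] by (simp only: distrib_left[symmetric] * sum.distrib)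
 qed
 have "(poly (pderiv V) x - poly (pderiv V) y) * Ssum r N V lam g n (d + (int r + 1)) (k(m := Suc l)) z =
  (\<Sum>G\<in>reps ?A. (poly (pderiv V) x - poly (pderiv V) y) * X G / of_nat (card (automorphisms G)))" unfolding B by (simp add: sum_distrib_left)
 also have "... = (\<Sum>G\<in>reps ?A. (?w z G - ?w (z((m, l) := y)) G) / of_nat (card (automorphisms G)))" by (intro sum.cong refl) (simp only: tele[OF representatives_subset])
 also have "... = Ssum r N V lam g n d (k(m := l)) z - Ssum r N V lam g n d (k(m := l)) (z((m, l) := y))" by (simp only: Ssum_def gsum_def sum_subtractf diff_divide_distrib)
 finally show ?thesis by (simp only: x_def y_def)
qed

lemma gen_S_nth:
 assumes deg: "degree (pderiv V) <= r" and k: "ALL i:{1..n}. 1 <= k i"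
 shows "fls_nth (gen_S r V N lam g n k z) d = Ssum r N V lam g n d k (%(m, i). z m i)"
proof -
 let ?z = "%(m, i). z m i"
 have "fls_nth (gen_S r V N lam g n k z) d = gsum {G:maps_S r N g n k. map_degree r G = d} (weight V lam ?z 0)" unfolding nth_gen by (rule gen_coeff_gsum) (simp add: maps_S_def coloured_map_def)
 also have "... = gsum {G:Sc r N g n d k. bounded_degree r G} (%G. wtc V ?z lam G)" unfolding maps_S_eq[OF k] by (rule gsum_cong) (auto intro!: weight_eq_wt dest: ScD)
 also have "... = Ssum r N V lam g n d k ?z" unfolding Ssum_def by (rule gsum_bounded) (auto intro: finite_reps_Sc ScD(2) wt_unbounded[OF _ deg])
 finally show ?thesis .
qed

text \<open>A white vertex of degree 1 carries the label \<open>m\<close> in one class and \<open>(m, 1)\<close> in the other.\<close>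

definition relabel :: "nat cmap=>(nat \<times> nat) cmap=>bool" where
 "relabel G H<->darts H = darts G&rot H = rot G & opp H = opp G & colour H = colour G &
  (ALL x:darts G. dl H x = map_decoration (%i. (i, 1)) (dl G x))"

context
 fixes G :: "nat cmap" and H :: "(nat \<times> nat) cmap"
 assumes R: "relabel G H"
begin

lemma relabel_simps:
 "darts H = darts G" "rot H = rot G" "opp H = opp G" "colour H = colour G" "face_perm H = face_perm G"
 "vx H = vx G" "fc H = fc G" "vertices H = vertices G" "edges H = edges G" "faces H = faces G"
 "cl H = cl G" "is_map H<->is_map G" "connected_map H <-> connected_map G" "has_genus g H<->has_genus g G" "map_degree r H = map_degree r G"
proof -
 show 1: "darts H = darts G" "rot H = rot G" "opp H = opp G" "colour H = colour G" using R by (auto simp: relabel_def)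
 show 2: "face_perm H = face_perm G" by (simp add: face_perm_def 1)
 show 3: "vx H = vx G" "fc H = fc G" by (simp_all add: vertex_at_def face_at_def 1 2 fun_eq_iff)
 show 4: "vertices H = vertices G" "edges H = edges G" "faces H = faces G" by (simp_all add: vertices_def edges_def faces_def 1 3)
 show "cl H = cl G" by (simp add: cl_def 1 3 fun_eq_iff)
 show "is_map H<->is_map G" "connected_map H <-> connected_map G" "has_genus g H<->has_genus g G" "map_degree r H = map_degree r G" by (simp_all add: is_map_def connected_map_def has_genus_def map_degree_def 1 4)
qed

lemma relabel_dl: "x:darts G==>dl H x = map_decoration (%i. (i, 1)) (dl G x)"
 "x:darts G==>dl H x = Marked (i, 1)<->dl G x = Marked i"
proof -
 show 1: "x:darts G==>dl H x = map_decoration (%i. (i, 1)) (dl G x)" using R by (auto simp: relabel_def)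
 show "x:darts G==>dl H x = Marked (i, 1)<->dl G x = Marked i" using 1 by (cases "dl G x") auto
qed

lemma relabel_class:
 assumes k: "ALL i:{1..n}. k i = 1"
 shows "H:Sc r N g n d k<->G:Wc r N {1..n} g d {1..n}"
proof (cases "is_map G")
 case True
 note s = relabel_simps and dl = relabel_dl
 have M: "(SIGMA i:{1..n}. {1..k i}) = (%i. (i, 1)) ` {1..n}" using k by auto
 have lab: "dl H x:Marked ` (%i. (i, 1)) ` {1..n} Un Unmarked ` {1..N}<->dl G x:Marked ` {1..n} Un Unmarked ` {1..N}"
  if "x:darts G" for x using dl(1)[OF that] by (cases "dl G x") auto
 have "decorated N ((%i. (i, 1)) ` {1..n}) H<->decorated N {1..n} G" unfolding decorated_iff s(1,7) using lab dl(2) by (simp cong: conj_cong)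
 then have "core r N (SIGMA i:{1..n}. {1..k i}) g d H <-> core r N {1..n} g d G" unfolding core_def M s by simp
 moreover have "black3 H<->black3 G" by (simp add: black3_def s)
 moreover have "star k n H<->leafy {1..n} G"
 proof
  assume st: "star k n H"
  have lb: "i:{1..n}&dl H h = Marked (i, 1)" if h: "h:darts G" "cl G h = White i" for h i using star_white[OF st, of h i] h k unfolding s by force
  show "leafy {1..n} G" unfolding leafy_def
  proof (intro conjI allI ballI impI)
  show "i:{1..n}<->(EX h:darts G. cl G h = White i)" for i using wd_in(1,2)[OF st, of i 1] lb k unfolding s by auto
  show "h = h'" if "h:darts G" "h':darts G" "cl G h = White i & cl G h' = White i" for h h' i using star_uniq[OF st, of h h' i i] lb[of h i] lb[of h' i] that unfolding s by simp
  show "dl G h = Marked i" if "h:darts G" "cl G h = White i" for h i using conjunct2[OF lb[OF that]] unfolding dl(2)[OF that(1)] .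
  qed
 next
  assume lf: "leafy {1..n} G"
  show "star k n H"
  proof (rule starI[where c = "%i j. leaf i G"])
  fix i j assume i: "i:{1..n}" and j: "j:{1..k i}"
  note l = leaf_in[OF lf i]
  have "j = 1" using i j k by auto
  then show "leaf i G:darts H & cl H (leaf i G) = White i&dl H (leaf i G) = Marked (i, j)&rot H (leaf i G) = leaf i G" using l dl(2)[OF l(1)] leafy_cl(2)[OF lf l] leafy_rot[OF True lf l] by (simp add: s)
  next
  fix h i assume h: "h:darts H" "cl H h = White i"
  have i: "i:{1..n}" using leafy_cl(1)[OF lf, of h i] h by (simp add: s)
  then have "1:{1..k i}" using k by auto
  then show "i:{1..n}&(EX j:{1..k i}. h = leaf i G)" using i leaf_eq[OF lf, of h i] h by (auto simp: s)
  qed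
 qed
 ultimately show ?thesis by (auto simp: Sc_def Wc_def s)
qed (auto simp: Sc_def Wc_def core_def relabel_simps)

lemma relabel_wt:
 assumes "is_map G"
 shows "wtc V z lam H =
  wtc V (%i. z (i, 1)) lam G"
proof -
 have "cv z lam H x = cv (%i. z (i, 1)) lam G x" if "x:darts G" for x using relabel_dl(1)[OF that] by (cases "dl G x") (auto simp: cv_dl)
 moreover have "wt V a b H = wt V a b G" for a b by (simp add: wt_def EW_def vw_def relabel_simps)
 ultimately show ?thesis using wt_cong[OF assms, of "cv z lam H"] by metis
qed

end

lemma relabel_iso:
 assumes "is_map G" "is_map G'" and R: "relabel G H" "relabel G' H'"
 shows "is_iso f H H'<->is_iso f G G'"
proof -
 note s = relabel_simps[OF R(1)] and s' = relabel_simps[OF R(2)]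
 have H: "is_map H" "is_map H'" using s s' assms by auto
 have "dl H' (f x) = dl H x<->dl G' (f x) = dl G x" if "x:darts G" "f x:darts G'" for x unfolding relabel_dl(1)[OF R(1) that(1)] relabel_dl(1)[OF R(2) that(2)] by (intro inj_eq decoration.inj_map) (simp add: inj_def)
 then show ?thesis unfolding is_iso_iff[OF assms(1,2)] is_iso_iff[OF H] s s' using bij_betwE by metis
qed

text \<open>A star vertex of degree one is a leaf, so the two classes differ only by the relabelling
  of marks. Both are rigid, and the first leaf serves as the distinguished dart.\<close>

lemma Ssum_base:
 assumes k: "ALL i:{1..n}. k i = 1" and n: "n >= 1"
 shows "Ssum r N V lam g n d k z = Wsum r N V lam {1..n} g d {1..n} (%i. z (i, 1))"
proof -
 let ?A = "Wc r N {1..n} g d {1..n}" and ?z = "%i. z (i, 1)"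
 have n1: "1:{1..n}" using n by simp
 have "Ssum r N V lam g n d k z = (\<Sum>G\<in>reps ?A. (\<Sum>h\<in>{leaf 1 G}. wtc V ?z lam G) / of_nat (card (automorphisms G)))" unfolding Ssum_def
 proof (rule gsum_transfer_pointed(2)[where R = "%G h H. relabel G H"])
  show "is_map G" "connected_map G" "{leaf 1 G} <= darts G" if "G:?A" for G using WcD[OF that] leaf_in[OF WcD(4)[OF that] n1] by auto
  show "finite (reps ?A)" by (rule finite_reps_Wc) auto
  show "is_map H" "card (automorphisms H) = 1" if "H:Sc r N g n d k" for H using ScD(2)[OF that] rigid_Sc[OF that n] k n1 by auto
  show "f h:{leaf 1 G'}" if "G:?A" "G':?A" "is_iso f G G'" "h:{leaf 1 G}" for G G' f h using leaf_iso[OF WcD(2)[OF that(1)] WcD(2)[OF that(2)] that(3) WcD(4)[OF that(1)] WcD(4)[OF that(2)] n1] that(4) by simp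
  show "EX H:Sc r N g n d k. relabel G H" if A: "G:?A" for G h
  proof -
  define H where "H = \<lparr>darts = darts G, rot = rot G, opp = opp G, colour = colour G, decor = map_decoration (%i. (i, 1::nat)) \<circ> decor G\<rparr>"
  have "fc H x = fc G x" for x by (simp add: face_at_def face_perm_def H_def)
  then have R: "relabel G H" by (simp add: relabel_def H_def dl_def)
  then show ?thesis using relabel_class[OF R k] A by blast
  qed
  show "EX G:?A. EX h:{leaf 1 G}. relabel G H" if A: "H:Sc r N g n d k" for H
  proof -
  define G where "G = \<lparr>darts = darts H, rot = rot H, opp = opp H, colour = colour H, decor = map_decoration fst \<circ> decor H\<rparr>"
  have "fc H x = fc G x" for x by (simp add: face_at_def face_perm_def G_def)
  moreover have "dl H x = map_decoration (%i. (i, 1)) (map_decoration fst (dl H x))" if "x:darts H" for x using coreD(4)[OF ScD(1)[OF A] that] k by auto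
  ultimately have R: "relabel G H" by (simp add: relabel_def G_def dl_def)
  then show ?thesis using relabel_class[OF R k] A by blast
  qed
  show "(EX f. is_iso f H H')<->(EX f. is_iso f G G'&f h = h')"
  if "G:?A" "G':?A" "h:{leaf 1 G}" "h':{leaf 1 G'}" "relabel G H" "relabel G' H'" for G h H G' h' H' using relabel_iso[OF WcD(2)[OF that(1)] WcD(2)[OF that(2)] that(5,6)] that(3,4)
  leaf_iso[OF WcD(2)[OF that(1)] WcD(2)[OF that(2)] _ WcD(4)[OF that(1)] WcD(4)[OF that(2)] n1] by auto
  show "wtc V z lam H = wtc V ?z lam G"
  if "G:?A" "relabel G H" for G H by (rule relabel_wt[OF that(2) WcD(2)[OF that(1)]])
  show "wtc V z lam H = wtc V z lam H'"
  if "H:Sc r N g n d k" "H':Sc r N g n d k" "is_iso f H H'" for H H' f using wt_iso[OF ScD(2)[OF that(1)] ScD(2)[OF that(2)] that(3)] by simp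
 qed
 then show ?thesis by (simp add: Wsum_def gsum_def)
qed

section \<open>The Lagrange sum and its recursion\<close>

lemma sum_PiE_split:
 assumes "finite I" "m:I"
 shows "(\<Sum>j\<in>PiE I S. f j) = (\<Sum>a\<in>S m. \<Sum>j\<in>PiE (I - {m}) S. f (j(m := a)))"
proof -
 have "PiE I S = (%(y, g). g(m := y)) ` (S m \<times> PiE (I - {m}) S)" using PiE_insert_eq[of m "I - {m}" S] assms(2) by (simp add: insert_absorb)
 then have "(\<Sum>j\<in>PiE I S. f j) = (\<Sum>(y, g)\<in>S m \<times> PiE (I - {m}) S. f (g(m := y)))" using inj_combinator[of m "I - {m}" S] by (simp add: sum.reindex case_prod_unfold)
 then show ?thesis by (simp add: sum.cartesian_product)
qed

text \<open>The sum is a divided difference of B at the nodes v. The two terms on the right omit q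
  and p respectively; the one without p is written as the first one with p moved onto q, because the
  map recursion substitutes z(m, l + 1) for z(m, l) in this way.\<close>

lemma lagrange_step:
 fixes v B :: "nat=>'a::field"
 assumes S: "finite S" "p~:S" "q~:S" "p~=q" and inj: "inj_on v (insert p (insert q S))"
 defines "L == %v B T. \<Sum>a\<in>T. B a / (\<Prod>i\<in>T - {a}. v a - v i)"
 shows "(v p - v q) * L v B (insert p (insert q S)) = L v B (insert p S) - L (v(p := v q)) (B(p := B q)) (insert p S)"
proof -
 define D where "D a = (\<Prod>i\<in>S - {a}. v a - v i)" for a
 have ne: "v a - v b~=0" if "a:insert p (insert q S)" "b:insert p (insert q S)" "a~=b" for a b using inj_onD[OF inj, of a b] that by auto
 have D0: "D a~=0" if "a:insert p (insert q S)" for a unfolding D_def using S(1) by (simp only: prod_zero_iff finite_Diff) (use ne that in auto)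
 have pq: "v p - v q~=0" using ne S(4) by simp
 have rm: "insert p T - {a} = insert p (T - {a})" if "a~=p" for T and a using that by auto
 have P2: "(\<Prod>i\<in>insert p (insert q S) - {a}. v a - v i) = (v a - v p) * (v a - v q) * D a" if "a:S" for a
 proof -
  have "insert p (insert q S) - {a} = insert p (insert q (S - {a}))" using that S by auto
  then show ?thesis using S by (simp add: D_def mult.assoc)
 qed
 have P1: "(\<Prod>i\<in>insert p S - {a}. v a - v i) = (v a - v p) * D a" if "a:S" for a
 proof -
  have "insert p S - {a} = insert p (S - {a})" using that S by auto
  then show ?thesis using S by (simp add: D_def)
 qed
 have P3: "(\<Prod>i\<in>insert p S - {a}. (v(p := v q)) a - (v(p := v q)) i) = (v a - v q) * D a" if "a:S" for a
 proof -
  have "insert p S - {a} = insert p (S - {a})" "a~=p" using that S by auto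
  moreover have "(\<Prod>i\<in>S - {a}. v a - (v(p := v q)) i) = D a" unfolding D_def using S by (intro prod.cong) auto
  ultimately show ?thesis using S by simp
 qed
 have Pp: "insert p (insert q S) - {p} = insert q S" "insert p (insert q S) - {q} = insert p S" "insert p S - {p} = S" using S by auto
 have Dv: "(\<Prod>i\<in>S. v a - v i) = D a" if "a~:S" for a using that by (simp add: D_def)
 have Dq: "(\<Prod>i\<in>S. v q - (v(p := v q)) i) = D q" unfolding Dv[OF S(3), symmetric] using S by (intro prod.cong) auto
 have two: "L v B (insert p (insert q S)) = B p / ((v p - v q) * D p) + B q / ((v q - v p) * D q) + (\<Sum>a\<in>S. B a / ((v a - v p) * (v a - v q) * D a))" unfolding L_def using S P2 by (simp add: Pp Dv add.assoc cong: sum.cong)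
 have one: "L v B (insert p S) = B p / D p + (\<Sum>a\<in>S. B a / ((v a - v p) * D a))" unfolding L_def using S P1 by (simp add: Pp Dv cong: sum.cong)
 have three: "L (v(p := v q)) (B(p := B q)) (insert p S) = B q / D q + (\<Sum>a\<in>S. B a / ((v a - v q) * D a))"
 proof -
  have *: "(\<Sum>a\<in>S. (B(p := B q)) a / (\<Prod>i\<in>insert p S - {a}. (v(p := v q)) a - (v(p := v q)) i)) = (\<Sum>a\<in>S. B a / ((v a - v q) * D a))"
  proof (rule sum.cong[OF refl])
  fix a assume a: "a:S"
  then have "a~=p" using S by auto
  then show "(B(p := B q)) a / (\<Prod>i\<in>insert p S - {a}. (v(p := v q)) a - (v(p := v q)) i) = B a / ((v a - v q) * D a)" unfolding P3[OF a] by simp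
  qed
  show ?thesis unfolding L_def sum.insert[OF S(1,2)] Pp(3) * by (simp only: fun_upd_same Dq)
 qed
 have "(v p - v q) * (B a / ((v a - v p) * (v a - v q) * D a)) = B a / ((v a - v p) * D a) - B a / ((v a - v q) * D a)" if "a:S" for a
 proof -
  have "v a - v p~=0" "v a - v q~=0" "D a~=0" using ne[of a p] ne[of a q] D0[of a] that S by auto
  then show ?thesis by (simp add: divide_simps) (simp add: algebra_simps)
 qed
 then have "(v p - v q) * (\<Sum>a\<in>S. B a / ((v a - v p) * (v a - v q) * D a)) =
  (\<Sum>a\<in>S. B a / ((v a - v p) * D a)) - (\<Sum>a\<in>S. B a / ((v a - v q) * D a))" by (simp add: sum_distrib_left sum_subtractf)
 moreover have "(v p - v q) * (B p / ((v p - v q) * D p)) = B p / D p" using pq by simp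
 moreover have "(v p - v q) * (B q / ((v q - v p) * D q)) = - (B q / D q)"
 proof -
  have "e * (b / (- e * c)) = - (b / c)" if "e~=0" for e b c :: 'a using that by simp
  from this[OF pq, of "B q" "D q"] show ?thesis by simp
 qed
 ultimately show ?thesis unfolding one two three by (simp add: distrib_left)
qed

text \<open>Substituting some variables for others keeps genericity as long as no two chosen
  variables coincide.\<close>

lemma generic_reindex:
 assumes "generic V N lam J z" "inj_on sg I" "sg ` I <= J"
 shows "generic V N lam I (z \<circ> sg)"
proof -
 have "inj_on (%i. poly (pderiv V) (z i)) (sg ` I)" using assms(1,3) inj_on_subset by (auto simp: generic_def)
 then have "inj_on (%i. poly (pderiv V) ((z \<circ> sg) i)) I" using comp_inj_on[OF assms(2)] by (simp add: comp_def)
 then show ?thesis using assms(1,3) unfolding generic_def by (auto simp: image_subset_iff)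
qed

context
 fixes r N g n :: nat and lam :: "nat => complex" and V :: "complex poly"
 assumes deg: "degree (pderiv V) <= r" and nd: "nondegenerate V N lam" and n: "n >= 1" and gn: "(g, n)~=(0, 1)"
begin

lemma gen_W_cong:
 assumes "!!i. i:{1..n}==>z i = z' i"
 shows "gen_W r V N lam g n z = gen_W r V N lam g n z'"
proof (rule fls_eqI)
 fix d
 show "fls_nth (gen_W r V N lam g n z) d = fls_nth (gen_W r V N lam g n z') d" unfolding gen_W_nth[OF deg nd n] Wsum_def
 proof (intro gsum_cong wt_cong)
  fix G x assume G: "G:Wc r N {1..n} g d {1..n}" and x: "x:darts G"
  show "cv z lam G x = cv z' lam G x" using coreD(4)[OF WcD(1)[OF G] x] assms by (auto simp: cv_dl)
  then show "cv z lam G x = cv z' lam G x" .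
 qed (rule WcD(2))
qed

text \<open>The shift of the degree by r + 1 in \<open>chord_recursion\<close> is multiplication by
  the corresponding power of \<alpha>.\<close>

lemma gen_S_step:
 assumes m: "m:{1..n}" and l: "1 <= l" and k: "ALL i:{1..n}. 1 <= k i"
  and z: "generic V N lam (SIGMA i:{1..n}. {1..(k(m := Suc l)) i}) (%(m, i). z m i)"
 shows "fls_const (poly (pderiv V) (z m l) - poly (pderiv V) (z m (Suc l))) * (fls_X_inv ^ (r + 1) * gen_S r V N lam g n (k(m := Suc l)) z) =
  gen_S r V N lam g n (k(m := l)) z - gen_S r V N lam g n (k(m := l)) (z(m := (z m)(l := z m (Suc l))))"
proof (rule fls_eqI)
 fix d
 let ?z = "%(m, i). z m i"
 have k1: "ALL i:{1..n}. 1 <= (k(m := l)) i" "ALL i:{1..n}. 1 <= (k(m := Suc l)) i" using k l by auto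
 have u: "(%(i, j). (z(m := (z m)(l := z m (Suc l)))) i j) = ?z((m, l) := ?z (m, Suc l))" by (auto simp: fun_eq_iff)
 have X: "fls_nth (fls_X_inv ^ (r + 1) * f) d = fls_nth f (d + (int r + 1))" for f :: "complex fls" by (simp add: fls_X_inv_power_times_conv_shift add.commute add.left_commute del: power_Suc)
 show "fls_nth (fls_const (poly (pderiv V) (z m l) - poly (pderiv V) (z m (Suc l))) *
  (fls_X_inv ^ (r + 1) * gen_S r V N lam g n (k(m := Suc l)) z)) d =
  fls_nth (gen_S r V N lam g n (k(m := l)) z - gen_S r V N lam g n (k(m := l)) (z(m := (z m)(l := z m (Suc l))))) d" unfolding fls_mult_const_nth fls_minus_nth X gen_S_nth[OF deg k1(1)] gen_S_nth[OF deg k1(2)] u using chord_recursion[OF m l gn k nonzero_generic[OF z nd], of r d] by simp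
qed

text \<open>The denominator contributed by the white vertex m when its corner a is selected.\<close>

definition star_term :: "(nat=>nat)=>(nat=>nat => complex)=>nat=>nat => complex fls" where
 "star_term k z m a = fls_X_inv ^ ((k m - 1) * (r + 1)) *
  (\<Prod>i\<in>{1..k m} - {a}. fls_const (poly (pderiv V) (z m a) - poly (pderiv V) (z m i)))"

text \<open>The coefficient seen by vertex m: the sum over the selections at all other white
  vertices, as a function of the argument t of W in place m.\<close>

definition star_rest :: "(nat=>nat)=>(nat=>nat => complex)=>nat => complex => complex fls" where
 "star_rest k z m t = (\<Sum>j\<in>(\<Pi>\<^sub>E i\<in>{1..n} - {m}. {1..k i}).
  gen_W r V N lam g n ((%i. z i (j i))(m := t)) / (\<Prod>i\<in>{1..n} - {m}. star_term k z i (j i)))"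

definition star_sum :: "(nat=>nat)=>(nat=>nat => complex) => complex fls" where
 "star_sum k z = (\<Sum>j\<in>(\<Pi>\<^sub>E i\<in>{1..n}. {1..k i}).
  gen_W r V N lam g n (%i. z i (j i)) / (\<Prod>i\<in>{1..n}. star_term k z i (j i)))"

lemma star_rest_cong:
 assumes "!!i. i~=m==>k i = k' i&z i = z' i"
 shows "star_rest k z m t = star_rest k' z' m t"
proof -
 have "(\<Pi>\<^sub>E i\<in>{1..n} - {m}. {1..k i}) = (\<Pi>\<^sub>E i\<in>{1..n} - {m}. {1..k' i})" using assms by (intro PiE_cong) auto
 moreover have "(%i. z i (j i))(m := t) = (%i. z' i (j i))(m := t)" for j using assms by (auto simp: fun_eq_iff)
 moreover have "(\<Prod>i\<in>{1..n} - {m}. star_term k z i (j i)) = (\<Prod>i\<in>{1..n} - {m}. star_term k' z' i (j i))" for j using assms by (intro prod.cong) (auto simp: star_term_def)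
 ultimately show ?thesis by (simp add: star_rest_def)
qed

text \<open>With the other vertices summed out, the expression is a Lagrange sum in the corners of m
  alone, so the one-variable recursion applies.\<close>

lemma star_sum_split:
 assumes m: "m:{1..n}"
 shows "star_sum k z = (\<Sum>a\<in>{1..k m}. star_rest k z m (z m a) / star_term k z m a)" unfolding star_sum_def sum_PiE_split[OF finite_atLeastAtMost m]
proof (rule sum.cong[OF refl])
 fix a
 have "gen_W r V N lam g n (%i. z i ((j(m := a)) i)) / (\<Prod>i\<in>{1..n}. star_term k z i ((j(m := a)) i)) =
  gen_W r V N lam g n ((%i. z i (j i))(m := z m a)) / (\<Prod>i\<in>{1..n} - {m}. star_term k z i (j i)) / star_term k z m a" for j
 proof -
  have "(%i. z i ((j(m := a)) i)) = (%i. z i (j i))(m := z m a)" by (auto simp: fun_eq_iff)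
  moreover have "(\<Prod>i\<in>{1..n}. star_term k z i ((j(m := a)) i)) = star_term k z m a * (\<Prod>i\<in>{1..n} - {m}. star_term k z i ((j(m := a)) i))" using prod.remove[OF finite_atLeastAtMost m, of "%i. star_term k z i ((j(m := a)) i)"] by simp
  moreover have "(\<Prod>i\<in>{1..n} - {m}. star_term k z i ((j(m := a)) i)) = (\<Prod>i\<in>{1..n} - {m}. star_term k z i (j i))" by (intro prod.cong) auto
  ultimately show ?thesis by (simp add: divide_divide_eq_left mult.commute)
 qed
 then show "(\<Sum>j\<in>(\<Pi>\<^sub>E i\<in>{1..n} - {m}. {1..k i}). gen_W r V N lam g n (%i. z i ((j(m := a)) i)) / (\<Prod>i\<in>{1..n}. star_term k z i ((j(m := a)) i)))
  = star_rest k z m (z m a) / star_term k z m a" by (simp only: star_rest_def sum_divide_distrib)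
qed

lemma star_sum_step:
 assumes m: "m:{1..n}" and l: "1 <= l" and inj: "inj_on (%i. poly (pderiv V) (z m i)) {1..Suc l}"
 shows "fls_const (poly (pderiv V) (z m l) - poly (pderiv V) (z m (Suc l))) * (fls_X_inv ^ (r + 1) * star_sum (k(m := Suc l)) z) =
  star_sum (k(m := l)) z - star_sum (k(m := l)) (z(m := (z m)(l := z m (Suc l))))"
proof -
 define v where "v a = fls_const (poly (pderiv V) (z m a))" for a
 define B where "B a = star_rest (k(m := l)) z m (z m a)" for a
 define E :: "complex fls" where "E = fls_X_inv ^ ((l - 1) * (r + 1))"
 define X :: "complex fls" where "X = fls_X_inv ^ (r + 1)"
 let ?L = "%v B T. \<Sum>a\<in>T. B a / (\<Prod>i\<in>T - {a}. v a - v i)"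
 let ?v = "v(l := v (Suc l))" and ?B = "B(l := B (Suc l))" and ?z = "z(m := (z m)(l := z m (Suc l)))"
 have X0: "X~=0" by (simp add: X_def)
 have XE: "fls_X_inv ^ (l * (r + 1)) = E * X" unfolding E_def X_def power_add[symmetric] using l by (cases l) (simp_all add: algebra_simps)
 have v: "fls_const (poly (pderiv V) (z m a) - poly (pderiv V) (z m i)) = v a - v i" for a i by (simp add: v_def fls_minus_const)
 have v': "fls_const (poly (pderiv V) (?z m a) - poly (pderiv V) (?z m i)) = ?v a - ?v i" for a i by (simp add: v_def fls_minus_const)
 have "inj_on v {1..Suc l}" using inj by (auto simp: inj_on_def v_def dest!: arg_cong[of "fls_const _" _ "%f. fls_nth f 0"])
 moreover have T: "{1..Suc l} = insert l (insert (Suc l) {1..<l})" "{1..l} = insert l {1..<l}" using l by auto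
 ultimately have L: "(v l - v (Suc l)) * ?L v B {1..Suc l} = ?L v B {1..l} - ?L ?v ?B {1..l}" using lagrange_step[of "{1..<l}" l "Suc l" v B] by simp
 have R: "star_rest (k(m := Suc l)) z m t = star_rest (k(m := l)) z m t" for t by (rule star_rest_cong) auto
 have "star_sum (k(m := Suc l)) z = (\<Sum>a\<in>{1..Suc l}. B a / (E * X * (\<Prod>i\<in>{1..Suc l} - {a}. v a - v i)))" unfolding star_sum_split[OF m] star_term_def v by (simp only: B_def XE fun_upd_same diff_Suc_1 R)
 moreover have "X * (b / (E * X * p)) = b / p / E" for b p
 proof -
  have "X * (b / (E * X * p)) = (X * b) / (X * (E * p))" by (simp add: mult_ac)
  also have "... = b / p / E" using X0 by (simp add: mult.commute)
  finally show ?thesis .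
 qed
 ultimately have "X * star_sum (k(m := Suc l)) z = ?L v B {1..Suc l} / E" by (simp only: sum_distrib_left sum_divide_distrib)
 moreover have "star_sum (k(m := l)) z = ?L v B {1..l} / E" unfolding star_sum_split[OF m] star_term_def v by (simp only: B_def E_def fun_upd_same sum_divide_distrib divide_divide_eq_left mult.commute)
 moreover have "star_sum (k(m := l)) ?z = ?L ?v ?B {1..l} / E"
 proof -
  have "star_rest (k(m := l)) ?z m t = star_rest (k(m := l)) z m t" for t by (rule star_rest_cong) auto
  then have "star_rest (k(m := l)) ?z m (?z m a) = ?B a" for a by (simp add: B_def)
  then show ?thesis unfolding star_sum_split[OF m] star_term_def v' by (simp only: E_def sum_divide_distrib fun_upd_same divide_divide_eq_left mult.commute)
 qed
 ultimately show ?thesis unfolding v X_def[symmetric] using L by (simp add: diff_divide_distrib[symmetric])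
qed

text \<open>Induction on the total degree of the white vertices. Both sides obey the same recursion,
  whose right side involves smaller degrees only, and its factor on the left is nonzero for generic
  decorations. The start is the case where all degrees are 1 and all denominators are empty
  products.\<close>

lemma gen_S_star_sum:
 assumes "ALL i:{1..n}. 1 <= k i" "generic V N lam (SIGMA i:{1..n}. {1..k i}) (%(m, i). z m i)"
 shows "gen_S r V N lam g n k z = star_sum k z" using assms
proof (induction "\<Sum>i\<in>{1..n}. k i" arbitrary: k z rule: less_induct)
 case less
 show ?case
 proof (cases "ALL i:{1..n}. k i = 1")
  case True
  let ?j = "restrict (%_. 1::nat) {1..n}"
  have "(\<Pi>\<^sub>E i\<in>{1..n}. {1..k i}) = (\<Pi>\<^sub>E i\<in>{1..n}. {?j i})" using True by (intro PiE_cong) auto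
  also have "... = {?j}" by (rule PiE_singleton[OF restrict_extensional])
  finally have "star_sum k z = gen_W r V N lam g n (%i. z i (?j i)) / (\<Prod>i\<in>{1..n}. star_term k z i (?j i))" by (simp add: star_sum_def)
  also have "(\<Prod>i\<in>{1..n}. star_term k z i (?j i)) = 1" using True by (intro prod.neutral) (simp add: star_term_def)
  also have "gen_W r V N lam g n (%i. z i (?j i)) = gen_W r V N lam g n (%i. z i 1)" by (rule gen_W_cong) simp
  also have "... = gen_S r V N lam g n k z" by (rule fls_eqI) (simp only: gen_S_nth[OF deg less.prems(1)] gen_W_nth[OF deg nd n] Ssum_base[OF True n] case_prod_conv)
  finally show ?thesis by simp
 next
  case False
  then obtain m where m: "m:{1..n}" "k m~=1" by blast
  define l where "l = k m - 1"
  have l: "1 <= l" "k m = Suc l" using m less.prems(1) by (force simp: l_def)+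
  have ku: "k(m := Suc l) = k" using l(2) by (simp add: fun_upd_idem)
  let ?k = "k(m := l)" and ?z = "z(m := (z m)(l := z m (Suc l)))" and ?Z = "%(m, i). z m i"
  have less': "(\<Sum>i\<in>{1..n}. ?k i) < (\<Sum>i\<in>{1..n}. k i)" using m(1) l(2) by (intro sum_strict_mono_ex1) auto
  have k1: "ALL i:{1..n}. 1 <= ?k i" using less.prems(1) l(1) by auto
  have sub: "(SIGMA i:{1..n}. {1..?k i}) <= (SIGMA i:{1..n}. {1..k i})" using l(2) by (auto split: if_splits)
  have g1: "generic V N lam (SIGMA i:{1..n}. {1..?k i}) ?Z" using generic_reindex[OF less.prems(2), of id, OF inj_on_id] sub by simp
  \<comment> \<open>Moving the variable (m, l) to (m, l + 1) is injective here, since the smaller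
    index set stops at (m, l); this keeps the substituted point generic.\<close>
  define sg where "sg p = (if p = (m, l) then (m, Suc l) else p)" for p
  have "inj_on sg (SIGMA i:{1..n}. {1..?k i})" by (rule inj_onI) (auto simp: sg_def split: if_splits)
  moreover have "sg ` (SIGMA i:{1..n}. {1..?k i}) <= (SIGMA i:{1..n}. {1..k i})" using sub m(1) l by (auto simp: sg_def)
  ultimately have "generic V N lam (SIGMA i:{1..n}. {1..?k i}) (?Z \<circ> sg)" by (rule generic_reindex[OF less.prems(2)])
  moreover have "?Z \<circ> sg = (%(m, i). ?z m i)" by (auto simp: sg_def fun_eq_iff)
  ultimately have g2: "generic V N lam (SIGMA i:{1..n}. {1..?k i}) (%(m, i). ?z m i)" by simp
  have "inj_on (%i. poly (pderiv V) (z m i)) {1..Suc l}"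
  proof (rule inj_onI)
  fix i j assume "i:{1..Suc l}" "j:{1..Suc l}" "poly (pderiv V) (z m i) = poly (pderiv V) (z m j)"
  then have "(m, i) = (m, j)" using less.prems(2) m(1) l(2) unfolding generic_def by (intro inj_onD[of "%p. poly (pderiv V) (?Z p)" "SIGMA i:{1..n}. {1..k i}"]) auto
  then show "i = j" by simp
  qed
  note inj = this
  have "poly (pderiv V) (z m l) - poly (pderiv V) (z m (Suc l))~=0" using inj_onD[OF inj, of l "Suc l"] l(1) by auto
  then have nz: "fls_const (poly (pderiv V) (z m l) - poly (pderiv V) (z m (Suc l))) * fls_X_inv ^ (r + 1)~=0" by (simp del: power_Suc add: fls_const_nonzero)
  have "fls_const (poly (pderiv V) (z m l) - poly (pderiv V) (z m (Suc l))) * (fls_X_inv ^ (r + 1) * gen_S r V N lam g n k z) =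
  fls_const (poly (pderiv V) (z m l) - poly (pderiv V) (z m (Suc l))) * (fls_X_inv ^ (r + 1) * star_sum k z)" by (simp only: gen_S_step[where m = m and l = l and k = k and z = z, unfolded ku, OF m(1) l(1) less.prems]
  star_sum_step[where m = m and l = l and k = k and z = z, unfolded ku, OF m(1) l(1) inj] less.hyps[OF less' k1 g1] less.hyps[OF less' k1 g2])
  then show ?thesis using nz by (simp only: mult.assoc[symmetric] mult_cancel_left) blast
 qed
qed

lemmas part_ii = gen_S_star_sum[unfolded star_sum_def star_term_def]

end

theorem mainTheorem3:
  fixes r N g n :: nat and v lam :: "nat \<Rightarrow> complex" and V :: "complex poly"
  assumes "r \<ge> 2"
    and "V = (\<Sum>j=1..r+1. monom (v j / of_nat j) j)" and "v (r + 1) \<noteq> 0"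
    and "nondegenerate V N lam"
    and "n \<ge> 1"
  shows
    "(\<forall>z. generic V N lam {1..n} z \<longrightarrow> (\<forall>d.
        fls_nth (gen_W r V N lam g n z) d =
          foldr (weighted_partial V) [1..<n+1] (\<lambda>y. fls_nth (gen_F r V N lam g n y) d) z +
          fls_nth (if g = 0 \<and> n = 2 then fls_const
             (1 / (poly (pderiv (pderiv V)) (z 1) * poly (pderiv (pderiv V)) (z 2) * (z 1 - z 2)\<^sup>2)
              - 1 / (poly (pderiv V) (z 1) - poly (pderiv V) (z 2))\<^sup>2) else 0) d +
          fls_nth (if g = 0 \<and> n = 1 then fls_const
             (\<Sum>j=1..N. 1 / (poly (pderiv (pderiv V)) (z 1) * (z 1 - lam j))
              - 1 / (poly (pderiv V) (z 1) - poly (pderiv V) (lam j))) else 0) d))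
     \<and> (\<forall>k z. (g, n) \<noteq> (0, 1) \<longrightarrow> (\<forall>m\<in>{1..n}. k m \<ge> 1) \<longrightarrow>
          generic V N lam (SIGMA m:{1..n}. {1..k m}) (\<lambda>(m, i). z m i) \<longrightarrow>
          gen_S r V N lam g n k z =
            (\<Sum>j\<in>(\<Pi>\<^sub>E m\<in>{1..n}. {1..k m}).
               gen_W r V N lam g n (\<lambda>m. z m (j m)) /
               (\<Prod>m=1..n. fls_X_inv ^ ((k m - 1) * (r + 1)) *
                  (\<Prod>i\<in>{1..k m} - {j m}. fls_const
                     (poly (pderiv V) (z m (j m)) - poly (pderiv V) (z m i))))))
     \<and> (\<forall>z. generic V N lam {1..n} z \<longrightarrow> (\<forall>d.
          - residue_at_infinity (\<lambda>u. fls_nth (fls_const (poly (pderiv V) u) * gen_U r V N lam g n u z) d) =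
            fls_nth (if g = 0 \<and> n = 1
              then fls_const (poly (pderiv V) (z 1) / poly (pderiv (pderiv V)) (z 1)) * fls_X_inv ^ (r + 1)
              else 0) d))
     \<and> (\<forall>z. generic V N lam {1..n} z \<longrightarrow> (\<forall>d.
          - residue_at_infinity
              (\<lambda>u. fls_nth (fls_const (poly (pderiv V) u * (u - z 1)) * gen_U r V N lam g n u z) d) =
            fls_nth (fls_const (poly (pderiv V) (z 1) / poly (pderiv (pderiv V)) (z 1)) * gen_W r V N lam g n z
              + (if g = 0 \<and> n = 1 then fls_const (of_nat N / poly (pderiv (pderiv V)) (z 1)) else 0)) d))
     \<and> (\<forall>z. generic V N lam {1..n} z \<longrightarrow> (\<forall>d.
          ((\<lambda>u. fls_nth (fls_const (u\<^sup>2) * (gen_U r V N lam g n u z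
              - (if g = 0 \<and> n = 1
                 then fls_const (1 / (poly (pderiv (pderiv V)) (z 1) * (u - z 1))) * fls_X_inv ^ (r + 1)
                 else 0))) d)
            \<longlongrightarrow> fls_nth (fls_const (1 / poly (pderiv (pderiv V)) (z 1)) * gen_W r V N lam g n z) d) at_infinity))"
proof -
  \<comment> \<open>The resulting bound r on the degree of V' makes every black vertex of degree
    above r + 1 weigh zero, which links the prescribed classes to the unbounded ones.\<close>
  have "degree V \<le> r + 1" unfolding assms(2)
  proof (rule degree_sum_le)
    fix j assume "j \<in> {1..r + 1}"
    then show "degree (monom (v j / of_nat j) j) \<le> r + 1"
      using degree_monom_le[of "v j / of_nat j" j] by simp
  qed simp
  then have deg: "degree (pderiv V) \<le> r" by (simp add: degree_pderiv)
  note nd = assms(4) and n = assms(5)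
  show ?thesis
  proof (intro conjI allI impI)
    fix k :: "nat \<Rightarrow> nat" and z :: "nat \<Rightarrow> nat \<Rightarrow> complex"
    assume "(g, n) \<noteq> (0, 1)" "\<forall>m\<in>{1..n}. k m \<ge> 1" "generic V N lam (SIGMA m:{1..n}. {1..k m}) (\<lambda>(m, i). z m i)"
    then show "gen_S r V N lam g n k z =
            (\<Sum>j\<in>(\<Pi>\<^sub>E m\<in>{1..n}. {1..k m}).
               gen_W r V N lam g n (\<lambda>m. z m (j m)) /
               (\<Prod>m=1..n. fls_X_inv ^ ((k m - 1) * (r + 1)) *
                  (\<Prod>i\<in>{1..k m} - {j m}. fls_const
                     (poly (pderiv V) (z m (j m)) - poly (pderiv V) (z m i)))))"
      by (rule part_ii[OF deg nd n])
  qed (rule part_i[OF deg nd n] part_iii[OF deg nd n] part_iv[OF deg nd n] part_v[OF deg nd n]; assumption)+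
qed

end
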